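(* Let $\rho\ge 0$ on $\mathbb{T}$ with $\int_0^1\rho\,dy=1$, and let $f^*(x,v)=\varphi\left(\frac12 v^2+U^*(x)\right)$ be a stationary solution of the Vlasov-Poisson system with background $\rho$ (with $\int_{\mathbb{T}\times\mathbb{R}}f^*\,dx\,dv=1$), where $U^*(x)=\int_0^x\int_0^1K(z,y)\left[\rho(y)-\int_{-\infty}^\infty f^*(y,v)\,dv\right]dy\,dz$, and where $\varphi\in C^1(\mathbb{R})$ is supported on $(-\infty,E_{max}]$ and satisfies $\varphi'(E)<0$ for all $E<E_{max}$. Let $v_0>0$ be such that $M:=\operatorname{supp}(f^* )\subset\mathbb{T}\times[-v_0,v_0]$. Then for every $C_1>0$ there exists $\delta>0$, depending on $C_1$, such that the following holds. If $f$ is a (smooth) solution of the Vlasov-Poisson system with $$f(x,v,0)\le C_1\quad\text{for all }(x,v)\in\mathbb{T}\times\mathbb{R},\qquad \int_{\mathbb{T}}\int_{\mathbb{R}}(1+v^2)\,|f(x,v,0)-f^*(x,v)|\,dv\,dx<\delta,$$ then, for the characteristic flow $\Phi_t$ of $f$, there exists $A>0$ such that $$\|\nabla\Phi_t\|_{L^1(\mathbb{T}\times[-v_0,v_0])}\ge At\qquad\text{for all }t\ge0.$$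
   Context: $\mathbb{T}=\mathbb{R}/\mathbb{Z}$. The one-dimensional Vlasov-Poisson system with given background charge density $\rho\ge0$ is $$\partial_t f(x,v,t)+v\,\partial_x f(x,v,t)-E(x,t)\,\partial_v f(x,v,t)=0,\qquad E(x,t)=\int_0^1K(x,y)\left[\rho(y)-\int_{-\infty}^\infty f(y,v,t)\,dv\right]dy,$$ for $(x,v)\in\mathbb{T}\times\mathbb{R}$, with kernel $K(x,y)=y-1$ for $0\le x<y$ and $K(x,y)=y$ for $y<x\le1$ (so that $\partial_xE=\rho-\int f\,dv$ and $\int_0^1E\,dx=0$). Standing assumptions: $\int_0^1\rho\,dy=1$, and solutions are nonnegative distribution functions, sufficiently smooth, with $\int_{\mathbb{T}\times\mathbb{R}}f(x,v,0)\,dx\,dv=1$. The characteristic flow $\Phi_t:\mathbb{T}\times\mathbb{R}\to\mathbb{T}\times\mathbb{R}$ of a solution $f$ is the flow of $\frac{dx}{dt}=v$, $\frac{dv}{dt}=-E(x,t)$ with $\Phi_0=\mathrm{id}$; then $f(x,v,t)=f(\Phi_t^{-1}(x,v),0)$. *)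

theory Defs
  imports "HOL-Analysis.Analysis"
begin

text \<open>
  Functions on the torus $\mathbb{T} = \mathbb{R}/\mathbb{Z}$ are represented by 1-periodic functions
  on the reals, and integrals over $\mathbb{T}$ by integrals over $[0,1]$.
  A distribution function is \<open>f x v t\<close>, with \<open>t \<ge> 0\<close>.
\<close>

text \<open>The value on the diagonal \<open>x = y\<close> is immaterial: it is a null set in every use.\<close>

definition vp_kernel :: "real \<Rightarrow> real \<Rightarrow> real" where
  "vp_kernel x y = (if x < y then y - 1 else y)"

text \<open>Field and potential of a phase-space density \<open>g x v\<close>; \<open>frac\<close> extends them from
  $[0,1)$ to 1-periodic functions.\<close>

definition electric_field ::
    "(real \<Rightarrow> real) \<Rightarrow> (real \<Rightarrow> real \<Rightarrow> real) \<Rightarrow> real \<Rightarrow> real" where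
  "electric_field \<rho> g x =
     (LBINT y:{0..1}. vp_kernel (frac x) y * (\<rho> y - (LBINT v. g y v)))"

definition potential ::
    "(real \<Rightarrow> real) \<Rightarrow> (real \<Rightarrow> real \<Rightarrow> real) \<Rightarrow> real \<Rightarrow> real" where
  "potential \<rho> g x = (LBINT z:{0..frac x}. electric_field \<rho> g z)"

definition background_density :: "(real \<Rightarrow> real) \<Rightarrow> bool" where
  "background_density \<rho> \<longleftrightarrow>
     (\<forall>x. \<rho> (x + 1) = \<rho> x) \<and> (\<forall>x. 0 \<le> \<rho> x) \<and>
     set_integrable lborel {0..1} \<rho> \<and> (LBINT y:{0..1}. \<rho> y) = 1"

text \<open>Classical solutions: \<open>f\<close> is $C^1$ on $\mathbb{T}\times\mathbb{R}\times[0,\infty)$ (one-sided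
  time derivative at \<open>t = 0\<close>), nonnegative, of initial mass 1, and decays enough in \<open>v\<close> that
  its spatial density $\int f\,dv$ is finite and continuous.\<close>

definition vlasov_poisson_solution ::
    "(real \<Rightarrow> real) \<Rightarrow> (real \<Rightarrow> real \<Rightarrow> real \<Rightarrow> real) \<Rightarrow> bool" where
  "vlasov_poisson_solution \<rho> f \<longleftrightarrow>
     (\<forall>x v. \<forall>t\<ge>0. f (x + 1) v t = f x v t) \<and>
     (\<forall>x v. \<forall>t\<ge>0. 0 \<le> f x v t) \<and>
     (\<integral>\<^sup>+x\<in>{0..1}. (\<integral>\<^sup>+v. ennreal (f x v 0) \<partial>lborel) \<partial>lborel) = 1 \<and>
     (\<forall>x. \<forall>t\<ge>0. integrable lborel (\<lambda>v. f x v t)) \<and>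
     continuous_on (UNIV \<times> {0..}) (\<lambda>(x, t). LBINT v. f x v t) \<and>
     (\<exists>fx fv ft.
        continuous_on (UNIV \<times> UNIV \<times> {0..}) (\<lambda>(x, v, t). fx x v t) \<and>
        continuous_on (UNIV \<times> UNIV \<times> {0..}) (\<lambda>(x, v, t). fv x v t) \<and>
        continuous_on (UNIV \<times> UNIV \<times> {0..}) (\<lambda>(x, v, t). ft x v t) \<and>
        (\<forall>x v. \<forall>t\<ge>0.
           ((\<lambda>x. f x v t) has_real_derivative fx x v t) (at x) \<and>
           ((\<lambda>v. f x v t) has_real_derivative fv x v t) (at v) \<and>
           ((\<lambda>t. f x v t) has_real_derivative ft x v t) (at t within {0..}) \<and>
           ft x v t + v * fx x v t - electric_field \<rho> (\<lambda>x v. f x v t) x * fv x v t = 0))"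

text \<open>The flow on $\mathbb{T}\times\mathbb{R}$ is represented by its lift to $\mathbb{R}\times\mathbb{R}$
  starting from the identity, which commutes with the deck translation \<open>x \<mapsto> x + 1\<close> and has
  the same gradient. As a flow it consists of $C^1$ bijections, with derivative continuous
  in time and phase space.\<close>

definition characteristic_flow ::
    "(real \<Rightarrow> real \<Rightarrow> real) \<Rightarrow> (real \<Rightarrow> real \<times> real \<Rightarrow> real \<times> real) \<Rightarrow> bool" where
  "characteristic_flow E \<Phi> \<longleftrightarrow>
     (\<forall>z. \<Phi> 0 z = z) \<and>
     (\<forall>t\<ge>0. \<forall>x v. \<Phi> t (x + 1, v) = \<Phi> t (x, v) + (1, 0)) \<and>
     (\<forall>t\<ge>0. \<forall>z.
        ((\<lambda>s. fst (\<Phi> s z)) has_real_derivative snd (\<Phi> t z)) (at t within {0..}) \<and>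
        ((\<lambda>s. snd (\<Phi> s z)) has_real_derivative - E (fst (\<Phi> t z)) t) (at t within {0..})) \<and>
     (\<forall>t\<ge>0. bij (\<Phi> t)) \<and>
     (\<exists>D :: real \<Rightarrow> real \<times> real \<Rightarrow> (real \<times> real) \<Rightarrow>\<^sub>L (real \<times> real).
        continuous_on ({0..} \<times> UNIV) (\<lambda>(t, z). D t z) \<and>
        (\<forall>t\<ge>0. \<forall>z. (\<Phi> t has_derivative blinfun_apply (D t z)) (at z)))"

text \<open>The $L^1$ norm of the gradient over $\mathbb{T}\times[-w,w]$, with the operator norm on
  $2\times 2$ matrices.\<close>

definition grad_L1_norm :: "real \<Rightarrow> (real \<times> real \<Rightarrow> real \<times> real) \<Rightarrow> ennreal" where
  "grad_L1_norm w \<Psi> =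
     (\<integral>\<^sup>+z\<in>{0..1} \<times> {-w..w}. ennreal (onorm (frechet_derivative \<Psi> (at z))) \<partial>lborel)"

end

theory Submission
  imports Defs
begin

text \<open>
  Let \<open>\<mu> = \<psi>(f)\<close>, a density transported by the flow. With \<open>B\<close> the mean-zero antiderivative in \<open>x\<close> of \<open>\<mu>\<close>
  minus its spatial average, and \<open>m\<close> the mass of \<open>\<mu>\<close> below a given velocity, the one-form
  $\lambda = B\,dv - m\,dx$ is bounded and satisfies $d\lambda = \mu\,dx\wedge dv$. Since the flow preserves
  this two-form, $\Phi_t^*\lambda_t - \lambda_0 = dS_t$, where $S_t$ is the time integral along characteristics of
  an explicit winding rate. Hence the oscillation of $S_t$ is controlled by the $L^1$ norm of $\nabla\Phi_t$.
  Energy-Casimir stability keeps \<open>f\<close> close to \<open>f*\<close> for all times, and therefore keeps the mean winding rate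
  of the particles on which the initial value of \<open>f\<close> lies in a given range close to its value for \<open>f*\<close>. For
  \<open>f*\<close>, particles with energies below and above those carrying \<open>\<mu>\<close> wind at different mean rates, so the
  oscillation of $S_t$ grows linearly in time.
\<close>

section \<open>Integrals along moving curves\<close>

text \<open>The background is only integrable and \<open>f\<close>, \<open>\<Phi>\<close> are only
  C^1. Hence \<open>E\<close> need not be differentiable in \<open>x\<close>, and neither the
  linearised equation for the gradient nor second derivatives of the flow are available; identities
  between forms are therefore proved for integrals along segments.

  The canonical form v dx is unbounded. The form B dv - m dx is bounded because \<mu> is bounded and
  integrable, at the price of a nonlocal winding rate.

  Single particles cannot be followed for all times. They are selected by a function of the initial
  value of \<open>f\<close>, which is transported, so an average over selected particles is a
  phase-space average at the current time, where stability applies. Two selections are combined into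
  a weight of mean zero, which removes the additive constant of S.

  What remains is a 2 by 2 determinant of steady averages. It is positive because the potential
  stays strictly below \<open>Emax\<close>: some energies carry mass on orbits that go all the way
  round the torus, and there the transit time decreases with the energy.\<close>

text \<open>\<open>has_derivative_partialsI\<close> for real partial derivatives. The requirements
  are asymmetric: the first partial derivative is taken at the point alone, the second must exist
  and be continuous on the whole domain.\<close>

lemma has_derivative_partials_real:
  fixes f :: "real \<Rightarrow> real \<Rightarrow> real"
  assumes "((\<lambda>x. f x y) has_real_derivative fx) (at x within A)"
    and "\<And>x y. x \<in> A \<Longrightarrow> y \<in> B \<Longrightarrow> ((\<lambda>y. f x y) has_real_derivative fy x y) (at y within B)"
    and "continuous_on (A \<times> B) (\<lambda>(x, y). fy x y)"
    and "x \<in> A" "y \<in> B" "convex B"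
  shows "((\<lambda>(x, y). f x y) has_derivative (\<lambda>(h, k). fx * h + fy x y * k)) (at (x, y) within A \<times> B)"
proof -
  have "((\<lambda>(x, y). f x y) has_derivative (\<lambda>(h, k). fx * h + blinfun_mult_right (fy x y) k))
      (at (x, y) within A \<times> B)"
  proof (rule has_derivative_partialsI)
    show "((\<lambda>x. f x y) has_derivative (\<lambda>h. fx * h)) (at x within A)"
      using assms(1) by (simp add: has_field_derivative_def)
    show "((\<lambda>y. f x y) has_derivative blinfun_mult_right (fy x y)) (at y within B)"
      if "x \<in> A" "y \<in> B" for x y
      using assms(2)[OF that] by (simp add: has_field_derivative_def)
    have "continuous_on (A \<times> B) (\<lambda>p. blinfun_mult_right ((\<lambda>(x, y). fy x y) p))"
      using assms(3) by (rule bounded_linear.continuous_on[OF bounded_linear_blinfun_mult_right])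
    then show "continuous (at (x, y) within A \<times> B) (\<lambda>(x, y). blinfun_mult_right (fy x y))"
      using assms(4,5) by (auto simp: continuous_on_eq_continuous_within case_prod_unfold)
  qed (use assms in auto)
  then show ?thesis by simp
qed

lemma continuous_on_partials_real:
  fixes f :: "real \<Rightarrow> real \<Rightarrow> real"
  assumes "\<And>x y. x \<in> A \<Longrightarrow> y \<in> B \<Longrightarrow> ((\<lambda>x. f x y) has_real_derivative fx x y) (at x within A)"
    and "\<And>x y. x \<in> A \<Longrightarrow> y \<in> B \<Longrightarrow> ((\<lambda>y. f x y) has_real_derivative fy x y) (at y within B)"
    and "continuous_on (A \<times> B) (\<lambda>(x, y). fy x y)" and "convex B"
  shows "continuous_on (A \<times> B) (\<lambda>(x, y). f x y)"
  unfolding continuous_on_eq_continuous_within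
proof safe
  fix x y assume "x \<in> A" "y \<in> B"
  from has_derivative_partials_real[OF assms(1)[OF this] assms(2,3) this assms(4)]
  show "continuous (at (x, y) within A \<times> B) (\<lambda>(x, y). f x y)"
    by (auto intro: has_derivative_continuous)
qed

text \<open>Integration by parts in \<open>\<tau>\<close> on one of the two factors avoids the mixed second derivatives that a
  direct differentiation under the integral would need.\<close>

lemma has_real_derivative_curve_integral:
  fixes P W P1 P2 W1 W2 :: "real \<Rightarrow> real \<Rightarrow> real"
  assumes ab: "a \<le> b" and S: "convex S" and s: "s \<in> S"
    and P1: "\<And>\<tau> s. \<tau> \<in> {a..b} \<Longrightarrow> s \<in> S \<Longrightarrow> ((\<lambda>\<tau>. P \<tau> s) has_real_derivative P1 \<tau> s) (at \<tau> within {a..b})"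
    and P2: "\<And>\<tau> s. \<tau> \<in> {a..b} \<Longrightarrow> s \<in> S \<Longrightarrow> ((\<lambda>s. P \<tau> s) has_real_derivative P2 \<tau> s) (at s within S)"
    and W1: "\<And>\<tau> s. \<tau> \<in> {a..b} \<Longrightarrow> s \<in> S \<Longrightarrow> ((\<lambda>\<tau>. W \<tau> s) has_real_derivative W1 \<tau> s) (at \<tau> within {a..b})"
    and W2: "\<And>\<tau> s. \<tau> \<in> {a..b} \<Longrightarrow> s \<in> S \<Longrightarrow> ((\<lambda>s. W \<tau> s) has_real_derivative W2 \<tau> s) (at s within S)"
    and cP1: "continuous_on ({a..b} \<times> S) (\<lambda>(\<tau>, s). P1 \<tau> s)"
    and cP2: "continuous_on ({a..b} \<times> S) (\<lambda>(\<tau>, s). P2 \<tau> s)"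
    and cW1: "continuous_on ({a..b} \<times> S) (\<lambda>(\<tau>, s). W1 \<tau> s)"
    and cW2: "continuous_on ({a..b} \<times> S) (\<lambda>(\<tau>, s). W2 \<tau> s)"
  shows "((\<lambda>s. integral {a..b} (\<lambda>\<tau>. P \<tau> s * W1 \<tau> s)) has_real_derivative
    integral {a..b} (\<lambda>\<tau>. P2 \<tau> s * W1 \<tau> s - P1 \<tau> s * W2 \<tau> s) + (P b s * W2 b s - P a s * W2 a s))
    (at s within S)"
proof -
  have cP: "continuous_on ({a..b} \<times> S) (\<lambda>(\<tau>, s). P \<tau> s)"
    by (rule continuous_on_partials_real[OF P1 P2 cP2 S])
  have cW: "continuous_on ({a..b} \<times> S) (\<lambda>(\<tau>, s). W \<tau> s)"
    by (rule continuous_on_partials_real[OF W1 W2 cW2 S])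
  note c = cP[unfolded case_prod_unfold] cW[unfolded case_prod_unfold]
    cP1[unfolded case_prod_unfold] cP2[unfolded case_prod_unfold]
    cW1[unfolded case_prod_unfold] cW2[unfolded case_prod_unfold]
  have ci: "continuous_on {a..b} (\<lambda>\<tau>. g \<tau> r)" if "continuous_on ({a..b} \<times> S) (\<lambda>p. g (fst p) (snd p))" "r \<in> S"
    for g :: "real \<Rightarrow> real \<Rightarrow> real" and r
    by (rule continuous_on_compose2[OF that(1), of "{a..b}" "\<lambda>\<tau>. (\<tau>, r)", unfolded fst_conv snd_conv])
       (intro continuous_intros, use that in auto)
  note ci' = c[THEN ci]
  \<comment> \<open>Separate parameters for the two factors. The derivative in \<open>r\<close>
    falls on \<open>P\<close>; in \<open>u\<close> it falls on \<open>W\<close>, once integration by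
    parts has replaced \<open>W1\<close> by \<open>W\<close>. No derivative of \<open>W1\<close> in
    the parameter occurs.\<close>
  define \<Psi> where "\<Psi> r u = integral {a..b} (\<lambda>\<tau>. P \<tau> r * W1 \<tau> u)" for r u
  have alt: "\<Psi> r u = P b r * W b u - P a r * W a u - integral {a..b} (\<lambda>\<tau>. P1 \<tau> r * W \<tau> u)"
    if "r \<in> S" "u \<in> S" for r u
  proof -
    have "((\<lambda>\<tau>. P1 \<tau> r * W \<tau> u + P \<tau> r * W1 \<tau> u) has_integral P b r * W b u - P a r * W a u) {a..b}"
      by (rule fundamental_theorem_of_calculus[OF ab])
        (use that in \<open>auto intro!: derivative_eq_intros P1 W1 simp: has_real_derivative_iff_has_vector_derivative[symmetric]\<close>)
    then have "integral {a..b} (\<lambda>\<tau>. P1 \<tau> r * W \<tau> u + P \<tau> r * W1 \<tau> u) = P b r * W b u - P a r * W a u"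
      by (rule integral_unique)
    moreover have "integral {a..b} (\<lambda>\<tau>. P1 \<tau> r * W \<tau> u + P \<tau> r * W1 \<tau> u)
        = integral {a..b} (\<lambda>\<tau>. P1 \<tau> r * W \<tau> u) + \<Psi> r u"
      unfolding \<Psi>_def using that
      by (intro integral_add integrable_continuous_interval continuous_intros ci')
    ultimately show ?thesis by simp
  qed
  have c2: "continuous_on (S \<times> cbox a b) (\<lambda>(r, \<tau>). g \<tau> r)"
    if "continuous_on ({a..b} \<times> S) (\<lambda>p. g (fst p) (snd p))" for g :: "real \<Rightarrow> real \<Rightarrow> real"
    unfolding case_prod_unfold
    by (rule continuous_on_compose2[OF that, of _ "\<lambda>p. (snd p, fst p)", unfolded fst_conv snd_conv])
       (intro continuous_intros, auto)
  note c2' = c[THEN c2, unfolded case_prod_unfold]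
  have d1: "((\<lambda>r. \<Psi> r u) has_real_derivative integral {a..b} (\<lambda>\<tau>. P2 \<tau> r * W1 \<tau> u)) (at r within S)"
    if "r \<in> S" "u \<in> S" for r u
    unfolding \<Psi>_def cbox_interval[symmetric]
  proof (rule leibniz_rule_field_derivative)
    show "continuous_on (S \<times> cbox a b) (\<lambda>(x, t). P2 t x * W1 t u)"
      unfolding case_prod_unfold using that
      by (intro continuous_intros c2' continuous_on_compose2[OF ci'(5)]) auto
  qed (use that S in \<open>auto intro!: derivative_eq_intros P2 integrable_continuous_interval continuous_intros ci'\<close>)
  have d2: "((\<lambda>u. \<Psi> r u) has_real_derivative
      P b r * W2 b u - P a r * W2 a u - integral {a..b} (\<lambda>\<tau>. P1 \<tau> r * W2 \<tau> u)) (at u within S)"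
    if "r \<in> S" "u \<in> S" for r u
  proof -
    have "((\<lambda>u. integral {a..b} (\<lambda>\<tau>. P1 \<tau> r * W \<tau> u)) has_real_derivative
       integral {a..b} (\<lambda>\<tau>. P1 \<tau> r * W2 \<tau> u)) (at u within S)"
      unfolding cbox_interval[symmetric]
    proof (rule leibniz_rule_field_derivative)
      show "continuous_on (S \<times> cbox a b) (\<lambda>(x, t). P1 t r * W2 t x)"
        unfolding case_prod_unfold using that
        by (intro continuous_intros c2' continuous_on_compose2[OF ci'(3)]) auto
    qed (use that S in \<open>auto intro!: derivative_eq_intros W2 integrable_continuous_interval continuous_intros ci'\<close>)
    then have "((\<lambda>u. P b r * W b u - P a r * W a u - integral {a..b} (\<lambda>\<tau>. P1 \<tau> r * W \<tau> u))
       has_real_derivative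
       P b r * W2 b u - P a r * W2 a u - integral {a..b} (\<lambda>\<tau>. P1 \<tau> r * W2 \<tau> u)) (at u within S)"
      using that ab by (auto intro!: derivative_eq_intros W2)
    then show ?thesis
      unfolding has_field_derivative_def
      by (rule has_derivative_transform[rotated 2]) (use that alt in auto)
  qed
  have cd2: "continuous_on (S \<times> S) (\<lambda>(r, u). P b r * W2 b u - P a r * W2 a u - integral {a..b} (\<lambda>\<tau>. P1 \<tau> r * W2 \<tau> u))"
  proof -
    have "continuous_on ((S \<times> S) \<times> cbox a b) (\<lambda>(p, \<tau>). P1 \<tau> (fst p) * W2 \<tau> (snd p))"
      unfolding case_prod_unfold
      by (intro continuous_intros continuous_on_compose2[OF c(3), of _ "\<lambda>p. (snd p, fst (fst p))", unfolded fst_conv snd_conv]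
          continuous_on_compose2[OF c(6), of _ "\<lambda>p. (snd p, snd (fst p))", unfolded fst_conv snd_conv]) auto
    from integral_continuous_on_param[OF this]
    have "continuous_on (S \<times> S) (\<lambda>p. integral {a..b} (\<lambda>\<tau>. P1 \<tau> (fst p) * W2 \<tau> (snd p)))" by simp
    then show ?thesis
      unfolding case_prod_unfold using ab
      by (intro continuous_intros continuous_on_compose2[OF c(1), of _ "\<lambda>p. (_, fst p)", unfolded fst_conv snd_conv]
          continuous_on_compose2[OF c(6), of _ "\<lambda>p. (_, snd p)", unfolded fst_conv snd_conv]) auto
  qed
  have "((\<lambda>(r, u). \<Psi> r u) has_derivative
     (\<lambda>(h, k). integral {a..b} (\<lambda>\<tau>. P2 \<tau> s * W1 \<tau> s) * h
       + (P b s * W2 b s - P a s * W2 a s - integral {a..b} (\<lambda>\<tau>. P1 \<tau> s * W2 \<tau> s)) * k)) (at (s, s) within S \<times> S)"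
    by (rule has_derivative_partials_real[OF d1 d2 cd2]) (use s S in auto)
  \<comment> \<open>The integral in the claim is \<open>\<Psi>\<close> on the diagonal
    \<open>r = u\<close>, so the joint differential is restricted to it.\<close>
  then have dd: "((\<lambda>(r, u). \<Psi> r u) has_derivative
     (\<lambda>(h, k). integral {a..b} (\<lambda>\<tau>. P2 \<tau> s * W1 \<tau> s) * h
       + (P b s * W2 b s - P a s * W2 a s - integral {a..b} (\<lambda>\<tau>. P1 \<tau> s * W2 \<tau> s)) * k))
     (at (s, s) within (\<lambda>s. (s, s)) ` S)"
    by (rule has_derivative_subset) auto
  have "((\<lambda>s. (s, s)) has_derivative (\<lambda>h. (h, h))) (at s within S)"
    by (intro has_derivative_Pair has_derivative_ident)
  from has_derivative_in_compose[OF this dd]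
  have "((\<lambda>s. \<Psi> s s) has_real_derivative integral {a..b} (\<lambda>\<tau>. P2 \<tau> s * W1 \<tau> s)
     + (P b s * W2 b s - P a s * W2 a s - integral {a..b} (\<lambda>\<tau>. P1 \<tau> s * W2 \<tau> s))) (at s within S)"
    unfolding has_field_derivative_def prod.case by (rule has_derivative_eq_rhs) (auto simp: algebra_simps fun_eq_iff)
  note D = this[unfolded \<Psi>_def]
  have "integral {a..b} (\<lambda>\<tau>. P2 \<tau> s * W1 \<tau> s - P1 \<tau> s * W2 \<tau> s) =
     integral {a..b} (\<lambda>\<tau>. P2 \<tau> s * W1 \<tau> s) - integral {a..b} (\<lambda>\<tau>. P1 \<tau> s * W2 \<tau> s)"
    using s by (intro integral_diff) (auto intro!: integrable_continuous_interval continuous_intros ci')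
  then show ?thesis
    by (intro DERIV_cong[OF D]) simp
qed

text \<open>The pair \<open>(x, v)\<close> is treated as one variable against time. This allows a
  time domain \<open>T\<close> with boundary while \<open>x\<close> and \<open>v\<close> range over
  the whole line.\<close>

lemma has_derivative_partials_real3:
  fixes F :: "real \<Rightarrow> real \<Rightarrow> real \<Rightarrow> real"
  assumes dF: "\<And>x v t. t \<in> T \<Longrightarrow> ((\<lambda>x. F x v t) has_real_derivative Fx x v t) (at x)"
    "\<And>x v t. t \<in> T \<Longrightarrow> ((\<lambda>v. F x v t) has_real_derivative Fv x v t) (at v)"
    "\<And>x v t. t \<in> T \<Longrightarrow> ((\<lambda>t. F x v t) has_real_derivative Ft x v t) (at t within T)"
    and cFv: "continuous_on (UNIV \<times> UNIV \<times> T) (\<lambda>(x, v, t). Fv x v t)"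
    and cFt: "continuous_on (UNIV \<times> UNIV \<times> T) (\<lambda>(x, v, t). Ft x v t)"
    and T: "convex T" and t: "t \<in> T"
  shows "((\<lambda>(p, t). F (fst p) (snd p) t) has_derivative (\<lambda>(p, k). Fx x v t * fst p + Fv x v t * snd p + Ft x v t * k))
     (at ((x, v), t) within UNIV \<times> T)"
proof -
  have "continuous_on (UNIV \<times> UNIV) (\<lambda>p. Fv (fst p) (snd p) t)"
    using continuous_on_compose2[OF cFv, of "UNIV \<times> UNIV" "\<lambda>p. (fst p, snd p, t)"] t
    by (auto simp: continuous_intros)
  then have d2: "((\<lambda>(x, v). F x v t) has_derivative (\<lambda>(h, k). Fx x v t * h + Fv x v t * k)) (at (x, v) within UNIV \<times> UNIV)"
    by (intro has_derivative_partials_real dF t) (auto simp: case_prod_unfold)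
  have "((\<lambda>(p, t). F (fst p) (snd p) t) has_derivative
     (\<lambda>(p, k). (\<lambda>(h, k). Fx x v t * h + Fv x v t * k) p + blinfun_mult_right (Ft (fst (x, v)) (snd (x, v)) t) k))
     (at ((x, v), t) within UNIV \<times> T)"
  proof (rule has_derivative_partialsI[where fy="\<lambda>p t. blinfun_mult_right (Ft (fst p) (snd p) t)"])
    show "((\<lambda>p. F (fst p) (snd p) t) has_derivative
       (\<lambda>(h, k). Fx x v t * h + Fv x v t * k)) (at (x, v) within UNIV)"
      using d2 by (simp add: case_prod_unfold)
    show "((\<lambda>t. F (fst p) (snd p) t) has_derivative blinfun_mult_right (Ft (fst p) (snd p) t)) (at t within T)"
      if "t \<in> T" for p t
      using dF(3)[OF that, of "fst p" "snd p"] by (simp add: has_field_derivative_def)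
    have "continuous_on (UNIV \<times> T) (\<lambda>q. Ft (fst (fst q)) (snd (fst q)) (snd q))"
      by (rule continuous_on_compose2[OF cFt[unfolded case_prod_unfold], of _ "\<lambda>q. (fst (fst q), snd (fst q), snd q)",
            unfolded fst_conv snd_conv]) (intro continuous_intros, auto)
    then have "continuous_on (UNIV \<times> T) (\<lambda>q. blinfun_mult_right (Ft (fst (fst q)) (snd (fst q)) (snd q)))"
      by (rule bounded_linear.continuous_on[OF bounded_linear_blinfun_mult_right])
    then show "continuous (at ((x, v), t) within UNIV \<times> T) (\<lambda>(p, t). blinfun_mult_right (Ft (fst p) (snd p) t))"
      using t by (auto simp: continuous_on_eq_continuous_within case_prod_unfold)
  qed (use t T in auto)
  then show ?thesis by (simp add: case_prod_unfold)
qed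

lemma continuous_on_partials_real3:
  fixes F :: "real \<Rightarrow> real \<Rightarrow> real \<Rightarrow> real"
  assumes "\<And>x v t. t \<in> T \<Longrightarrow> ((\<lambda>x. F x v t) has_real_derivative Fx x v t) (at x)"
    "\<And>x v t. t \<in> T \<Longrightarrow> ((\<lambda>v. F x v t) has_real_derivative Fv x v t) (at v)"
    "\<And>x v t. t \<in> T \<Longrightarrow> ((\<lambda>t. F x v t) has_real_derivative Ft x v t) (at t within T)"
    and "continuous_on (UNIV \<times> UNIV \<times> T) (\<lambda>(x, v, t). Fv x v t)"
    and "continuous_on (UNIV \<times> UNIV \<times> T) (\<lambda>(x, v, t). Ft x v t)"
    and "convex T"
  shows "continuous_on (UNIV \<times> UNIV \<times> T) (\<lambda>(x, v, t). F x v t)"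
proof -
  have c: "continuous_on (UNIV \<times> T) (\<lambda>(p, t). F (fst p) (snd p) t)"
    unfolding continuous_on_eq_continuous_within
  proof safe
    fix x v t assume "t \<in> T"
    from has_derivative_partials_real3[where F=F, OF assms this]
    show "continuous (at ((x, v), t) within UNIV \<times> T) (\<lambda>(p, t). F (fst p) (snd p) t)"
      by (rule has_derivative_continuous)
  qed
  show ?thesis
    unfolding case_prod_unfold
    by (rule continuous_on_compose2[OF c[unfolded case_prod_unfold], of _ "\<lambda>q. ((fst q, fst (snd q)), snd (snd q))",
          unfolded fst_conv snd_conv])
      (intro continuous_intros, auto)
qed

text \<open>The chain rule along a curve in phase space and time. Constant \<open>W\<close> gives
  curves at a fixed time, \<open>W s = s\<close> gives characteristics, and \<open>T\<close> may
  even be a single point.\<close>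

lemma has_real_derivative_compose_partials:
  fixes F :: "real \<Rightarrow> real \<Rightarrow> real \<Rightarrow> real"
  assumes dF: "\<And>x v t. t \<in> T \<Longrightarrow> ((\<lambda>x. F x v t) has_real_derivative Fx x v t) (at x)"
    "\<And>x v t. t \<in> T \<Longrightarrow> ((\<lambda>v. F x v t) has_real_derivative Fv x v t) (at v)"
    "\<And>x v t. t \<in> T \<Longrightarrow> ((\<lambda>t. F x v t) has_real_derivative Ft x v t) (at t within T)"
    and cF: "continuous_on (UNIV \<times> UNIV \<times> T) (\<lambda>(x, v, t). Fv x v t)"
      "continuous_on (UNIV \<times> UNIV \<times> T) (\<lambda>(x, v, t). Ft x v t)"
    and T: "convex T"
    and X: "(X has_real_derivative X') (at s within S)"
    and V: "(V has_real_derivative V') (at s within S)"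
    and W: "(W has_real_derivative W') (at s within S)" "W ` S \<subseteq> T" "s \<in> S"
  shows "((\<lambda>s. F (X s) (V s) (W s)) has_real_derivative
    Fx (X s) (V s) (W s) * X' + Fv (X s) (V s) (W s) * V' + Ft (X s) (V s) (W s) * W') (at s within S)"
proof -
  let ?x = "X s" and ?v = "V s" and ?t = "W s"
  have t: "?t \<in> T" using W by auto
  note dd = has_derivative_partials_real3[where F=F, OF dF cF T t, of ?x ?v]
  have dc: "((\<lambda>s. ((X s, V s), W s)) has_derivative (\<lambda>h. ((X' * h, V' * h), W' * h))) (at s within S)"
    using X V W unfolding has_field_derivative_def by (intro has_derivative_Pair) auto
  have "(\<lambda>s. ((X s, V s), W s)) ` S \<subseteq> UNIV \<times> T"
    using W by auto
  from has_derivative_in_compose[OF dc has_derivative_subset[OF dd this]]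
  show ?thesis
    unfolding has_field_derivative_def prod.case fst_conv snd_conv
    by (rule has_derivative_eq_rhs) (auto simp: algebra_simps fun_eq_iff)
qed

text \<open>The antiderivative that vanishes at 0. Rescaling to the fixed interval
  \<open>{0..1}\<close> gives one formula for both signs of \<open>x\<close> and reduces continuity
  in a parameter to that of an integral over a fixed interval.\<close>

definition primitive :: "(real \<Rightarrow> real) \<Rightarrow> real \<Rightarrow> real" where
  "primitive g x = x * integral {0..1} (\<lambda>r. g (x * r))"

lemma primitive_0 [simp]: "primitive g 0 = 0"
  by (simp add: primitive_def)

lemma primitive_eqI:
  assumes "\<And>x. (G has_real_derivative g x) (at x)"
  shows "primitive g x = G x - G 0"
proof -
  have "((\<lambda>r. x * g (x * r)) has_integral G (x * 1) - G (x * 0)) {0..1}"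
  proof (rule fundamental_theorem_of_calculus)
    fix r :: real
    have "((\<lambda>r. G (x * r)) has_real_derivative g (x * r) * x) (at r within {0..1})"
      by (rule DERIV_chain2[OF assms]) (auto intro!: derivative_eq_intros)
    then show "((\<lambda>r. G (x * r)) has_vector_derivative x * g (x * r)) (at r within {0..1})"
      by (simp add: has_real_derivative_iff_has_vector_derivative mult.commute)
  qed simp
  then show ?thesis
    by (simp add: primitive_def integral_unique integral_mult_right[symmetric] del: integral_mult_right)
qed

lemma ex_antiderivative:
  assumes "continuous_on UNIV (g :: real \<Rightarrow> real)"
  obtains G where "\<And>x. (G has_real_derivative g x) (at x)"
proof -
  define G where "G x = (if 0 \<le> x then integral {0..x} g else - integral {x..0} g)" for x
  \<comment> \<open>A base point to the left of both \<open>0\<close> and \<open>x\<close> merges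
    the two cases in the definition of \<open>G\<close> into one formula valid near
    \<open>x\<close>.\<close>
  have *: "G x = integral {-K..x} g - integral {-K..0} g" if "- K \<le> x" "0 \<le> K" for x K
  proof (cases "0 \<le> x")
    case True
    have "integral {-K..0} g + integral {0..x} g = integral {-K..x} g"
      using that True by (intro Henstock_Kurzweil_Integration.integral_combine integrable_continuous_interval
          continuous_on_subset[OF assms]) auto
    then show ?thesis using True by (simp add: G_def)
  next
    case False
    have "integral {-K..x} g + integral {x..0} g = integral {-K..0} g"
      using that False by (intro Henstock_Kurzweil_Integration.integral_combine integrable_continuous_interval
          continuous_on_subset[OF assms]) auto
    then show ?thesis using False by (simp add: G_def)
  qed
  have "(G has_real_derivative g x) (at x)" for x
  proof -
    define K where "K = \<bar>x\<bar> + 1"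
    have "((\<lambda>u. integral {-K..u} g) has_real_derivative g x) (at x within {-K..K})"
      by (rule integral_has_real_derivative) (auto intro: continuous_on_subset[OF assms] simp: K_def)
    then have "((\<lambda>u. integral {-K..u} g) has_real_derivative g x) (at x)"
      by (subst (asm) at_within_Icc_at) (auto simp: K_def)
    then have "((\<lambda>u. integral {-K..u} g - integral {-K..0} g) has_real_derivative g x) (at x)"
      by (auto intro!: derivative_eq_intros)
    then show ?thesis
      by (rule has_field_derivative_transform_within_open[where S="{-K<..}"]) (use *[of K] in \<open>auto simp: K_def\<close>)
  qed
  then show ?thesis by (rule that)
qed

lemma has_real_derivative_primitive:
  assumes "continuous_on UNIV g"
  shows "(primitive g has_real_derivative g x) (at x)"
proof -
  obtain G where G: "\<And>x. (G has_real_derivative g x) (at x)"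
    using ex_antiderivative[OF assms] by blast
  have "primitive g = (\<lambda>x. G x - G 0)"
    using primitive_eqI[OF G] by auto
  then show ?thesis
    by (auto intro!: derivative_eq_intros G)
qed

lemma primitive_diff_eq_integral:
  assumes "continuous_on UNIV g" "a \<le> b"
  shows "primitive g b - primitive g a = integral {a..b} g" "(g has_integral primitive g b - primitive g a) {a..b}"
proof -
  show "(g has_integral primitive g b - primitive g a) {a..b}"
    by (rule fundamental_theorem_of_calculus[OF assms(2)])
      (auto simp: has_real_derivative_iff_has_vector_derivative[symmetric]
        intro: DERIV_subset has_real_derivative_primitive[OF assms(1)])
  then show "primitive g b - primitive g a = integral {a..b} g"
    by (simp add: integral_unique)
qed

lemma primitive_eq_integral:
  assumes "continuous_on UNIV g" "0 \<le> x"
  shows "primitive g x = integral {0..x} g"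
  using primitive_diff_eq_integral(1)[OF assms] by simp

lemma abs_primitive_le:
  assumes g: "continuous_on UNIV g" and x: "0 \<le> x" "x \<le> 1"
  shows "\<bar>primitive g x\<bar> \<le> integral {0..1} (\<lambda>y. \<bar>g y\<bar>)"
proof -
  have i: "(\<lambda>y. \<bar>g y\<bar>) integrable_on {a..b}" for a b
    by (intro integrable_continuous_interval continuous_intros continuous_on_subset[OF g]) auto
  have "\<bar>primitive g x\<bar> \<le> integral {0..x} (\<lambda>y. \<bar>g y\<bar>)"
    unfolding primitive_eq_integral[OF g x(1)]
    by (rule order_trans[OF _ integral_norm_bound_integral[where f=g]])
      (auto intro!: i integrable_continuous_interval continuous_on_subset[OF g])
  also have "\<dots> \<le> integral {0..1} (\<lambda>y. \<bar>g y\<bar>)"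
    by (rule integral_subset_le) (use x i in auto)
  finally show ?thesis .
qed

lemma primitive_periodic:
  assumes g: "continuous_on UNIV g" "\<And>x. g (x + 1) = g x"
  shows "primitive g (x + 1) = primitive g x + integral {0..1} g"
proof -
  have "((\<lambda>x. primitive g (x + 1) - primitive g x) has_real_derivative 0) (at y)" for y
    by (rule derivative_eq_intros has_real_derivative_primitive[OF g(1)]
        DERIV_chain2[OF has_real_derivative_primitive[OF g(1)]] refl)+ (simp add: g(2))
  then have "primitive g (x + 1) - primitive g x = primitive g (0 + 1) - primitive g 0"
    using DERIV_isconst_all by blast
  then show ?thesis
    using primitive_eq_integral[OF g(1), of 1] by simp
qed

section \<open>The Poisson kernel\<close>

lemma periodic_add_int:
  assumes "\<And>x. g (x + 1) = g (x :: real)"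
  shows "g (x + of_int k) = g x"
proof (induction k rule: int_induct[where k=0])
  case (step1 i)
  then show ?case using assms[of "x + of_int i"] by (simp add: ac_simps)
next
  case (step2 i)
  then show ?case using assms[of "x + of_int (i - 1)"] by (simp add: algebra_simps)
qed simp

lemma periodic_frac:
  assumes "\<And>x. g (x + 1) = g (x :: real)"
  shows "g (frac x) = g x"
  using periodic_add_int[of g "frac x" "\<lfloor>x\<rfloor>"] assms by (simp add: frac_def)

text \<open>For periodic \<open>w\<close>, this is the periodic antiderivative of mean zero of \<open>w\<close> minus its mean.\<close>

definition mean_zero_primitive :: "(real \<Rightarrow> real) \<Rightarrow> real \<Rightarrow> real" where
  "mean_zero_primitive w x = primitive w x + integral {0..1} (\<lambda>y. (y - x - 1/2) * w y)"

lemma primitive_param_continuous: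
  assumes "continuous_on (UNIV \<times> U) (\<lambda>(y, p). w y p)"
  shows "continuous_on (UNIV \<times> U) (\<lambda>(x :: real, p). primitive (\<lambda>y. w y p) x)"
proof -
  have "continuous_on ((UNIV \<times> U) \<times> cbox 0 1) (\<lambda>(q, r). w (fst q * r) (snd q))"
    unfolding case_prod_unfold
    by (rule continuous_on_compose2[OF assms[unfolded case_prod_unfold], of _ "\<lambda>z. (fst (fst z) * snd z, snd (fst z))",
          unfolded fst_conv snd_conv]) (intro continuous_intros, auto)
  from integral_continuous_on_param[OF this]
  show ?thesis
    unfolding primitive_def case_prod_unfold by (auto intro!: continuous_intros)
qed

lemma mean_zero_primitive_continuous:
  assumes "continuous_on (UNIV \<times> U) (\<lambda>(y, p). w y p)"
  shows "continuous_on (UNIV \<times> U) (\<lambda>(x :: real, p). mean_zero_primitive (\<lambda>y. w y p) x)"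
proof -
  have "continuous_on ((UNIV \<times> U) \<times> cbox 0 1) (\<lambda>(q, y). (y - fst q - 1/2) * w y (snd q))"
    unfolding case_prod_unfold
    by (intro continuous_intros continuous_on_compose2[OF assms[unfolded case_prod_unfold], of _ "\<lambda>z. (snd z, snd (fst z))",
          unfolded fst_conv snd_conv]) auto
  from integral_continuous_on_param[OF this]
  show ?thesis
    unfolding mean_zero_primitive_def case_prod_unfold
    using primitive_param_continuous[OF assms] by (auto intro!: continuous_intros simp: case_prod_unfold)
qed

lemma mean_zero_primitive_param_deriv:
  fixes w :: "real \<Rightarrow> real \<Rightarrow> real"
  assumes d: "\<And>y p. p \<in> U \<Longrightarrow> ((\<lambda>p. w y p) has_real_derivative wp y p) (at p within U)"
    and c: "continuous_on (UNIV \<times> U) (\<lambda>(y, p). wp y p)"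
    and cw: "\<And>p. p \<in> U \<Longrightarrow> continuous_on UNIV (\<lambda>y. w y p)"
    and p: "convex U" "p \<in> U"
  shows "((\<lambda>p. mean_zero_primitive (\<lambda>y. w y p) x) has_real_derivative mean_zero_primitive (\<lambda>y. wp y p) x) (at p within U)"
proof -
  have "((\<lambda>p. integral (cbox 0 1) (\<lambda>r. w (x * r) p)) has_real_derivative integral (cbox 0 1) (\<lambda>r. wp (x * r) p)) (at p within U)"
  proof (rule leibniz_rule_field_derivative)
    show "continuous_on (U \<times> cbox 0 1) (\<lambda>(p, r). wp (x * r) p)"
      unfolding case_prod_unfold
      by (rule continuous_on_compose2[OF c[unfolded case_prod_unfold], of _ "\<lambda>z. (x * snd z, fst z)",
          unfolded fst_conv snd_conv]) (intro continuous_intros, auto)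
    show "(\<lambda>r. w (x * r) q) integrable_on cbox 0 1" if "q \<in> U" for q
      by (intro integrable_continuous continuous_on_compose2[OF cw[OF that]] continuous_intros) auto
  qed (use p d in auto)
  moreover have "((\<lambda>p. integral (cbox 0 1) (\<lambda>y. (y - x - 1/2) * w y p)) has_real_derivative
      integral (cbox 0 1) (\<lambda>y. (y - x - 1/2) * wp y p)) (at p within U)"
  proof (rule leibniz_rule_field_derivative)
    show "continuous_on (U \<times> cbox 0 1) (\<lambda>(p, y). (y - x - 1/2) * wp y p)"
      unfolding case_prod_unfold
      by (intro continuous_intros continuous_on_compose2[OF c[unfolded case_prod_unfold], of _ "\<lambda>z. (snd z, fst z)",
          unfolded fst_conv snd_conv]) auto
    show "(\<lambda>y. (y - x - 1/2) * w y q) integrable_on cbox 0 1" if "q \<in> U" for q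
      by (intro integrable_continuous continuous_intros continuous_on_subset[OF cw[OF that]]) auto
  qed (use p d in \<open>auto intro!: derivative_eq_intros\<close>)
  ultimately show ?thesis
    unfolding mean_zero_primitive_def primitive_def by (auto intro!: derivative_eq_intros)
qed

lemma has_real_derivative_mean_zero_primitive:
  assumes c: "continuous_on UNIV w"
  shows "(mean_zero_primitive w has_real_derivative w x - integral {0..1} w) (at x)"
proof -
  have i: "w integrable_on {0..1}" "(\<lambda>y. (y - 1/2) * w y) integrable_on {0..1}"
    by (auto intro!: integrable_continuous_interval continuous_intros continuous_on_subset[OF c])
  have "mean_zero_primitive w = (\<lambda>x. primitive w x + integral {0..1} (\<lambda>y. (y - 1/2) * w y) - x * integral {0..1} w)"
  proof
    fix x
    have "integral {0..1} (\<lambda>y. (y - x - 1/2) * w y) = integral {0..1} (\<lambda>y. (y - 1/2) * w y - x * w y)"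
      by (simp add: algebra_simps)
    also have "\<dots> = integral {0..1} (\<lambda>y. (y - 1/2) * w y) - x * integral {0..1} w"
      using i integrable_cmul[OF i(1), of x] by (subst integral_diff) auto
    finally show "mean_zero_primitive w x = primitive w x + integral {0..1} (\<lambda>y. (y - 1/2) * w y) - x * integral {0..1} w"
      by (simp add: mean_zero_primitive_def)
  qed
  then show ?thesis
    by (auto intro!: derivative_eq_intros has_real_derivative_primitive[OF c])
qed

lemma mean_zero_primitive_periodic:
  assumes c: "continuous_on UNIV w" and p: "\<And>x. w (x + 1) = w x"
  shows "mean_zero_primitive w (x + 1) = mean_zero_primitive w x"
proof -
  have i: "w integrable_on {0..1}" "(\<lambda>y. (y - x - 1/2) * w y) integrable_on {0..1}"
    by (auto intro!: integrable_continuous_interval continuous_intros continuous_on_subset[OF c])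
  have "integral {0..1} (\<lambda>y. (y - (x + 1) - 1/2) * w y) = integral {0..1} (\<lambda>y. (y - x - 1/2) * w y - w y)"
    by (simp add: algebra_simps)
  also have "\<dots> = integral {0..1} (\<lambda>y. (y - x - 1/2) * w y) - integral {0..1} w"
    using i by (rule integral_diff[rotated])
  finally show ?thesis
    by (simp add: mean_zero_primitive_def primitive_periodic[OF c p])
qed

text \<open>By periodicity \<open>x\<close> may be replaced by \<open>frac x\<close>. The constant
  is 1 from \<open>primitive\<close> plus the crude bound 2 on the weight
  \<open>y - frac x - 1/2\<close>.\<close>

lemma abs_mean_zero_primitive_le:
  assumes c: "continuous_on UNIV w" and p: "\<And>x. w (x + 1) = w x"
  shows "\<bar>mean_zero_primitive w x\<bar> \<le> 3 * integral {0..1} (\<lambda>y. \<bar>w y\<bar>)"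
proof -
  let ?x = "frac x"
  have x: "0 \<le> ?x" "?x \<le> 1" using frac_lt_1[of x] by (auto simp: less_imp_le)
  have i: "(\<lambda>y. (y - ?x - 1/2) * w y) integrable_on {0..1}" "(\<lambda>y. 2 * \<bar>w y\<bar>) integrable_on {0..1}"
    by (auto intro!: integrable_continuous_interval continuous_intros continuous_on_subset[OF c])
  have "\<bar>integral {0..1} (\<lambda>y. (y - ?x - 1/2) * w y)\<bar> \<le> integral {0..1} (\<lambda>y. 2 * \<bar>w y\<bar>)"
    unfolding real_norm_def[symmetric]
  proof (rule integral_norm_bound_integral)
    fix y :: real assume "y \<in> {0..1}"
    then have "\<bar>y - ?x - 1/2\<bar> \<le> 2" using x unfolding atLeastAtMost_iff by linarith
    then show "norm ((y - ?x - 1/2) * w y) \<le> 2 * norm (w y)"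
      by (simp add: abs_mult mult_right_mono)
  qed (use i in simp_all)
  with abs_primitive_le[OF c x] have "\<bar>mean_zero_primitive w ?x\<bar> \<le> 3 * integral {0..1} (\<lambda>y. \<bar>w y\<bar>)"
    unfolding mean_zero_primitive_def by simp
  then show ?thesis
    using periodic_frac[of "mean_zero_primitive w" x] mean_zero_primitive_periodic[OF c p] by simp
qed

lemma mean_zero_primitive_diff:
  assumes "continuous_on UNIV w" "continuous_on UNIV w'"
  shows "mean_zero_primitive (\<lambda>y. w y - w' y) x = mean_zero_primitive w x - mean_zero_primitive w' x"
proof -
  have "integral {0..1} (\<lambda>r. w (x * r) - w' (x * r)) = integral {0..1} (\<lambda>r. w (x * r)) - integral {0..1} (\<lambda>r. w' (x * r))"
    by (intro integral_diff integrable_continuous_interval continuous_on_compose2[OF assms(1)]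
        continuous_on_compose2[OF assms(2)] continuous_intros) auto
  moreover have "integral {0..1} (\<lambda>y. (y - x - 1/2) * (w y - w' y)) =
     integral {0..1} (\<lambda>y. (y - x - 1/2) * w y) - integral {0..1} (\<lambda>y. (y - x - 1/2) * w' y)"
    unfolding right_diff_distrib
    by (intro integral_diff integrable_continuous_interval continuous_intros continuous_on_subset[OF assms(1)]
        continuous_on_subset[OF assms(2)]) auto
  ultimately show ?thesis
    unfolding mean_zero_primitive_def primitive_def by (simp only: right_diff_distrib)
qed

text \<open>The field of a charge density that is merely integrable, as the background is.
  \<open>mean_zero_primitive\<close> plays the same role for continuous densities and takes over
  wherever the background cancels.\<close>

definition kernel_transform :: "(real \<Rightarrow> real) \<Rightarrow> real \<Rightarrow> real" where
  "kernel_transform w x = (LBINT y:{0..1}. vp_kernel (frac x) y * w y)"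

lemma electric_field_eq: "electric_field \<rho> g x = kernel_transform (\<lambda>y. \<rho> y - (LBINT v. g y v)) x"
  by (simp add: electric_field_def kernel_transform_def)

lemma vp_kernel_measurable [measurable]: "vp_kernel x \<in> borel_measurable borel"
  unfolding vp_kernel_def by measurable

lemma vp_kernel_measurable2: "(\<lambda>(x, y). vp_kernel x y) \<in> borel_measurable (borel \<Otimes>\<^sub>M borel)"
  unfolding vp_kernel_def by measurable

lemma abs_vp_kernel_le: "0 \<le> y \<Longrightarrow> y \<le> 1 \<Longrightarrow> \<bar>vp_kernel x y\<bar> \<le> 1"
  by (simp add: vp_kernel_def)

lemma set_integrable_bounded_mult:
  fixes w k :: "real \<Rightarrow> real"
  assumes "set_integrable lborel S w" "k \<in> borel_measurable borel" "\<And>y. y \<in> S \<Longrightarrow> \<bar>k y\<bar> \<le> K"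
  shows "set_integrable lborel S (\<lambda>y. k y * w y)"
proof -
  have "integrable lborel (\<lambda>y. K * (indicator S y *\<^sub>R w y))"
    using assms(1) unfolding set_integrable_def by simp
  then show ?thesis
    unfolding set_integrable_def
  proof (rule Bochner_Integration.integrable_bound)
    have "(\<lambda>y. k y * (indicator S y *\<^sub>R w y)) \<in> borel_measurable lborel"
      using assms(1,2) unfolding set_integrable_def by (intro borel_measurable_times) auto
    then show "(\<lambda>y. indicator S y *\<^sub>R (k y * w y)) \<in> borel_measurable lborel"
      by (simp add: mult.left_commute)
    show "AE y in lborel. norm (indicator S y *\<^sub>R (k y * w y)) \<le> norm (K * (indicator S y *\<^sub>R w y))"
      using assms(3) by (intro AE_I2) (auto simp: indicator_def abs_mult intro!: mult_right_mono intro: order_trans[OF _ abs_ge_self])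
  qed
qed

lemma abs_kernel_transform_le:
  assumes "set_integrable lborel {0..1} w"
  shows "\<bar>kernel_transform w x\<bar> \<le> (LBINT y:{0..1}. \<bar>w y\<bar>)"
proof -
  have 1: "set_integrable lborel {0..1} (\<lambda>y. vp_kernel (frac x) y * w y)"
    by (rule set_integrable_bounded_mult[OF assms, where K=1]) (auto intro: abs_vp_kernel_le)
  have 2: "set_integrable lborel {0..1} (\<lambda>y. \<bar>w y\<bar>)"
    using assms by (rule set_integrable_abs)
  have "\<bar>kernel_transform w x\<bar> \<le> (LBINT y:{0..1}. \<bar>vp_kernel (frac x) y * w y\<bar>)"
    using set_integral_norm_bound[OF 1] by (simp add: kernel_transform_def)
  also have "\<dots> \<le> (LBINT y:{0..1}. \<bar>w y\<bar>)"
    using 1 2 by (intro set_integral_mono set_integrable_abs[OF 1])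
      (auto simp: abs_mult intro!: mult_left_le_one_le abs_vp_kernel_le)
  finally show ?thesis .
qed

lemma kernel_transform_diff:
  assumes "set_integrable lborel {0..1} w" "set_integrable lborel {0..1} w'"
  shows "kernel_transform (\<lambda>y. w y - w' y) x = kernel_transform w x - kernel_transform w' x"
  unfolding kernel_transform_def right_diff_distrib
  by (intro set_integral_diff set_integrable_bounded_mult[where K=1] assms) (auto intro: abs_vp_kernel_le)

lemma kernel_transform_periodic: "kernel_transform w (x + 1) = kernel_transform w x"
  by (simp add: kernel_transform_def frac_1_eq)

lemma kernel_transform_eq:
  assumes w: "set_integrable lborel {0..1} w" and x: "0 \<le> x" "x < 1"
  shows "kernel_transform w x = (LBINT y:{0..1}. (y - 1) * w y) + integral {0..x} w"
proof -
  have f: "frac x = x" using x by (simp add: frac_eq)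
  have 1: "set_integrable lborel {0..1} (\<lambda>y. (y - 1) * w y)"
    by (rule set_integrable_bounded_mult[OF w, where K=1]) auto
  have 2: "set_integrable lborel {0..x} w"
    using w by (rule set_integrable_subset) (use x in auto)
  have "kernel_transform w x = (LBINT y:{0..1}. (y - 1) * w y + indicator {0..x} y * w y)"
    unfolding kernel_transform_def f using x
    by (intro set_lebesgue_integral_cong) (auto simp: vp_kernel_def indicator_def algebra_simps)
  also have "\<dots> = (LBINT y:{0..1}. (y - 1) * w y) + (LBINT y:{0..1}. indicator {0..x} y * w y)"
    by (intro set_integral_add 1 set_integrable_bounded_mult[OF w, where K=1]) auto
  also have "(LBINT y:{0..1}. indicator {0..x} y * w y) = (LBINT y:{0..x}. w y)"
    unfolding set_lebesgue_integral_def using x by (intro Bochner_Integration.integral_cong) (auto simp: indicator_def)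
  also have "\<dots> = integral {0..x} w"
    using set_borel_integral_eq_integral(2)[OF 2] .
  finally show ?thesis .
qed

text \<open>At \<open>x = 1\<close> the formula agrees with the periodic extension only because \<open>w\<close> has mean zero.\<close>

lemma kernel_transform_eq':
  assumes w: "set_integrable lborel {0..1} w" "integral {0..1} w = 0" and x: "0 \<le> x" "x \<le> 1"
  shows "kernel_transform w x = (LBINT y:{0..1}. (y - 1) * w y) + integral {0..x} w"
  using kernel_transform_eq[OF w(1), of x] kernel_transform_eq[OF w(1), of 0] w x
    kernel_transform_periodic[of w 0] by (cases "x = 1") auto

lemma continuous_on_periodic:
  fixes g :: "real \<Rightarrow> real"
  assumes g: "continuous_on {0..1} g" and p: "\<And>x. g (x + 1) = g x"
  shows "continuous_on UNIV g"
proof -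
  have 1: "continuous_on {of_int k .. of_int (k + 1)} g" for k :: int
  proof -
    have "continuous_on {of_int k .. of_int (k + 1)} (\<lambda>x. g (x - of_int k))"
      by (rule continuous_on_compose2[OF g]) (auto intro!: continuous_intros)
    then show ?thesis
      using periodic_add_int[of g, OF p, of "_" "- k"] by simp
  qed
  \<comment> \<open>An integer point is not interior to a unit interval with integer ends, but it is
    interior to the union of two adjacent ones.\<close>
  have 2: "continuous_on {of_int k .. of_int (k + 2)} g" for k :: int
  proof -
    have "continuous_on ({of_int k .. of_int (k + 1)} \<union> {of_int (k + 1) .. of_int (k + 1 + 1)}) g"
      by (intro continuous_on_closed_Un 1) auto
    moreover have "{of_int k .. of_int (k + 1)} \<union> {of_int (k + 1) .. of_int (k + 1 + 1)} = {of_int k .. of_int (k + 2) :: real}"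
      by auto
    ultimately show ?thesis by simp
  qed
  have "isCont g x" for x
  proof -
    define k where "k = \<lceil>x\<rceil> - 1"
    have "of_int k < x" "x < of_int (k + 2)"
      unfolding k_def by linarith+
    then show ?thesis
      using continuous_on_interior[OF 2[of k]] by simp
  qed
  then show ?thesis
    by (simp add: continuous_at_imp_continuous_on)
qed

lemma continuous_on_kernel_transform:
  assumes w: "set_integrable lborel {0..1} w" "integral {0..1} w = 0"
  shows "continuous_on UNIV (kernel_transform w)"
proof (rule continuous_on_periodic)
  have "w integrable_on {0..1}"
    using w(1) set_borel_integral_eq_integral(1) by blast
  then have "continuous_on {0..1} (\<lambda>x. (LBINT y:{0..1}. (y - 1) * w y) + integral {0..x} w)"
    by (intro continuous_intros indefinite_integral_continuous_1)
  then show "continuous_on {0..1} (kernel_transform w)"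
    by (rule continuous_on_eq) (use kernel_transform_eq'[OF w] in auto)
qed (rule kernel_transform_periodic)

text \<open>On \<open>[0,1)\<close> the two expressions differ by the integral of
  \<open>(x - 1/2) * w y\<close> over \<open>y\<close>, which vanishes for neutral charges.
  Periodicity of both sides does the rest.\<close>

lemma kernel_transform_continuous_eq:
  assumes c: "continuous_on UNIV w" and p: "\<And>x. w (x + 1) = w x" and z: "integral {0..1} w = 0"
  shows "kernel_transform w x = mean_zero_primitive w x"
proof -
  have si: "set_integrable lborel {0..1} w"
    by (intro borel_integrable_atLeastAtMost' continuous_on_subset[OF c]) auto
  have si2: "set_integrable lborel {0..1} (\<lambda>y. (y - 1) * w y)"
    by (intro borel_integrable_atLeastAtMost' continuous_intros continuous_on_subset[OF c]) auto
  have eq: "kernel_transform w x = mean_zero_primitive w x" if x: "0 \<le> x" "x < 1" for x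
  proof -
    have "(LBINT y:{0..1}. (y - 1) * w y) = integral {0..1} (\<lambda>y. (y - x - 1/2) * w y + (x - 1/2) * w y)"
      using set_borel_integral_eq_integral(2)[OF si2] by (simp add: algebra_simps)
    also have "\<dots> = integral {0..1} (\<lambda>y. (y - x - 1/2) * w y) + integral {0..1} (\<lambda>y. (x - 1/2) * w y)"
      by (intro integral_add integrable_continuous_interval continuous_intros continuous_on_subset[OF c]) auto
    finally show ?thesis
      using kernel_transform_eq[OF si x] primitive_eq_integral[OF c x(1)] z
      by (simp add: mean_zero_primitive_def)
  qed
  show ?thesis
    using eq[of "frac x"] periodic_frac[of "kernel_transform w" x] kernel_transform_periodic
      periodic_frac[of "mean_zero_primitive w" x] mean_zero_primitive_periodic[OF c p]
    by (simp add: frac_lt_1)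
qed

lemma integral_vp_kernel:
  assumes "0 \<le> y" "y \<le> 1"
  shows "(LBINT x:{0..1}. vp_kernel x y) = 0"
proof -
  have "((\<lambda>x::real. y - indicator {..<y} x) has_integral (y - y)) {0..1}"
  proof (rule has_integral_diff)
    show "((\<lambda>x::real. y) has_integral y) {0..1}" using has_integral_const_real[of y 0 1] by simp
    have "((\<lambda>x::real. 1::real) has_integral y) {0..y}" using has_integral_const_real[of "1::real" 0 y] assms by simp
    then have "((\<lambda>x. if x \<in> {0..y} then 1 else 0) has_integral y) {0..1}"
      by (subst has_integral_restrict) (use assms in auto)
    then show "(indicator {..<y} has_integral y) {0..1}"
      by (rule has_integral_spike[OF negligible_sing[of y], rotated]) (auto simp: indicator_def)
  qed
  then have "((\<lambda>x::real. y - indicator {..<y} x) has_integral 0) {0..1}"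
    by simp
  then have "((\<lambda>x. vp_kernel x y) has_integral 0) {0..1}"
    by (rule has_integral_eq[rotated]) (auto simp: vp_kernel_def indicator_def)
  moreover have "set_integrable lborel {0..1} (\<lambda>x. vp_kernel x y)"
  proof -
    have "(\<lambda>x. vp_kernel x y) \<in> borel_measurable borel" unfolding vp_kernel_def by measurable
    then have "set_integrable lborel {0..1::real} (\<lambda>x. vp_kernel x y * 1)"
      by (intro set_integrable_bounded_mult[where K=1]) (use assms abs_vp_kernel_le in \<open>auto simp: set_integrable_def\<close>)
    then show ?thesis by simp
  qed
  ultimately show ?thesis
    using set_borel_integral_eq_integral(2) by (metis integral_unique)
qed

text \<open>The kernel has mean zero in its first variable, so exchanging the order of integration
  gives zero. Fubini applies because the kernel is bounded by one and \<open>w\<close> is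
  integrable.\<close>

lemma integral_kernel_transform:
  assumes w: "set_integrable lborel {0..1} w" "integral {0..1} w = 0"
  shows "integral {0..1} (kernel_transform w) = 0"
proof -
  let ?w = "\<lambda>y. indicator {0..1} y * w y"
  have iw: "integrable lborel ?w" using w(1) by (simp add: set_integrable_def)
  have mw [measurable]: "?w \<in> borel_measurable borel" using iw by (simp add: borel_measurable_integrable)
  note vp_kernel_measurable2 [measurable]
  have i2: "integrable (lborel \<Otimes>\<^sub>M lborel) (\<lambda>(x, y). indicator {0..1::real} x * ?w y)"
    by (rule lborel_pair.Fubini_integrable) (use iw in \<open>auto simp: abs_mult\<close>)
  have i: "integrable (lborel \<Otimes>\<^sub>M lborel) (\<lambda>(x, y). indicator {0..1} x * vp_kernel x y * ?w y)"
  proof (rule Bochner_Integration.integrable_bound[OF i2])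
    have [measurable]: "(\<lambda>z. vp_kernel (fst z) (snd z)) \<in> borel_measurable (lborel \<Otimes>\<^sub>M lborel)"
      using vp_kernel_measurable2 by (simp add: case_prod_unfold)
    show "(\<lambda>(x, y). indicator {0..1} x * vp_kernel x y * ?w y) \<in> borel_measurable (lborel \<Otimes>\<^sub>M lborel)"
      unfolding case_prod_unfold by measurable
    show "AE z in lborel \<Otimes>\<^sub>M lborel. norm (case z of (x, y) \<Rightarrow> indicator {0..1} x * vp_kernel x y * ?w y)
        \<le> norm (case z of (x, y) \<Rightarrow> indicator {0..1::real} x * ?w y)"
      by (intro AE_I2) (auto simp: indicator_def abs_mult intro!: mult_left_le_one_le abs_vp_kernel_le)
  qed
  have si: "set_integrable lborel {0..1} (kernel_transform w)"
    by (intro borel_integrable_atLeastAtMost' continuous_on_subset[OF continuous_on_kernel_transform[OF w]]) auto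
  have "integral {0..1} (kernel_transform w) = (LBINT x:{0..1}. kernel_transform w x)"
    using set_borel_integral_eq_integral(2)[OF si] by simp
  also have "\<dots> = (LBINT x. (LBINT y. indicator {0..1} x * vp_kernel x y * ?w y))"
    unfolding set_lebesgue_integral_def
  proof (rule integral_cong_AE)
    \<comment> \<open>At \<open>x = 1\<close> the definition evaluates the kernel at
      \<open>frac 1 = 0\<close>, so the two integrands agree only off this point.\<close>
    show "AE x in lborel. indicator {0..1} x *\<^sub>R kernel_transform w x = (LBINT y. indicator {0..1} x * vp_kernel x y * ?w y)"
      using AE_lborel_singleton[of "1::real"]
    proof eventually_elim
      case (elim x)
      show ?case
      proof (cases "x \<in> {0..1}")
        case True
        then have "frac x = x" using elim by (auto simp: frac_eq)
        then show ?thesis using True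
          by (simp add: kernel_transform_def set_lebesgue_integral_def mult_ac)
      qed simp
    qed
    show "(\<lambda>x. LBINT y. indicator {0..1} x * vp_kernel x y * ?w y) \<in> borel_measurable lborel"
      using lborel_pair.integrable_fst[OF i] by (simp add: borel_measurable_integrable)
    show "(\<lambda>x. indicator {0..1} x *\<^sub>R kernel_transform w x) \<in> borel_measurable lborel"
      using si by (simp add: set_integrable_def borel_measurable_integrable)
  qed
  also have "\<dots> = (LBINT y. (LBINT x. indicator {0..1} x * vp_kernel x y * ?w y))"
    using lborel_pair.Fubini_integral[OF i] by simp
  also have "\<dots> = (LBINT y::real. 0)"
  proof (rule Bochner_Integration.integral_cong[OF refl])
    fix y
    have "(LBINT x. indicator {0..1} x * vp_kernel x y * ?w y) = (LBINT x:{0..1}. vp_kernel x y) * ?w y"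
      by (simp add: set_lebesgue_integral_def)
    also have "\<dots> = 0" using integral_vp_kernel[of y] by (auto simp: indicator_def)
    finally show "(LBINT x. indicator {0..1} x * vp_kernel x y * ?w y) = 0" .
  qed
  finally show ?thesis by simp
qed

section \<open>The characteristic flow is area preserving\<close>

text \<open>The gradient \<open>D\<close> is part of the data. Since the field is only continuous,
  \<open>D\<close> satisfies no linearised equation here, and its properties have to be extracted
  from identities for the flow itself.\<close>

locale phase_flow =
  fixes E :: "real \<Rightarrow> real \<Rightarrow> real" and \<Phi> :: "real \<Rightarrow> real \<times> real \<Rightarrow> real \<times> real"
    and D :: "real \<Rightarrow> real \<times> real \<Rightarrow> (real \<times> real) \<Rightarrow>\<^sub>L (real \<times> real)"
  assumes field_continuous: "continuous_on (UNIV \<times> {0..}) (\<lambda>(x, t). E x t)"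
    and flow_0: "\<Phi> 0 z = z"
    and flow_shift: "t \<ge> 0 \<Longrightarrow> \<Phi> t (x + 1, v) = \<Phi> t (x, v) + (1, 0)"
    and flow_fst: "t \<ge> 0 \<Longrightarrow> ((\<lambda>s. fst (\<Phi> s z)) has_real_derivative snd (\<Phi> t z)) (at t within {0..})"
    and flow_snd: "t \<ge> 0 \<Longrightarrow> ((\<lambda>s. snd (\<Phi> s z)) has_real_derivative - E (fst (\<Phi> t z)) t) (at t within {0..})"
    and flow_bij: "t \<ge> 0 \<Longrightarrow> bij (\<Phi> t)"
    and flow_deriv_continuous: "continuous_on ({0..} \<times> UNIV) (\<lambda>(t, z). D t z)"
    and flow_deriv: "t \<ge> 0 \<Longrightarrow> (\<Phi> t has_derivative blinfun_apply (D t z)) (at z)"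
begin

lemma flow_continuous: "continuous_on ({0..} \<times> UNIV) (\<lambda>(t, z). \<Phi> t z)"
  unfolding continuous_on_eq_continuous_within
proof safe
  fix t :: real and z :: "real \<times> real" assume t: "0 \<le> t"
  have "((\<lambda>(t, z). \<Phi> t z) has_derivative
     (\<lambda>(h, k). (snd (\<Phi> t z) * h, - E (fst (\<Phi> t z)) t * h) + D t z k)) (at (t, z) within {0..} \<times> UNIV)"
  proof (rule has_derivative_partialsI)
    have "((\<lambda>s. (fst (\<Phi> s z), snd (\<Phi> s z))) has_derivative (\<lambda>h. (snd (\<Phi> t z) * h, - E (fst (\<Phi> t z)) t * h))) (at t within {0..})"
      by (intro has_derivative_Pair)
        (use flow_fst[OF t, of z] flow_snd[OF t, of z] in \<open>simp_all add: has_field_derivative_def mult_minus_left[abs_def, symmetric] del: mult_minus_left\<close>)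
    then show "((\<lambda>s. \<Phi> s z) has_derivative (\<lambda>h. (snd (\<Phi> t z) * h, - E (fst (\<Phi> t z)) t * h))) (at t within {0..})"
      by simp
    show "continuous (at (t, z) within {0..} \<times> UNIV) (\<lambda>(t, z). D t z)"
      using flow_deriv_continuous[unfolded continuous_on_eq_continuous_within, rule_format, of "(t, z)"] t by simp
  qed (use flow_deriv in auto)
  then show "continuous (at (t, z) within {0..} \<times> UNIV) (\<lambda>(t, z). \<Phi> t z)"
    by (rule has_derivative_continuous)
qed

lemma continuous_on_flow [continuous_intros]:
  assumes "continuous_on S s" "continuous_on S p" "\<And>x. x \<in> S \<Longrightarrow> 0 \<le> s x"
  shows "continuous_on S (\<lambda>x. \<Phi> (s x) (p x))"
  using continuous_on_compose2[OF flow_continuous[unfolded case_prod_unfold], of S "\<lambda>x. (s x, p x)"] assms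
  by (auto intro: continuous_on_Pair)

lemma continuous_on_flow_deriv [continuous_intros]:
  assumes "continuous_on S s" "continuous_on S p" "\<And>x. x \<in> S \<Longrightarrow> 0 \<le> s x"
  shows "continuous_on S (\<lambda>x. D (s x) (p x))"
  using continuous_on_compose2[OF flow_deriv_continuous[unfolded case_prod_unfold], of S "\<lambda>x. (s x, p x)"] assms
  by (auto intro: continuous_on_Pair)

lemma continuous_on_field [continuous_intros]:
  assumes "continuous_on S x" "continuous_on S t" "\<And>z. z \<in> S \<Longrightarrow> 0 \<le> t z"
  shows "continuous_on S (\<lambda>z. E (x z) (t z))"
  using continuous_on_compose2[OF field_continuous[unfolded case_prod_unfold], of S "\<lambda>z. (x z, t z)"] assms
  by (auto intro: continuous_on_Pair)

lemma flow_line_deriv: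
  assumes "0 \<le> s"
  shows "((\<lambda>\<tau>. fst (\<Phi> s (p + \<tau> *\<^sub>R d))) has_real_derivative fst (D s (p + \<tau> *\<^sub>R d) d)) (at \<tau> within A)"
    and "((\<lambda>\<tau>. snd (\<Phi> s (p + \<tau> *\<^sub>R d))) has_real_derivative snd (D s (p + \<tau> *\<^sub>R d) d)) (at \<tau> within A)"
proof -
  have l: "((\<lambda>\<tau>. p + \<tau> *\<^sub>R d) has_derivative (\<lambda>h. h *\<^sub>R d)) (at \<tau> within A)"
    by (auto intro!: derivative_eq_intros)
  have "((\<lambda>\<tau>. \<Phi> s (p + \<tau> *\<^sub>R d)) has_derivative (\<lambda>h. D s (p + \<tau> *\<^sub>R d) (h *\<^sub>R d))) (at \<tau> within A)"
    by (rule has_derivative_compose[OF l flow_deriv[OF assms]])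
  then have "((\<lambda>\<tau>. \<Phi> s (p + \<tau> *\<^sub>R d)) has_derivative (\<lambda>h. h *\<^sub>R D s (p + \<tau> *\<^sub>R d) d)) (at \<tau> within A)"
    by (simp add: blinfun.scaleR_right)
  from has_derivative_fst[OF this] has_derivative_snd[OF this]
  show "((\<lambda>\<tau>. fst (\<Phi> s (p + \<tau> *\<^sub>R d))) has_real_derivative fst (D s (p + \<tau> *\<^sub>R d) d)) (at \<tau> within A)"
    "((\<lambda>\<tau>. snd (\<Phi> s (p + \<tau> *\<^sub>R d))) has_real_derivative snd (D s (p + \<tau> *\<^sub>R d) d)) (at \<tau> within A)"
    by (simp_all add: has_field_derivative_def mult_commute_abs)
qed

lemma deriv_flow_0: "D 0 z d = d"
proof -
  have "(\<Phi> 0 has_derivative (\<lambda>d. d)) (at z)"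
    by (rule has_derivative_transform[OF _ _ has_derivative_ident]) (auto simp: flow_0)
  then show ?thesis
    using has_derivative_unique[OF flow_deriv[of 0 z]] by (metis order_refl)
qed

definition potential_primitive :: "real \<Rightarrow> real \<Rightarrow> real" where
  "potential_primitive x s = primitive (\<lambda>y. E y s) x"

text \<open>The Lagrangian action of a trajectory: the force is \<open>- E\<close>, so
  \<open>potential_primitive\<close> is its potential energy and the integrand is kinetic minus
  potential energy.\<close>

definition action :: "real \<Rightarrow> real \<times> real \<Rightarrow> real" where
  "action t z = integral {0..t} (\<lambda>s. (snd (\<Phi> s z))\<^sup>2 / 2 - potential_primitive (fst (\<Phi> s z)) s)"

lemma field_continuous_at: "0 \<le> s \<Longrightarrow> continuous_on UNIV (\<lambda>y. E y s)"
  by (intro continuous_intros) auto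

lemma continuous_on_potential_primitive [continuous_intros]:
  assumes "continuous_on S x" "continuous_on S t" "\<And>z. z \<in> S \<Longrightarrow> 0 \<le> t z"
  shows "continuous_on S (\<lambda>z. potential_primitive (x z) (t z))"
  unfolding potential_primitive_def
  using continuous_on_compose2[OF primitive_param_continuous[OF field_continuous, unfolded case_prod_unfold],
      of S "\<lambda>z. (x z, t z)"] assms
  by (auto intro: continuous_on_Pair)

lemma potential_primitive_deriv:
  "0 \<le> s \<Longrightarrow> ((\<lambda>x. potential_primitive x s) has_real_derivative E x s) (at x)"
  unfolding potential_primitive_def by (rule has_real_derivative_primitive[OF field_continuous_at])

text \<open>The integral of v dx along a moving segment has as its time derivative the boundary
  difference of the Lagrangian, because both the force term and \<open>v\<close> times the change of
  \<open>v\<close> are exact along the segment. Integration in time yields the pullback of v dx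
  minus v dx as a differential, in a form that needs only first derivatives of the flow.\<close>

lemma action_diff:
  assumes t: "0 \<le> t"
  shows "action t (p + d) - action t p =
    integral {0..1} (\<lambda>\<tau>. snd (\<Phi> t (p + \<tau> *\<^sub>R d)) * fst (D t (p + \<tau> *\<^sub>R d) d)) - integral {0..1} (\<lambda>\<tau>. snd (p + \<tau> *\<^sub>R d) * fst d)"
proof -
  let ?V = "\<lambda>\<tau> s. snd (\<Phi> s (p + \<tau> *\<^sub>R d))" and ?X = "\<lambda>\<tau> s. fst (\<Phi> s (p + \<tau> *\<^sub>R d))"
  let ?V1 = "\<lambda>\<tau> s. snd (D s (p + \<tau> *\<^sub>R d) d)" and ?X1 = "\<lambda>\<tau> s. fst (D s (p + \<tau> *\<^sub>R d) d)"
  let ?L = "\<lambda>z s. (snd (\<Phi> s z))\<^sup>2 / 2 - potential_primitive (fst (\<Phi> s z)) s"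
  have der: "((\<lambda>s. integral {0..1} (\<lambda>\<tau>. ?V \<tau> s * ?X1 \<tau> s)) has_real_derivative ?L (p + d) s - ?L p s) (at s within {0..})"
    if s: "0 \<le> s" for s
  proof -
    have "((\<lambda>s. integral {0..1} (\<lambda>\<tau>. ?V \<tau> s * ?X1 \<tau> s)) has_real_derivative
       integral {0..1} (\<lambda>\<tau>. - E (?X \<tau> s) s * ?X1 \<tau> s - ?V1 \<tau> s * ?V \<tau> s) + (?V 1 s * ?V 1 s - ?V 0 s * ?V 0 s)) (at s within {0..})"
      by (rule has_real_derivative_curve_integral)
        (use s in \<open>auto intro!: flow_line_deriv flow_fst flow_snd continuous_intros simp: case_prod_unfold\<close>)
    moreover have "((\<lambda>\<tau>. - E (?X \<tau> s) s * ?X1 \<tau> s - ?V1 \<tau> s * ?V \<tau> s) has_integral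
       (- potential_primitive (?X 1 s) s - (?V 1 s)\<^sup>2 / 2) - (- potential_primitive (?X 0 s) s - (?V 0 s)\<^sup>2 / 2)) {0..1}"
      by (rule fundamental_theorem_of_calculus)
        (auto intro!: derivative_eq_intros flow_line_deriv[OF s] DERIV_chain2[OF potential_primitive_deriv[OF s]]
          simp: has_real_derivative_iff_has_vector_derivative[symmetric])
    ultimately show ?thesis
      by (simp add: integral_unique power2_eq_square algebra_simps)
  qed
  have "((\<lambda>s. ?L (p + d) s - ?L p s) has_integral
     integral {0..1} (\<lambda>\<tau>. ?V \<tau> t * ?X1 \<tau> t) - integral {0..1} (\<lambda>\<tau>. ?V \<tau> 0 * ?X1 \<tau> 0)) {0..t}"
    by (rule fundamental_theorem_of_calculus[OF t])
      (auto simp: has_real_derivative_iff_has_vector_derivative[symmetric] intro: DERIV_subset[OF der])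
  moreover have "?L z integrable_on {0..t}" for z
    by (intro integrable_continuous_interval continuous_intros) auto
  ultimately show ?thesis
    unfolding action_def by (simp add: integral_diff[symmetric] integral_unique flow_0 deriv_flow_0)
qed

lemma action_deriv_snd:
  assumes t: "0 \<le> t"
  shows "((\<lambda>v. action t (x, v)) has_real_derivative snd (\<Phi> t (x, v)) * fst (D t (x, v) (0, 1))) (at v)"
proof -
  have eq: "action t (x, v) = action t (x, 0) + primitive (\<lambda>w. snd (\<Phi> t (x, w)) * fst (D t (x, w) (0, 1))) v" for v
  proof -
    have "D t z (0, v) = v *\<^sub>R D t z (0, 1)" for z
      by (simp add: blinfun.scaleR_right[symmetric])
    then show ?thesis
      using action_diff[OF t, of "(x, 0)" "(0, v)"]
      by (simp add: primitive_def mult.left_commute mult.commute[of _ v] del: integral_mult_right)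
        (simp add: mult_ac)
  qed
  have d: "((\<lambda>v. action t (x, 0) + primitive (\<lambda>w. snd (\<Phi> t (x, w)) * fst (D t (x, w) (0, 1))) v)
      has_real_derivative snd (\<Phi> t (x, v)) * fst (D t (x, v) (0, 1))) (at v)"
    using t by (auto intro!: derivative_eq_intros has_real_derivative_primitive continuous_intros)
  show ?thesis
    by (rule has_field_derivative_transform_within_open[OF d open_UNIV UNIV_I]) (rule eq[symmetric])
qed

lemma action_diff_fst:
  assumes t: "0 \<le> t"
  shows "primitive (\<lambda>y. snd (\<Phi> t (y, v)) * fst (D t (y, v) (1, 0))) x = action t (x, v) - action t (0, v) + v * x"
proof -
  have "D t z (x, 0) = x *\<^sub>R D t z (1, 0)" for z
    by (simp add: blinfun.scaleR_right[symmetric])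
  then show ?thesis
    using action_diff[OF t, of "(0, v)" "(x, 0)"]
    by (simp add: primitive_def mult.left_commute mult.commute[of _ x] del: integral_mult_right)
      (simp add: mult_ac)
qed

text \<open>Taking the exterior derivative of the identity in \<open>action_diff\<close> would need
  second derivatives of the flow. Instead, the integral of v dx along the image of a horizontal
  segment is differentiated in the height \<open>v\<close> in two ways: as a curve integral, which
  produces the integral of the Jacobian, and through the action, which produces the length of the
  segment. The boundary terms agree.\<close>

lemma flow_jacobian:
  assumes t: "0 \<le> t"
  shows "fst (D t (x, v) (1, 0)) * snd (D t (x, v) (0, 1)) - fst (D t (x, v) (0, 1)) * snd (D t (x, v) (1, 0)) = 1"
proof -
  let ?V = "\<lambda>y v. snd (\<Phi> t (y, v))"
  let ?Xx = "\<lambda>y v. fst (D t (y, v) (1, 0))" and ?Xv = "\<lambda>y v. fst (D t (y, v) (0, 1))"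
  let ?Vx = "\<lambda>y v. snd (D t (y, v) (1, 0))" and ?Vv = "\<lambda>y v. snd (D t (y, v) (0, 1))"
  let ?J = "\<lambda>y. ?Vv y v * ?Xx y v - ?Vx y v * ?Xv y v"
  have d: "((\<lambda>y. fst (\<Phi> t (y, v))) has_real_derivative ?Xx y v) (at y within A)"
    "((\<lambda>v. fst (\<Phi> t (y, v))) has_real_derivative ?Xv y v) (at v within B)"
    "((\<lambda>y. ?V y v) has_real_derivative ?Vx y v) (at y within A)"
    "((\<lambda>v. ?V y v) has_real_derivative ?Vv y v) (at v within B)" for y v A B
    using flow_line_deriv[OF t, of "(0, v)" "(1, 0)" y A] flow_line_deriv[OF t, of "(y, 0)" "(0, 1)" v B] by simp_all
  have cJ: "continuous_on UNIV ?J"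
    using t by (intro continuous_intros) auto
  have J: "integral {a..b} ?J = b - a" if ab: "a \<le> b" for a b
  proof -
    have "((\<lambda>v. integral {a..b} (\<lambda>y. ?V y v * ?Xx y v)) has_real_derivative
       integral {a..b} ?J + (?V b v * ?Xv b v - ?V a v * ?Xv a v)) (at v within UNIV)"
      by (rule has_real_derivative_curve_integral[OF ab, where W="\<lambda>y v. fst (\<Phi> t (y, v))"])
        (use t in \<open>auto intro!: d continuous_intros simp: case_prod_unfold\<close>)
    moreover have "integral {a..b} (\<lambda>y. ?V y v * ?Xx y v) = action t (b, v) - action t (a, v) + v * (b - a)" for v
    proof -
      have "continuous_on UNIV (\<lambda>y. ?V y v * ?Xx y v)"
        using t by (intro continuous_intros) auto
      from primitive_diff_eq_integral(1)[OF this ab] show ?thesis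
        by (simp add: action_diff_fst[OF t] algebra_simps)
    qed
    ultimately have "((\<lambda>v. action t (b, v) - action t (a, v) + v * (b - a)) has_real_derivative
       integral {a..b} ?J + (?V b v * ?Xv b v - ?V a v * ?Xv a v)) (at v)"
      by simp
    moreover have "((\<lambda>v. action t (b, v) - action t (a, v) + v * (b - a)) has_real_derivative
       ?V b v * ?Xv b v - ?V a v * ?Xv a v + (b - a)) (at v)"
      by (auto intro!: derivative_eq_intros action_deriv_snd[OF t])
    ultimately show ?thesis
      using DERIV_unique by fastforce
  qed
  \<comment> \<open>The Jacobian has the right integral over every interval; differentiating its
    antiderivative turns this into the pointwise value.\<close>
  have "primitive ?J = (\<lambda>y. y)"
  proof
    fix y
    show "primitive ?J y = y"
      using primitive_diff_eq_integral(1)[OF cJ, of 0 y] primitive_diff_eq_integral(1)[OF cJ, of y 0] J[of 0 y] J[of y 0]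
      by (cases "0 \<le> y") simp_all
  qed
  then have "((\<lambda>y. y) has_real_derivative ?J x) (at x)"
    using has_real_derivative_primitive[OF cJ, of x] by simp
  then have "?J x = 1"
    by (rule DERIV_unique) (rule DERIV_ident)
  then show ?thesis by (simp add: algebra_simps)
qed

lemma abs_snd_flow_diff_le:
  assumes "0 \<le> s" "s \<le> t" "\<And>x r. s \<le> r \<Longrightarrow> r \<le> t \<Longrightarrow> \<bar>E x r\<bar> \<le> K"
  shows "\<bar>snd (\<Phi> t z) - snd (\<Phi> s z)\<bar> \<le> K * (t - s)"
proof -
  have "norm (snd (\<Phi> t z) - snd (\<Phi> s z)) \<le> K * norm (t - s)"
  proof (rule field_differentiable_bound[of "{s..t}" _ "\<lambda>r. - E (fst (\<Phi> r z)) r"])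
    show "((\<lambda>r. snd (\<Phi> r z)) has_field_derivative - E (fst (\<Phi> r z)) r) (at r within {s..t})" if "r \<in> {s..t}" for r
      using flow_snd[of r z] assms that by (auto intro: DERIV_subset)
  qed (use assms in auto)
  then show ?thesis using assms by simp
qed

lemma flow_shift_int: "0 \<le> t \<Longrightarrow> \<Phi> t (x + of_int k, v) = \<Phi> t (x, v) + (of_int k, 0)"
proof (induction k rule: int_induct[where k=0])
  case (step1 i)
  then show ?case using flow_shift[of t "x + of_int i" v] by (simp add: ac_simps)
next
  case (step2 i)
  have "\<Phi> t (x + of_int (i - 1) + 1, v) = \<Phi> t (x + of_int (i - 1), v) + (1, 0)"
    using step2 by (intro flow_shift) auto
  moreover have "x + of_int (i - 1) + 1 = x + of_int i" by simp
  ultimately show ?case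
    using step2 by (auto simp: prod_eq_iff)
qed (simp add: zero_prod_def[symmetric])

end

section \<open>The phase-space measure\<close>

text \<open>Determinants and the measure of differentiable images live on \<open>real ^ 2\<close>;
  \<open>vec2\<close> and \<open>unvec2\<close> are the isometric coordinates that carry them to
  \<open>real \<times> real\<close>.\<close>

definition vec2 :: "real \<times> real \<Rightarrow> real ^ 2" where
  "vec2 p = (\<chi> i. if i = 1 then fst p else snd p)"

definition unvec2 :: "real ^ 2 \<Rightarrow> real \<times> real" where
  "unvec2 x = (x $ 1, x $ 2)"

lemma vec2_unvec2 [simp]: "unvec2 (vec2 p) = p" "vec2 (unvec2 x) = x"
  by (simp_all add: vec2_def unvec2_def vec_eq_iff forall_2)

lemma bounded_linear_unvec2: "bounded_linear unvec2"
  unfolding unvec2_def by (intro bounded_linear_Pair bounded_linear_vec_nth)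

lemma bounded_linear_vec2: "bounded_linear vec2"
proof -
  have "linear vec2"
    by (rule linearI) (auto simp: vec2_def vec_eq_iff)
  then show ?thesis by (rule linear_conv_bounded_linear[THEN iffD1])
qed

lemma unvec2_vimage_box: "unvec2 -` box l u = box (vec2 l) (vec2 u)"
  by (auto simp: mem_box[where 'a="real \<times> real"] mem_box_cart Basis_prod_def unvec2_def vec2_def forall_2 inner_prod_def)

lemma distr_unvec2: "distr lborel borel unvec2 = lborel"
proof (rule lborel_eqI[symmetric])
  fix l u :: "real \<times> real" assume "\<And>b. b \<in> Basis \<Longrightarrow> l \<bullet> b \<le> u \<bullet> b"
  from this[of "(1,0)"] this[of "(0,1)"] have le: "fst l \<le> fst u" "snd l \<le> snd u"
    by (auto simp: Basis_prod_def inner_prod_def)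
  have [measurable]: "unvec2 \<in> borel_measurable borel"
    by (intro borel_measurable_continuous_onI linear_continuous_on bounded_linear_unvec2)
  have "emeasure (distr lborel borel unvec2) (box l u) = emeasure lborel (box (vec2 l) (vec2 u))"
    by (simp add: emeasure_distr unvec2_vimage_box)
  also have "\<dots> = (\<Prod>b\<in>Basis. (vec2 u - vec2 l) \<bullet> b)"
    using le by (intro emeasure_lborel_box) (auto simp: Basis_vec_def vec2_def inner_axis)
  also have "(\<Prod>b\<in>Basis. (vec2 u - vec2 l) \<bullet> b) = (\<Prod>i\<in>UNIV. (vec2 u - vec2 l) $ i)"
  proof -
    have B: "(Basis :: (real ^ 2) set) = range (\<lambda>i. axis i 1)"
      by (auto simp: Basis_vec_def)
    have inj: "inj (\<lambda>i. axis i (1::real) :: real ^ 2)"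
      by (rule injI) (metis axis_eq_axis zero_neq_one)
    show ?thesis
      unfolding B by (subst prod.reindex[OF inj]) (simp add: inner_axis)
  qed
  also have "\<dots> = (fst u - fst l) * (snd u - snd l)"
    by (simp add: UNIV_2 vec2_def)
  also have "\<dots> = (\<Prod>b\<in>Basis. (u - l) \<bullet> b)"
  proof -
    have B: "(Basis :: (real \<times> real) set) = {(1, 0), (0, 1)}" by (auto simp: Basis_prod_def)
    show ?thesis unfolding B by (simp add: inner_prod_def)
  qed
  finally show "emeasure (distr lborel borel unvec2) (box l u) = (\<Prod>b\<in>Basis. (u - l) \<bullet> b)" .
qed simp

section \<open>Bijections of the plane with Jacobian one\<close>

context
  fixes F :: "real \<times> real \<Rightarrow> real \<times> real" and F' :: "real \<times> real \<Rightarrow> real \<times> real \<Rightarrow> real \<times> real"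
  assumes F: "\<And>z. (F has_derivative F' z) (at z)" and bij_F: "bij F"
    and jac: "\<And>z. fst (F' z (1, 0)) * snd (F' z (0, 1)) - fst (F' z (0, 1)) * snd (F' z (1, 0)) = 1"
begin

lemma area_preserving_measurable: "F \<in> borel_measurable borel"
  by (intro borel_measurable_continuous_onI has_derivative_continuous_on[OF F[THEN has_derivative_at_withinI]])

text \<open>A continuous injective map of the plane is open by invariance of domain, so the inverse
  is even continuous.\<close>

lemma area_preserving_inverse_measurable: "inv F \<in> borel_measurable borel"
proof (rule borel_measurableI)
  fix S :: "(real \<times> real) set" assume "open S"
  have "continuous_on S F"
    by (rule has_derivative_continuous_on[OF F[THEN has_derivative_at_withinI]])
  then have "open (F ` S)"
    using \<open>open S\<close> bij_is_inj[OF bij_F] by (intro invariance_of_domain) (auto intro: inj_on_subset)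
  then show "inv F -` S \<inter> space borel \<in> sets borel"
    using bij_F by (simp add: bij_vimage_eq_inv_image bij_imp_bij_inv inv_inv_eq)
qed

text \<open>Lebesgue measure is determined by its values on boxes. The preimage of a box under the
  inverse is its image under \<open>F\<close>, whose area is the integral of the absolute
  determinant, here constantly one.\<close>

lemma distr_area_preserving_inverse: "distr lborel borel (inv F) = lborel"
proof (rule lborel_eqI[symmetric])
  note area_preserving_inverse_measurable [measurable]
  have [measurable]: "unvec2 \<in> borel_measurable borel"
    by (intro borel_measurable_continuous_onI linear_continuous_on bounded_linear_unvec2)
  fix l u :: "real \<times> real" assume le: "\<And>b. b \<in> Basis \<Longrightarrow> l \<bullet> b \<le> u \<bullet> b"
  define G where "G = vec2 \<circ> F \<circ> unvec2"
  define G' where "G' x h = vec2 (F' (unvec2 x) (unvec2 h))" for x h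
  let ?B = "box (vec2 l) (vec2 u)"
  have G: "(G has_derivative G' x) (at x within ?B)" for x
  proof -
    have "(G has_derivative G' x) (at x)"
      unfolding G_def G'_def o_def
      by (rule bounded_linear.has_derivative[OF bounded_linear_vec2],
          rule has_derivative_compose[OF bounded_linear_imp_has_derivative[OF bounded_linear_unvec2] F])
    then show ?thesis by (rule has_derivative_at_withinI)
  qed
  have det1: "det (matrix (G' x)) = 1" for x
  proof -
    have "unvec2 (axis 1 1) = (1, 0)" "unvec2 (axis 2 1) = (0, 1)"
      by (simp_all add: unvec2_def axis_def)
    then show ?thesis
      using jac[of "unvec2 x"] by (simp add: det_2 matrix_def G'_def vec2_def)
  qed
  have inj: "inj_on G ?B"
    using bij_F unfolding G_def by (intro inj_onI) (metis comp_apply vec2_unvec2 bij_is_inj injD)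
  have im: "G ` ?B = unvec2 -` (F ` box l u)"
  proof -
    have "G ` ?B = vec2 ` F ` unvec2 ` (unvec2 -` box l u)"
      by (simp add: G_def unvec2_vimage_box image_comp)
    also have "unvec2 ` (unvec2 -` box l u) = box l u"
      by (rule surj_image_vimage_eq) (metis surjI vec2_unvec2(1))
    finally show ?thesis by (auto simp: image_iff) (metis vec2_unvec2)
  qed
  have "((\<lambda>x. \<bar>det (matrix (G' x))\<bar>) has_integral measure lebesgue ?B) ?B"
    using has_integral_measure_lborel[of ?B] emeasure_lborel_box_finite[of "vec2 l" "vec2 u"] by (simp add: det1)
  then have 1: "G ` ?B \<in> lmeasurable" "measure lebesgue (G ` ?B) = measure lebesgue ?B"
    using has_measure_differentiable_image[OF _ G inj] by auto
  have [measurable]: "F ` box l u \<in> sets borel"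
    using measurable_sets[OF area_preserving_inverse_measurable, of "box l u"] bij_F
    by (simp add: bij_vimage_eq_inv_image bij_imp_bij_inv inv_inv_eq)
  have vim: "unvec2 -` (F ` box l u) \<in> sets borel"
    using measurable_sets[of unvec2 borel borel "F ` box l u"] by simp
  have "emeasure (distr lborel borel (inv F)) (box l u) = emeasure lborel (F ` box l u)"
    using bij_F by (simp add: emeasure_distr bij_vimage_eq_inv_image bij_imp_bij_inv inv_inv_eq)
  also have "\<dots> = emeasure (distr lborel borel unvec2) (F ` box l u)"
    by (simp add: distr_unvec2)
  also have "\<dots> = emeasure lborel (G ` ?B)"
    by (simp add: emeasure_distr im)
  also have "\<dots> = emeasure lebesgue (G ` ?B)"
    using vim by (simp add: im)
  also have "\<dots> = emeasure lebesgue ?B"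
    using 1 lmeasurable_box by (simp add: emeasure_eq_measure2)
  also have "\<dots> = emeasure lborel (unvec2 -` box l u)"
    by (simp add: unvec2_vimage_box)
  also have "\<dots> = emeasure (distr lborel borel unvec2) (box l u)"
    by (simp add: emeasure_distr)
  also have "\<dots> = (\<Prod>b\<in>Basis. (u - l) \<bullet> b)"
    unfolding distr_unvec2 using le by (rule emeasure_lborel_box)
  finally show "emeasure (distr lborel borel (inv F)) (box l u) = (\<Prod>b\<in>Basis. (u - l) \<bullet> b)" .
qed simp

lemma nn_integral_area_preserving:
  assumes g: "g \<in> borel_measurable borel"
  shows "(\<integral>\<^sup>+z. g (F z) \<partial>lborel) = (\<integral>\<^sup>+z. g z \<partial>lborel)"
proof -
  have m: "(\<lambda>z. g (F z)) \<in> borel_measurable borel"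
    using measurable_comp[OF area_preserving_measurable g] by (simp add: o_def)
  have "(\<integral>\<^sup>+z. g (F z) \<partial>lborel) = (\<integral>\<^sup>+z. g (F z) \<partial>distr lborel borel (inv F))"
    by (simp add: distr_area_preserving_inverse)
  also have "\<dots> = (\<integral>\<^sup>+z. g (F (inv F z)) \<partial>lborel)"
    using area_preserving_inverse_measurable m by (intro nn_integral_distr) auto
  also have "\<dots> = (\<integral>\<^sup>+z. g z \<partial>lborel)"
    using bij_F by (simp add: bij_is_surj surj_f_inv_f)
  finally show ?thesis .
qed

end

section \<open>Integration over the cylinder, with the unit interval as fundamental domain\<close>

definition torus :: "real measure" where
  "torus = density lborel (\<lambda>x. ennreal (indicator {0..1} x))"

definition phase :: "(real \<times> real) measure" where
  "phase = torus \<Otimes>\<^sub>M lborel"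

lemma sets_torus [measurable_cong, simp]: "sets torus = sets borel"
  by (simp add: torus_def)

lemma space_torus [simp]: "space torus = UNIV"
  by (simp add: torus_def)

lemma sets_phase [measurable_cong, simp]: "sets phase = sets borel"
  unfolding phase_def by (simp add: borel_prod[symmetric] cong: sets_pair_measure_cong)

lemma space_phase [simp]: "space phase = UNIV"
  by (simp add: phase_def space_pair_measure)

lemma nn_integral_torus:
  "g \<in> borel_measurable borel \<Longrightarrow> (\<integral>\<^sup>+x. g x \<partial>torus) = (\<integral>\<^sup>+x\<in>{0..1}. g x \<partial>lborel)"
  unfolding torus_def by (subst nn_integral_density) (auto simp: mult.commute indicator_def intro!: nn_integral_cong)

lemma emeasure_torus: "emeasure torus UNIV = 1"
  using nn_integral_torus[of "\<lambda>_. 1"] by simp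

interpretation torus: finite_measure torus
  by (rule finite_measureI) (simp add: emeasure_torus)

interpretation phase: pair_sigma_finite torus lborel ..

lemma integral_torus: "g \<in> borel_measurable borel \<Longrightarrow> integral\<^sup>L torus g = (LBINT x:{0..1}. (g x :: real))"
  unfolding torus_def set_lebesgue_integral_def by (subst integral_density) auto

lemma integrable_torus: "g \<in> borel_measurable borel \<Longrightarrow> integrable torus g \<longleftrightarrow> set_integrable lborel {0..1} (g :: real \<Rightarrow> real)"
  unfolding torus_def set_integrable_def by (subst integrable_density) auto

lemma nn_integral_phase:
  assumes "g \<in> borel_measurable borel"
  shows "(\<integral>\<^sup>+z. g z \<partial>phase) = (\<integral>\<^sup>+x\<in>{0..1}. (\<integral>\<^sup>+v. g (x, v) \<partial>lborel) \<partial>lborel)"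
proof -
  have g: "g \<in> borel_measurable (torus \<Otimes>\<^sub>M lborel)"
    unfolding phase_def[symmetric] measurable_cong_sets[OF sets_phase refl] by (rule assms)
  have "(\<lambda>x. \<integral>\<^sup>+v. g (x, v) \<partial>lborel) \<in> borel_measurable torus"
    using g by (rule lborel.borel_measurable_nn_integral_fst)
  then show ?thesis
    unfolding phase_def using lborel.nn_integral_fst[OF g] by (subst nn_integral_torus[symmetric]) auto
qed

text \<open>The half-open strip differs from the closed one by a null set and has the advantage that
  its integer translates tile the plane without overlap.\<close>

lemma nn_integral_phase_lborel:
  assumes "g \<in> borel_measurable borel"
  shows "(\<integral>\<^sup>+z. g z \<partial>phase) = (\<integral>\<^sup>+z. indicator ({0..<1} \<times> UNIV) z * g z \<partial>lborel)"
proof -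
  have m: "(\<lambda>z. indicator ({0..<1} \<times> UNIV) z * g z) \<in> borel_measurable (lborel \<Otimes>\<^sub>M (lborel :: real measure))"
    using assms unfolding lborel_prod by (intro borel_measurable_times_ennreal borel_measurable_indicator) (auto intro!: borel_Times)
  have "(\<integral>\<^sup>+z. g z \<partial>phase) = (\<integral>\<^sup>+x. \<integral>\<^sup>+v. indicator ({0..<1} \<times> UNIV) (x, v) * g (x, v) \<partial>lborel \<partial>lborel)"
    unfolding nn_integral_phase[OF assms]
  proof (rule nn_integral_cong_AE)
    show "AE x in lborel. (\<integral>\<^sup>+v. g (x, v) \<partial>lborel) * indicator {0..1} x = (\<integral>\<^sup>+v. indicator ({0..<1} \<times> UNIV) (x, v) * g (x, v) \<partial>lborel)"
      using AE_lborel_singleton[of "1::real"] by eventually_elim (auto simp: indicator_def)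
  qed
  also have "\<dots> = (\<integral>\<^sup>+z. indicator ({0..<1} \<times> UNIV) z * g z \<partial>(lborel \<Otimes>\<^sub>M lborel))"
    by (rule lborel.nn_integral_fst[OF m])
  finally show ?thesis by (simp add: lborel_prod)
qed

lemma indicator_unit_interval_sum:
  fixes x :: real
  shows "(\<integral>\<^sup>+k. indicator {0..<1} (x + of_int k) \<partial>count_space UNIV) = 1"
proof -
  have "(\<lambda>k::int. indicator {0..<1} (x + of_int k)) = (indicator {- \<lfloor>x\<rfloor>} :: int \<Rightarrow> ennreal)"
  proof
    fix k :: int
    have "0 \<le> x + of_int k \<and> x + of_int k < 1 \<longleftrightarrow> k = - \<lfloor>x\<rfloor>" by linarith
    then show "indicator {0..<1} (x + of_int k) = (indicator {- \<lfloor>x\<rfloor>} k :: ennreal)"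
      by (auto simp: indicator_def)
  qed
  then show ?thesis by simp
qed

lemma nn_integral_lborel_shift:
  fixes g :: "real \<times> real \<Rightarrow> ennreal"
  assumes "g \<in> borel_measurable borel"
  shows "(\<integral>\<^sup>+z. g (z + c) \<partial>lborel) = (\<integral>\<^sup>+z. g z \<partial>lborel)"
proof -
  have "(\<integral>\<^sup>+z. g z \<partial>lborel) = (\<integral>\<^sup>+z. g z \<partial>distr lborel borel ((+) c))"
    by (simp add: lborel_distr_plus)
  also have "\<dots> = (\<integral>\<^sup>+z. g (c + z) \<partial>lborel)"
    using assms by (intro nn_integral_distr) auto
  finally show ?thesis by (simp add: add.commute)
qed

text \<open>\<open>F\<close> maps a fundamental domain of the translation \<open>x \<mapsto> x + 1\<close> to another one.\<close>

lemma nn_integral_phase_area_preserving: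
  fixes F :: "real \<times> real \<Rightarrow> real \<times> real" and g :: "real \<times> real \<Rightarrow> ennreal"
  assumes F: "\<And>z. (F has_derivative F' z) (at z)" "bij F"
      "\<And>z. fst (F' z (1, 0)) * snd (F' z (0, 1)) - fst (F' z (0, 1)) * snd (F' z (1, 0)) = 1"
    and shift: "\<And>x v k. F (x + of_int k, v) = F (x, v) + (of_int k, 0)"
    and g [measurable]: "g \<in> borel_measurable borel" and per: "\<And>x v k. g (x + of_int k, v) = g (x, v)"
  shows "(\<integral>\<^sup>+z. g (F z) \<partial>phase) = (\<integral>\<^sup>+z. g z \<partial>phase)"
proof -
  let ?I = "\<lambda>z :: real \<times> real. indicator ({0..<1} \<times> UNIV) z :: ennreal"
  have F_meas [measurable]: "F \<in> borel_measurable borel"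
    by (rule area_preserving_measurable[OF F])
  have I [measurable]: "?I \<in> borel_measurable borel"
    by (intro borel_measurable_indicator borel_Times) auto
  let ?k = "\<lambda>k. (of_int k, 0) :: real \<times> real"
  have [measurable]: "(\<lambda>z. z + c) \<in> borel_measurable borel" for c :: "real \<times> real"
    by (intro borel_measurable_continuous_onI continuous_intros)
  have s: "(\<integral>\<^sup>+k. ?I (z + ?k k) \<partial>count_space UNIV) = 1" for z
    using indicator_unit_interval_sum[of "fst z"] by (cases z) (simp add: indicator_def)
  have sF: "F (z + ?k k) = F z + ?k k" "g (z + ?k k) = g z" for z k
    using shift[of "fst z" k "snd z"] per[of "fst z" k "snd z"] by (cases z; simp)+
  have sF': "F (z + ?k (- k)) = F z + ?k (- k)" for z k
    using sF(1) by blast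
  have "(\<integral>\<^sup>+z. g (F z) \<partial>phase) = (\<integral>\<^sup>+z. ?I z * g (F z) \<partial>lborel)"
    by (rule nn_integral_phase_lborel) simp
  \<comment> \<open>Inserts the sum over the integer translates of the unit strip, exactly one of
    which contains \<open>F z\<close>. After exchanging sum and integral, shifting \<open>z\<close>
    moves the translate from \<open>F z\<close> to \<open>z\<close>, since \<open>F\<close> commutes
    with the shift.\<close>
  also have "\<dots> = (\<integral>\<^sup>+z. \<integral>\<^sup>+k. ?I z * g (F z) * ?I (F z + ?k k) \<partial>count_space UNIV \<partial>lborel)"
    by (simp add: nn_integral_cmult s)
  also have "\<dots> = (\<integral>\<^sup>+k. \<integral>\<^sup>+z. ?I z * g (F z) * ?I (F z + ?k k) \<partial>lborel \<partial>count_space UNIV)"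
    by (rule nn_integral_count_space_nn_integral) auto
  also have "\<dots> = (\<integral>\<^sup>+k. \<integral>\<^sup>+z. ?I (z + ?k (- k)) * g (F z) * ?I (F z) \<partial>lborel \<partial>count_space UNIV)"
  proof (rule nn_integral_cong)
    fix k :: int
    have "(\<integral>\<^sup>+z. ?I (z + ?k (- k)) * g (F z) * ?I (F z) \<partial>lborel)
       = (\<integral>\<^sup>+z. ?I ((z + ?k k) + ?k (- k)) * g (F (z + ?k k)) * ?I (F (z + ?k k)) \<partial>lborel)"
      by (rule nn_integral_lborel_shift[symmetric]) measurable
    also have "\<dots> = (\<integral>\<^sup>+z. ?I z * g (F z) * ?I (F z + ?k k) \<partial>lborel)"
      unfolding sF by (simp add: add.assoc zero_prod_def[symmetric])
    finally show "(\<integral>\<^sup>+z. ?I z * g (F z) * ?I (F z + ?k k) \<partial>lborel) = (\<integral>\<^sup>+z. ?I (z + ?k (- k)) * g (F z) * ?I (F z) \<partial>lborel)" ..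
  qed
  also have "\<dots> = (\<integral>\<^sup>+z. \<integral>\<^sup>+k. ?I (z + ?k (- k)) * g (F z) * ?I (F z) \<partial>count_space UNIV \<partial>lborel)"
    by (rule nn_integral_count_space_nn_integral[symmetric]) auto
  also have "\<dots> = (\<integral>\<^sup>+z. g (F z) * ?I (F z) \<partial>lborel)"
  proof (rule nn_integral_cong)
    fix z
    have "(\<integral>\<^sup>+k. ?I (z + ?k (- k)) \<partial>count_space UNIV) = (\<integral>\<^sup>+k. ?I (z + ?k k) \<partial>count_space (UNIV :: int set))"
      by (rule nn_integral_bij_count_space[where g=uminus]) (auto intro!: bij_uminus)
    then have "(\<integral>\<^sup>+k. ?I (z + ?k (- k)) \<partial>count_space UNIV) = 1" using s by simp
    then show "(\<integral>\<^sup>+k. ?I (z + ?k (- k)) * g (F z) * ?I (F z) \<partial>count_space UNIV) = g (F z) * ?I (F z)"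
      by (simp add: nn_integral_multc mult.assoc)
  qed
  also have "\<dots> = (\<integral>\<^sup>+z. g z * ?I z \<partial>lborel)"
    by (rule nn_integral_area_preserving[OF F, of "\<lambda>z. g z * ?I z"]) auto
  also have "\<dots> = (\<integral>\<^sup>+z. g z \<partial>phase)"
    by (subst nn_integral_phase_lborel) (auto simp: mult.commute)
  finally show ?thesis .
qed

section \<open>Invariance of phase-space integrals under the flow\<close>

context phase_flow
begin

lemma flow_measurable: "0 \<le> t \<Longrightarrow> \<Phi> t \<in> borel_measurable borel"
  by (intro borel_measurable_continuous_onI continuous_intros) auto

lemma nn_integral_flow:
  assumes t: "0 \<le> t" and g: "g \<in> borel_measurable borel" and per: "\<And>x v. g (x + 1, v) = g (x, v)"
  shows "(\<integral>\<^sup>+z. g (\<Phi> t z) \<partial>phase) = (\<integral>\<^sup>+z. (g z :: ennreal) \<partial>phase)"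
proof (rule nn_integral_phase_area_preserving[OF flow_deriv[OF t] flow_bij[OF t] _ flow_shift_int[OF t] g])
  show "fst (D t z (1, 0)) * snd (D t z (0, 1)) - fst (D t z (0, 1)) * snd (D t z (1, 0)) = 1" for z
    using flow_jacobian[OF t] by (cases z) simp
  show "g (x + of_int k, v) = g (x, v)" for x v k
  proof (induction k rule: int_induct[where k=0])
    case (step1 i)
    then show ?case using per[of "x + of_int i" v] by (simp add: ac_simps)
  next
    case (step2 i)
    then show ?case using per[of "x + of_int (i - 1)" v] by (simp add: algebra_simps)
  qed simp
qed

lemma integrable_flow:
  fixes g :: "real \<times> real \<Rightarrow> real"
  assumes t: "0 \<le> t" and g: "g \<in> borel_measurable borel" and per: "\<And>x v. g (x + 1, v) = g (x, v)"
  shows "integrable phase (\<lambda>z. g (\<Phi> t z)) \<longleftrightarrow> integrable phase g"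
    and "integral\<^sup>L phase (\<lambda>z. g (\<Phi> t z)) = integral\<^sup>L phase g"
proof -
  have m [measurable]: "(\<lambda>z. g (\<Phi> t z)) \<in> borel_measurable borel"
    using measurable_comp[OF flow_measurable[OF t] g] by (simp add: o_def)
  have 1: "(\<integral>\<^sup>+z. ennreal (norm (g (\<Phi> t z))) \<partial>phase) = (\<integral>\<^sup>+z. ennreal (norm (g z)) \<partial>phase)"
    using g per by (intro nn_integral_flow[OF t, where g="\<lambda>z. ennreal (norm (g z))"]) auto
  show i: "integrable phase (\<lambda>z. g (\<Phi> t z)) \<longleftrightarrow> integrable phase g"
    using 1 g unfolding integrable_iff_bounded by simp
  show "integral\<^sup>L phase (\<lambda>z. g (\<Phi> t z)) = integral\<^sup>L phase g"
  proof (cases "integrable phase g")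
    case True
    with i have "integrable phase (\<lambda>z. g (\<Phi> t z))" by simp
    from real_lebesgue_integral_def[OF this] real_lebesgue_integral_def[OF True] show ?thesis
      using nn_integral_flow[OF t, where g="\<lambda>z. ennreal (g z)"] nn_integral_flow[OF t, where g="\<lambda>z. ennreal (- g z)"] g per
      by simp
  next
    case False
    then show ?thesis using i by (simp add: not_integrable_integral_eq)
  qed
qed

end

section \<open>Transported densities\<close>

text \<open>A nonzero limit keeps the modulus of \<open>g\<close> above half of it on a half line,
  and a long enough piece of that half line violates the bound. This lets integrability in velocity
  do the work of pointwise decay.\<close>

lemma limit_at_bot_zero_if_integral_bounded:
  fixes g :: "real \<Rightarrow> real"
  assumes c: "continuous_on UNIV g" and lim: "(g \<longlongrightarrow> a) at_bot"
    and bnd: "\<And>N. 0 \<le> N \<Longrightarrow> integral {-N..N} (\<lambda>v. \<bar>g v\<bar>) \<le> C"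
  shows "a = 0"
proof (rule ccontr)
  assume "a \<noteq> 0"
  then have "\<forall>\<^sub>F v in at_bot. dist (g v) a < \<bar>a\<bar> / 2"
    using tendstoD[OF lim, of "\<bar>a\<bar> / 2"] by simp
  then obtain N0 where N0: "\<And>v. v \<le> N0 \<Longrightarrow> dist (g v) a < \<bar>a\<bar> / 2"
    by (auto simp: eventually_at_bot_linorder)
  have g: "\<bar>a\<bar> / 2 \<le> \<bar>g v\<bar>" if "v \<le> N0" for v
    using N0[OF that] by (simp add: dist_real_def abs_if split: if_splits)
  define N1 where "N1 = max 0 (- N0)"
  define N where "N = N1 + 2 * (\<bar>C\<bar> + 1) / \<bar>a\<bar>"
  have N: "0 \<le> N" "N1 \<le> N" "0 \<le> N1" "- N1 \<le> N0" by (auto simp: N1_def N_def)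
  have i: "(\<lambda>v. \<bar>g v\<bar>) integrable_on {u..w}" for u w
    by (intro integrable_continuous_interval continuous_intros continuous_on_subset[OF c]) auto
  have "(N - N1) * (\<bar>a\<bar> / 2) = integral {-N..-N1} (\<lambda>_. \<bar>a\<bar> / 2)"
    using N by simp
  also have "\<dots> \<le> integral {-N..-N1} (\<lambda>v. \<bar>g v\<bar>)"
    by (rule integral_le) (use N g i in auto)
  also have "\<dots> \<le> integral {-N..N} (\<lambda>v. \<bar>g v\<bar>)"
    using N by (intro integral_subset_le i) auto
  also have "\<dots> \<le> C" by (rule bnd[OF N(1)])
  finally have "(N - N1) * (\<bar>a\<bar> / 2) \<le> C" .
  moreover have "(N - N1) * (\<bar>a\<bar> / 2) = \<bar>C\<bar> + 1"
    using \<open>a \<noteq> 0\<close> by (simp add: N_def)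
  ultimately show False by linarith
qed

lemma limit_at_top_zero_if_integral_bounded:
  fixes g :: "real \<Rightarrow> real"
  assumes c: "continuous_on UNIV g" and lim: "(g \<longlongrightarrow> a) at_top"
    and bnd: "\<And>N. 0 \<le> N \<Longrightarrow> integral {-N..N} (\<lambda>v. \<bar>g v\<bar>) \<le> C"
  shows "a = 0"
proof (rule limit_at_bot_zero_if_integral_bounded[where g="\<lambda>v. g (- v)"])
  show "continuous_on UNIV (\<lambda>v. g (- v))"
    by (intro continuous_on_compose2[OF c] continuous_intros) auto
  show "((\<lambda>v. g (- v)) \<longlongrightarrow> a) at_bot"
    using lim by (simp add: at_top_mirror filterlim_filtermap)
  show "integral {-N..N} (\<lambda>v. \<bar>g (- v)\<bar>) \<le> C" if "0 \<le> N" for N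
    using bnd[OF that] Henstock_Kurzweil_Integration.integral_reflect_real[of N "-N" "\<lambda>v. \<bar>g v\<bar>"] by simp
qed

lemma LBINT_Icc_eq_integral:
  fixes g :: "real \<Rightarrow> real"
  assumes "continuous_on {a..b} g"
  shows "(LBINT x:{a..b}. g x) = integral {a..b} g"
  using set_borel_integral_eq_integral(2)[OF borel_integrable_atLeastAtMost'[OF assms]] .

lemma continuous_on_compose_2:
  assumes "continuous_on (A \<times> B) (\<lambda>(x, t). g x t)"
    and "continuous_on S x" "continuous_on S t" "\<And>z. z \<in> S \<Longrightarrow> x z \<in> A" "\<And>z. z \<in> S \<Longrightarrow> t z \<in> B"
  shows "continuous_on S (\<lambda>z. g (x z) (t z))"
  by (rule continuous_on_compose2[OF assms(1)[unfolded case_prod_unfold], of S "\<lambda>z. (x z, t z)", unfolded fst_conv snd_conv])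
    (use assms in \<open>auto intro: continuous_on_Pair\<close>)

lemma continuous_on_compose_3:
  assumes "continuous_on (A \<times> B \<times> C) (\<lambda>(x, v, t). g x v t)"
    and "continuous_on S x" "continuous_on S v" "continuous_on S t"
    and "\<And>z. z \<in> S \<Longrightarrow> x z \<in> A" "\<And>z. z \<in> S \<Longrightarrow> v z \<in> B" "\<And>z. z \<in> S \<Longrightarrow> t z \<in> C"
  shows "continuous_on S (\<lambda>z. g (x z) (v z) (t z))"
  by (rule continuous_on_compose2[OF assms(1)[unfolded case_prod_unfold], of S "\<lambda>z. (x z, v z, t z)", unfolded fst_conv snd_conv])
    (use assms in \<open>auto intro!: continuous_on_Pair\<close>)

text \<open>Interpreted twice: for \<open>f\<close> itself, to obtain conservation of mass, and
  later for \<mu>, to obtain the time derivative of the mass below a given velocity. The field is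
  prescribed on \<open>{0..1}\<close> only, because for the first use it is not yet known to match
  at the two end points. Instead of decay in \<open>v\<close> there is a bound on the mass that is
  uniform on bounded time intervals.\<close>

locale transported_density =
  fixes \<mu> \<mu>x \<mu>v \<mu>t :: "real \<Rightarrow> real \<Rightarrow> real \<Rightarrow> real" and e :: "real \<Rightarrow> real \<Rightarrow> real"
  assumes dx: "t \<ge> 0 \<Longrightarrow> ((\<lambda>x. \<mu> x v t) has_real_derivative \<mu>x x v t) (at x)"
    and dv: "t \<ge> 0 \<Longrightarrow> ((\<lambda>v. \<mu> x v t) has_real_derivative \<mu>v x v t) (at v)"
    and dt: "t \<ge> 0 \<Longrightarrow> ((\<lambda>t. \<mu> x v t) has_real_derivative \<mu>t x v t) (at t within {0..})"
    and cx: "continuous_on (UNIV \<times> UNIV \<times> {0..}) (\<lambda>(x, v, t). \<mu>x x v t)"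
    and cv: "continuous_on (UNIV \<times> UNIV \<times> {0..}) (\<lambda>(x, v, t). \<mu>v x v t)"
    and ct: "continuous_on (UNIV \<times> UNIV \<times> {0..}) (\<lambda>(x, v, t). \<mu>t x v t)"
    and c: "continuous_on (UNIV \<times> UNIV \<times> {0..}) (\<lambda>(x, v, t). \<mu> x v t)"
    and periodic: "t \<ge> 0 \<Longrightarrow> \<mu> (x + 1) v t = \<mu> x v t"
    and ce: "continuous_on ({0..1} \<times> {0..}) (\<lambda>(x, t). e x t)"
    and transport: "x \<in> {0..1} \<Longrightarrow> t \<ge> 0 \<Longrightarrow> \<mu>t x v t + v * \<mu>x x v t - e x t * \<mu>v x v t = 0"
    and nonneg: "t \<ge> 0 \<Longrightarrow> 0 \<le> \<mu> x v t"
    and mass_bounded: "T \<ge> 0 \<Longrightarrow> \<exists>C. \<forall>s\<in>{0..T}. integrable lborel (\<lambda>v. integral {0..1} (\<lambda>x. \<mu> x v s)) \<and>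
        (LBINT v. integral {0..1} (\<lambda>x. \<mu> x v s)) \<le> C"
begin

definition average :: "real \<Rightarrow> real \<Rightarrow> real" where
  "average v t = integral {0..1} (\<lambda>x. \<mu> x v t)"

definition flux :: "real \<Rightarrow> real \<Rightarrow> real" where
  "flux v t = integral {0..1} (\<lambda>x. e x t * \<mu> x v t)"

definition flux_dv :: "real \<Rightarrow> real \<Rightarrow> real" where
  "flux_dv v t = integral {0..1} (\<lambda>x. e x t * \<mu>v x v t)"

lemma cont [continuous_intros]:
  assumes "continuous_on S x" "continuous_on S v" "continuous_on S t" "\<And>z. z \<in> S \<Longrightarrow> 0 \<le> t z"
  shows "continuous_on S (\<lambda>z. \<mu> (x z) (v z) (t z))" "continuous_on S (\<lambda>z. \<mu>x (x z) (v z) (t z))"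
    "continuous_on S (\<lambda>z. \<mu>v (x z) (v z) (t z))" "continuous_on S (\<lambda>z. \<mu>t (x z) (v z) (t z))"
  using assms by (auto intro!: continuous_on_compose_3[OF c] continuous_on_compose_3[OF cx]
      continuous_on_compose_3[OF cv] continuous_on_compose_3[OF ct])

lemma cont_e [continuous_intros]:
  assumes "continuous_on S x" "continuous_on S t" "\<And>z. z \<in> S \<Longrightarrow> 0 \<le> t z" "\<And>z. z \<in> S \<Longrightarrow> 0 \<le> x z \<and> x z \<le> 1"
  shows "continuous_on S (\<lambda>z. e (x z) (t z))"
  using assms by (auto intro!: continuous_on_compose_2[OF ce])

lemma continuous_integral_01:
  fixes g :: "real \<Rightarrow> real \<Rightarrow> real \<Rightarrow> real"
  assumes "continuous_on ((UNIV \<times> {0..}) \<times> cbox 0 1) (\<lambda>(p, x). g x (fst p) (snd p))"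
    and "continuous_on S v" "continuous_on S t" "\<And>z. z \<in> S \<Longrightarrow> 0 \<le> t z"
  shows "continuous_on S (\<lambda>z. integral {0..1} (\<lambda>x. g x (v z) (t z)))"
  using continuous_on_compose2[OF integral_continuous_on_param[OF assms(1)], of S "\<lambda>z. (v z, t z)"] assms(2-)
  by (auto intro!: continuous_on_Pair)

lemma cont_average [continuous_intros]:
  assumes "continuous_on S v" "continuous_on S t" "\<And>z. z \<in> S \<Longrightarrow> 0 \<le> t z"
  shows "continuous_on S (\<lambda>z. average (v z) (t z))"
  unfolding average_def
  by (rule continuous_integral_01[OF _ assms]) (auto intro!: continuous_intros simp: case_prod_unfold)

lemma cont_flux [continuous_intros]:
  assumes "continuous_on S v" "continuous_on S t" "\<And>z. z \<in> S \<Longrightarrow> 0 \<le> t z"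
  shows "continuous_on S (\<lambda>z. flux (v z) (t z))"
  unfolding flux_def
  by (rule continuous_integral_01[OF _ assms]) (auto intro!: continuous_intros simp: case_prod_unfold)

lemma cont_flux_dv [continuous_intros]:
  assumes "continuous_on S v" "continuous_on S t" "\<And>z. z \<in> S \<Longrightarrow> 0 \<le> t z"
  shows "continuous_on S (\<lambda>z. flux_dv (v z) (t z))"
  unfolding flux_dv_def
  by (rule continuous_integral_01[OF _ assms]) (auto intro!: continuous_intros simp: case_prod_unfold)

lemma average_nonneg: "t \<ge> 0 \<Longrightarrow> 0 \<le> average v t"
  unfolding average_def by (rule integral_nonneg) (auto intro!: nonneg integrable_continuous_interval continuous_intros)

text \<open>Integrating the transport equation over one period removes the
  \<open>x\<close>-derivative and leaves a conservation law in the single variable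
  \<open>v\<close>.\<close>

lemma average_dt:
  assumes t: "0 \<le> t"
  shows "((\<lambda>t. average v t) has_real_derivative flux_dv v t) (at t within {0..})"
proof -
  have "((\<lambda>t. integral (cbox 0 1) (\<lambda>x. \<mu> x v t)) has_real_derivative integral (cbox 0 1) (\<lambda>x. \<mu>t x v t)) (at t within {0..})"
    by (rule leibniz_rule_field_derivative)
      (use t in \<open>auto intro!: dt integrable_continuous_interval continuous_intros simp: case_prod_unfold\<close>)
  moreover have "integral {0..1} (\<lambda>x. \<mu>t x v t) = flux_dv v t"
  proof -
    have "((\<lambda>x. \<mu>x x v t) has_integral \<mu> 1 v t - \<mu> 0 v t) {0..1}"
      by (rule fundamental_theorem_of_calculus)
        (auto simp: has_real_derivative_iff_has_vector_derivative[symmetric] intro: DERIV_subset[OF dx[OF t]])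
    then have "integral {0..1} (\<lambda>x. \<mu>x x v t) = 0"
      using periodic[OF t, of 0 v] by (simp add: integral_unique)
    moreover have "integral {0..1} (\<lambda>x. \<mu>t x v t) = integral {0..1} (\<lambda>x. e x t * \<mu>v x v t - v * \<mu>x x v t)"
      using transport[OF _ t, of _ v] by (intro Henstock_Kurzweil_Integration.integral_cong) (simp add: algebra_simps)
    moreover have "\<dots> = integral {0..1} (\<lambda>x. e x t * \<mu>v x v t) - integral {0..1} (\<lambda>x. v * \<mu>x x v t)"
      using t by (intro integral_diff) (auto intro!: integrable_continuous_interval continuous_intros)
    ultimately show ?thesis by (simp add: flux_dv_def)
  qed
  ultimately show ?thesis by (simp add: average_def[abs_def])
qed

lemma flux_deriv:
  assumes t: "0 \<le> t"
  shows "((\<lambda>v. flux v t) has_real_derivative flux_dv v t) (at v)"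
proof -
  have "((\<lambda>v. integral (cbox 0 1) (\<lambda>x. e x t * \<mu> x v t)) has_real_derivative integral (cbox 0 1) (\<lambda>x. e x t * \<mu>v x v t)) (at v within UNIV)"
    by (rule leibniz_rule_field_derivative)
      (use t in \<open>auto intro!: derivative_eq_intros dv integrable_continuous_interval continuous_intros simp: case_prod_unfold\<close>)
  then show ?thesis by (simp add: flux_def[abs_def] flux_dv_def)
qed

lemma abs_flux_le:
  assumes t: "0 \<le> t" and e_le: "\<And>x. x \<in> {0..1} \<Longrightarrow> \<bar>e x t\<bar> \<le> K"
  shows "\<bar>flux v t\<bar> \<le> K * average v t"
proof -
  have "norm (flux v t) \<le> integral {0..1} (\<lambda>x. K * \<mu> x v t)"
    unfolding flux_def
  proof (rule integral_norm_bound_integral)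
    show "norm (e x t * \<mu> x v t) \<le> K * \<mu> x v t" if "x \<in> {0..1}" for x
      using e_le[OF that] nonneg[OF t, of x v] by (simp add: abs_mult mult_right_mono)
  qed (use t in \<open>auto intro!: integrable_continuous_interval continuous_intros\<close>)
  then show ?thesis by (simp add: average_def)
qed

text \<open>The net mass carried from above the velocity \<open>v\<close> to below it during
  \<open>[0,t]\<close>. The sign fits because velocities change at the rate
  \<open>- e\<close>.\<close>

definition flow_through :: "real \<Rightarrow> real \<Rightarrow> real" where
  "flow_through v t = integral {0..t} (\<lambda>s. flux v s)"

lemma flow_through_deriv:
  assumes t: "0 \<le> t"
  shows "((\<lambda>v. flow_through v t) has_real_derivative average v t - average v 0) (at v)"
proof -
  have "((\<lambda>v. integral (cbox 0 t) (\<lambda>s. flux v s)) has_real_derivative integral (cbox 0 t) (\<lambda>s. flux_dv v s)) (at v within UNIV)"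
    by (rule leibniz_rule_field_derivative)
      (auto intro!: flux_deriv integrable_continuous_interval continuous_intros simp: case_prod_unfold)
  moreover have "((\<lambda>s. flux_dv v s) has_integral average v t - average v 0) {0..t}"
    by (rule fundamental_theorem_of_calculus[OF t])
      (auto simp: has_real_derivative_iff_has_vector_derivative[symmetric] intro: DERIV_subset[OF average_dt])
  ultimately show ?thesis by (simp add: flow_through_def[abs_def] integral_unique)
qed

lemma average_integrable: "0 \<le> t \<Longrightarrow> integrable lborel (\<lambda>v. average v t)"
  using mass_bounded[of t] by (auto simp: average_def)

lemma flow_through_diff:
  assumes t: "0 \<le> t" and uv: "u \<le> v"
  shows "flow_through v t - flow_through u t = (LBINT w:{u..v}. average w t) - (LBINT w:{u..v}. average w 0)"
proof -
  have "((\<lambda>w. average w t - average w 0) has_integral flow_through v t - flow_through u t) {u..v}"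
    by (rule fundamental_theorem_of_calculus[OF uv])
      (auto simp: has_real_derivative_iff_has_vector_derivative[symmetric] intro: DERIV_subset[OF flow_through_deriv[OF t]])
  then have "flow_through v t - flow_through u t = integral {u..v} (\<lambda>w. average w t - average w 0)"
    by (simp add: integral_unique)
  also have "\<dots> = integral {u..v} (\<lambda>w. average w t) - integral {u..v} (\<lambda>w. average w 0)"
    using t by (intro integral_diff) (auto intro!: integrable_continuous_interval continuous_intros)
  also have "\<dots> = (LBINT w:{u..v}. average w t) - (LBINT w:{u..v}. average w 0)"
    using t by (subst (1 2) LBINT_Icc_eq_integral) (auto intro!: continuous_intros)
  finally show ?thesis .
qed

text \<open>The flux is at most the maximum \<open>K\<close> of the field times the average, so
  after exchanging the integrals over velocity and time the bound is \<open>K * C * t\<close>, with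
  \<open>C\<close> the bound on the mass.\<close>

lemma flow_through_L1_bounded:
  assumes t: "0 \<le> t"
  obtains C where "\<And>N. 0 \<le> N \<Longrightarrow> integral {-N..N} (\<lambda>v. \<bar>flow_through v t\<bar>) \<le> C"
proof -
  obtain C where C: "\<And>s. 0 \<le> s \<Longrightarrow> s \<le> t \<Longrightarrow> (LBINT v. average v s) \<le> C"
    using mass_bounded[OF t] unfolding average_def by fastforce
  have "compact ((\<lambda>(x, s). e x s) ` ({0..1} \<times> {0..t}))"
    by (intro compact_continuous_image continuous_on_subset[OF ce] compact_Times) auto
  then obtain K where K: "\<And>x s. x \<in> {0..1} \<Longrightarrow> s \<in> {0..t} \<Longrightarrow> \<bar>e x s\<bar> \<le> K"
    by (fastforce dest!: compact_imp_bounded simp: bounded_iff)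
  have K_nonneg: "0 \<le> K"
    using K[of 0 0] t by auto
  have "integral {-N..N} (\<lambda>v. \<bar>flow_through v t\<bar>) \<le> K * C * t" if N: "0 \<le> N" for N
  proof -
    have c2: "continuous_on UNIV (\<lambda>v. integral {0..t} (\<lambda>s. K * average v s))"
    proof -
      have "continuous_on (UNIV \<times> cbox 0 t) (\<lambda>(v, s). K * average v s)"
        by (auto intro!: continuous_intros simp: case_prod_unfold)
      from integral_continuous_on_param[OF this] show ?thesis by simp
    qed
    have c1: "continuous_on UNIV (\<lambda>v. flow_through v t)"
      using flow_through_deriv[OF t] by (intro continuous_at_imp_continuous_on) (auto intro: DERIV_isCont)
    have "integral {-N..N} (\<lambda>v. \<bar>flow_through v t\<bar>) \<le> integral {-N..N} (\<lambda>v. integral {0..t} (\<lambda>s. K * average v s))"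
    proof (rule integral_le)
      fix v
      have "norm (flow_through v t) \<le> integral {0..t} (\<lambda>s. K * average v s)"
        unfolding flow_through_def
        by (rule integral_norm_bound_integral) (auto intro!: abs_flux_le K integrable_continuous_interval continuous_intros)
      then show "\<bar>flow_through v t\<bar> \<le> integral {0..t} (\<lambda>s. K * average v s)" by simp
    qed (auto intro!: integrable_continuous_interval continuous_intros continuous_on_subset[OF c1] continuous_on_subset[OF c2] simp del: integral_mult_right)
    also have "\<dots> = integral {0..t} (\<lambda>s. integral {-N..N} (\<lambda>v. K * average v s))"
    proof -
      have "continuous_on (cbox (-N, 0) (N, t)) (\<lambda>(v, s). K * average v s)"
        by (auto intro!: continuous_intros simp: case_prod_unfold cbox_Pair_eq)
      from integral_swap_continuous[OF this] show ?thesis by simp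
    qed
    also have "\<dots> \<le> integral {0..t} (\<lambda>s. K * C)"
    proof (rule integral_le)
      have "continuous_on ({0..} \<times> cbox (-N) N) (\<lambda>(s, v). K * average v s)"
        by (auto intro!: continuous_intros simp: case_prod_unfold)
      from integral_continuous_on_param[OF this]
      show "(\<lambda>s. integral {-N..N} (\<lambda>v. K * average v s)) integrable_on {0..t}"
        by (auto intro!: integrable_continuous_interval intro: continuous_on_subset)
      fix s assume s: "s \<in> {0..t}"
      have "integral {-N..N} (\<lambda>v. average v s) = (LBINT v:{-N..N}. average v s)"
        using s by (subst LBINT_Icc_eq_integral) (auto intro!: continuous_intros)
      also have "\<dots> \<le> (LBINT v. average v s)"
        unfolding set_lebesgue_integral_def
        using s average_integrable[of s] average_nonneg[of s]
        by (intro integral_mono integrable_mult_indicator[of _ lborel, simplified]) (auto simp: indicator_def)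
      also have "\<dots> \<le> C" using C s by auto
      finally show "integral {-N..N} (\<lambda>v. K * average v s) \<le> K * C"
        using K_nonneg by (simp add: mult_left_mono)
    qed auto
    also have "\<dots> = K * C * t" using t by simp
    finally show ?thesis .
  qed
  then show ?thesis by (rule that)
qed

lemma flow_through_continuous: "0 \<le> t \<Longrightarrow> continuous_on UNIV (\<lambda>v. flow_through v t)"
  using flow_through_deriv by (intro continuous_at_imp_continuous_on) (auto intro: DERIV_isCont)

text \<open>By \<open>flow_through_diff\<close> the transported mass has a limit as the velocity
  tends to minus infinity, and the L1 bound forces this limit to be zero.\<close>

lemma flow_through_eq:
  assumes t: "0 \<le> t"
  shows "flow_through v t = (LBINT w:{..v}. average w t) - (LBINT w:{..v}. average w 0)"
proof -
  obtain C where C: "\<And>N. 0 \<le> N \<Longrightarrow> integral {-N..N} (\<lambda>v. \<bar>flow_through v t\<bar>) \<le> C"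
    using flow_through_L1_bounded[OF t] by blast
  have si: "set_integrable lborel {..v} (\<lambda>w. average w s)" if "0 \<le> s" for s
    unfolding set_integrable_def using average_integrable[OF that] by (intro integrable_mult_indicator) auto
  have "((\<lambda>u. flow_through v t - ((LBINT w:{u..v}. average w t) - (LBINT w:{u..v}. average w 0)))
     \<longlongrightarrow> flow_through v t - ((LBINT w:{..v}. average w t) - (LBINT w:{..v}. average w 0))) at_bot"
    using t by (intro tendsto_intros tendsto_set_lebesgue_integral_at_bot si) auto
  moreover have "\<forall>\<^sub>F u in at_bot. flow_through v t - ((LBINT w:{u..v}. average w t) - (LBINT w:{u..v}. average w 0)) = flow_through u t"
    using eventually_le_at_bot[of v] by (rule eventually_mono) (use flow_through_diff[OF t, of _ v] in force)
  ultimately have "((\<lambda>u. flow_through u t) \<longlongrightarrow> flow_through v t - ((LBINT w:{..v}. average w t) - (LBINT w:{..v}. average w 0))) at_bot"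
    by (rule Lim_transform_eventually)
  from limit_at_bot_zero_if_integral_bounded[OF flow_through_continuous[OF t] this C] show ?thesis by simp
qed

text \<open>No mass enters or escapes at infinite velocity: the limit of \<open>flow_through\<close>
  vanishes at the upper end for the same reason as at the lower end.\<close>

lemma mass_conserved:
  assumes t: "0 \<le> t"
  shows "(LBINT w. average w t) = (LBINT w. average w 0)"
proof -
  obtain C where C: "\<And>N. 0 \<le> N \<Longrightarrow> integral {-N..N} (\<lambda>v. \<bar>flow_through v t\<bar>) \<le> C"
    using flow_through_L1_bounded[OF t] by blast
  have si: "set_integrable lborel {u..} (\<lambda>w. average w s)" "set_integrable lborel {..u} (\<lambda>w. average w s)" if "0 \<le> s" for s u
    unfolding set_integrable_def using average_integrable[OF that] by (intro integrable_mult_indicator; auto)+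
  have *: "((\<lambda>v. flow_through 0 t + ((LBINT w:{0..v}. average w t) - (LBINT w:{0..v}. average w 0)))
     \<longlongrightarrow> flow_through 0 t + ((LBINT w:{0..}. average w t) - (LBINT w:{0..}. average w 0))) at_top"
    using t by (intro tendsto_intros tendsto_set_lebesgue_integral_at_top si) auto
  have "\<forall>\<^sub>F v in at_top. flow_through 0 t + ((LBINT w:{0..v}. average w t) - (LBINT w:{0..v}. average w 0)) = flow_through v t"
    using eventually_ge_at_top[of 0] by (rule eventually_mono) (use flow_through_diff[OF t, of 0] in force)
  from Lim_transform_eventually[OF * this]
  have z: "flow_through 0 t + ((LBINT w:{0..}. average w t) - (LBINT w:{0..}. average w 0)) = 0"
    using limit_at_top_zero_if_integral_bounded[OF flow_through_continuous[OF t] _ C] by blast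
  have split: "(LBINT w. average w s) = (LBINT w:{..0}. average w s) + (LBINT w:{0..}. average w s)" if s: "0 \<le> s" for s
  proof -
    have "(LBINT w:{..0} \<union> {0..}. average w s) = (LBINT w:{..0}. average w s) + (LBINT w:{0..}. average w s)"
    proof (rule set_integral_Un_AE[OF _ _ _ si(2)[OF s] si(1)[OF s]])
      show "AE x in lborel. \<not> (x \<in> {..0} \<and> x \<in> {0::real..})"
        using AE_lborel_singleton[of "0::real"] by eventually_elim auto
    qed auto
    moreover have "{..0} \<union> {0..} = (UNIV :: real set)" by auto
    ultimately show ?thesis by (simp add: set_lebesgue_integral_def)
  qed
  show ?thesis
    using z split[OF t] split[of 0] flow_through_eq[OF t, of 0] by simp
qed

end

section \<open>Solutions of the Vlasov-Poisson system\<close>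

lemma measurable_phase: "borel_measurable phase = borel_measurable borel"
  by (rule measurable_cong_sets) auto

lemma integrable_phaseI:
  fixes F :: "real \<times> real \<Rightarrow> real"
  assumes F: "F \<in> borel_measurable borel" and F0: "\<And>z. 0 \<le> F z"
    and i: "\<And>x. integrable lborel (\<lambda>v. F (x, v))"
    and i2: "set_integrable lborel {0..1} (\<lambda>x. LBINT v. F (x, v))"
  shows "integrable phase F"
  unfolding phase_def
proof (rule phase.Fubini_integrable)
  have m: "F \<in> borel_measurable (torus \<Otimes>\<^sub>M lborel)"
    using F unfolding phase_def[symmetric] measurable_phase .
  then show "F \<in> borel_measurable (torus \<Otimes>\<^sub>M lborel)" .
  have "(\<lambda>x. LBINT v. F (x, v)) \<in> borel_measurable torus"
    using lborel.borel_measurable_lebesgue_integral[of "\<lambda>x v. F (x, v)" torus] m by simp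
  then have "(\<lambda>x. LBINT v. F (x, v)) \<in> borel_measurable borel"
    by (simp add: measurable_cong_sets[OF sets_torus refl])
  then show "integrable torus (\<lambda>x. LBINT y. norm (F (x, y)))"
    using i2 F0 by (simp add: integrable_torus)
  show "AE x in torus. integrable lborel (\<lambda>y. F (x, y))"
    using i by simp
qed

lemma integral_phase:
  fixes F :: "real \<times> real \<Rightarrow> real"
  assumes "integrable phase F"
  shows "integral\<^sup>L phase F = (LBINT x:{0..1}. LBINT v. F (x, v))"
proof -
  have i: "integrable (torus \<Otimes>\<^sub>M lborel) F" using assms by (simp add: phase_def)
  have "(\<lambda>x. LBINT v. F (x, v)) \<in> borel_measurable borel"
    using phase.integrable_fst'[OF i] borel_measurable_integrable measurable_cong_sets[OF sets_torus refl] by blast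
  then show ?thesis
    using phase.integral_fst'[OF i] by (simp add: phase_def integral_torus)
qed

lemma integral_phase_swap:
  fixes F :: "real \<times> real \<Rightarrow> real"
  assumes "integrable phase F" and c: "\<And>v. continuous_on {0..1} (\<lambda>x. F (x, v))"
  shows "integral\<^sup>L phase F = (LBINT v. integral {0..1} (\<lambda>x. F (x, v)))"
    and "integrable lborel (\<lambda>v. integral {0..1} (\<lambda>x. F (x, v)))"
proof -
  have i: "integrable (torus \<Otimes>\<^sub>M lborel) (\<lambda>(x, v). F (x, v))" using assms by (simp add: phase_def)
  have m: "F \<in> borel_measurable borel"
    using assms(1) borel_measurable_integrable measurable_phase by blast
  have "(\<lambda>x. F (x, v)) \<in> borel_measurable borel" for v
    using measurable_compose[OF _ m, of "\<lambda>x. (x, v)" borel] by (simp add: borel_measurable_continuous_onI continuous_intros)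
  then have eq: "(LINT x|torus. F (x, v)) = integral {0..1} (\<lambda>x. F (x, v))" for v
    by (simp add: integral_torus LBINT_Icc_eq_integral c)
  show "integral\<^sup>L phase F = (LBINT v. integral {0..1} (\<lambda>x. F (x, v)))"
    using phase.integral_snd[OF i] by (simp add: phase_def eq)
  show "integrable lborel (\<lambda>v. integral {0..1} (\<lambda>x. F (x, v)))"
    using phase.integrable_snd[OF i] by (simp add: eq)
qed

locale vp_solution =
  fixes \<rho> :: "real \<Rightarrow> real" and f fx fv ft :: "real \<Rightarrow> real \<Rightarrow> real \<Rightarrow> real"
  assumes background: "background_density \<rho>"
    and f_periodic: "0 \<le> t \<Longrightarrow> f (x + 1) v t = f x v t"
    and f_nonneg: "0 \<le> t \<Longrightarrow> 0 \<le> f x v t"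
    and mass_initial: "(\<integral>\<^sup>+x\<in>{0..1}. (\<integral>\<^sup>+v. ennreal (f x v 0) \<partial>lborel) \<partial>lborel) = 1"
    and f_integrable: "0 \<le> t \<Longrightarrow> integrable lborel (\<lambda>v. f x v t)"
    and density_continuous: "continuous_on (UNIV \<times> {0..}) (\<lambda>(x, t). LBINT v. f x v t)"
    and cfx: "continuous_on (UNIV \<times> UNIV \<times> {0..}) (\<lambda>(x, v, t). fx x v t)"
    and cfv: "continuous_on (UNIV \<times> UNIV \<times> {0..}) (\<lambda>(x, v, t). fv x v t)"
    and cft: "continuous_on (UNIV \<times> UNIV \<times> {0..}) (\<lambda>(x, v, t). ft x v t)"
    and dfx: "0 \<le> t \<Longrightarrow> ((\<lambda>x. f x v t) has_real_derivative fx x v t) (at x)"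
    and dfv: "0 \<le> t \<Longrightarrow> ((\<lambda>v. f x v t) has_real_derivative fv x v t) (at v)"
    and dft: "0 \<le> t \<Longrightarrow> ((\<lambda>t. f x v t) has_real_derivative ft x v t) (at t within {0..})"
    and vlasov: "0 \<le> t \<Longrightarrow> ft x v t + v * fx x v t - electric_field \<rho> (\<lambda>x v. f x v t) x * fv x v t = 0"

lemma vp_solutionI:
  assumes "background_density \<rho>" "vlasov_poisson_solution \<rho> f"
  obtains fx fv ft where "vp_solution \<rho> f fx fv ft"
proof -
  note sol = assms(2)[unfolded vlasov_poisson_solution_def]
  from sol[THEN conjunct2, THEN conjunct2, THEN conjunct2, THEN conjunct2, THEN conjunct2] obtain fx fv ft where
    "continuous_on (UNIV \<times> UNIV \<times> {0..}) (\<lambda>(x, v, t). fx x v t)"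
    "continuous_on (UNIV \<times> UNIV \<times> {0..}) (\<lambda>(x, v, t). fv x v t)"
    "continuous_on (UNIV \<times> UNIV \<times> {0..}) (\<lambda>(x, v, t). ft x v t)"
    "\<forall>x v. \<forall>t\<ge>0. ((\<lambda>x. f x v t) has_real_derivative fx x v t) (at x) \<and>
       ((\<lambda>v. f x v t) has_real_derivative fv x v t) (at v) \<and>
       ((\<lambda>t. f x v t) has_real_derivative ft x v t) (at t within {0..}) \<and>
       ft x v t + v * fx x v t - electric_field \<rho> (\<lambda>x v. f x v t) x * fv x v t = 0"
    by (elim exE conjE) (rule that, assumption+)
  with assms have "vp_solution \<rho> f fx fv ft"
    using sol[THEN conjunct1] sol[THEN conjunct2, THEN conjunct1] sol[THEN conjunct2, THEN conjunct2, THEN conjunct1]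
      sol[THEN conjunct2, THEN conjunct2, THEN conjunct2, THEN conjunct1]
      sol[THEN conjunct2, THEN conjunct2, THEN conjunct2, THEN conjunct2, THEN conjunct1]
    by (intro vp_solution.intro) blast+
  then show ?thesis by (rule that)
qed

context vp_solution
begin

definition spatial_density :: "real \<Rightarrow> real \<Rightarrow> real" where
  "spatial_density x t = (LBINT v. f x v t)"

abbreviation E :: "real \<Rightarrow> real \<Rightarrow> real" where
  "E x t \<equiv> electric_field \<rho> (\<lambda>y v. f y v t) x"

lemma cf: "continuous_on (UNIV \<times> UNIV \<times> {0..}) (\<lambda>(x, v, t). f x v t)"
  by (rule continuous_on_partials_real3[OF dfx dfv dft cfv cft]) auto

lemma f_cont [continuous_intros]:
  assumes "continuous_on S x" "continuous_on S v" "continuous_on S t" "\<And>z. z \<in> S \<Longrightarrow> 0 \<le> t z"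
  shows "continuous_on S (\<lambda>z. f (x z) (v z) (t z))" "continuous_on S (\<lambda>z. fx (x z) (v z) (t z))"
    "continuous_on S (\<lambda>z. fv (x z) (v z) (t z))" "continuous_on S (\<lambda>z. ft (x z) (v z) (t z))"
  using assms by (auto intro!: continuous_on_compose_3[OF cf] continuous_on_compose_3[OF cfx]
      continuous_on_compose_3[OF cfv] continuous_on_compose_3[OF cft])

lemma density_cont [continuous_intros]:
  assumes "continuous_on S x" "continuous_on S t" "\<And>z. z \<in> S \<Longrightarrow> 0 \<le> t z"
  shows "continuous_on S (\<lambda>z. spatial_density (x z) (t z))"
  unfolding spatial_density_def using assms by (auto intro!: continuous_on_compose_2[OF density_continuous])

lemma density_nonneg: "0 \<le> t \<Longrightarrow> 0 \<le> spatial_density x t"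
  unfolding spatial_density_def by (intro integral_nonneg_AE AE_I2 f_nonneg)

lemma density_periodic: "0 \<le> t \<Longrightarrow> spatial_density (x + 1) t = spatial_density x t"
  by (simp add: spatial_density_def f_periodic)

lemma f_measurable: "0 \<le> t \<Longrightarrow> (\<lambda>z. f (fst z) (snd z) t) \<in> borel_measurable borel"
  by (intro borel_measurable_continuous_onI continuous_intros) auto

lemma density_set_integrable: "0 \<le> t \<Longrightarrow> set_integrable lborel {0..1} (\<lambda>x. spatial_density x t)"
  by (intro borel_integrable_atLeastAtMost' continuous_intros) auto

lemma f_phase_integrable: "0 \<le> t \<Longrightarrow> integrable phase (\<lambda>z. f (fst z) (snd z) t)"
  using density_set_integrable f_integrable
  by (intro integrable_phaseI f_measurable) (auto simp: f_nonneg spatial_density_def)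

lemma f_phase_integral:
  "0 \<le> t \<Longrightarrow> integral\<^sup>L phase (\<lambda>z. f (fst z) (snd z) t) = integral {0..1} (\<lambda>x. spatial_density x t)"
  using integral_phase[OF f_phase_integrable, of t]
  by (simp add: spatial_density_def[symmetric] LBINT_Icc_eq_integral continuous_intros)

lemma rho_integrable: "set_integrable lborel {0..1} \<rho>" "\<rho> integrable_on {0..1}" "integral {0..1} \<rho> = 1"
  using background set_borel_integral_eq_integral[of "{0..1}" \<rho>] by (auto simp: background_density_def)

lemma rho_nonneg: "0 \<le> \<rho> x"
  using background by (auto simp: background_density_def)

text \<open>The formula for \<open>E\<close> on \<open>[0,1)\<close>, extended continuously to
  \<open>x = 1\<close>. Its values at 1 and 0 differ by the total charge, so before mass is known to
  be conserved it need not be the restriction of a continuous periodic function, and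
  \<open>E\<close> itself may jump.\<close>

definition boundary_field :: "real \<Rightarrow> real \<Rightarrow> real" where
  "boundary_field x t = (LBINT y:{0..1}. (y - 1) * \<rho> y) - integral {0..1} (\<lambda>y. (y - 1) * spatial_density y t)
     + (integral {0..x} \<rho> - primitive (\<lambda>y. spatial_density y t) x)"

lemma E_eq_kernel_transform: "E x t = kernel_transform (\<lambda>y. \<rho> y - spatial_density y t) x"
  by (simp add: electric_field_eq spatial_density_def)

lemma charge_set_integrable: "0 \<le> t \<Longrightarrow> set_integrable lborel {0..1} (\<lambda>y. \<rho> y - spatial_density y t)"
  by (intro set_integral_diff rho_integrable density_set_integrable)

lemma E_eq_boundary_field:
  assumes t: "0 \<le> t" and x: "0 \<le> x" "x < 1"
  shows "E x t = boundary_field x t"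
proof -
  have 1: "set_integrable lborel {0..1} (\<lambda>y. (y - 1) * \<rho> y)"
    by (rule set_integrable_bounded_mult[OF rho_integrable(1), where K=1]) auto
  have 2: "continuous_on {0..1} (\<lambda>y. (y - 1) * spatial_density y t)"
    using t by (intro continuous_intros) auto
  have "(LBINT y:{0..1}. (y - 1) * (\<rho> y - spatial_density y t)) =
    (LBINT y:{0..1}. (y - 1) * \<rho> y) - integral {0..1} (\<lambda>y. (y - 1) * spatial_density y t)"
    unfolding right_diff_distrib LBINT_Icc_eq_integral[OF 2, symmetric]
    by (intro set_integral_diff 1 borel_integrable_atLeastAtMost' 2)
  moreover have "integral {0..x} (\<lambda>y. \<rho> y - spatial_density y t) = integral {0..x} \<rho> - primitive (\<lambda>y. spatial_density y t) x"
    using t x rho_integrable(2)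
    by (subst primitive_eq_integral, (auto intro!: continuous_intros)[2], subst integral_diff)
       (use integrable_on_subinterval[OF rho_integrable(2), of 0 x] in \<open>auto intro!: integrable_continuous_interval[where f="\<lambda>y. spatial_density y t"] continuous_intros\<close>)
  ultimately show ?thesis
    unfolding E_eq_kernel_transform boundary_field_def kernel_transform_eq[OF charge_set_integrable[OF t] x] by simp
qed

lemma boundary_field_continuous: "continuous_on ({0..1} \<times> {0..}) (\<lambda>(x, t). boundary_field x t)"
proof -
  have "continuous_on ({0..} \<times> cbox 0 1) (\<lambda>(t, y). (y - 1) * spatial_density y t)"
    by (auto intro!: continuous_intros simp: case_prod_unfold)
  from integral_continuous_on_param[OF this]
  have 1: "continuous_on {0..} (\<lambda>t. integral {0..1} (\<lambda>y. (y - 1) * spatial_density y t))" by simp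
  have 2: "continuous_on {0..1} (\<lambda>x. integral {0..x} \<rho>)"
    by (intro indefinite_integral_continuous_1 rho_integrable)
  have 3: "continuous_on (UNIV \<times> {0..}) (\<lambda>(x, t). primitive (\<lambda>y. spatial_density y t) x)"
    by (rule primitive_param_continuous) (auto intro!: continuous_intros simp: case_prod_unfold)
  show ?thesis
    unfolding boundary_field_def case_prod_unfold
    by (intro continuous_intros continuous_on_compose2[OF 1] continuous_on_compose2[OF 2]
        continuous_on_subset[OF 3[unfolded case_prod_unfold]]) auto
qed

text \<open>Both fields agree on \<open>[0,1)\<close>, where the equation is given; it passes to
  \<open>x = 1\<close> because every term is continuous on the closed interval.\<close>

lemma vlasov_boundary_field:
  assumes x: "x \<in> {0..1}" and t: "0 \<le> t"
  shows "ft x v t + v * fx x v t - boundary_field x t * fv x v t = 0"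
proof (rule continuous_constant_on_closure[where S="{0..<1}" and f="\<lambda>x. ft x v t + v * fx x v t - boundary_field x t * fv x v t"])
  have b: "continuous_on {0..1} (\<lambda>x. boundary_field x t)"
    by (rule continuous_on_compose_2[OF boundary_field_continuous]) (use t in \<open>auto intro!: continuous_intros\<close>)
  show "continuous_on (closure {0..<1}) (\<lambda>x. ft x v t + v * fx x v t - boundary_field x t * fv x v t)"
    using t by (auto intro!: continuous_intros b)
  show "ft x v t + v * fx x v t - boundary_field x t * fv x v t = 0" if "x \<in> {0..<1}" for x
    using vlasov[OF t, of x v] E_eq_boundary_field[OF t, of x] that by simp
qed (use x in auto)

lemma average_f:
  assumes t: "0 \<le> t"
  shows "(LBINT v. integral {0..1} (\<lambda>x. f x v t)) = integral {0..1} (\<lambda>x. spatial_density x t)"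
    and "integrable lborel (\<lambda>v. integral {0..1} (\<lambda>x. f x v t))"
proof -
  have "continuous_on {0..1} (\<lambda>x. f (fst (x, v)) (snd (x, v)) t)" for v
    using t by (auto intro!: continuous_intros)
  from integral_phase_swap[OF f_phase_integrable[OF t] this] f_phase_integral[OF t]
  show "(LBINT v. integral {0..1} (\<lambda>x. f x v t)) = integral {0..1} (\<lambda>x. spatial_density x t)"
    "integrable lborel (\<lambda>v. integral {0..1} (\<lambda>x. f x v t))" by auto
qed

text \<open>Conservation of mass is what this interpretation is for, so the required mass bound must
  come from elsewhere: the spatial density is continuous in time and \<open>{0..T}\<close> is
  compact.\<close>

sublocale transport: transported_density f fx fv ft boundary_field
proof
  fix T :: real assume T: "0 \<le> T"
  have "continuous_on ({0..T} \<times> cbox 0 1) (\<lambda>(t, x). spatial_density x t)"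
    by (auto intro!: continuous_intros simp: case_prod_unfold)
  from integral_continuous_on_param[OF this]
  have "compact ((\<lambda>t. integral {0..1} (\<lambda>x. spatial_density x t)) ` {0..T})"
    by (intro compact_continuous_image) auto
  then obtain C where C: "\<And>t. t \<in> {0..T} \<Longrightarrow> \<bar>integral {0..1} (\<lambda>x. spatial_density x t)\<bar> \<le> C"
    by (fastforce dest!: compact_imp_bounded simp: bounded_iff)
  show "\<exists>C. \<forall>s\<in>{0..T}. integrable lborel (\<lambda>v. integral {0..1} (\<lambda>x. f x v s)) \<and> (LBINT v. integral {0..1} (\<lambda>x. f x v s)) \<le> C"
    using average_f C by (intro exI[of _ C]) (fastforce simp: abs_le_iff)
qed (use dfx dfv dft cfx cfv cft cf f_periodic f_nonneg boundary_field_continuous vlasov_boundary_field in auto)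

lemma mass_density:
  assumes t: "0 \<le> t"
  shows "integral {0..1} (\<lambda>x. spatial_density x t) = 1"
proof -
  have "ennreal (integral\<^sup>L phase (\<lambda>z. f (fst z) (snd z) 0)) = (\<integral>\<^sup>+z. ennreal (f (fst z) (snd z) 0) \<partial>phase)"
    by (intro nn_integral_eq_integral[symmetric] f_phase_integrable) (auto simp: f_nonneg)
  also have "\<dots> = 1"
    using f_measurable[of 0] by (subst nn_integral_phase) (auto simp: mass_initial)
  finally have "integral {0..1} (\<lambda>x. spatial_density x 0) = 1"
    by (simp add: f_phase_integral ennreal_eq_1)
  then show ?thesis
    using transport.mass_conserved[OF t] average_f(1)[OF t] average_f(1)[of 0] by (simp add: transport.average_def)
qed

lemma mass_f: "0 \<le> t \<Longrightarrow> integral\<^sup>L phase (\<lambda>z. f (fst z) (snd z) t) = 1"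
  by (simp add: f_phase_integral mass_density)

lemma charge_neutral: "0 \<le> t \<Longrightarrow> integral {0..1} (\<lambda>y. \<rho> y - spatial_density y t) = 0"
  using rho_integrable
  by (subst integral_diff) (auto simp: mass_density intro!: integrable_continuous_interval continuous_intros)

lemma E_continuous_at: "0 \<le> t \<Longrightarrow> continuous_on UNIV (\<lambda>x. E x t)"
  unfolding E_eq_kernel_transform using continuous_on_kernel_transform[OF charge_set_integrable charge_neutral] by simp

lemma E_periodic: "E (x + 1) t = E x t"
  unfolding E_eq_kernel_transform by (rule kernel_transform_periodic)

lemma E_mean_zero: "0 \<le> t \<Longrightarrow> integral {0..1} (\<lambda>x. E x t) = 0"
  unfolding E_eq_kernel_transform using integral_kernel_transform[OF charge_set_integrable charge_neutral] by simp

text \<open>The kernel is bounded by one, and the charge has total variation at most 1 from the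
  background plus 1 from \<open>f\<close>.\<close>

lemma abs_E_le: "0 \<le> t \<Longrightarrow> \<bar>E x t\<bar> \<le> 2"
proof -
  assume t: "0 \<le> t"
  have "\<bar>E x t\<bar> \<le> (LBINT y:{0..1}. \<bar>\<rho> y - spatial_density y t\<bar>)"
    unfolding E_eq_kernel_transform by (rule abs_kernel_transform_le[OF charge_set_integrable[OF t]])
  also have "\<dots> \<le> (LBINT y:{0..1}. \<rho> y + spatial_density y t)"
    by (intro set_integral_mono set_integrable_abs charge_set_integrable set_integral_add rho_integrable density_set_integrable t)
      (use rho_nonneg density_nonneg[OF t] in \<open>simp add: abs_le_iff\<close>)
  also have "\<dots> = 2"
    using background t by (simp add: set_integral_add rho_integrable density_set_integrable background_density_def
       LBINT_Icc_eq_integral continuous_intros mass_density)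
  finally show ?thesis .
qed

text \<open>The background cancels in differences of the field at two times; what is left is a
  continuous neutral charge. This is also how joint continuity of the field follows from continuity
  at time 0.\<close>

lemma E_diff:
  assumes "0 \<le> s" "0 \<le> t"
  shows "E x t - E x s = mean_zero_primitive (\<lambda>y. spatial_density y s - spatial_density y t) x"
proof -
  have "E x t - E x s = kernel_transform (\<lambda>y. (\<rho> y - spatial_density y t) - (\<rho> y - spatial_density y s)) x"
    unfolding E_eq_kernel_transform by (rule kernel_transform_diff[symmetric]) (use assms charge_set_integrable in auto)
  also have "\<dots> = kernel_transform (\<lambda>y. spatial_density y s - spatial_density y t) x" by simp
  also have "\<dots> = mean_zero_primitive (\<lambda>y. spatial_density y s - spatial_density y t) x"
  proof (rule kernel_transform_continuous_eq)
    have "(\<lambda>y. spatial_density y r) integrable_on {0..1}" if "0 \<le> r" for r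
      using that by (intro integrable_continuous_interval continuous_intros) auto
    then show "integral {0..1} (\<lambda>y. spatial_density y s - spatial_density y t) = 0"
      using assms by (subst integral_diff) (auto simp: mass_density)
  qed (use assms in \<open>auto intro!: continuous_intros simp: density_periodic\<close>)
  finally show ?thesis .
qed

lemma E_continuous: "continuous_on (UNIV \<times> {0..}) (\<lambda>(x, t). E x t)"
proof -
  have "continuous_on (UNIV \<times> {0..}) (\<lambda>(x, t). mean_zero_primitive (\<lambda>y. spatial_density y 0 - spatial_density y t) x)"
    by (rule mean_zero_primitive_continuous) (auto intro!: continuous_intros simp: case_prod_unfold)
  then have "continuous_on (UNIV \<times> {0..}) (\<lambda>p. E (fst p) 0 + mean_zero_primitive (\<lambda>y. spatial_density y 0 - spatial_density y (snd p)) (fst p))"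
    unfolding case_prod_unfold by (intro continuous_intros continuous_on_compose2[OF E_continuous_at]) auto
  then show ?thesis
    by (rule continuous_on_eq) (auto simp: E_diff[symmetric])
qed

end

section \<open>Solutions together with their characteristic flow\<close>

locale vp_flow = vp_solution \<rho> f fx fv ft + phase_flow "\<lambda>x t. electric_field \<rho> (\<lambda>y v. f y v t) x" \<Phi> D
  for \<rho> f fx fv ft \<Phi> D
begin

lemma f_flow:
  assumes t: "0 \<le> t"
  shows "f (fst (\<Phi> t z)) (snd (\<Phi> t z)) t = f (fst z) (snd z) 0"
proof -
  have "((\<lambda>s. f (fst (\<Phi> s z)) (snd (\<Phi> s z)) s) has_real_derivative 0) (at s within {0..})" if s: "0 \<le> s" for s
  proof -
    have "((\<lambda>s. f (fst (\<Phi> s z)) (snd (\<Phi> s z)) s) has_real_derivative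
      fx (fst (\<Phi> s z)) (snd (\<Phi> s z)) s * snd (\<Phi> s z) + fv (fst (\<Phi> s z)) (snd (\<Phi> s z)) s * (- E (fst (\<Phi> s z)) s)
        + ft (fst (\<Phi> s z)) (snd (\<Phi> s z)) s * 1) (at s within {0..})"
      by (rule has_real_derivative_compose_partials[where T="{0..}" and F=f and Fx=fx and Fv=fv and Ft=ft
            and X="\<lambda>s. fst (\<Phi> s z)" and V="\<lambda>s. snd (\<Phi> s z)" and W="\<lambda>s. s"])
        (use s in \<open>auto intro!: dfx dfv dft cfv cft flow_fst flow_snd derivative_eq_intros\<close>)
    then show ?thesis
      using vlasov[OF s, of "fst (\<Phi> s z)" "snd (\<Phi> s z)"] by (auto simp: algebra_simps elim!: DERIV_cong)
  qed
  then have "\<exists>c. \<forall>s\<in>{0..}. f (fst (\<Phi> s z)) (snd (\<Phi> s z)) s = c"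
    by (intro has_field_derivative_zero_constant) auto
  then obtain c where "\<And>s. s \<in> {0..} \<Longrightarrow> f (fst (\<Phi> s z)) (snd (\<Phi> s z)) s = c"
    by blast
  from this[of t] this[of 0] show ?thesis using t by (simp add: flow_0)
qed

end

lemma vp_flowI:
  assumes "vp_solution \<rho> f fx fv ft" "characteristic_flow (\<lambda>x t. electric_field \<rho> (\<lambda>y v. f y v t) x) \<Phi>"
  obtains D where "vp_flow \<rho> f fx fv ft \<Phi> D"
proof -
  interpret vp_solution \<rho> f fx fv ft by fact
  note flow = assms(2)[unfolded characteristic_flow_def]
  from flow[THEN conjunct2, THEN conjunct2, THEN conjunct2, THEN conjunct2] obtain D where D: "continuous_on ({0..} \<times> UNIV) (\<lambda>(t, z). D t z)"
      "\<forall>t\<ge>0. \<forall>z. (\<Phi> t has_derivative blinfun_apply (D t z)) (at z)"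
    by (elim exE conjE) (rule that, assumption+)
  have "phase_flow E \<Phi> D"
    using flow[THEN conjunct1] flow[THEN conjunct2, THEN conjunct1] flow[THEN conjunct2, THEN conjunct2, THEN conjunct1]
      flow[THEN conjunct2, THEN conjunct2, THEN conjunct2, THEN conjunct1] D E_continuous
    by (intro phase_flow.intro) blast+
  then have "vp_flow \<rho> f fx fv ft \<Phi> D"
    unfolding vp_flow_def using vp_solution_axioms by blast
  then show ?thesis by (rule that)
qed

section \<open>Conservation of the relative energy\<close>

text \<open>The hypothesis is a uniform form of vanishing derivative. It suits quantities such as
  the energy, whose increments can be estimated without a formula for the time derivative of the
  field.\<close>

lemma constant_if_small_increments:
  fixes Y :: "real \<Rightarrow> real"
  assumes T: "0 \<le> T"
    and Y: "\<And>\<epsilon>. 0 < \<epsilon> \<Longrightarrow> \<exists>d>0. \<forall>s t. 0 \<le> s \<longrightarrow> s \<le> t \<longrightarrow> t \<le> T \<longrightarrow> t - s < d \<longrightarrow> \<bar>Y t - Y s\<bar> \<le> \<epsilon> * (t - s)"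
  shows "Y T = Y 0"
proof -
  have "(Y has_real_derivative 0) (at s within {0..T})" if s: "s \<in> {0..T}" for s
    unfolding has_field_derivative_def has_derivative_within_alt
  proof (intro conjI allI impI)
    show "bounded_linear ((*) (0 :: real))" by (rule bounded_linear_mult_right)
    fix \<epsilon> :: real assume "0 < \<epsilon>"
    from Y[OF this] obtain d where d: "0 < d"
      "\<And>s t. 0 \<le> s \<Longrightarrow> s \<le> t \<Longrightarrow> t \<le> T \<Longrightarrow> t - s < d \<Longrightarrow> \<bar>Y t - Y s\<bar> \<le> \<epsilon> * (t - s)" by blast
    have "norm (Y t - Y s - 0 * (t - s)) \<le> \<epsilon> * norm (t - s)" if "t \<in> {0..T}" "norm (t - s) < d" for t
      using d(2)[of s t] d(2)[of t s] s that by (cases "s \<le> t") (auto simp: abs_minus_commute)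
    then show "\<exists>d>0. \<forall>t\<in>{0..T}. norm (t - s) < d \<longrightarrow> norm (Y t - Y s - 0 * (t - s)) \<le> \<epsilon> * norm (t - s)"
      using d(1) by blast
  qed
  then have "\<exists>c. \<forall>s\<in>{0..T}. Y s = c"
    by (intro has_field_derivative_zero_constant) auto
  then obtain c where "\<And>s. s \<in> {0..T} \<Longrightarrow> Y s = c" by blast
  from this[of T] this[of 0] T show ?thesis by simp
qed

context vp_flow
begin

definition f0 :: "real \<times> real \<Rightarrow> real" where
  "f0 z = f (fst z) (snd z) 0"

lemma f0_nonneg: "0 \<le> f0 z"
  by (simp add: f0_def f_nonneg)

lemma f0_measurable [measurable]: "f0 \<in> borel_measurable borel"
  using f_measurable[of 0] by (simp add: f0_def[abs_def])

lemma f_flow_f0: "0 \<le> t \<Longrightarrow> f (fst (\<Phi> t z)) (snd (\<Phi> t z)) t = f0 z"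
  by (simp add: f_flow f0_def)

lemma flow_components_measurable [measurable]:
  assumes "0 \<le> t"
  shows "(\<lambda>z. fst (\<Phi> t z)) \<in> borel_measurable borel" "(\<lambda>z. snd (\<Phi> t z)) \<in> borel_measurable borel"
  by (intro borel_measurable_continuous_onI continuous_intros; use assms in auto)+

text \<open>\<open>f\<close> is constant along characteristics and the flow preserves area. A weight
  depending on the initial value of \<open>f\<close> therefore becomes the same weight of the
  current value; this is how particles are selected once for all times.\<close>

lemma phase_integral_transport:
  fixes g :: "real \<times> real \<Rightarrow> real" and c :: "real \<Rightarrow> real"
  assumes t: "0 \<le> t" and g: "g \<in> borel_measurable borel" "\<And>x v. g (x + 1, v) = g (x, v)"
    and c: "c \<in> borel_measurable borel"
  shows "integral\<^sup>L phase (\<lambda>z. c (f (fst z) (snd z) t) * g z) = integral\<^sup>L phase (\<lambda>z. c (f0 z) * g (\<Phi> t z))"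
    and "integrable phase (\<lambda>z. c (f (fst z) (snd z) t) * g z) \<longleftrightarrow> integrable phase (\<lambda>z. c (f0 z) * g (\<Phi> t z))"
proof -
  note f_measurable[OF t, measurable] g(1)[measurable] c[measurable]
  have m: "(\<lambda>z. c (f (fst z) (snd z) t) * g z) \<in> borel_measurable borel"
    by measurable
  show "integral\<^sup>L phase (\<lambda>z. c (f (fst z) (snd z) t) * g z) = integral\<^sup>L phase (\<lambda>z. c (f0 z) * g (\<Phi> t z))"
    using integrable_flow(2)[OF t m] by (simp add: f_periodic[OF t] g f_flow_f0[OF t])
  show "integrable phase (\<lambda>z. c (f (fst z) (snd z) t) * g z) \<longleftrightarrow> integrable phase (\<lambda>z. c (f0 z) * g (\<Phi> t z))"
    using integrable_flow(1)[OF t m] by (simp add: f_periodic[OF t] g f_flow_f0[OF t])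
qed

lemma abs_snd_flow_le: "0 \<le> t \<Longrightarrow> \<bar>snd (\<Phi> t z)\<bar> \<le> \<bar>snd z\<bar> + 2 * t"
  using abs_snd_flow_diff_le[of 0 t 2 z] abs_E_le by (simp add: flow_0)

lemma E_uniformly_continuous:
  assumes "0 < \<epsilon>"
  obtains d where "0 < d" "\<And>x s t. 0 \<le> s \<Longrightarrow> s \<le> T \<Longrightarrow> 0 \<le> t \<Longrightarrow> t \<le> T \<Longrightarrow> \<bar>t - s\<bar> < d \<Longrightarrow> \<bar>E x t - E x s\<bar> < \<epsilon>"
proof -
  have "uniformly_continuous_on ({0..1} \<times> {0..T}) (\<lambda>(x, t). E x t)"
    by (intro compact_uniformly_continuous continuous_on_subset[OF E_continuous] compact_Times) auto
  from this[unfolded uniformly_continuous_on_def, rule_format, OF assms]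
  obtain d where d: "0 < d" and dd: "\<And>p q. p \<in> {0..1} \<times> {0..T} \<Longrightarrow> q \<in> {0..1} \<times> {0..T} \<Longrightarrow> dist q p < d \<Longrightarrow>
      dist (case q of (x, t) \<Rightarrow> E x t) (case p of (x, t) \<Rightarrow> E x t) < \<epsilon>"
    by blast
  have "\<bar>E x t - E x s\<bar> < \<epsilon>" if "0 \<le> s" "s \<le> T" "0 \<le> t" "t \<le> T" "\<bar>t - s\<bar> < d" for x s t
  proof -
    have "\<bar>E (frac x) t - E (frac x) s\<bar> < \<epsilon>"
      using dd[of "(frac x, s)" "(frac x, t)"] that frac_lt_1[of x]
      by (simp add: dist_prod_def dist_real_def less_imp_le)
    then show ?thesis
      using periodic_frac[of "\<lambda>x. E x t" x] periodic_frac[of "\<lambda>x. E x s" x] E_periodic by simp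
  qed
  with d show ?thesis by (rule that)
qed

lemma phase_integral_density:
  assumes t: "0 \<le> t" and P: "continuous_on UNIV P" "\<And>x. P (x + 1) = P x"
  shows "integral\<^sup>L phase (\<lambda>z. f0 z * P (fst (\<Phi> t z))) = integral {0..1} (\<lambda>x. P x * spatial_density x t)"
    and "integrable phase (\<lambda>z. f0 z * P (fst (\<Phi> t z)))"
proof -
  have m: "(\<lambda>z. P (fst z)) \<in> borel_measurable borel"
    by (intro borel_measurable_continuous_onI continuous_on_compose2[OF P(1)] continuous_intros) auto
  have "compact (P ` {0..1})"
    by (intro compact_continuous_image continuous_on_subset[OF P(1)]) auto
  then obtain K where K: "\<And>x. x \<in> {0..1} \<Longrightarrow> \<bar>P x\<bar> \<le> K"
    by (fastforce dest!: compact_imp_bounded simp: bounded_iff)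
  have K': "\<bar>P x\<bar> \<le> K" for x
    using K[of "frac x"] periodic_frac[of P x] P(2) frac_lt_1[of x] by (simp add: less_imp_le)
  have i: "integrable phase (\<lambda>z. f (fst z) (snd z) t * P (fst z))"
  proof (rule Bochner_Integration.integrable_bound[OF integrable_mult_right[OF f_phase_integrable[OF t], of K]])
    show "(\<lambda>z. f (fst z) (snd z) t * P (fst z)) \<in> borel_measurable phase"
      unfolding measurable_phase by (intro borel_measurable_times f_measurable[OF t] m)
    show "AE z in phase. norm (f (fst z) (snd z) t * P (fst z)) \<le> norm (K * f (fst z) (snd z) t)"
    proof (rule AE_I2)
      fix z :: "real \<times> real"
      have "\<bar>P (fst z)\<bar> \<le> \<bar>K\<bar>" using K'[of "fst z"] by linarith
      then show "norm (f (fst z) (snd z) t * P (fst z)) \<le> norm (K * f (fst z) (snd z) t)"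
        by (simp add: abs_mult mult.commute[of "\<bar>f (fst z) (snd z) t\<bar>"] mult_right_mono)
    qed
  qed
  have tr: "integral\<^sup>L phase (\<lambda>z. f (fst z) (snd z) t * P (fst z)) = integral\<^sup>L phase (\<lambda>z. f0 z * P (fst (\<Phi> t z)))"
    "integrable phase (\<lambda>z. f (fst z) (snd z) t * P (fst z)) \<longleftrightarrow> integrable phase (\<lambda>z. f0 z * P (fst (\<Phi> t z)))"
    using phase_integral_transport[OF t m, where c="\<lambda>x. x"] P(2) by auto
  then show "integrable phase (\<lambda>z. f0 z * P (fst (\<Phi> t z)))" using i by simp
  have c: "continuous_on {0..1} (\<lambda>x. P x * spatial_density x t)"
    using t by (auto intro!: continuous_intros continuous_on_subset[OF P(1)])
  have "integral\<^sup>L phase (\<lambda>z. f (fst z) (snd z) t * P (fst z)) = (LBINT x:{0..1}. spatial_density x t * P x)"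
    using integral_phase[OF i] by (simp add: spatial_density_def)
  then show "integral\<^sup>L phase (\<lambda>z. f0 z * P (fst (\<Phi> t z))) = integral {0..1} (\<lambda>x. P x * spatial_density x t)"
    using tr(1) LBINT_Icc_eq_integral[OF c] by (simp add: mult.commute)
qed

section \<open>Energy relative to a fixed periodic field of mean zero\<close>

context
  fixes G :: "real \<Rightarrow> real"
  assumes kinetic: "integrable phase (\<lambda>z. (1 + (snd z)\<^sup>2) * f0 z)"
    and G: "continuous_on UNIV G" "\<And>x. G (x + 1) = G x" "integral {0..1} G = 0"
begin

lemma f0_times_integrable:
  assumes g: "g \<in> borel_measurable borel" and b: "\<And>z. \<bar>g z\<bar> \<le> K * (1 + (snd z)\<^sup>2)"
  shows "integrable phase (\<lambda>z. f0 z * g z)"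
proof (rule Bochner_Integration.integrable_bound[OF integrable_mult_right[OF kinetic, of K]])
  show "(\<lambda>z. f0 z * g z) \<in> borel_measurable phase"
    using g unfolding measurable_phase by measurable
  show "AE z in phase. norm (f0 z * g z) \<le> norm (K * ((1 + (snd z)\<^sup>2) * f0 z))"
  proof (rule AE_I2)
    fix z
    have "norm (f0 z * g z) = f0 z * \<bar>g z\<bar>" using f0_nonneg[of z] by (simp add: abs_mult)
    also have "\<dots> \<le> f0 z * (K * (1 + (snd z)\<^sup>2))" by (intro mult_left_mono b f0_nonneg)
    also have "\<dots> \<le> norm (K * ((1 + (snd z)\<^sup>2) * f0 z))" by (simp add: mult_ac)
    finally show "norm (f0 z * g z) \<le> norm (K * ((1 + (snd z)\<^sup>2) * f0 z))" .
  qed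
qed

lemma primitive_G:
  "(primitive G has_real_derivative G x) (at x)" "primitive G (x + 1) = primitive G x"
  "continuous_on UNIV (primitive G)"
  using has_real_derivative_primitive[OF G(1)] primitive_periodic[OF G(1,2)] G(3)
  by (auto intro!: continuous_at_imp_continuous_on DERIV_isCont)

definition reference_energy :: "real \<times> real \<Rightarrow> real" where
  "reference_energy z = (snd z)\<^sup>2 / 2 + primitive G (fst z)"

lemma reference_energy_measurable [measurable]: "reference_energy \<in> borel_measurable borel"
  unfolding reference_energy_def
  by (intro borel_measurable_continuous_onI continuous_intros continuous_on_compose2[OF primitive_G(3)]) auto

lemma energy_integrable:
  assumes t: "0 \<le> t"
  shows "integrable phase (\<lambda>z. f0 z * reference_energy (\<Phi> t z))"
proof -
  have "compact (primitive G ` {0..1})"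
    by (intro compact_continuous_image continuous_on_subset[OF primitive_G(3)]) auto
  then obtain K where K: "\<And>x. x \<in> {0..1} \<Longrightarrow> \<bar>primitive G x\<bar> \<le> K"
    by (fastforce dest!: compact_imp_bounded simp: bounded_iff)
  have K': "\<bar>primitive G x\<bar> \<le> K" for x
    using K[of "frac x"] periodic_frac[of "primitive G" x] primitive_G(2) frac_lt_1[of x] by (simp add: less_imp_le)
  have b: "\<bar>reference_energy (\<Phi> t z)\<bar> \<le> (1 + K + 4 * t\<^sup>2) * (1 + (snd z)\<^sup>2)" for z
  proof -
    have "\<bar>snd (\<Phi> t z)\<bar>\<^sup>2 \<le> (\<bar>snd z\<bar> + 2 * t)\<^sup>2"
      by (rule power_mono[OF abs_snd_flow_le[OF t]]) simp
    also have "\<dots> \<le> 2 * (snd z)\<^sup>2 + 8 * t\<^sup>2"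
      using zero_le_power2[of "\<bar>snd z\<bar> - 2 * t"] by (simp add: power2_eq_square algebra_simps)
    finally have "\<bar>reference_energy (\<Phi> t z)\<bar> \<le> (snd z)\<^sup>2 + 4 * t\<^sup>2 + K"
      using K'[of "fst (\<Phi> t z)"] zero_le_power2[of "snd (\<Phi> t z)"]
      unfolding reference_energy_def power2_abs by linarith
    also have "\<dots> \<le> (1 + K + 4 * t\<^sup>2) * (1 + (snd z)\<^sup>2)"
      using K'[of 0] by (simp add: algebra_simps)
    finally show ?thesis .
  qed
  have "(\<lambda>z. reference_energy (\<Phi> t z)) \<in> borel_measurable borel"
    using measurable_comp[OF flow_measurable[OF t] reference_energy_measurable] by (simp add: o_def)
  then show ?thesis by (rule f0_times_integrable[OF _ b])
qed

text \<open>Particle energy in the reference field plus field energy of the deviation. Expanding the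
  square and integrating \<open>E * G\<close> by parts shows that it differs from the total energy
  by a constant depending on the background and on \<open>G\<close> alone.\<close>

definition relative_energy :: "real \<Rightarrow> real" where
  "relative_energy t = integral\<^sup>L phase (\<lambda>z. f0 z * reference_energy (\<Phi> t z)) + integral {0..1} (\<lambda>x. (E x t - G x)\<^sup>2) / 2"

lemma relative_energy_increment:
  assumes st: "0 \<le> s" "s \<le> t" and \<omega>: "\<And>x r. s \<le> r \<Longrightarrow> r \<le> t \<Longrightarrow> \<bar>(E x t + E x s) / 2 - E x r\<bar> \<le> \<omega>"
  shows "\<bar>relative_energy t - relative_energy s\<bar> \<le> (t - s) * (\<omega> * integral\<^sup>L phase (\<lambda>z. f0 z * (\<bar>snd z\<bar> + 2 * t)))"
proof -
  have t: "0 \<le> t" using st by simp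
  define e where "e x = (E x t + E x s) / 2 - G x" for x
  define P where "P = primitive e"
  have ce: "continuous_on UNIV e"
    unfolding e_def by (intro continuous_intros E_continuous_at G st t) auto
  have ep: "e (x + 1) = e x" for x by (simp add: e_def E_periodic G)
  have iE: "(\<lambda>x. E x r) integrable_on {0..1}" if "0 \<le> r" for r
    by (intro integrable_continuous_interval continuous_on_subset[OF E_continuous_at[OF that]]) auto
  have iG: "G integrable_on {0..1}"
    by (intro integrable_continuous_interval continuous_on_subset[OF G(1)]) auto
  have e0: "integral {0..1} e = 0"
    unfolding e_def using iE[OF st(1)] iE[OF t] iG E_mean_zero[OF t] E_mean_zero[OF st(1)] G(3)
    by (subst integral_diff) (auto simp: integral_add integrable_add)
  have P: "(P has_real_derivative e x) (at x)" "P (x + 1) = P x" "continuous_on UNIV P" for x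
    unfolding P_def using has_real_derivative_primitive[OF ce] primitive_periodic[OF ce ep] e0
    by (auto intro!: continuous_at_imp_continuous_on DERIV_isCont)
  have P01: "P 0 = 0" "P 1 = 0" using P(2)[of 0] by (simp_all add: P_def)
  define d where "d x = E x t - E x s" for x
  have cn: "continuous_on UNIV (\<lambda>y. spatial_density y r)" if "0 \<le> r" for r
    using that by (intro continuous_intros) auto
  have d': "(d has_real_derivative spatial_density x s - spatial_density x t) (at x)" for x
  proof -
    have "d = mean_zero_primitive (\<lambda>y. spatial_density y s - spatial_density y t)"
      unfolding d_def using E_diff[OF st(1) t] by auto
    moreover have "(\<dots> has_real_derivative (spatial_density x s - spatial_density x t) -
        integral {0..1} (\<lambda>y. spatial_density y s - spatial_density y t)) (at x)"
      by (rule has_real_derivative_mean_zero_primitive) (intro continuous_intros cn st t)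
    moreover have "integral {0..1} (\<lambda>y. spatial_density y s - spatial_density y t) = 0"
      using st t by (subst integral_diff) (auto simp: mass_density intro!: integrable_continuous_interval continuous_on_subset[OF cn])
    ultimately show ?thesis by simp
  qed
  have cd: "continuous_on UNIV d" unfolding d_def by (intro continuous_intros E_continuous_at st t)
  have "((\<lambda>x. e x * d x + P x * (spatial_density x s - spatial_density x t)) has_integral P 1 * d 1 - P 0 * d 0) {0..1}"
    by (rule fundamental_theorem_of_calculus)
      (auto intro!: derivative_eq_intros DERIV_subset[OF P(1)] DERIV_subset[OF d'] simp: has_real_derivative_iff_has_vector_derivative[symmetric])
  then have "integral {0..1} (\<lambda>x. e x * d x + P x * (spatial_density x s - spatial_density x t)) = 0"
    by (simp add: P01 integral_unique)
  moreover have "integral {0..1} (\<lambda>x. e x * d x + P x * (spatial_density x s - spatial_density x t)) =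
     integral {0..1} (\<lambda>x. e x * d x) + integral {0..1} (\<lambda>x. P x * spatial_density x s - P x * spatial_density x t)"
    unfolding right_diff_distrib
    by (intro integral_add integrable_continuous_interval continuous_intros continuous_on_subset[OF ce]
      continuous_on_subset[OF cd] continuous_on_subset[OF P(3)] continuous_on_subset[OF cn] st t) auto
  moreover have "integral {0..1} (\<lambda>x. P x * spatial_density x s - P x * spatial_density x t) =
     integral {0..1} (\<lambda>x. P x * spatial_density x s) - integral {0..1} (\<lambda>x. P x * spatial_density x t)"
    by (intro integral_diff integrable_continuous_interval continuous_intros continuous_on_subset[OF P(3)]
      continuous_on_subset[OF cn] st t) auto
  \<comment> \<open>Integrals against the spatial densities at the two times are averages over the
    initial particles, evaluated along the flow.\<close>
  ultimately have ed: "integral {0..1} (\<lambda>x. e x * d x) =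
     integral\<^sup>L phase (\<lambda>z. f0 z * P (fst (\<Phi> t z))) - integral\<^sup>L phase (\<lambda>z. f0 z * P (fst (\<Phi> s z)))"
    using phase_integral_density(1)[OF t P(3,2)] phase_integral_density(1)[OF st(1) P(3,2)] by simp
  have "integral {0..1} (\<lambda>x. (E x t - G x)\<^sup>2) - integral {0..1} (\<lambda>x. (E x s - G x)\<^sup>2) =
     integral {0..1} (\<lambda>x. (E x t - G x)\<^sup>2 - (E x s - G x)\<^sup>2)"
    by (intro integral_diff[symmetric] integrable_continuous_interval continuous_intros
      continuous_on_subset[OF E_continuous_at] continuous_on_subset[OF G(1)] st t) auto
  also have "\<dots> = integral {0..1} (\<lambda>x. 2 * (e x * d x))"
    by (intro Henstock_Kurzweil_Integration.integral_cong) (simp add: e_def d_def power2_eq_square field_simps)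
  also have "\<dots> = 2 * integral {0..1} (\<lambda>x. e x * d x)" by simp
  finally have pot: "integral {0..1} (\<lambda>x. (E x t - G x)\<^sup>2) / 2 - integral {0..1} (\<lambda>x. (E x s - G x)\<^sup>2) / 2 =
     integral\<^sup>L phase (\<lambda>z. f0 z * P (fst (\<Phi> t z))) - integral\<^sup>L phase (\<lambda>z. f0 z * P (fst (\<Phi> s z)))"
    using ed by simp
  let ?R = "\<lambda>r z. reference_energy (\<Phi> r z) + P (fst (\<Phi> r z))"
  have iR: "integrable phase (\<lambda>z. f0 z * ?R r z)" if "0 \<le> r" for r
    unfolding distrib_left by (intro Bochner_Integration.integrable_add energy_integrable phase_integral_density(2) P that)
  have "relative_energy t - relative_energy s = integral\<^sup>L phase (\<lambda>z. f0 z * ?R t z) - integral\<^sup>L phase (\<lambda>z. f0 z * ?R s z)"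
    using pot energy_integrable[OF t] energy_integrable[OF st(1)] phase_integral_density(2)[OF t P(3,2)]
      phase_integral_density(2)[OF st(1) P(3,2)]
    by (simp add: relative_energy_def distrib_left)
  also have "\<dots> = integral\<^sup>L phase (\<lambda>z. f0 z * ?R t z - f0 z * ?R s z)"
    by (intro Bochner_Integration.integral_diff[symmetric] iR st t)
  finally have eq: "relative_energy t - relative_energy s = integral\<^sup>L phase (\<lambda>z. f0 z * ?R t z - f0 z * ?R s z)" .
  have R: "\<bar>?R t z - ?R s z\<bar> \<le> (\<bar>snd z\<bar> + 2 * t) * \<omega> * (t - s)" for z
  proof -
    let ?X = "\<lambda>r. fst (\<Phi> r z)" and ?V = "\<lambda>r. snd (\<Phi> r z)"
    have "norm (?R t z - ?R s z) \<le> ((\<bar>snd z\<bar> + 2 * t) * \<omega>) * norm (t - s)"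
    proof (rule field_differentiable_bound[of "{s..t}" _ "\<lambda>r. ?V r * ((E (?X r) t + E (?X r) s) / 2 - E (?X r) r)"])
      fix r assume r: "r \<in> {s..t}"
      then have r0: "0 \<le> r" using st by auto
      have X: "(?X has_real_derivative ?V r) (at r within {s..t})" and V: "(?V has_real_derivative - E (?X r) r) (at r within {s..t})"
        using flow_fst[OF r0, of z] flow_snd[OF r0, of z] st by (auto intro: DERIV_subset)
      show "((\<lambda>r. ?R r z) has_real_derivative ?V r * ((E (?X r) t + E (?X r) s) / 2 - E (?X r) r)) (at r within {s..t})"
        unfolding reference_energy_def
        by (auto intro!: derivative_eq_intros X V DERIV_chain2[OF primitive_G(1) X] DERIV_chain2[OF P(1) X] simp: e_def field_simps)
      have "\<bar>?V r\<bar> \<le> \<bar>snd z\<bar> + 2 * t" using abs_snd_flow_le[OF r0, of z] r by auto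
      then show "norm (?V r * ((E (?X r) t + E (?X r) s) / 2 - E (?X r) r)) \<le> (\<bar>snd z\<bar> + 2 * t) * \<omega>"
        unfolding real_norm_def abs_mult using \<omega>[of r "?X r"] r t by (intro mult_mono) auto
    qed (use st in auto)
    then show ?thesis using st by simp
  qed
  have i1: "integrable phase (\<lambda>z. f0 z * (\<bar>snd z\<bar> + 2 * t))"
  proof (rule f0_times_integrable)
    show "\<bar>\<bar>snd z\<bar> + 2 * t\<bar> \<le> (1 + 2 * t) * (1 + (snd z)\<^sup>2)" for z :: "real \<times> real"
    proof -
      have "\<bar>snd z\<bar> \<le> 1 + (snd z)\<^sup>2"
        using zero_le_power2[of "\<bar>snd z\<bar> - 1"] by (simp add: power2_eq_square algebra_simps)
      moreover have "0 \<le> t * (2 * (snd z)\<^sup>2)" using t by simp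
      moreover have "(1 + 2 * t) * (1 + (snd z)\<^sup>2) = 1 + (snd z)\<^sup>2 + 2 * t + t * (2 * (snd z)\<^sup>2)"
        by (simp add: algebra_simps)
      ultimately show ?thesis using t by linarith
    qed
  qed (intro borel_measurable_continuous_onI continuous_intros)
  have "\<bar>relative_energy t - relative_energy s\<bar> \<le> integral\<^sup>L phase (\<lambda>z. \<bar>f0 z * ?R t z - f0 z * ?R s z\<bar>)"
    unfolding eq by (rule integral_abs_bound)
  also have "\<dots> \<le> integral\<^sup>L phase (\<lambda>z. ((t - s) * \<omega>) * (f0 z * (\<bar>snd z\<bar> + 2 * t)))"
  proof (rule integral_mono)
    show "integrable phase (\<lambda>z. \<bar>f0 z * ?R t z - f0 z * ?R s z\<bar>)"
      by (intro Bochner_Integration.integrable_abs Bochner_Integration.integrable_diff iR st t)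
    show "integrable phase (\<lambda>z. ((t - s) * \<omega>) * (f0 z * (\<bar>snd z\<bar> + 2 * t)))"
      by (intro integrable_mult_right i1)
    fix z
    have "\<bar>f0 z * ?R t z - f0 z * ?R s z\<bar> = f0 z * \<bar>?R t z - ?R s z\<bar>"
      unfolding right_diff_distrib[symmetric] using f0_nonneg[of z] by (simp only: abs_mult abs_of_nonneg)
    also have "\<dots> \<le> f0 z * ((\<bar>snd z\<bar> + 2 * t) * \<omega> * (t - s))"
      by (intro mult_left_mono R f0_nonneg)
    finally show "\<bar>f0 z * ?R t z - f0 z * ?R s z\<bar> \<le> ((t - s) * \<omega>) * (f0 z * (\<bar>snd z\<bar> + 2 * t))"
      by (simp add: mult_ac)
  qed
  finally show ?thesis using i1 by (simp add: mult.assoc)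
qed

text \<open>The error per unit of time is the modulus of continuity of the field in time, uniform in
  \<open>x\<close> by periodicity, times a finite first velocity moment of the initial data.\<close>

lemma relative_energy_conserved:
  assumes T: "0 \<le> T"
  shows "relative_energy T = relative_energy 0"
proof (rule constant_if_small_increments[OF T])
  fix \<epsilon> :: real assume \<epsilon>: "0 < \<epsilon>"
  define I where "I = integral\<^sup>L phase (\<lambda>z. f0 z * (\<bar>snd z\<bar> + 2 * T))"
  have I0: "0 \<le> I" unfolding I_def using T f0_nonneg by (intro integral_nonneg_AE AE_I2) auto
  have ii: "integrable phase (\<lambda>z. f0 z * (\<bar>snd z\<bar> + 2 * t))" for t
  proof (rule f0_times_integrable)
    show "\<bar>\<bar>snd z\<bar> + 2 * t\<bar> \<le> (1 + 2 * \<bar>t\<bar>) * (1 + (snd z)\<^sup>2)" for z :: "real \<times> real"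
    proof -
      have "\<bar>snd z\<bar> \<le> 1 + (snd z)\<^sup>2"
        using zero_le_power2[of "\<bar>snd z\<bar> - 1"] by (simp add: power2_eq_square algebra_simps)
      moreover have "\<bar>\<bar>snd z\<bar> + 2 * t\<bar> \<le> \<bar>snd z\<bar> + 2 * \<bar>t\<bar> * 1" by linarith
      moreover have "2 * \<bar>t\<bar> * 1 \<le> 2 * \<bar>t\<bar> * (1 + (snd z)\<^sup>2)" by (intro mult_left_mono) auto
      ultimately show ?thesis by (simp add: distrib_right)
    qed
  qed (intro borel_measurable_continuous_onI continuous_intros)
  from E_uniformly_continuous[of "\<epsilon> / (I + 1)" T] \<epsilon> I0
  obtain d where d: "0 < d" "\<And>x s t. 0 \<le> s \<Longrightarrow> s \<le> T \<Longrightarrow> 0 \<le> t \<Longrightarrow> t \<le> T \<Longrightarrow> \<bar>t - s\<bar> < d \<Longrightarrow> \<bar>E x t - E x s\<bar> < \<epsilon> / (I + 1)"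
    by (metis add_nonneg_pos divide_pos_pos zero_less_one)
  have "\<bar>relative_energy t - relative_energy s\<bar> \<le> \<epsilon> * (t - s)" if st: "0 \<le> s" "s \<le> t" "t \<le> T" "t - s < d" for s t
  proof -
    have "\<bar>relative_energy t - relative_energy s\<bar> \<le> (t - s) * (\<epsilon> / (I + 1) * integral\<^sup>L phase (\<lambda>z. f0 z * (\<bar>snd z\<bar> + 2 * t)))"
    proof (rule relative_energy_increment[OF st(1,2)])
      fix x r assume r: "s \<le> r" "r \<le> t"
      have "\<bar>E x t - E x r\<bar> < \<epsilon> / (I + 1)" "\<bar>E x s - E x r\<bar> < \<epsilon> / (I + 1)"
        using r st by (intro d(2); simp)+
      moreover have "\<bar>(a + b) / 2 - r\<bar> \<le> k" if "\<bar>a - r\<bar> < k" "\<bar>b - r\<bar> < k" for a b r k :: real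
        using that by (auto simp: abs_le_iff abs_less_iff field_simps)
      ultimately show "\<bar>(E x t + E x s) / 2 - E x r\<bar> \<le> \<epsilon> / (I + 1)" by blast
    qed
    also have "\<dots> \<le> (t - s) * (\<epsilon> / (I + 1) * I)"
      unfolding I_def[symmetric] using st \<epsilon> I0
      by (intro mult_left_mono) (auto simp: I_def intro!: integral_mono ii mult_left_mono f0_nonneg)
    also have "\<dots> \<le> (t - s) * \<epsilon>"
      using st \<epsilon> I0 by (intro mult_left_mono) (auto simp: field_simps)
    finally show ?thesis by (simp add: mult.commute)
  qed
  then show "\<exists>d>0. \<forall>s t. 0 \<le> s \<longrightarrow> s \<le> t \<longrightarrow> t \<le> T \<longrightarrow> t - s < d \<longrightarrow> \<bar>relative_energy t - relative_energy s\<bar> \<le> \<epsilon> * (t - s)"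
    using d(1) by blast
qed

end

end

section \<open>Decreasing energy profiles\<close>

locale decreasing_profile =
  fixes \<phi> \<phi>' :: "real \<Rightarrow> real" and Emax :: real
  assumes profile_deriv: "(\<phi> has_real_derivative \<phi>' x) (at x)"
    and profile_deriv_neg: "x < Emax \<Longrightarrow> \<phi>' x < 0"
    and profile_zero: "Emax \<le> x \<Longrightarrow> \<phi> x = 0"
    and profile_deriv_continuous: "continuous_on UNIV \<phi>'"
begin

lemma profile_continuous: "continuous_on UNIV \<phi>"
  using profile_deriv by (intro continuous_at_imp_continuous_on) (auto intro: DERIV_isCont)

lemma profile_strict_antimono:
  assumes "x < y" "x < Emax"
  shows "\<phi> y < \<phi> x"
proof -
  have *: "\<phi> b < \<phi> a" if "a < b" "b \<le> Emax" for a b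
  proof (rule DERIV_neg_imp_decreasing_open[OF that(1)])
    show "\<exists>y. DERIV \<phi> x :> y \<and> y < 0" if "a < x" "x < b" for x
      using profile_deriv[of x] profile_deriv_neg[of x] \<open>b \<le> Emax\<close> that by auto
  qed (rule continuous_on_subset[OF profile_continuous], simp)
  show ?thesis
  proof (cases "y \<le> Emax")
    case True then show ?thesis using * assms by blast
  next
    case False
    then show ?thesis using *[OF assms(2)] profile_zero[of y] profile_zero[of Emax] by simp
  qed
qed

lemma profile_antimono: "x \<le> y \<Longrightarrow> \<phi> y \<le> \<phi> x"
  using profile_strict_antimono[of x y] profile_zero[of x] profile_zero[of y]
  by (cases "x = y"; cases "x < Emax") (auto simp: less_imp_le)

lemma profile_nonneg: "0 \<le> \<phi> x"
  using profile_antimono[of x "max x Emax"] profile_zero[of "max x Emax"] by simp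

lemma profile_pos: "x < Emax \<Longrightarrow> 0 < \<phi> x"
  using profile_strict_antimono[of x Emax] profile_zero[of Emax] by simp

lemma profile_deriv_zero: "Emax < x \<Longrightarrow> \<phi>' x = 0"
proof -
  assume x: "Emax < x"
  have "((\<lambda>x. 0) has_real_derivative \<phi>' x) (at x)"
    by (rule has_field_derivative_transform_within_open[OF profile_deriv, of "{Emax<..}"]) (use x profile_zero in auto)
  then show ?thesis using DERIV_unique[OF _ DERIV_const] by blast
qed

text \<open>The derivative vanishes beyond \<open>Emax\<close> and is bounded on compact intervals,
  but it may grow towards minus infinity; hence a constant for each lower bound \<open>lo\<close> on
  the energy.\<close>

lemma profile_lipschitz:
  obtains L where "1 \<le> L" "\<And>x y. lo \<le> x \<Longrightarrow> lo \<le> y \<Longrightarrow> \<bar>\<phi> x - \<phi> y\<bar> \<le> L * \<bar>x - y\<bar>"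
proof -
  have "compact (\<phi>' ` {lo..Emax})"
    by (intro compact_continuous_image continuous_on_subset[OF profile_deriv_continuous]) auto
  then obtain K where K: "\<And>x. x \<in> {lo..Emax} \<Longrightarrow> \<bar>\<phi>' x\<bar> \<le> K"
    by (fastforce dest!: compact_imp_bounded simp: bounded_iff)
  have K': "\<bar>\<phi>' x\<bar> \<le> max 1 K" if "lo \<le> x" for x
    using K[of x] profile_deriv_zero[of x] that by (cases "x \<le> Emax") auto
  have "\<bar>\<phi> x - \<phi> y\<bar> \<le> max 1 K * \<bar>x - y\<bar>" if "lo \<le> x" "lo \<le> y" for x y
    using field_differentiable_bound[of "{lo..}" \<phi> \<phi>' "max 1 K" x y] K' that
    by (auto intro: DERIV_subset[OF profile_deriv])
  then show ?thesis by (intro that[of "max 1 K"]) auto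
qed

text \<open>The integral of the profile over all energies above \<open>h\<close>. It is convex
  because its derivative \<open>- \<phi>\<close> is increasing, and it is the function whose
  Legendre transform gives the Casimir density.\<close>

definition tail :: "real \<Rightarrow> real" where
  "tail h = primitive \<phi> Emax - primitive \<phi> h"

lemma tail_deriv: "(tail has_real_derivative - \<phi> x) (at x)"
  unfolding tail_def[abs_def] by (auto intro!: derivative_eq_intros has_real_derivative_primitive profile_continuous)

lemma tail_continuous: "continuous_on UNIV tail"
  using tail_deriv by (intro continuous_at_imp_continuous_on) (auto intro: DERIV_isCont)

lemma tail_zero: "Emax \<le> h \<Longrightarrow> tail h = 0"
proof -
  assume h: "Emax \<le> h"
  have "primitive \<phi> h - primitive \<phi> Emax = integral {Emax..h} \<phi>"
    by (rule primitive_diff_eq_integral(1)[OF profile_continuous h])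
  also have "\<dots> = integral {Emax..h} (\<lambda>_. 0)"
    by (intro Henstock_Kurzweil_Integration.integral_cong) (simp add: profile_zero)
  finally show ?thesis by (simp add: tail_def)
qed

lemma tail_nonneg: "0 \<le> tail h"
proof (cases "h \<le> Emax")
  case True
  have "tail Emax \<le> tail h"
    by (rule DERIV_nonpos_imp_nonincreasing[OF True]) (use tail_deriv profile_nonneg in force)
  then show ?thesis by (simp add: tail_zero)
qed (simp add: tail_zero)

lemma tail_le: "tail h - tail y \<le> (y - h) * \<phi> h"
proof -
  let ?G = "\<lambda>y. tail h - tail y - (y - h) * \<phi> h"
  have d: "(?G has_real_derivative \<phi> y - \<phi> h) (at y)" for y
    by (auto intro!: derivative_eq_intros tail_deriv)
  have "?G y \<le> ?G h"
  proof (cases "h \<le> y")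
    case True
    show ?thesis
      by (rule DERIV_nonpos_imp_nonincreasing[OF True]) (use d profile_antimono in \<open>force simp: intro!: exI\<close>)
  next
    case False
    then have "y \<le> h" by simp
    then show ?thesis
      by (rule DERIV_nonneg_imp_nondecreasing) (use d profile_antimono in \<open>force simp: intro!: exI\<close>)
  qed
  then show ?thesis by simp
qed

text \<open>A function with Lipschitz derivative lies below a parabola touching it at
  \<open>h\<close>. The dual statement, quadratic growth of the Legendre transform away from the
  minimiser, is what stability needs.\<close>

lemma tail_ge:
  assumes L: "\<And>x y. lo \<le> x \<Longrightarrow> lo \<le> y \<Longrightarrow> \<bar>\<phi> x - \<phi> y\<bar> \<le> L * \<bar>x - y\<bar>" and lo: "lo \<le> h" "lo \<le> y"
  shows "(y - h) * \<phi> h - L * (y - h)\<^sup>2 / 2 \<le> tail h - tail y"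
proof -
  let ?G = "\<lambda>y. tail h - tail y - (y - h) * \<phi> h + L * (y - h)\<^sup>2 / 2"
  have d: "(?G has_real_derivative \<phi> y - \<phi> h + L * (y - h)) (at y)" for y
    by (auto intro!: derivative_eq_intros tail_deriv)
  have "?G h \<le> ?G y"
  proof (cases "h \<le> y")
    case True
    show ?thesis
    proof (rule DERIV_nonneg_imp_nondecreasing[OF True])
      fix x assume x: "h \<le> x" "x \<le> y"
      then have "0 \<le> \<phi> x - \<phi> h + L * (x - h)" using L[of x h] lo by (simp add: abs_le_iff)
      then show "\<exists>D. (?G has_real_derivative D) (at x) \<and> 0 \<le> D" using d by blast
    qed
  next
    case False
    then have "y \<le> h" by simp
    then show ?thesis
    proof (rule DERIV_nonpos_imp_nonincreasing)
      fix x assume x: "y \<le> x" "x \<le> h"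
      then have "\<phi> x - \<phi> h + L * (x - h) \<le> 0" using L[of x h] lo by (simp add: abs_le_iff algebra_simps)
      then show "\<exists>D. (?G has_real_derivative D) (at x) \<and> D \<le> 0" using d by blast
    qed
  qed
  then show ?thesis by simp
qed

text \<open>The Casimir density is the Legendre transform for which \<open>\<phi> h\<close> is the minimiser of
  \<open>casimir lo s + h * s\<close>; the supremum is restricted to \<open>[lo, Emax]\<close> to make it Lipschitz.\<close>

definition casimir :: "real \<Rightarrow> real \<Rightarrow> real" where
  "casimir lo s = (SUP y\<in>{lo..Emax}. - y * s - tail y)"

lemma casimir_bdd: "bdd_above ((\<lambda>y. - y * s - tail y) ` {lo..Emax})"
proof -
  have "compact ((\<lambda>y. - y * s - tail y) ` {lo..Emax})"
    by (intro compact_continuous_image continuous_intros continuous_on_subset[OF tail_continuous]) auto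
  then show ?thesis by (intro bounded_imp_bdd_above compact_imp_bounded)
qed

lemma casimir_ge: "lo \<le> y \<Longrightarrow> y \<le> Emax \<Longrightarrow> - y * s - tail y \<le> casimir lo s"
  unfolding casimir_def by (intro cSUP_upper casimir_bdd) auto

lemma casimir_le:
  assumes "lo \<le> Emax" "\<And>y. lo \<le> y \<Longrightarrow> y \<le> Emax \<Longrightarrow> - y * s - tail y \<le> c"
  shows "casimir lo s \<le> c"
  unfolding casimir_def using assms by (intro cSUP_least) auto

lemma casimir_lipschitz:
  assumes lo: "lo \<le> Emax"
  shows "\<bar>casimir lo s - casimir lo s'\<bar> \<le> max \<bar>lo\<bar> \<bar>Emax\<bar> * \<bar>s - s'\<bar>"
proof -
  let ?M = "max \<bar>lo\<bar> \<bar>Emax\<bar>"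
  have *: "casimir lo s \<le> casimir lo s' + ?M * \<bar>s - s'\<bar>" for s s'
  proof (rule casimir_le[OF lo])
    fix y assume y: "lo \<le> y" "y \<le> Emax"
    have "- y * (s - s') \<le> \<bar>y\<bar> * \<bar>s - s'\<bar>" by (simp add: abs_mult[symmetric])
    also have "\<dots> \<le> ?M * \<bar>s - s'\<bar>" using y by (intro mult_right_mono) auto
    finally show "- y * s - tail y \<le> casimir lo s' + ?M * \<bar>s - s'\<bar>"
      using casimir_ge[OF y, of s'] by (simp add: algebra_simps)
  qed
  show ?thesis using *[of s s'] *[of s' s] by (simp add: abs_le_iff abs_minus_commute)
qed

lemma casimir_0: "lo \<le> Emax \<Longrightarrow> casimir lo 0 = 0"
  using casimir_ge[of lo Emax 0] casimir_le[of lo 0 0] tail_nonneg tail_zero[of Emax] by (intro antisym) auto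

text \<open>The gap in the Fenchel-Young inequality between a value \<open>s\<close> and an energy
  \<open>h\<close>. Its phase-space integral is the energy-Casimir functional, up to terms that are
  the same for all times.\<close>

definition excess :: "real \<Rightarrow> real \<Rightarrow> real \<Rightarrow> real" where
  "excess lo h s = casimir lo s + h * s + tail h"

lemma excess_profile_le:
  assumes "lo \<le> Emax"
  shows "excess lo h (\<phi> h) \<le> 0"
proof (cases "h \<le> Emax")
  case True
  have "casimir lo (\<phi> h) \<le> - h * \<phi> h - tail h"
    using assms by (rule casimir_le) (use tail_le[of h] in \<open>simp add: algebra_simps\<close>)
  then show ?thesis by (simp add: excess_def)
next
  case False
  then show ?thesis using casimir_0[OF assms] by (simp add: excess_def profile_zero tail_zero)
qed

context
  fixes lo L h s C :: real
  assumes L: "1 \<le> L" "\<And>x y. lo \<le> x \<Longrightarrow> lo \<le> y \<Longrightarrow> \<bar>\<phi> x - \<phi> y\<bar> \<le> L * \<bar>x - y\<bar>"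
    and h: "lo + C \<le> h" "lo + C \<le> Emax" and s: "0 \<le> s" "s \<le> C"
begin

lemma div_L_le: "s / L \<le> C"
proof -
  have "s / L \<le> s / 1" using s L(1) by (intro divide_left_mono) auto
  then show ?thesis using s by simp
qed

text \<open>Above \<open>Emax\<close> the gap grows linearly in the energy. This linear term is the
  source of the factor \<open>1 + (snd z)\<^sup>2\<close> in the stability estimate at large
  velocities.\<close>

lemma excess_ge_beyond:
  assumes "Emax \<le> h"
  shows "(h - Emax) * s + s\<^sup>2 / (2 * L) \<le> excess lo h s"
proof -
  \<comment> \<open>The maximiser of \<open>- y * s - L * (y - Emax)\<^sup>2 / 2\<close>. It stays
    above \<open>lo\<close> because \<open>s / L\<close> is at most \<open>C\<close>, the margin
    required of \<open>lo\<close>.\<close>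
  define y where "y = Emax - s / L"
  have y: "lo \<le> y" "y \<le> Emax" using div_L_le h s L by (auto simp: y_def)
  have lo: "lo \<le> Emax" using h s by simp
  have "tail y \<le> L * (y - Emax)\<^sup>2 / 2"
    using tail_ge[of lo L, OF L(2) lo y(1)] by (simp add: profile_zero tail_zero)
  also have "L * (y - Emax)\<^sup>2 / 2 = s\<^sup>2 / (2 * L)"
    using L(1) by (simp add: y_def power2_eq_square field_simps)
  finally have "tail y \<le> s\<^sup>2 / (2 * L)" .
  moreover have "- y * s = - Emax * s + 2 * (s\<^sup>2 / (2 * L))"
    by (simp add: y_def power2_eq_square algebra_simps)
  ultimately show ?thesis
    using casimir_ge[OF y, of s] tail_zero[OF assms] by (simp add: excess_def algebra_simps)
qed

lemma excess_ge_square: "(s - \<phi> h)\<^sup>2 / (2 * L) \<le> excess lo h s"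
proof (cases "h \<le> Emax")
  case True
  have lo: "lo \<le> Emax" "lo \<le> h" using h s by auto
  define k where "k = \<phi> h - s"
  \<comment> \<open>The maximiser of \<open>(y - h) * k - L * (y - h)\<^sup>2 / 2\<close>, the lower
    bound that \<open>tail_ge\<close> gives for the excess.\<close>
  define y where "y = h + k / L"
  have "\<phi> h \<le> L * (Emax - h)"
    using L(2)[of h Emax] lo True profile_zero[of Emax] profile_nonneg[of h] by simp
  then have "k / L \<le> Emax - h" using s L(1) by (simp add: k_def field_simps)
  moreover have "- (s / L) \<le> k / L" using profile_nonneg[of h] L(1) by (simp add: k_def field_simps)
  ultimately have y: "lo \<le> y" "y \<le> Emax" using div_L_le h by (auto simp: y_def)
  have "(y - h) * \<phi> h - L * (y - h)\<^sup>2 / 2 \<le> tail h - tail y"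
    by (rule tail_ge[of lo L, OF L(2) lo(2) y(1)])
  then have "(y - h) * k - L * (y - h)\<^sup>2 / 2 \<le> excess lo h s"
    using casimir_ge[OF y, of s] by (simp add: excess_def k_def algebra_simps)
  moreover have "(y - h) * k - L * (y - h)\<^sup>2 / 2 = k\<^sup>2 / (2 * L)"
    using L(1) by (simp add: y_def power2_eq_square field_simps)
  ultimately show ?thesis by (simp add: k_def power2_commute)
next
  case False
  then have "0 \<le> (h - Emax) * s" using s by simp
  then show ?thesis using excess_ge_beyond False by (simp add: profile_zero)
qed

end

end

section \<open>Nonlinear stability of the steady state\<close>

lemma phase_strip:
  assumes "0 \<le> a"
  shows "integrable phase (\<lambda>z. indicator {-a..a} (snd z) :: real)"
    and "integral\<^sup>L phase (\<lambda>z. indicator {-a..a} (snd z) :: real) = 2 * a"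
proof -
  have m: "(\<lambda>z :: real \<times> real. indicator {-a..a} (snd z) :: real) \<in> borel_measurable borel"
  proof -
    have "(indicator (UNIV \<times> {-a..a}) :: real \<times> real \<Rightarrow> real) \<in> borel_measurable borel"
      by (intro borel_measurable_indicator borel_closed closed_Times) auto
    moreover have "indicator (UNIV \<times> {-a..a}) = (\<lambda>z :: real \<times> real. indicator {-a..a} (snd z) :: real)"
      by (auto simp: indicator_def fun_eq_iff)
    ultimately show ?thesis by simp
  qed
  show i: "integrable phase (\<lambda>z. indicator {-a..a} (snd z) :: real)"
  proof (rule integrable_phaseI[OF m])
    show "set_integrable lborel {0..1} (\<lambda>x::real. LBINT v. indicator {-a..a} (snd (x, v)) :: real)"
      by (intro borel_integrable_atLeastAtMost') auto
    show "integrable lborel (\<lambda>v. indicator {-a..a} (snd (x, v)) :: real)" for x :: real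
      by (simp add: integrable_real_indicator emeasure_lborel_Icc_eq)
  qed (auto simp: indicator_def)
  show "integral\<^sup>L phase (\<lambda>z. indicator {-a..a} (snd z) :: real) = 2 * a"
    unfolding integral_phase[OF i] using assms by (simp add: set_lebesgue_integral_def)
qed

text \<open>The common background cancels and the kernel is bounded by one, so the L1 distance of
  the phase-space densities controls the fields uniformly in \<open>x\<close>.\<close>

lemma vp_field_diff_le:
  assumes "vp_solution \<rho> f fx fv ft" "vp_solution \<rho> g gx gv gt" and t: "0 \<le> t" "0 \<le> s"
  shows "\<bar>electric_field \<rho> (\<lambda>y v. f y v t) x - electric_field \<rho> (\<lambda>y v. g y v s) x\<bar>
    \<le> integral\<^sup>L phase (\<lambda>z. \<bar>f (fst z) (snd z) t - g (fst z) (snd z) s\<bar>)"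
proof -
  interpret f: vp_solution \<rho> f fx fv ft by fact
  interpret g: vp_solution \<rho> g gx gv gt by fact
  note si = f.density_set_integrable[OF t(1)] g.density_set_integrable[OF t(2)]
  have eq: "electric_field \<rho> (\<lambda>y v. f y v t) x - electric_field \<rho> (\<lambda>y v. g y v s) x =
      kernel_transform (\<lambda>y. (\<rho> y - f.spatial_density y t) - (\<rho> y - g.spatial_density y s)) x"
    unfolding f.E_eq_kernel_transform g.E_eq_kernel_transform
    by (rule kernel_transform_diff[symmetric]) (use f.charge_set_integrable g.charge_set_integrable t in auto)
  have "\<bar>electric_field \<rho> (\<lambda>y v. f y v t) x - electric_field \<rho> (\<lambda>y v. g y v s) x\<bar>
      \<le> (LBINT y:{0..1}. \<bar>(\<rho> y - f.spatial_density y t) - (\<rho> y - g.spatial_density y s)\<bar>)"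
    unfolding eq by (intro abs_kernel_transform_le set_integral_diff f.charge_set_integrable g.charge_set_integrable t)
  also have "\<dots> = (LBINT y:{0..1}. \<bar>f.spatial_density y t - g.spatial_density y s\<bar>)"
  proof -
    have "\<bar>(\<rho> y - a) - (\<rho> y - b)\<bar> = \<bar>a - b\<bar>" for y a b by linarith
    then show ?thesis by presburger
  qed
  also have "\<dots> \<le> (LBINT y:{0..1}. LBINT v. \<bar>f y v t - g y v s\<bar>)"
  proof (rule set_integral_mono)
    show "set_integrable lborel {0..1} (\<lambda>y. \<bar>f.spatial_density y t - g.spatial_density y s\<bar>)"
      by (intro set_integrable_abs set_integral_diff si)
    have i: "integrable (torus \<Otimes>\<^sub>M lborel) (\<lambda>z. \<bar>f (fst z) (snd z) t - g (fst z) (snd z) s\<bar>)"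
      unfolding phase_def[symmetric]
      by (intro Bochner_Integration.integrable_abs Bochner_Integration.integrable_diff f.f_phase_integrable g.f_phase_integrable t)
    have i1: "integrable torus (\<lambda>y. LBINT v. \<bar>f y v t - g y v s\<bar>)"
      using phase.integrable_fst'[OF i] by simp
    then have "(\<lambda>y. LBINT v. \<bar>f y v t - g y v s\<bar>) \<in> borel_measurable borel"
      using borel_measurable_integrable measurable_cong_sets[OF sets_torus refl] by blast
    with i1 show "set_integrable lborel {0..1} (\<lambda>y. LBINT v. \<bar>f y v t - g y v s\<bar>)"
      by (simp add: integrable_torus)
    show "\<bar>f.spatial_density y t - g.spatial_density y s\<bar> \<le> (LBINT v. \<bar>f y v t - g y v s\<bar>)" for y
      unfolding f.spatial_density_def g.spatial_density_def
      using f.f_integrable[OF t(1)] g.f_integrable[OF t(2)] integral_abs_bound[of lborel "\<lambda>v. f y v t - g y v s"] by simp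
  qed
  also have "\<dots> = integral\<^sup>L phase (\<lambda>z. \<bar>f (fst z) (snd z) t - g (fst z) (snd z) s\<bar>)"
    by (subst integral_phase) (auto intro!: Bochner_Integration.integrable_abs Bochner_Integration.integrable_diff
        f.f_phase_integrable g.f_phase_integrable t)
  finally show ?thesis .
qed

locale vp_steady = vp_solution \<rho> "\<lambda>x v t. fs x v" sx sv st
  for \<rho> and fs :: "real \<Rightarrow> real \<Rightarrow> real" and sx sv st +
  fixes \<phi> :: "real \<Rightarrow> real" and Emax v0 :: real
  assumes profile: "fs x v = \<phi> (v\<^sup>2 / 2 + potential \<rho> fs x)"
    and profile_C1: "\<phi> C1_differentiable_on UNIV"
    and profile_support: "closure {e. \<phi> e \<noteq> 0} \<subseteq> {..Emax}"
    and profile_decreasing: "e < Emax \<Longrightarrow> deriv \<phi> e < 0"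
    and v0: "0 < v0"
    and velocity_support: "closure {(x, v). fs x v \<noteq> 0} \<subseteq> UNIV \<times> {-v0..v0}"

sublocale vp_steady \<subseteq> decreasing_profile \<phi> "deriv \<phi>" Emax
proof
  from profile_C1 obtain d where d: "\<And>x. (\<phi> has_vector_derivative d x) (at x)" "continuous_on UNIV d"
    unfolding C1_differentiable_on_def by auto
  then have d': "(\<phi> has_real_derivative d x) (at x)" for x
    by (simp add: has_real_derivative_iff_has_vector_derivative)
  then have "deriv \<phi> = d" using DERIV_imp_deriv by blast
  then show "(\<phi> has_real_derivative deriv \<phi> x) (at x)" "continuous_on UNIV (deriv \<phi>)" for x
    using d d' by auto
  have c: "continuous_on UNIV \<phi>"
    using d' by (intro continuous_at_imp_continuous_on) (auto intro: DERIV_isCont)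
  have z: "\<phi> x = 0" if "x \<in> {Emax<..}" for x
    using profile_support closure_subset[of "{e. \<phi> e \<noteq> 0}"] that by force
  show "\<phi> x = 0" if "Emax \<le> x" for x
    by (rule continuous_constant_on_closure[where S="{Emax<..}" and f=\<phi>]) (use that z in \<open>auto intro: continuous_on_subset[OF c]\<close>)
qed (rule profile_decreasing)

context vp_steady
begin

abbreviation Es :: "real \<Rightarrow> real" where
  "Es \<equiv> electric_field \<rho> fs"

lemma Es: "continuous_on UNIV Es" "Es (x + 1) = Es x" "integral {0..1} Es = 0" "\<bar>Es x\<bar> \<le> 2"
  using E_continuous_at[of 0] E_periodic[of x] E_mean_zero[of 0] abs_E_le[of 0 x] by simp_all

lemma potential_eq: "potential \<rho> fs x = primitive Es x"
proof -
  have "potential \<rho> fs x = primitive Es (frac x)"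
    unfolding potential_def
    by (subst LBINT_Icc_eq_integral) (auto intro: continuous_on_subset[OF Es(1)] simp: primitive_eq_integral[OF Es(1)])
  also have "\<dots> = primitive Es x"
    using periodic_frac[of "primitive Es" x] primitive_periodic[OF Es(1,2)] Es(3) by simp
  finally show ?thesis .
qed

definition U :: "real \<Rightarrow> real" where "U = primitive Es"

lemma U: "(U has_real_derivative Es x) (at x)" "U (x + 1) = U x" "continuous_on UNIV U" "\<bar>U x\<bar> \<le> 2"
proof -
  show 1: "(U has_real_derivative Es x) (at x)" for x
    unfolding U_def by (rule has_real_derivative_primitive[OF Es(1)])
  then show "continuous_on UNIV U" by (intro continuous_at_imp_continuous_on) (auto intro: DERIV_isCont)
  show p: "U (x + 1) = U x" for x unfolding U_def using primitive_periodic[OF Es(1,2)] Es(3) by simp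
  have "\<bar>primitive Es (frac x)\<bar> \<le> integral {0..1} (\<lambda>y. \<bar>Es y\<bar>)"
    using frac_lt_1[of x] by (intro abs_primitive_le Es) (auto simp: less_imp_le)
  also have "\<dots> \<le> integral {0..1} (\<lambda>y::real. 2)"
    by (intro integral_le) (auto intro!: Es(4) integrable_continuous_interval continuous_intros continuous_on_subset[OF Es(1)])
  finally show "\<bar>U x\<bar> \<le> 2" using periodic_frac[of U x] p by (simp add: U_def)
qed

definition hs :: "real \<times> real \<Rightarrow> real" where
  "hs z = (snd z)\<^sup>2 / 2 + U (fst z)"

lemma hs_continuous [continuous_intros]:
  "continuous_on S x \<Longrightarrow> continuous_on S v \<Longrightarrow> continuous_on S (\<lambda>z. hs (x z, v z))"
  unfolding hs_def by (auto intro!: continuous_intros continuous_on_compose2[OF U(3)])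

lemma hs_measurable [measurable]: "hs \<in> borel_measurable borel"
  using hs_continuous[of UNIV fst snd] by (intro borel_measurable_continuous_onI) (simp add: continuous_intros)

lemma fs_eq: "fs x v = \<phi> (hs (x, v))"
  by (simp add: profile potential_eq hs_def U_def)

lemma hs_ge: "- 2 \<le> hs z"
  using U(4)[of "fst z"] zero_le_power2[of "snd z"] unfolding hs_def abs_le_iff by linarith

lemma abs_hs_le: "\<bar>hs z\<bar> \<le> 2 * (1 + (snd z)\<^sup>2)"
  using U(4)[of "fst z"] zero_le_power2[of "snd z"] unfolding hs_def by argo

lemma fs_zero: "v0 < \<bar>v\<bar> \<Longrightarrow> fs x v = 0"
  using velocity_support closure_subset[of "{(x, v). fs x v \<noteq> 0}"] by force

lemma fs_kinetic: "integrable phase (\<lambda>z. (1 + (snd z)\<^sup>2) * fs (fst z) (snd z))"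
proof (rule Bochner_Integration.integrable_bound[OF integrable_mult_right[OF f_phase_integrable[of 0], of "1 + v0\<^sup>2"]])
  show "(\<lambda>z. (1 + (snd z)\<^sup>2) * fs (fst z) (snd z)) \<in> borel_measurable phase"
    unfolding measurable_phase
    by (intro borel_measurable_times f_measurable[of 0] borel_measurable_continuous_onI continuous_intros) auto
  show "AE z in phase. norm ((1 + (snd z)\<^sup>2) * fs (fst z) (snd z)) \<le> norm ((1 + v0\<^sup>2) * fs (fst z) (snd z))"
  proof (rule AE_I2)
    fix z :: "real \<times> real"
    show "norm ((1 + (snd z)\<^sup>2) * fs (fst z) (snd z)) \<le> norm ((1 + v0\<^sup>2) * fs (fst z) (snd z))"
    proof (cases "v0 < \<bar>snd z\<bar>")
      case False
      then have "(snd z)\<^sup>2 \<le> v0\<^sup>2" using v0 by (simp add: abs_le_square_iff[symmetric])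
      then show ?thesis by (simp add: abs_mult mult_right_mono)
    qed (simp add: fs_zero)
  qed
qed simp

lemma abs_le_eta_square:
  fixes w \<eta> :: real assumes "0 < \<eta>" shows "\<bar>w\<bar> \<le> \<eta> + w\<^sup>2 / (4 * \<eta>)"
proof -
  have "0 \<le> (\<bar>w\<bar> - 2 * \<eta>)\<^sup>2" by simp
  then show ?thesis using assms by (simp add: power2_eq_square field_simps)
qed

text \<open>Energy-Casimir stability: the excess integral plus half the squared field difference is conserved.\<close>

lemma stability:
  assumes C1: "0 < C1" and \<epsilon>: "0 < \<epsilon>"
  obtains \<delta> where "0 < \<delta>"
    "\<And>f fx fv ft \<Phi> D t. vp_flow \<rho> f fx fv ft \<Phi> D \<Longrightarrow> (\<And>x v. f x v 0 \<le> C1) \<Longrightarrow>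
      (\<integral>\<^sup>+x\<in>{0..1}. (\<integral>\<^sup>+v. ennreal ((1 + v\<^sup>2) * \<bar>f x v 0 - fs x v\<bar>) \<partial>lborel) \<partial>lborel) < ennreal \<delta> \<Longrightarrow> 0 \<le> t \<Longrightarrow>
      integrable phase (\<lambda>z. (1 + (snd z)\<^sup>2) * \<bar>f (fst z) (snd z) t - fs (fst z) (snd z)\<bar>) \<and>
      integral\<^sup>L phase (\<lambda>z. (1 + (snd z)\<^sup>2) * \<bar>f (fst z) (snd z) t - fs (fst z) (snd z)\<bar>) \<le> \<epsilon>"
proof -
  \<comment> \<open>Steady energies are at least -2 because the potential is bounded by 2.
    Subtracting \<open>C1\<close> leaves the margin that the lower bounds on \<open>excess\<close>
    ask for when values of \<open>f\<close> go up to \<open>C1\<close>.\<close>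
  define lo where "lo = min (-2) Emax - C1"
  have lo: "lo \<le> Emax" "lo + C1 \<le> Emax" "lo + C1 \<le> hs z" for z
    using C1 hs_ge[of z] by (auto simp: lo_def)
  obtain L where L: "1 \<le> L" "\<And>x y. lo \<le> x \<Longrightarrow> lo \<le> y \<Longrightarrow> \<bar>\<phi> x - \<phi> y\<bar> \<le> L * \<bar>x - y\<bar>"
    using profile_lipschitz[of lo] by blast
  define M where "M = max \<bar>lo\<bar> \<bar>Emax\<bar>"
  have M: "0 \<le> M" by (simp add: M_def)
  \<comment> \<open>Large enough that beyond it the steady energy exceeds \<open>Emax\<close> by at
    least a quarter of the weight.\<close>
  define V1 where "V1 = v0 + 2 * (3 + \<bar>Emax\<bar>)"
  have V1: "v0 \<le> V1" "0 < V1" using v0 by (auto simp: V1_def)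
  have far: "Emax + (1 + v\<^sup>2) / 4 \<le> hs (x, v)" if "V1 < \<bar>v\<bar>" for x v
  proof -
    have "2 * (3 + \<bar>Emax\<bar>) < \<bar>v\<bar>" using that v0 by (simp add: V1_def)
    then have "(2 * (3 + \<bar>Emax\<bar>))\<^sup>2 \<le> \<bar>v\<bar>\<^sup>2" by (intro power_mono) auto
    moreover have "(2 * (3 + \<bar>Emax\<bar>))\<^sup>2 \<ge> 4 * (3 + \<bar>Emax\<bar>)" by (simp add: power2_eq_square algebra_simps)
    ultimately have "4 * (3 + \<bar>Emax\<bar>) \<le> v\<^sup>2" by simp
    then show ?thesis using U(4)[of x] abs_ge_self[of Emax] unfolding hs_def fst_conv snd_conv abs_le_iff by argo
  qed
  define cV where "cV = 1 + V1\<^sup>2"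
  have cV: "1 \<le> cV" by (simp add: cV_def)
  \<comment> \<open>The free constant in Young's inequality. The strip up to \<open>V1\<close> has
    area \<open>2 * V1\<close> and weight at most \<open>cV\<close>, so this part costs
    \<open>\<epsilon> / 2\<close>.\<close>
  define \<eta> where "\<eta> = \<epsilon> / (4 * cV * V1)"
  have \<eta>: "0 < \<eta>" using \<epsilon> cV V1 by (simp add: \<eta>_def)
  \<comment> \<open>The factor 4 inverts the quarter gained at large velocities; the other summand
    comes from Young's inequality at bounded velocities.\<close>
  define K where "K = 4 + cV * L / (2 * \<eta>)"
  have K: "4 \<le> K" using cV L \<eta> by (simp add: K_def)
  \<comment> \<open>The cap at 1 bounds the square of the initial field difference by
    \<open>\<delta>\<close> itself; the other entry makes the excess part at most
    \<open>\<epsilon> / 2\<close>.\<close>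
  define \<delta> where "\<delta> = min 1 (\<epsilon> / (2 * K * (M + 4)))"
  have \<delta>: "0 < \<delta>" "\<delta> \<le> 1" "K * ((M + 4) * \<delta>) \<le> \<epsilon> / 2"
  proof -
    show "0 < \<delta>" "\<delta> \<le> 1" using \<epsilon> K M by (auto simp: \<delta>_def)
    have "K * ((M + 4) * \<delta>) \<le> K * ((M + 4) * (\<epsilon> / (2 * K * (M + 4))))"
      using K M by (intro mult_left_mono) (auto simp: \<delta>_def)
    also have "\<dots> = \<epsilon> / 2"
    proof -
      have "a * (b * (\<epsilon> / (2 * a * b))) = \<epsilon> / 2" if "a \<noteq> 0" "b \<noteq> 0" for a b :: real
        using that by (simp add: field_simps)
      then show ?thesis using K M by simp
    qed
    finally show "K * ((M + 4) * \<delta>) \<le> \<epsilon> / 2" .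
  qed
  show ?thesis
  proof (rule that[OF \<delta>(1)])
    fix f fx fv ft \<Phi> D and t :: real
    assume flow: "vp_flow \<rho> f fx fv ft \<Phi> D" and fC1: "\<And>x v. f x v 0 \<le> C1"
      and close: "(\<integral>\<^sup>+x\<in>{0..1}. (\<integral>\<^sup>+v. ennreal ((1 + v\<^sup>2) * \<bar>f x v 0 - fs x v\<bar>) \<partial>lborel) \<partial>lborel) < ennreal \<delta>"
      and t: "0 \<le> t"
    interpret F: vp_flow \<rho> f fx fv ft \<Phi> D by fact
    let ?w = "\<lambda>t z. (1 + (snd z)\<^sup>2) * \<bar>f (fst z) (snd z) t - fs (fst z) (snd z)\<bar>"
    have c2: "(\<lambda>z :: real \<times> real. 1 + (snd z)\<^sup>2) \<in> borel_measurable borel"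
      by (intro borel_measurable_continuous_onI continuous_intros)
    have wm: "?w r \<in> borel_measurable borel" if "0 \<le> r" for r
      by (intro borel_measurable_times borel_measurable_abs borel_measurable_diff c2 F.f_measurable that f_measurable[of 0]) simp
    have w0: "integrable phase (?w 0)" "integral\<^sup>L phase (?w 0) < \<delta>"
    proof -
      have n: "(\<integral>\<^sup>+z. ennreal (?w 0 z) \<partial>phase) < ennreal \<delta>"
        using wm[of 0] close by (subst nn_integral_phase) auto
      then show i: "integrable phase (?w 0)"
        using wm[of 0] by (intro integrableI_nonneg) (auto simp: measurable_phase intro: less_trans)
      have "ennreal (integral\<^sup>L phase (?w 0)) < ennreal \<delta>"
        using n nn_integral_eq_integral[OF i] by simp
      then show "integral\<^sup>L phase (?w 0) < \<delta>"
        by (simp add: ennreal_less_iff integral_nonneg_AE)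
    qed
    have kin: "integrable phase (\<lambda>z. (1 + (snd z)\<^sup>2) * F.f0 z)"
    proof (rule Bochner_Integration.integrable_bound[OF Bochner_Integration.integrable_add[OF w0(1) fs_kinetic]])
      show "(\<lambda>z. (1 + (snd z)\<^sup>2) * F.f0 z) \<in> borel_measurable phase"
        unfolding measurable_phase by (intro borel_measurable_times c2 F.f0_measurable)
      have "norm ((1 + (snd z)\<^sup>2) * F.f0 z) \<le> norm (?w 0 z + (1 + (snd z)\<^sup>2) * fs (fst z) (snd z))" for z
        unfolding distrib_left[symmetric] F.f0_def using F.f_nonneg[of 0 "fst z" "snd z"] f_nonneg[of 0 "fst z" "snd z"]
        by (auto simp: abs_mult intro!: mult_left_mono)
      then show "AE z in phase. norm ((1 + (snd z)\<^sup>2) * F.f0 z) \<le> norm (?w 0 z + (1 + (snd z)\<^sup>2) * fs (fst z) (snd z))"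
        by simp
    qed
    have Es2: "Es (x + 1) = Es x" for x by (rule Es(2))
    note RE = F.relative_energy_conserved[OF kin Es(1) Es2 Es(3)]
    have re: "F.reference_energy Es = hs"
      unfolding F.reference_energy_def[OF kin Es(1) Es2 Es(3)] hs_def U_def by auto
    have hs_periodic: "hs (x + 1, v) = hs (x, v)" for x v by (simp add: hs_def U(2))
    \<comment> \<open>Every phase-space point is reached by the flow at time \<open>r\<close>, so
      the initial bound persists.\<close>
    have fC: "f x v r \<le> C1" if r: "0 \<le> r" for x v r
    proof -
      obtain z where "\<Phi> r z = (x, v)" using bij_is_surj[OF F.flow_bij[OF r]] by (metis surjD)
      then show ?thesis using F.f_flow[OF r, of z] fC1 by simp
    qed
    have cas_m: "casimir lo \<in> borel_measurable borel"
    proof (rule borel_measurable_continuous_onI)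
      have "M-lipschitz_on UNIV (casimir lo)"
        by (rule lipschitz_onI) (use casimir_lipschitz[OF lo(1)] M in \<open>auto simp: dist_real_def M_def\<close>)
      then show "continuous_on UNIV (casimir lo)" by (rule lipschitz_on_continuous_on)
    qed
    have cas_i: "integrable phase (\<lambda>z. casimir lo (f (fst z) (snd z) r))" if r: "0 \<le> r" for r
    proof (rule Bochner_Integration.integrable_bound[OF integrable_mult_right[OF F.f_phase_integrable[OF r], of M]])
      show "(\<lambda>z. casimir lo (f (fst z) (snd z) r)) \<in> borel_measurable phase"
        unfolding measurable_phase using measurable_comp[OF F.f_measurable[OF r] cas_m] by (simp add: o_def)
      show "AE z in phase. norm (casimir lo (f (fst z) (snd z) r)) \<le> norm (M * f (fst z) (snd z) r)"
        using casimir_lipschitz[OF lo(1), of _ 0] casimir_0[OF lo(1)] M by (simp add: abs_mult M_def)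
    qed
    have h_i: "integrable phase (\<lambda>z. f (fst z) (snd z) r * hs z)"
      and h_eq: "integral\<^sup>L phase (\<lambda>z. f (fst z) (snd z) r * hs z) = integral\<^sup>L phase (\<lambda>z. F.f0 z * hs (\<Phi> r z))" if r: "0 \<le> r" for r
      using F.energy_integrable[OF kin Es(1) Es2 Es(3) r] re
        F.phase_integral_transport[OF r hs_measurable hs_periodic, where c="\<lambda>x. x"] by auto
    have strip_i: "integrable phase (\<lambda>z. tail (-2) * indicator {-V1..V1} (snd z))"
      using phase_strip(1)[of V1] V1 by simp
    have tail_i: "integrable phase (\<lambda>z. tail (hs z))"
    proof (rule Bochner_Integration.integrable_bound[OF strip_i])
      show "(\<lambda>z. tail (hs z)) \<in> borel_measurable phase"
        unfolding measurable_phase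
        using measurable_comp[OF hs_measurable borel_measurable_continuous_onI[OF tail_continuous]] by (simp add: o_def)
      have "norm (tail (hs z)) \<le> norm (tail (-2) * indicator {-V1..V1} (snd z))" for z
      proof (cases "V1 < \<bar>snd z\<bar>")
        case True
        have "0 \<le> (1 + (snd z)\<^sup>2) / 4" by simp
        then have "Emax \<le> hs z" using far[OF True, of "fst z"] unfolding prod.collapse by linarith
        then show ?thesis by (simp add: tail_zero)
      next
        case False
        have "tail (hs z) \<le> tail (-2)"
          by (rule DERIV_nonpos_imp_nonincreasing[OF hs_ge]) (use tail_deriv profile_nonneg in force)
        then show ?thesis using False tail_nonneg by (auto simp: indicator_def abs_le_iff)
      qed
      then show "AE z in phase. norm (tail (hs z)) \<le> norm (tail (-2) * indicator {-V1..V1} (snd z))" by simp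
    qed
    let ?D = "\<lambda>r z. excess lo (hs z) (f (fst z) (snd z) r)"
    have D_i: "integrable phase (?D r)"
      and D_eq: "integral\<^sup>L phase (?D r) = integral\<^sup>L phase (\<lambda>z. casimir lo (F.f0 z)) + integral\<^sup>L phase (\<lambda>z. F.f0 z * hs (\<Phi> r z))
         + integral\<^sup>L phase (\<lambda>z. tail (hs z))" if r: "0 \<le> r" for r
    proof -
      have "integral\<^sup>L phase (\<lambda>z. casimir lo (f (fst z) (snd z) r)) = integral\<^sup>L phase (\<lambda>z. casimir lo (F.f0 z))"
        using F.phase_integral_transport(1)[OF r, of "\<lambda>_. 1" "casimir lo"] cas_m by simp
      then show "integral\<^sup>L phase (?D r) = integral\<^sup>L phase (\<lambda>z. casimir lo (F.f0 z)) + integral\<^sup>L phase (\<lambda>z. F.f0 z * hs (\<Phi> r z))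
         + integral\<^sup>L phase (\<lambda>z. tail (hs z))"
        unfolding excess_def using cas_i[OF r] h_i[OF r] h_eq[OF r] tail_i by (simp add: mult.commute)
      show "integrable phase (?D r)"
        unfolding excess_def using cas_i[OF r] h_i[OF r] tail_i by (simp add: mult.commute)
    qed
    \<comment> \<open>The Casimir and tail integrals are the same at both times, so the change of
      the excess integral is minus the change of the field term. At time \<open>t\<close> that term
      is nonnegative and is dropped.\<close>
    have D_bound: "integral\<^sup>L phase (?D t) \<le> integral\<^sup>L phase (?D 0) + integral {0..1} (\<lambda>x. (F.E x 0 - Es x)\<^sup>2) / 2"
    proof -
      have "0 \<le> integral {0..1} (\<lambda>x. (F.E x t - Es x)\<^sup>2)"
        by (intro integral_nonneg integrable_continuous_interval continuous_intros
            continuous_on_subset[OF F.E_continuous_at[OF t]] continuous_on_subset[OF Es(1)]) auto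
      then show ?thesis
        using RE[OF t] D_eq[OF t] D_eq[of 0] unfolding F.relative_energy_def[OF kin Es(1) Es2 Es(3)] re by simp
    qed
    have D0: "integral\<^sup>L phase (?D 0) \<le> (M + 2) * integral\<^sup>L phase (?w 0)"
    proof -
      have "?D 0 z \<le> (M + 2) * ?w 0 z" for z
      proof -
        let ?d = "f (fst z) (snd z) 0 - fs (fst z) (snd z)"
        have fse: "fs (fst z) (snd z) = \<phi> (hs z)" using fs_eq[of "fst z" "snd z"] by simp
        have "?D 0 z = excess lo (hs z) (fs (fst z) (snd z)) + (casimir lo (f (fst z) (snd z) 0) - casimir lo (fs (fst z) (snd z))) + hs z * ?d"
          by (simp add: excess_def algebra_simps)
        also have "\<dots> \<le> 0 + M * \<bar>?d\<bar> + \<bar>hs z\<bar> * \<bar>?d\<bar>"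
          using excess_profile_le[OF lo(1), of "hs z"] casimir_lipschitz[OF lo(1), of "f (fst z) (snd z) 0" "fs (fst z) (snd z)"]
          by (intro add_mono) (auto simp: fse M_def abs_le_iff abs_mult[symmetric])
        also have "\<dots> \<le> 0 + M * ((1 + (snd z)\<^sup>2) * \<bar>?d\<bar>) + (2 * (1 + (snd z)\<^sup>2)) * \<bar>?d\<bar>"
          using M by (intro add_mono mult_right_mono abs_hs_le mult_left_mono) (auto simp: mult_le_cancel_right1 distrib_right)
        finally show ?thesis by (simp add: algebra_simps)
      qed
      then have "integral\<^sup>L phase (?D 0) \<le> integral\<^sup>L phase (\<lambda>z. (M + 2) * ?w 0 z)"
        by (intro integral_mono D_i integrable_mult_right w0) auto
      then show ?thesis by simp
    qed
    have e0: "integral {0..1} (\<lambda>x. (F.E x 0 - Es x)\<^sup>2) \<le> \<delta>"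
    proof -
      have "(F.E x 0 - Es x)\<^sup>2 \<le> \<delta>" for x
      proof -
        have "\<bar>F.E x 0 - Es x\<bar> \<le> integral\<^sup>L phase (\<lambda>z. \<bar>f (fst z) (snd z) 0 - fs (fst z) (snd z)\<bar>)"
          using vp_field_diff_le[OF F.vp_solution_axioms vp_solution_axioms, of 0 0 x] by simp
        also have "\<dots> \<le> integral\<^sup>L phase (?w 0)"
          using F.f_phase_integrable[of 0] f_phase_integrable[of 0] w0
          by (intro integral_mono) (auto simp: mult_le_cancel_right1 distrib_right)
        finally have "\<bar>F.E x 0 - Es x\<bar> \<le> \<delta>" using w0 by simp
        then have "\<bar>F.E x 0 - Es x\<bar>\<^sup>2 \<le> \<delta>\<^sup>2" by (intro power_mono) auto
        also have "\<delta>\<^sup>2 \<le> \<delta>" using \<delta> by (simp add: power2_eq_square mult_left_le)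
        finally show ?thesis by simp
      qed
      then have "integral {0..1} (\<lambda>x. (F.E x 0 - Es x)\<^sup>2) \<le> integral {0..1} (\<lambda>x::real. \<delta>)"
        by (intro integral_le integrable_continuous_interval continuous_intros
            continuous_on_subset[OF F.E_continuous_at] continuous_on_subset[OF Es(1)]) auto
      then show ?thesis by simp
    qed
    have "integral\<^sup>L phase (?D t) \<le> (M + 2) * \<delta> + \<delta> / 2"
      using D_bound D0 e0 w0(2) M mult_left_mono[of "integral\<^sup>L phase (?w 0)" \<delta> "M + 2"] by linarith
    also have "\<dots> \<le> (M + 4) * \<delta>" using \<delta> by (simp add: algebra_simps)
    finally have Dt: "integral\<^sup>L phase (?D t) \<le> (M + 4) * \<delta>" .
    \<comment> \<open>At large velocities \<open>fs\<close> vanishes and the linear growth of the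
      excess absorbs the weight. At bounded velocities the weight is at most \<open>cV\<close>, and
      the quadratic growth enters through Young's inequality.\<close>
    have pw: "?w t z \<le> cV * \<eta> * indicator {-V1..V1} (snd z) + K * ?D t z" for z
    proof -
      define x v where "x = fst z" and "v = snd z"
      have z: "z = (x, v)" by (simp add: x_def v_def)
      have s: "0 \<le> f x v t" "f x v t \<le> C1" using F.f_nonneg[OF t] fC[OF t] by auto
      have fse: "fs x v = \<phi> (hs z)" using fs_eq z by simp
      have sq: "(f x v t - fs x v)\<^sup>2 / (2 * L) \<le> ?D t z"
        unfolding fse x_def[symmetric] v_def[symmetric] by (rule excess_ge_square[OF L lo(3) lo(2) s])
      have "0 \<le> (f x v t - fs x v)\<^sup>2 / (2 * L)" using L by simp
      then have D0: "0 \<le> ?D t z" using sq by linarith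
      show ?thesis
      proof (cases "V1 < \<bar>v\<bar>")
        case True
        then have fs0: "fs x v = 0" using V1 by (intro fs_zero) auto
        have hE: "Emax + (1 + v\<^sup>2) / 4 \<le> hs z" using far[OF True] z by simp
        have "0 \<le> (1 + v\<^sup>2) / 4" by simp
        then have hE': "Emax \<le> hs z" using hE by linarith
        have "(hs z - Emax) * f x v t + (f x v t)\<^sup>2 / (2 * L) \<le> ?D t z"
          unfolding x_def[symmetric] v_def[symmetric] by (rule excess_ge_beyond[OF L lo(3) lo(2) s hE'])
        moreover have "0 \<le> (f x v t)\<^sup>2 / (2 * L)" using L by simp
        moreover have "(1 + v\<^sup>2) / 4 * f x v t \<le> (hs z - Emax) * f x v t"
          using hE s by (intro mult_right_mono) linarith+
        ultimately have "(1 + v\<^sup>2) * f x v t \<le> 4 * ?D t z" by simp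
        also have "\<dots> \<le> K * ?D t z" using K D0 by (intro mult_right_mono) auto
        finally show ?thesis using s True fs0 by (auto simp: x_def v_def indicator_def)
      next
        case False
        then have v: "1 + v\<^sup>2 \<le> cV" using abs_le_square_iff[of v V1] V1 by (simp add: cV_def)
        have "(f x v t - fs x v)\<^sup>2 / (4 * \<eta>) \<le> (2 * L * ?D t z) / (4 * \<eta>)"
          using sq L \<eta> by (intro divide_right_mono) (auto simp: field_simps)
        then have "\<bar>f x v t - fs x v\<bar> \<le> \<eta> + L / (2 * \<eta>) * ?D t z"
          using abs_le_eta_square[OF \<eta>, of "f x v t - fs x v"] by (simp add: field_simps)
        then have "(1 + v\<^sup>2) * \<bar>f x v t - fs x v\<bar> \<le> cV * (\<eta> + L / (2 * \<eta>) * ?D t z)"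
          using v cV by (intro mult_mono) auto
        also have "\<dots> \<le> cV * \<eta> + K * ?D t z"
          using D0 by (simp add: K_def algebra_simps)
        finally show ?thesis using False by (auto simp: x_def v_def indicator_def)
      qed
    qed
    have R_i: "integrable phase (\<lambda>z. cV * \<eta> * indicator {-V1..V1} (snd z) + K * ?D t z)"
      using phase_strip(1)[of V1] V1 D_i[OF t] by simp
    have wt: "integrable phase (?w t)"
    proof (rule Bochner_Integration.integrable_bound[OF R_i])
      have "norm (?w t z) \<le> norm (cV * \<eta> * indicator {-V1..V1} (snd z) + K * ?D t z)" for z
        using pw[of z] by (simp add: abs_mult)
      then show "AE z in phase. norm (?w t z) \<le> norm (cV * \<eta> * indicator {-V1..V1} (snd z) + K * ?D t z)" by simp
    qed (use wm[OF t] in \<open>simp add: measurable_phase\<close>)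
    have "integral\<^sup>L phase (?w t) \<le> integral\<^sup>L phase (\<lambda>z. cV * \<eta> * indicator {-V1..V1} (snd z) + K * ?D t z)"
      by (rule integral_mono[OF wt R_i pw])
    also have "\<dots> = cV * \<eta> * (2 * V1) + K * integral\<^sup>L phase (?D t)"
      using phase_strip[of V1] V1 D_i[OF t] by simp
    also have "\<dots> \<le> cV * \<eta> * (2 * V1) + K * ((M + 4) * \<delta>)"
      using Dt K by (intro add_left_mono mult_left_mono) auto
    also have "\<dots> \<le> \<epsilon> / 2 + \<epsilon> / 2"
      using \<delta>(3) cV V1 by (intro add_mono) (auto simp: \<eta>_def field_simps)
    finally show "integrable phase (?w t) \<and> integral\<^sup>L phase (?w t) \<le> \<epsilon>"
      using wt by simp
  qed
qed

end

section \<open>Winding rates of the steady state\<close>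

text \<open>A Gronwall argument for \<open>g\<close> coupled to its own integral: with
  \<open>c \<le> k * k\<close> the combination \<open>g + k * primitive g\<close> times a decaying
  exponential of rate \<open>k\<close> cannot increase, and it starts at zero.\<close>

lemma zero_if_deriv_le_integral:
  fixes g g' :: "real \<Rightarrow> real"
  assumes g': "\<And>y. (g has_real_derivative g' y) (at y)" and g: "continuous_on UNIV g" "\<And>y. 0 \<le> g y" "g 0 = 0" and c: "0 \<le> c"
    and le: "\<And>y. 0 \<le> y \<Longrightarrow> y \<le> a \<Longrightarrow> g' y \<le> c * integral {0..y} g"
    and y: "0 \<le> y" "y \<le> a"
  shows "g y = 0"
proof -
  define k where "k = max 1 c"
  have k: "1 \<le> k" "c \<le> k * k" 
  proof -
    show k1: "1 \<le> k" by (simp add: k_def)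
    have "c \<le> k * 1" by (simp add: k_def)
    also have "\<dots> \<le> k * k" using k1 by (intro mult_left_mono) auto
    finally show "c \<le> k * k" .
  qed
  let ?I = "primitive g"
  let ?S = "\<lambda>x. (g x + k * ?I x) * exp (- k * x)"
  have d: "(?S has_real_derivative (g' x + k * g x) * exp (- k * x) + (g x + k * ?I x) * (exp (- k * x) * (- k))) (at x)" for x
    by (auto intro!: derivative_eq_intros g' has_real_derivative_primitive[OF g(1)])
  have "?S y \<le> ?S 0"
  proof (rule DERIV_nonpos_imp_nonincreasing[OF y(1)])
    fix x assume x: "0 \<le> x" "x \<le> y"
    have I: "?I x = integral {0..x} g" by (rule primitive_eq_integral[OF g(1) x(1)])
    have "0 \<le> ?I x" unfolding I by (intro integral_nonneg integrable_continuous_interval continuous_on_subset[OF g(1)]) (auto simp: g)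
    then have "c * ?I x \<le> k * k * ?I x" using k by (intro mult_right_mono) auto
    then have "g' x + k * g x \<le> k * (g x + k * ?I x)"
      using le[of x] x y by (simp add: I algebra_simps)
    then have "(g' x + k * g x) * exp (- k * x) + (g x + k * ?I x) * (exp (- k * x) * (- k)) \<le> 0"
      by (simp add: algebra_simps)
    then show "\<exists>D. (?S has_real_derivative D) (at x) \<and> D \<le> 0" using d by blast
  qed
  then have "g y + k * ?I y \<le> 0" by (simp add: g mult_le_0_iff)
  moreover have "0 \<le> k * ?I y"
    using k primitive_eq_integral[OF g(1) y(1)]
    by (auto intro!: mult_nonneg_nonneg integral_nonneg integrable_continuous_interval continuous_on_subset[OF g(1)] simp: g)
  ultimately show ?thesis using g(2)[of y] by linarith
qed

context vp_steady
begin

text \<open>The background only raises the field, being nonnegative; so the decrease of the field is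
  at most the mass of the steady state in between.\<close>

lemma Es_diff_ge:
  assumes "0 \<le> x" "x \<le> y" "y \<le> 1"
  shows "- integral {x..y} (\<lambda>z. spatial_density z 0) \<le> Es y - Es x"
proof -
  have si: "set_integrable lborel {0..1} (\<lambda>y. \<rho> y - spatial_density y 0)" by (rule charge_set_integrable) simp
  have i: "(\<lambda>y. \<rho> y - spatial_density y 0) integrable_on {0..1}"
    using set_borel_integral_eq_integral(1)[OF si] .
  have ch: "integral {0..1} (\<lambda>y. \<rho> y - spatial_density y 0) = 0" by (rule charge_neutral) simp
  have E: "Es z = kernel_transform (\<lambda>y. \<rho> y - spatial_density y 0) z" for z
    using E_eq_kernel_transform[of z 0] by simp
  have "Es y - Es x = integral {0..y} (\<lambda>y. \<rho> y - spatial_density y 0) - integral {0..x} (\<lambda>y. \<rho> y - spatial_density y 0)"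
    unfolding E using kernel_transform_eq'[OF si ch] assms by simp
  also have "\<dots> = integral {x..y} (\<lambda>y. \<rho> y - spatial_density y 0)"
    using Henstock_Kurzweil_Integration.integral_combine[of 0 x y "\<lambda>y. \<rho> y - spatial_density y 0"] assms
      integrable_on_subinterval[OF i, of 0 y] by simp
  also have "\<dots> \<ge> integral {x..y} (\<lambda>z. - spatial_density z 0)"
  proof (rule integral_le)
    show "(\<lambda>y. \<rho> y - spatial_density y 0) integrable_on {x..y}"
      by (rule integrable_on_subinterval[OF i]) (use assms in auto)
    show "(\<lambda>z. - spatial_density z 0) integrable_on {x..y}"
      by (intro integrable_continuous_interval continuous_intros) auto
  qed (use rho_nonneg in auto)
  finally show ?thesis by simp
qed

text \<open>Suppose the maximum of the potential, at \<open>x0\<close>, reached \<open>Emax\<close>.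
  Then the density is at most a constant times the depth \<open>?u\<close> below the maximum, and
  the field vanishes at \<open>x0\<close>. The slope of \<open>?u\<close> is at most the mass
  between \<open>x0\<close> and the given point, hence at most a constant times the integral of
  \<open>?u\<close> over that stretch. Gronwall on both sides of \<open>x0\<close> makes
  \<open>?u\<close>, and with it the density, vanish over a whole period, contradicting mass
  one.\<close>

lemma U_less_Emax: "U x < Emax"
proof (rule ccontr)
  assume "\<not> U x < Emax"
  then have Ux: "Emax \<le> U (frac x)" using periodic_frac[of U x] U(2) by simp
  have "\<exists>x0\<in>{0..1}. \<forall>y\<in>{0..1}. U y \<le> U x0"
    by (intro continuous_attains_sup continuous_on_subset[OF U(3)]) auto
  then obtain x0 where x0: "0 \<le> x0" "x0 \<le> 1" and max01: "\<And>y. y \<in> {0..1} \<Longrightarrow> U y \<le> U x0" by auto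
  have max: "U y \<le> U x0" for y
    using max01[of "frac y"] periodic_frac[of U y] U(2) frac_lt_1[of y] by (simp add: less_imp_le)
  have m: "Emax \<le> U x0" using max01[of "frac x"] Ux frac_lt_1[of x] by (simp add: less_imp_le)
  have E0: "Es x0 = 0"
    by (rule DERIV_local_max[OF U(1)[of x0] zero_less_one]) (use max in auto)
  obtain L where L: "1 \<le> L" "\<And>x y. -2 \<le> x \<Longrightarrow> -2 \<le> y \<Longrightarrow> \<bar>\<phi> x - \<phi> y\<bar> \<le> L * \<bar>x - y\<bar>"
    using profile_lipschitz[of "-2"] by blast
  let ?u = "\<lambda>x. U x0 - U x"
  have u0: "0 \<le> ?u y" for y using max[of y] by simp
  \<comment> \<open>The profile vanishes from \<open>Emax\<close> on, so its Lipschitz bound applies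
    to \<open>Emax\<close> minus the energy, which is at most the depth because \<open>Emax\<close>
    does not exceed the maximal potential.\<close>
  have fs_le: "fs y v \<le> L * ?u y" for y v
  proof (cases "Emax \<le> hs (y, v)")
    case True
    then show ?thesis using L u0[of y] by (simp add: fs_eq profile_zero)
  next
    case False
    have "fs y v \<le> L * \<bar>hs (y, v) - Emax\<bar>"
      using L(2)[of "hs (y, v)" Emax] hs_ge[of "(y, v)"] False profile_zero[of Emax] by (simp add: fs_eq)
    also have "\<dots> \<le> L * ?u y"
    proof (rule mult_left_mono)
      have "0 \<le> v\<^sup>2 / 2" by simp
      then show "\<bar>hs (y, v) - Emax\<bar> \<le> ?u y"
        using False m unfolding hs_def fst_conv snd_conv by linarith
    qed (use L in simp)
    finally show ?thesis .
  qed
  have n_le: "spatial_density y 0 \<le> 2 * v0 * L * ?u y" for y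
  proof -
    have "spatial_density y 0 = (LBINT v. fs y v)" by (simp add: spatial_density_def)
    also have "\<dots> \<le> (LBINT v. (L * ?u y) * indicator {-v0..v0} v)"
    proof (rule integral_mono)
      show "integrable lborel (\<lambda>v. fs y v)" using f_integrable[of 0] by simp
      show "integrable lborel (\<lambda>v. (L * ?u y) * indicator {-v0..v0} v)"
        by (intro integrable_mult_right) (simp add: integrable_real_indicator emeasure_lborel_Icc_eq)
      show "fs y v \<le> (L * ?u y) * indicator {-v0..v0} v" for v
        using fs_le[of y v] fs_zero[of v y] by (auto simp: indicator_def abs_le_iff not_le)
    qed
    also have "\<dots> = 2 * v0 * L * ?u y" using v0 by simp
    finally show ?thesis .
  qed
  have cu: "continuous_on UNIV ?u" by (intro continuous_intros U)
  have n_int: "integral {a..b} (\<lambda>z. spatial_density z 0) \<le> 2 * v0 * L * integral {a..b} ?u" for a b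
  proof -
    have "integral {a..b} (\<lambda>z. spatial_density z 0) \<le> integral {a..b} (\<lambda>z. 2 * v0 * L * ?u z)"
      by (intro integral_le integrable_continuous_interval continuous_intros continuous_on_subset[OF U(3)] n_le) auto
    then show ?thesis by simp
  qed
  have c: "0 \<le> 2 * v0 * L" using v0 L by simp
  have "?u y = 0" if y: "x0 \<le> y" "y \<le> 1" for y
  proof -
    have "?u (x0 + (y - x0)) = 0"
    proof (rule zero_if_deriv_le_integral[where g="\<lambda>z. ?u (x0 + z)" and g'="\<lambda>z. - Es (x0 + z)" and a="1 - x0", OF _ _ _ _ c])
      show "((\<lambda>z. ?u (x0 + z)) has_real_derivative - Es (x0 + z)) (at z)" for z
        by (auto intro!: derivative_eq_intros DERIV_chain2[OF U(1)])
      show "continuous_on UNIV (\<lambda>z. ?u (x0 + z))" by (intro continuous_intros continuous_on_compose2[OF U(3)]) auto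
      fix z assume z: "0 \<le> z" "z \<le> 1 - x0"
      have "- Es (x0 + z) \<le> integral {x0..x0 + z} (\<lambda>z. spatial_density z 0)"
        using Es_diff_ge[of x0 "x0 + z"] x0 z E0 by simp
      also have "\<dots> \<le> 2 * v0 * L * integral {x0..x0 + z} ?u" by (rule n_int)
      also have "integral {x0..x0 + z} ?u = integral {0..z} (\<lambda>z. ?u (x0 + z))"
      proof -
        have "(?u has_integral integral {x0..x0+z} ?u) {x0..x0+z}"
          by (intro integrable_integral integrable_continuous_interval continuous_on_subset[OF cu]) auto
        from has_integral_affinity[OF this[folded cbox_interval], of 1 x0]
        have "((\<lambda>y. ?u (y + x0)) has_integral integral {x0..x0+z} ?u) ((\<lambda>y. y - x0) ` {x0..x0+z})" by (simp add: cbox_interval)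
        moreover have "(\<lambda>y. y - x0) ` {x0..x0+z} = {0..z}" by (simp add: image_diff_atLeastAtMost)
        ultimately show ?thesis by (simp add: integral_unique add.commute)
      qed
      finally show "- Es (x0 + z) \<le> 2 * v0 * L * integral {0..z} (\<lambda>z. ?u (x0 + z))" .
    qed (use u0 y in auto)
    then show ?thesis by simp
  qed
  moreover have "?u y = 0" if y: "0 \<le> y" "y \<le> x0" for y
  proof -
    have "?u (x0 - (x0 - y)) = 0"
    proof (rule zero_if_deriv_le_integral[where g="\<lambda>z. ?u (x0 - z)" and g'="\<lambda>z. Es (x0 - z)" and a="x0", OF _ _ _ _ c])
      show "((\<lambda>z. ?u (x0 - z)) has_real_derivative Es (x0 - z)) (at z)" for z
        by (auto intro!: derivative_eq_intros DERIV_chain2[OF U(1)])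
      show "continuous_on UNIV (\<lambda>z. ?u (x0 - z))" by (intro continuous_intros continuous_on_compose2[OF U(3)]) auto
      fix z assume z: "0 \<le> z" "z \<le> x0"
      have "Es (x0 - z) \<le> integral {x0 - z..x0} (\<lambda>z. spatial_density z 0)"
        using Es_diff_ge[of "x0 - z" x0] x0 z E0 by simp
      also have "\<dots> \<le> 2 * v0 * L * integral {x0 - z..x0} ?u" by (rule n_int)
      also have "integral {x0 - z..x0} ?u = integral {0..z} (\<lambda>z. ?u (x0 - z))"
      proof -
        have "(?u has_integral integral {x0-z..x0} ?u) {x0-z..x0}"
          by (intro integrable_integral integrable_continuous_interval continuous_on_subset[OF cu]) auto
        from has_integral_affinity[OF this[folded cbox_interval], of "-1" x0]
        have "((\<lambda>y. ?u (x0 - y)) has_integral integral {x0-z..x0} ?u) ((\<lambda>y. x0 - y) ` {x0-z..x0})"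
          by (simp add: cbox_interval)
        moreover have "(\<lambda>y. x0 - y) ` {x0-z..x0} = {0..z}" by (simp add: image_diff_atLeastAtMost)
        ultimately show ?thesis by (simp add: integral_unique)
      qed
      finally show "Es (x0 - z) \<le> 2 * v0 * L * integral {0..z} (\<lambda>z. ?u (x0 - z))" .
    qed (use u0 y in auto)
    then show ?thesis by simp
  qed
  ultimately have "?u y = 0" if "y \<in> {0..1}" for y using that by (cases "y \<le> x0") auto
  then have "spatial_density y 0 = 0" if "y \<in> {0..1}" for y
    using n_le[of y] density_nonneg[of 0 y] that by simp
  then have "integral {0..1} (\<lambda>y. spatial_density y 0) = integral {0..1} (\<lambda>y::real. 0)"
    by (intro Henstock_Kurzweil_Integration.integral_cong) auto
  then show False using mass_density[of 0] by simp
qed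

end

text \<open>Integration by parts against the weight \<open>y - x - 1/2\<close>, whose end values
  differ by one, leaves \<open>P 0\<close> minus the mean of \<open>P\<close>; the term
  \<open>P 0\<close> cancels with the normalisation of \<open>primitive\<close>.\<close>

lemma mean_zero_primitive_deriv:
  assumes P: "\<And>x. (P has_real_derivative w x) (at x)" and w: "continuous_on UNIV w" and per: "P 1 = P 0"
  shows "mean_zero_primitive w x = P x - integral {0..1} P"
proof -
  have cP: "continuous_on UNIV P" using P by (intro continuous_at_imp_continuous_on) (auto intro: DERIV_isCont)
  have "((\<lambda>y. P y + (y - x - 1/2) * w y) has_integral (1 - x - 1/2) * P 1 - (0 - x - 1/2) * P 0) {0..1}"
    by (rule fundamental_theorem_of_calculus)
      (auto intro!: derivative_eq_intros DERIV_subset[OF P] simp: has_real_derivative_iff_has_vector_derivative[symmetric])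
  then have "integral {0..1} (\<lambda>y. P y + (y - x - 1/2) * w y) = P 0"
    by (simp add: integral_unique per algebra_simps)
  moreover have "integral {0..1} (\<lambda>y. P y + (y - x - 1/2) * w y) = integral {0..1} P + integral {0..1} (\<lambda>y. (y - x - 1/2) * w y)"
    by (intro integral_add integrable_continuous_interval continuous_intros continuous_on_subset[OF w] continuous_on_subset[OF cP]) auto
  ultimately show ?thesis
    using primitive_eqI[of P w x] P by (simp add: mean_zero_primitive_def)
qed

lemma LBINT_atMost_eq:
  fixes g :: "real \<Rightarrow> real"
  assumes c: "continuous_on UNIV g" and i: "integrable lborel g"
  shows "(LBINT w:{..v}. g w) = (LBINT w:{..0}. g w) + primitive g v"
proof -
  have si: "set_integrable lborel S g" if "S \<in> sets borel" for S
    unfolding set_integrable_def using i that by (intro integrable_mult_indicator) auto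
  have *: "(LBINT w:{..b}. g w) = (LBINT w:{..a}. g w) + integral {a..b} g" if "a \<le> b" for a b
  proof -
    have "(LBINT w:{..a} \<union> {a..b}. g w) = (LBINT w:{..a}. g w) + (LBINT w:{a..b}. g w)"
    proof (rule set_integral_Un_AE)
      show "AE x in lborel. \<not> (x \<in> {..a} \<and> x \<in> {a..b})"
        using AE_lborel_singleton[of a] by eventually_elim auto
    qed (auto intro: si)
    moreover have "{..a} \<union> {a..b} = {..b}" using that by auto
    ultimately show ?thesis using LBINT_Icc_eq_integral[OF continuous_on_subset[OF c]] by simp
  qed
  show ?thesis
  proof (cases "0 \<le> v")
    case True then show ?thesis using *[of 0 v] primitive_eq_integral[OF c] by simp
  next
    case False then show ?thesis using *[of v 0] primitive_diff_eq_integral(1)[OF c, of v 0] by simp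
  qed
qed

lemma LBINT_atMost_deriv:
  fixes g :: "real \<Rightarrow> real"
  assumes c: "continuous_on UNIV g" and i: "integrable lborel g"
  shows "((\<lambda>v. LBINT w:{..v}. g w) has_real_derivative g v) (at v)"
proof -
  have "((\<lambda>v. (LBINT w:{..0}. g w) + primitive g v) has_real_derivative g v) (at v)"
    by (auto intro!: derivative_eq_intros has_real_derivative_primitive[OF c])
  then show ?thesis unfolding LBINT_atMost_eq[OF c i, symmetric] .
qed

lemma phase_integral_strip:
  fixes F :: "real \<times> real \<Rightarrow> real"
  assumes c: "continuous_on UNIV F"
  shows "integrable phase (\<lambda>z. indicator {-a..a} (snd z) * F z)"
    and "integral\<^sup>L phase (\<lambda>z. indicator {-a..a} (snd z) * F z) = integral (cbox (0, -a) (1, a)) F"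
proof -
  have cS: "continuous_on S (\<lambda>v. H (x, v))" if "continuous_on UNIV H" for S x and H :: "real \<times> real \<Rightarrow> real"
    by (rule continuous_on_compose2[OF that]) (intro continuous_intros, auto)
  have I: "integrable lborel (\<lambda>v. indicator {-a..a} v * H (x, v))"
    "(LBINT v. indicator {-a..a} v * H (x, v)) = integral {-a..a} (\<lambda>v. H (x, v))"
    if "continuous_on UNIV H" for x and H :: "real \<times> real \<Rightarrow> real"
    using borel_integrable_atLeastAtMost'[OF cS[OF that], of "-a" a x] LBINT_Icc_eq_integral[OF cS[OF that], of "-a" a x]
    by (simp_all add: set_integrable_def set_lebesgue_integral_def)
  have cI: "continuous_on S (\<lambda>x. integral {-a..a} (\<lambda>v. H (x, v)))" if "continuous_on UNIV H" for S and H :: "real \<times> real \<Rightarrow> real"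
    using integral_continuous_on_param[of S "-a" a "\<lambda>x v. H (x, v)"] continuous_on_subset[OF that] by simp
  have m: "(\<lambda>z. indicator {-a..a} (snd z) * F z) \<in> borel_measurable borel"
    by (intro borel_measurable_times borel_measurable_continuous_onI c
        measurable_compose[OF borel_measurable_continuous_onI borel_measurable_indicator] continuous_intros) simp
  have ca: "continuous_on UNIV (\<lambda>z. \<bar>F z\<bar>)" by (intro continuous_intros c)
  have "integrable phase (\<lambda>z. \<bar>indicator {-a..a} (snd z) * F z\<bar>)"
  proof (rule integrable_phaseI)
    show "set_integrable lborel {0..1} (\<lambda>x. LBINT v. \<bar>indicator {-a..a} (snd (x, v)) * F (x, v)\<bar>)"
      unfolding snd_conv abs_mult abs_indicator I(2)[OF ca] by (intro borel_integrable_atLeastAtMost' cI ca)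
    show "integrable lborel (\<lambda>v. \<bar>indicator {-a..a} (snd (x, v)) * F (x, v)\<bar>)" for x
      unfolding snd_conv abs_mult abs_indicator by (rule I(1)[OF ca])
  qed (use m in auto)
  then show i: "integrable phase (\<lambda>z. indicator {-a..a} (snd z) * F z)"
    using m by (subst (asm) integrable_abs_iff) (auto simp: measurable_phase)
  show "integral\<^sup>L phase (\<lambda>z. indicator {-a..a} (snd z) * F z) = integral (cbox (0, -a) (1, a)) F"
    unfolding integral_phase[OF i] snd_conv I(2)[OF c] LBINT_Icc_eq_integral[OF cI[OF c]]
    using integral_prod_continuous[OF continuous_on_subset[OF c], of 0 "-a" 1 a] by simp
qed

lemma phase_integral_compact:
  fixes F :: "real \<Rightarrow> real \<Rightarrow> real"
  assumes c: "continuous_on UNIV (\<lambda>z. F (fst z) (snd z))" and z: "\<And>x v. a < \<bar>v\<bar> \<Longrightarrow> F x v = 0"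
  shows "integrable phase (\<lambda>z. F (fst z) (snd z))"
    and "integral\<^sup>L phase (\<lambda>z. F (fst z) (snd z)) = integral {0..1} (\<lambda>x. integral {-a..a} (\<lambda>v. F x v))"
    and "integral\<^sup>L phase (\<lambda>z. F (fst z) (snd z)) = integral {-a..a} (\<lambda>v. integral {0..1} (\<lambda>x. F x v))"
proof -
  let ?F = "\<lambda>z. F (fst z) (snd z)"
  have F: "indicator {-a..a} (snd z) * ?F z = ?F z" for z
    using z[of "snd z" "fst z"] by (cases "a < \<bar>snd z\<bar>") (auto simp: indicator_def)
  note strip = phase_integral_strip[OF c, of a, unfolded F]
  show "integrable phase ?F" by (rule strip)
  show eq: "integral\<^sup>L phase ?F = integral {0..1} (\<lambda>x. integral {-a..a} (\<lambda>v. F x v))"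
    unfolding strip(2) using integral_prod_continuous[OF continuous_on_subset[OF c], of 0 "-a" 1 a] by simp
  have "continuous_on (cbox (0, -a) (1, a)) (\<lambda>(x, v). F x v)"
    using continuous_on_subset[OF c] by (simp add: case_prod_unfold)
  from integral_swap_continuous[OF this] eq
  show "integral\<^sup>L phase ?F = integral {-a..a} (\<lambda>v. integral {0..1} (\<lambda>x. F x v))"
    by simp
qed

text \<open>Chosen so that its time integral along characteristics is a potential for the change of the
  one-form $B\,dv - m\,dx$ under the flow; the precise statement is \<open>winding_diff\<close> below.\<close>

definition winding_rate :: "(real \<Rightarrow> real) \<Rightarrow> (real \<Rightarrow> real \<Rightarrow> real) \<Rightarrow> real \<Rightarrow> real \<Rightarrow> real" where
  "winding_rate e \<mu> x v = mean_zero_primitive (\<lambda>y. e y * \<mu> y v) x - e x * mean_zero_primitive (\<lambda>y. \<mu> y v) x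
     - primitive (\<lambda>w. LBINT u:{..w}. integral {0..1} (\<lambda>y. \<mu> y u)) v"

lemma integral_positive:
  fixes g :: "real \<Rightarrow> real"
  assumes c: "continuous_on {a..b} g" and g: "\<And>x. x \<in> {a..b} \<Longrightarrow> 0 \<le> g x" and x: "x \<in> {a..b}" "0 < g x" and ab: "a < b"
  shows "0 < integral {a..b} g"
proof -
  have "0 \<le> integral {a..b} g" by (intro integral_nonneg integrable_continuous_interval c g)
  moreover have "integral {a..b} g \<noteq> 0"
  proof
    assume 0: "integral {a..b} g = 0"
    have "(g has_integral 0) (cbox a b)"
      using integrable_integral[OF integrable_continuous_interval[OF c]] 0 by simp
    then have "g x = 0"
      by (rule has_integral_0_cbox_imp_0[rotated 2]) (use c g x ab in \<open>auto simp: box_real\<close>)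
    then show False using x by simp
  qed
  ultimately show ?thesis by simp
qed

text \<open>The square of the positive part of a parabola: squaring makes it C^1, which suffices
  here, and for \<open>a < b\<close> it is positive exactly between the two roots.\<close>

definition bump :: "real \<Rightarrow> real \<Rightarrow> real \<Rightarrow> real" where
  "bump a b s = (max 0 ((s - a) * (b - s)))\<^sup>2"

definition bump_deriv :: "real \<Rightarrow> real \<Rightarrow> real \<Rightarrow> real" where
  "bump_deriv a b s = 2 * max 0 ((s - a) * (b - s)) * (a + b - 2 * s)"

lemma square_pos_part_deriv: "((\<lambda>y::real. (max 0 y)\<^sup>2) has_real_derivative 2 * max 0 y) (at y)"
proof -
  consider "y < 0" | "0 < y" | "y = 0" by linarith
  then show ?thesis
  proof cases
    case 1
    have "((\<lambda>y::real. 0) has_real_derivative 2 * max 0 y) (at y)" using 1 by simp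
    then show ?thesis by (rule has_field_derivative_transform_within_open[of _ _ _ "{..<0}"]) (use 1 in auto)
  next
    case 2
    have "((\<lambda>y::real. y\<^sup>2) has_real_derivative 2 * max 0 y) (at y)" using 2 by (auto intro!: derivative_eq_intros)
    then show ?thesis by (rule has_field_derivative_transform_within_open[of _ _ _ "{0<..}"]) (use 2 in auto)
  next
    case 3
    have "((\<lambda>h::real. (max 0 h)\<^sup>2 / h) \<longlongrightarrow> 0) (at 0)"
    proof (rule Lim_null_comparison[of _ "\<lambda>h. \<bar>h\<bar>"])
      show "\<forall>\<^sub>F h in at 0. norm ((max 0 h)\<^sup>2 / h) \<le> \<bar>h::real\<bar>"
        by (intro always_eventually allI) (auto simp: max_def power2_eq_square)
      show "((\<lambda>h::real. \<bar>h\<bar>) \<longlongrightarrow> 0) (at 0)" by (intro tendsto_eq_intros) auto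
    qed
    then show ?thesis using 3 by (simp add: DERIV_def)
  qed
qed

lemma bump_has_deriv: "(bump a b has_real_derivative bump_deriv a b s) (at s)"
proof -
  have "((\<lambda>s. (s - a) * (b - s)) has_real_derivative (a + b - 2 * s)) (at s)"
    by (auto intro!: derivative_eq_intros)
  from DERIV_chain2[OF square_pos_part_deriv this] show ?thesis
    by (simp add: bump_def[abs_def] bump_deriv_def)
qed

lemma bump_deriv_continuous: "continuous_on S (bump_deriv a b)"
  unfolding bump_deriv_def by (intro continuous_intros)

lemma bump_continuous: "continuous_on S (bump a b)"
  unfolding bump_def by (intro continuous_intros)

lemma bump_nonneg: "0 \<le> bump a b s"
  by (simp add: bump_def)

lemma bump_eq_0_iff: "a < b \<Longrightarrow> bump a b s = 0 \<longleftrightarrow> \<not> (a < s \<and> s < b)"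
  by (auto simp: bump_def max_def mult_le_0_iff zero_le_mult_iff not_less not_le)

lemma bump_lipschitz:
  assumes "a < b"
  obtains K where "0 < K" "\<And>s s'. \<bar>bump a b s - bump a b s'\<bar> \<le> K * \<bar>s - s'\<bar>" "\<And>s. bump a b s \<le> K"
proof -
  have 1: "compact (bump_deriv a b ` {a..b})" and 2: "compact (bump a b ` {a..b})"
    by (intro compact_continuous_image bump_deriv_continuous bump_continuous; simp)+
  from compact_imp_bounded[OF 1] obtain K1 where K1: "\<And>s. s \<in> {a..b} \<Longrightarrow> \<bar>bump_deriv a b s\<bar> \<le> K1"
    by (fastforce simp: bounded_iff)
  from compact_imp_bounded[OF 2] obtain K2 where K2: "\<And>s. s \<in> {a..b} \<Longrightarrow> \<bar>bump a b s\<bar> \<le> K2"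
    by (fastforce simp: bounded_iff)
  have z: "bump_deriv a b s = 0" "bump a b s = 0" if "s \<notin> {a..b}" for s
  proof -
    have "(s - a) * (b - s) \<le> 0" using that assms by (auto simp: mult_le_0_iff)
    then show "bump_deriv a b s = 0" "bump a b s = 0" by (simp_all add: bump_deriv_def bump_def max_def)
  qed
  define K where "K = max 1 (max K1 K2)"
  have K: "\<bar>bump_deriv a b s\<bar> \<le> K" "bump a b s \<le> K" for s
    using K1[of s] K2[of s] z[of s] by (cases "s \<in> {a..b}"; auto simp: K_def)+
  have "\<bar>bump a b s - bump a b s'\<bar> \<le> K * \<bar>s - s'\<bar>" for s s'
    using field_differentiable_bound[of UNIV "bump a b" "bump_deriv a b" K s s'] bump_has_deriv K by auto
  then show ?thesis using K by (intro that[of K]) (auto simp: K_def)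
qed

lemma winding_rate_continuous:
  assumes e: "continuous_on UNIV e" and m: "continuous_on UNIV (\<lambda>z. \<mu> (fst z) (snd z))"
    and i: "integrable lborel (\<lambda>u. integral {0..1} (\<lambda>y. \<mu> y u))"
  shows "continuous_on UNIV (\<lambda>z. winding_rate e \<mu> (fst z) (snd z))"
proof -
  have c1: "continuous_on (UNIV \<times> UNIV) (\<lambda>(x, v). mean_zero_primitive (\<lambda>y. e y * \<mu> y v) x)"
    by (rule mean_zero_primitive_continuous)
      (auto intro!: continuous_intros continuous_on_compose2[OF e] m simp: case_prod_unfold)
  have c2: "continuous_on (UNIV \<times> UNIV) (\<lambda>(x, v). mean_zero_primitive (\<lambda>y. \<mu> y v) x)"
    by (rule mean_zero_primitive_continuous) (use m in \<open>simp add: case_prod_unfold\<close>)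
  have "continuous_on (UNIV \<times> cbox 0 1) (\<lambda>(u, y). \<mu> y u)"
    unfolding case_prod_unfold
    by (rule continuous_on_compose2[OF m, of _ "\<lambda>p. (snd p, fst p)", unfolded fst_conv snd_conv]) (intro continuous_intros, auto)
  from integral_continuous_on_param[OF this]
  have c3: "continuous_on UNIV (\<lambda>u. integral {0..1} (\<lambda>y. \<mu> y u))" by simp
  have c4: "continuous_on UNIV (\<lambda>v. LBINT u:{..v}. integral {0..1} (\<lambda>y. \<mu> y u))"
    using LBINT_atMost_deriv[OF c3 i] by (intro continuous_at_imp_continuous_on) (auto intro: DERIV_isCont)
  have c5: "continuous_on UNIV (primitive (\<lambda>w. LBINT u:{..w}. integral {0..1} (\<lambda>y. \<mu> y u)))"
    using has_real_derivative_primitive[OF c4] by (intro continuous_at_imp_continuous_on) (auto intro: DERIV_isCont)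
  show ?thesis
    unfolding winding_rate_def
    using c1 c2 by (auto intro!: continuous_intros continuous_on_compose2[OF e] continuous_on_compose2[OF c5] simp: case_prod_unfold)
qed

section \<open>Averages of the winding rate over energy levels\<close>

context vp_steady
begin

lemma hs_beyond: "v0 < \<bar>v\<bar> \<Longrightarrow> Emax \<le> hs (x, v)"
  using fs_zero[of v x] profile_pos[of "hs (x, v)"] by (force simp: fs_eq)

text \<open>Normalised at \<open>Emax\<close>, so that the antiderivative of a function supported
  below \<open>Emax\<close> vanishes above its support and is a negative total mass below it
  whenever the function is a nonnegative bump.\<close>

definition energy_primitive :: "(real \<Rightarrow> real) \<Rightarrow> real \<Rightarrow> real" where
  "energy_primitive G h = primitive G h - primitive G Emax"

lemma energy_primitive_deriv: "continuous_on UNIV G \<Longrightarrow> (energy_primitive G has_real_derivative G h) (at h)"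
  unfolding energy_primitive_def[abs_def] by (auto intro!: derivative_eq_intros has_real_derivative_primitive)

lemma energy_primitive_continuous: "continuous_on UNIV G \<Longrightarrow> continuous_on UNIV (energy_primitive G)"
  using energy_primitive_deriv by (intro continuous_at_imp_continuous_on) (auto intro: DERIV_isCont)

lemma energy_primitive_const:
  assumes G: "continuous_on UNIV G" and z: "\<And>h. a \<le> h \<Longrightarrow> h \<le> b \<Longrightarrow> G h = 0" and ab: "a \<le> b"
  shows "energy_primitive G a = energy_primitive G b"
proof -
  have "integral {a..b} G = integral {a..b} (\<lambda>_. 0)"
    by (intro Henstock_Kurzweil_Integration.integral_cong) (use z in auto)
  then show ?thesis using primitive_diff_eq_integral(1)[OF G ab] by (simp add: energy_primitive_def)
qed

lemma energy_primitive_zero: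
  assumes G: "continuous_on UNIV G" and z: "\<And>h. b \<le> h \<Longrightarrow> G h = 0" and h: "b \<le> h" "b \<le> Emax"
  shows "energy_primitive G h = 0"
proof -
  have "energy_primitive G Emax = 0" by (simp add: energy_primitive_def)
  then show ?thesis
    using energy_primitive_const[OF G, of h Emax] energy_primitive_const[OF G, of Emax h] z h by (cases "h \<le> Emax") auto
qed

lemma hs_comp_continuous:
  assumes "continuous_on UNIV G" "continuous_on S x" "continuous_on S v"
  shows "continuous_on S (\<lambda>z. G (hs (x z, v z)))"
  by (rule continuous_on_compose2[OF assms(1)]) (intro hs_continuous assms, simp)

lemma hs_deriv_fst: "((\<lambda>x. hs (x, v)) has_real_derivative Es x) (at x)"
  unfolding hs_def by (auto intro!: derivative_eq_intros U(1))

lemma hs_deriv_snd: "((\<lambda>v. hs (x, v)) has_real_derivative v) (at v)"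
  unfolding hs_def by (auto intro!: derivative_eq_intros)

lemma hs_periodic: "hs (x + 1, v) = hs (x, v)" "hs (1, v) = hs (0, v)"
  using U(2)[of x] U(2)[of 0] by (simp_all add: hs_def)

context
  fixes Gm :: "real \<Rightarrow> real"
  assumes Gm: "continuous_on UNIV Gm" and Gm0: "\<And>h. Emax \<le> h \<Longrightarrow> Gm h = 0"
begin

definition level_average :: "real \<Rightarrow> real" where
  "level_average v = integral {0..1} (\<lambda>x. Gm (hs (x, v)))"

lemma level_average_continuous: "continuous_on UNIV level_average"
proof -
  have "continuous_on (UNIV \<times> cbox 0 1) (\<lambda>(v, x). Gm (hs (x, v)))"
    unfolding case_prod_unfold by (intro hs_comp_continuous[OF Gm] continuous_intros)
  from integral_continuous_on_param[OF this] show ?thesis by (simp add: level_average_def[abs_def])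
qed

lemma level_average_integrable: "integrable lborel level_average"
proof -
  have eq: "level_average = (\<lambda>v. indicator {-v0..v0} v *\<^sub>R level_average v)"
  proof
    fix v
    show "level_average v = indicator {-v0..v0} v *\<^sub>R level_average v"
  proof (cases "v0 < \<bar>v\<bar>")
    case True
    then show ?thesis by (simp add: level_average_def hs_beyond Gm0)
  next
    case False
    then show ?thesis by (auto simp: indicator_def)
  qed
  qed
  have "set_integrable lborel {-v0..v0} level_average"
    by (intro borel_integrable_atLeastAtMost' continuous_on_subset[OF level_average_continuous]) auto
  then show ?thesis
    unfolding set_integrable_def by (subst eq)
qed

definition level_mass :: "real \<Rightarrow> real" where
  "level_mass v = (LBINT w:{..v}. level_average w)"

lemma level_mass_deriv: "(level_mass has_real_derivative level_average v) (at v)"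
  unfolding level_mass_def[abs_def] by (rule LBINT_atMost_deriv[OF level_average_continuous level_average_integrable])

lemma level_mass_continuous: "continuous_on UNIV level_mass"
  using level_mass_deriv by (intro continuous_at_imp_continuous_on) (auto intro: DERIV_isCont)

text \<open>For a density depending on the energy alone, \<open>Es\<close> times the density is the
  \<open>x\<close>-derivative of the energy primitive, which makes the first term explicit. The
  \<open>v\<close>-derivative of the spatial mean of that primitive is
  \<open>v * level_average v\<close>, so its variation combines with the antiderivative of
  \<open>level_mass\<close> to \<open>v * level_mass v\<close>.\<close>

lemma steady_winding_rate:
  "winding_rate Es (\<lambda>x v. Gm (hs (x, v))) x v = energy_primitive Gm (hs (x, v)) - integral {0..1} (\<lambda>y. energy_primitive Gm (hs (y, 0)))
     - Es x * mean_zero_primitive (\<lambda>y. Gm (hs (y, v))) x - v * level_mass v"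
proof -
  let ?F = "energy_primitive Gm"
  note F = energy_primitive_deriv[OF Gm]
  have cF: "continuous_on UNIV ?F" by (rule energy_primitive_continuous[OF Gm])
  have 1: "mean_zero_primitive (\<lambda>y. Es y * Gm (hs (y, v))) x = ?F (hs (x, v)) - integral {0..1} (\<lambda>y. ?F (hs (y, v)))"
  proof (rule mean_zero_primitive_deriv)
    show "((\<lambda>x. ?F (hs (x, v))) has_real_derivative Es x * Gm (hs (x, v))) (at x)" for x
      using DERIV_chain2[OF F hs_deriv_fst] by (simp add: mult.commute)
    show "continuous_on UNIV (\<lambda>y. Es y * Gm (hs (y, v)))"
      by (intro continuous_intros Es hs_comp_continuous[OF Gm])
  qed (simp add: hs_periodic)
  let ?Fb = "\<lambda>v. integral {0..1} (\<lambda>y. ?F (hs (y, v)))"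
  have Fb: "(?Fb has_real_derivative v * level_average v) (at v)" for v
  proof -
    have "((\<lambda>v. integral (cbox 0 1) (\<lambda>y. ?F (hs (y, v)))) has_real_derivative integral (cbox 0 1) (\<lambda>y. v * Gm (hs (y, v)))) (at v within UNIV)"
    proof (rule leibniz_rule_field_derivative)
      show "((\<lambda>v. ?F (hs (y, v))) has_real_derivative v * Gm (hs (y, v))) (at v)" for v y
        using DERIV_chain2[OF F hs_deriv_snd] by (simp add: mult.commute)
      show "(\<lambda>y. ?F (hs (y, v))) integrable_on cbox 0 1" for v
        by (intro integrable_continuous hs_comp_continuous[OF cF] continuous_intros)
      show "continuous_on (UNIV \<times> cbox 0 1) (\<lambda>(v, y). v * Gm (hs (y, v)))"
        unfolding case_prod_unfold by (intro continuous_intros hs_comp_continuous[OF Gm])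
    qed auto
    then show ?thesis by (simp add: level_average_def)
  qed
  have "primitive level_mass v = (v * level_mass v - ?Fb v) - (0 * level_mass 0 - ?Fb 0)"
    by (rule primitive_eqI) (auto intro!: derivative_eq_intros level_mass_deriv Fb)
  then show ?thesis
    unfolding winding_rate_def 1 by (simp add: level_average_def[symmetric] level_mass_def[abs_def, symmetric])
qed

text \<open>The two nonlocal terms are integrated by parts, one in \<open>x\<close> and one in
  \<open>v\<close>, using that \<open>Gg (hs z)\<close> times \<open>Es\<close> or \<open>v\<close>
  is a derivative of the energy primitive of \<open>Gg\<close>. The contributions of
  \<open>level_average\<close> cancel, and only products of one profile with the primitive of the
  other are left.\<close>

lemma steady_average:
  assumes Gg: "continuous_on UNIV Gg" and Gg0: "\<And>h. Emax \<le> h \<Longrightarrow> Gg h = 0"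
  shows "integral\<^sup>L phase (\<lambda>z. Gg (hs z) * winding_rate Es (\<lambda>x v. Gm (hs (x, v))) (fst z) (snd z)) =
    integral\<^sup>L phase (\<lambda>z. Gg (hs z) * energy_primitive Gm (hs z) + energy_primitive Gg (hs z) * Gm (hs z))
     - integral {0..1} (\<lambda>y. energy_primitive Gm (hs (y, 0))) * integral\<^sup>L phase (\<lambda>z. Gg (hs z))"
proof -
  define a where "a = v0 + 1"
  have a: "v0 < a" "0 < a" using v0 by (auto simp: a_def)
  let ?F = "energy_primitive Gm" and ?\<Gamma> = "energy_primitive Gg"
  let ?B = "\<lambda>x v. mean_zero_primitive (\<lambda>y. Gm (hs (y, v))) x"
  have c\<Gamma>: "continuous_on UNIV ?\<Gamma>" and cF: "continuous_on UNIV ?F"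
    by (intro energy_primitive_continuous Gg Gm)+
  have z: "Gg (hs (x, v)) = 0" "Gm (hs (x, v)) = 0" "?\<Gamma> (hs (x, v)) = 0" if "a \<le> \<bar>v\<bar>" for x v
  proof -
    have h: "Emax \<le> hs (x, v)" using that a by (intro hs_beyond) auto
    show "Gg (hs (x, v)) = 0" "Gm (hs (x, v)) = 0" using h by (simp_all add: Gg0 Gm0)
    show "?\<Gamma> (hs (x, v)) = 0" by (rule energy_primitive_zero[OF Gg Gg0 h order_refl]) 
  qed
  have "continuous_on (UNIV \<times> UNIV) (\<lambda>(y, v). Gm (hs (y, v)))"
    unfolding case_prod_unfold by (intro hs_comp_continuous[OF Gm] continuous_intros)
  from mean_zero_primitive_continuous[OF this]
  have cB: "continuous_on UNIV (\<lambda>z. ?B (fst z) (snd z))"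
    by (simp add: case_prod_unfold)
  have cBx: "continuous_on S (\<lambda>x. ?B x v)" for S v
    by (rule continuous_on_compose2[OF cB, of S "\<lambda>x. (x, v)", unfolded fst_conv snd_conv]) (intro continuous_intros, auto)
  note cc = hs_comp_continuous[OF Gg] hs_comp_continuous[OF Gm] hs_comp_continuous[OF c\<Gamma>] hs_comp_continuous[OF cF]
    continuous_on_compose2[OF Es(1)] continuous_on_compose2[OF level_mass_continuous] continuous_on_compose2[OF level_average_continuous] cB
  have c1: "continuous_on UNIV (\<lambda>z. Gg (hs (fst z, snd z)) * (Es (fst z) * ?B (fst z) (snd z)))"
    by (intro continuous_intros cc; auto)
  have c2: "continuous_on UNIV (\<lambda>z. Gg (hs (fst z, snd z)) * (snd z * level_mass (snd z)))"
    by (intro continuous_intros cc; auto)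
  have c3: "continuous_on UNIV (\<lambda>z. ?\<Gamma> (hs (fst z, snd z)) * (Gm (hs (fst z, snd z)) - level_average (snd z)))"
    by (intro continuous_intros cc; auto)
  have c4: "continuous_on UNIV (\<lambda>z. ?\<Gamma> (hs (fst z, snd z)) * level_average (snd z))"
    by (intro continuous_intros cc; auto)
  have c5: "continuous_on UNIV (\<lambda>z. Gg (hs (fst z, snd z)) * ?F (hs (fst z, snd z)))"
    by (intro continuous_intros cc; auto)
  have c6: "continuous_on UNIV (\<lambda>z. ?\<Gamma> (hs (fst z, snd z)) * Gm (hs (fst z, snd z)))"
    by (intro continuous_intros cc; auto)
  have c7: "continuous_on UNIV (\<lambda>z. Gg (hs (fst z, snd z)))"
    by (intro continuous_intros cc; auto)
  note p1 = phase_integral_compact[where a=a and F="\<lambda>x v. Gg (hs (x, v)) * (Es x * ?B x v)", OF c1]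
  note p2 = phase_integral_compact[where a=a and F="\<lambda>x v. Gg (hs (x, v)) * (v * level_mass v)", OF c2]
  note p3 = phase_integral_compact[where a=a and F="\<lambda>x v. ?\<Gamma> (hs (x, v)) * (Gm (hs (x, v)) - level_average v)", OF c3]
  note p4 = phase_integral_compact[where a=a and F="\<lambda>x v. ?\<Gamma> (hs (x, v)) * level_average v", OF c4]
  note p5 = phase_integral_compact[where a=a and F="\<lambda>x v. Gg (hs (x, v)) * ?F (hs (x, v))", OF c5]
  note p6 = phase_integral_compact[where a=a and F="\<lambda>x v. ?\<Gamma> (hs (x, v)) * Gm (hs (x, v))", OF c6]
  note p7 = phase_integral_compact[where a=a and F="\<lambda>x v. Gg (hs (x, v))", OF c7]
  have i1: "integral {0..1} (\<lambda>x. Gg (hs (x, v)) * (Es x * ?B x v)) = - integral {0..1} (\<lambda>x. ?\<Gamma> (hs (x, v)) * (Gm (hs (x, v)) - level_average v))" for v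
  proof -
    have cm: "continuous_on UNIV (\<lambda>y. Gm (hs (y, v)))" by (intro cc continuous_intros)
    have "((\<lambda>x. Gg (hs (x, v)) * (Es x * ?B x v) + ?\<Gamma> (hs (x, v)) * (Gm (hs (x, v)) - level_average v)) has_integral
       ?\<Gamma> (hs (1, v)) * ?B 1 v - ?\<Gamma> (hs (0, v)) * ?B 0 v) {0..1}"
    proof (rule fundamental_theorem_of_calculus)
      fix x :: real
      have "((\<lambda>x. ?\<Gamma> (hs (x, v)) * ?B x v) has_real_derivative
         ?\<Gamma> (hs (x, v)) * (Gm (hs (x, v)) - level_average v) + Gg (hs (x, v)) * Es x * ?B x v) (at x)"
        unfolding level_average_def
        by (rule DERIV_mult'[OF DERIV_chain2[OF energy_primitive_deriv[OF Gg] hs_deriv_fst] has_real_derivative_mean_zero_primitive[OF cm]])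
      then show "((\<lambda>x. ?\<Gamma> (hs (x, v)) * ?B x v) has_vector_derivative
         Gg (hs (x, v)) * (Es x * ?B x v) + ?\<Gamma> (hs (x, v)) * (Gm (hs (x, v)) - level_average v)) (at x within {0..1})"
        unfolding has_real_derivative_iff_has_vector_derivative[symmetric]
        by (rule has_field_derivative_at_within[OF DERIV_cong]) (simp add: algebra_simps)
    qed simp
    moreover have "?B 1 v = ?B 0 v"
      using mean_zero_primitive_periodic[OF cm, of 0] hs_periodic by simp
    ultimately have "integral {0..1} (\<lambda>x. Gg (hs (x, v)) * (Es x * ?B x v) + ?\<Gamma> (hs (x, v)) * (Gm (hs (x, v)) - level_average v)) = 0"
      by (simp add: integral_unique hs_periodic)
    moreover have "integral {0..1} (\<lambda>x. Gg (hs (x, v)) * (Es x * ?B x v) + ?\<Gamma> (hs (x, v)) * (Gm (hs (x, v)) - level_average v)) =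
       integral {0..1} (\<lambda>x. Gg (hs (x, v)) * (Es x * ?B x v)) + integral {0..1} (\<lambda>x. ?\<Gamma> (hs (x, v)) * (Gm (hs (x, v)) - level_average v))"
      by (intro integral_add integrable_continuous_interval continuous_intros cc(1-5) cBx) auto
    ultimately show ?thesis by simp
  qed
  have i2: "integral {-a..a} (\<lambda>v. Gg (hs (x, v)) * (v * level_mass v)) = - integral {-a..a} (\<lambda>v. ?\<Gamma> (hs (x, v)) * level_average v)" for x
  proof -
    have "((\<lambda>v. Gg (hs (x, v)) * (v * level_mass v) + ?\<Gamma> (hs (x, v)) * level_average v) has_integral
       ?\<Gamma> (hs (x, a)) * level_mass a - ?\<Gamma> (hs (x, -a)) * level_mass (-a)) {-a..a}"
    proof (rule fundamental_theorem_of_calculus)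
      fix v :: real
      have "((\<lambda>v. ?\<Gamma> (hs (x, v)) * level_mass v) has_real_derivative
         ?\<Gamma> (hs (x, v)) * level_average v + Gg (hs (x, v)) * v * level_mass v) (at v)"
        by (rule DERIV_mult'[OF DERIV_chain2[OF energy_primitive_deriv[OF Gg] hs_deriv_snd] level_mass_deriv])
      then show "((\<lambda>v. ?\<Gamma> (hs (x, v)) * level_mass v) has_vector_derivative
         Gg (hs (x, v)) * (v * level_mass v) + ?\<Gamma> (hs (x, v)) * level_average v) (at v within {-a..a})"
        unfolding has_real_derivative_iff_has_vector_derivative[symmetric]
        by (rule has_field_derivative_at_within[OF DERIV_cong]) (simp add: algebra_simps)
    qed (use a in simp)
    then have "integral {-a..a} (\<lambda>v. Gg (hs (x, v)) * (v * level_mass v) + ?\<Gamma> (hs (x, v)) * level_average v) = 0"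
      using z(3)[of a x] z(3)[of "-a" x] a by (simp add: integral_unique)
    moreover have "integral {-a..a} (\<lambda>v. Gg (hs (x, v)) * (v * level_mass v) + ?\<Gamma> (hs (x, v)) * level_average v) =
       integral {-a..a} (\<lambda>v. Gg (hs (x, v)) * (v * level_mass v)) + integral {-a..a} (\<lambda>v. ?\<Gamma> (hs (x, v)) * level_average v)"
      by (intro integral_add integrable_continuous_interval continuous_intros cc(1-7)) auto
    ultimately show ?thesis by simp
  qed
  have e1: "integral\<^sup>L phase (\<lambda>z. Gg (hs z) * (Es (fst z) * ?B (fst z) (snd z))) =
     - integral\<^sup>L phase (\<lambda>z. ?\<Gamma> (hs z) * (Gm (hs z) - level_average (snd z)))"
    using p1(3) p3(3) z by (simp add: i1)
  have e2: "integral\<^sup>L phase (\<lambda>z. Gg (hs z) * (snd z * level_mass (snd z))) = - integral\<^sup>L phase (\<lambda>z. ?\<Gamma> (hs z) * level_average (snd z))"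
    using p2(2) p4(2) z by (simp add: i2)
  have I: "integrable phase (\<lambda>z. Gg (hs z) * (Es (fst z) * ?B (fst z) (snd z)))"
    "integrable phase (\<lambda>z. Gg (hs z) * (snd z * level_mass (snd z)))"
    "integrable phase (\<lambda>z. ?\<Gamma> (hs z) * (Gm (hs z) - level_average (snd z)))"
    "integrable phase (\<lambda>z. ?\<Gamma> (hs z) * level_average (snd z))"
    "integrable phase (\<lambda>z. Gg (hs z) * ?F (hs z))" "integrable phase (\<lambda>z. ?\<Gamma> (hs z) * Gm (hs z))" "integrable phase (\<lambda>z. Gg (hs z))"
    using p1(1) p2(1) p3(1) p4(1) p5(1) p6(1) p7(1) z by simp_all
  let ?c = "integral {0..1} (\<lambda>y. ?F (hs (y, 0)))"
  have "integral\<^sup>L phase (\<lambda>z. Gg (hs z) * winding_rate Es (\<lambda>x v. Gm (hs (x, v))) (fst z) (snd z)) =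
     integral\<^sup>L phase (\<lambda>z. Gg (hs z) * ?F (hs z) - ?c * Gg (hs z) - Gg (hs z) * (Es (fst z) * ?B (fst z) (snd z)) - Gg (hs z) * (snd z * level_mass (snd z)))"
    unfolding steady_winding_rate by (intro Bochner_Integration.integral_cong) (auto simp: algebra_simps)
  also have "\<dots> = integral\<^sup>L phase (\<lambda>z. Gg (hs z) * ?F (hs z)) - ?c * integral\<^sup>L phase (\<lambda>z. Gg (hs z)) +
      integral\<^sup>L phase (\<lambda>z. ?\<Gamma> (hs z) * (Gm (hs z) - level_average (snd z))) + integral\<^sup>L phase (\<lambda>z. ?\<Gamma> (hs z) * level_average (snd z))"
    using I e1 e2 by simp
  finally have main: "integral\<^sup>L phase (\<lambda>z. Gg (hs z) * winding_rate Es (\<lambda>x v. Gm (hs (x, v))) (fst z) (snd z)) =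
      integral\<^sup>L phase (\<lambda>z. Gg (hs z) * ?F (hs z)) - ?c * integral\<^sup>L phase (\<lambda>z. Gg (hs z)) +
      integral\<^sup>L phase (\<lambda>z. ?\<Gamma> (hs z) * (Gm (hs z) - level_average (snd z))) + integral\<^sup>L phase (\<lambda>z. ?\<Gamma> (hs z) * level_average (snd z))" .
  have "integral\<^sup>L phase (\<lambda>z. ?\<Gamma> (hs z) * (Gm (hs z) - level_average (snd z))) + integral\<^sup>L phase (\<lambda>z. ?\<Gamma> (hs z) * level_average (snd z))
     = integral\<^sup>L phase (\<lambda>z. ?\<Gamma> (hs z) * Gm (hs z))"
    using Bochner_Integration.integral_add[OF I(3,4)] by (simp add: algebra_simps)
  then show ?thesis
    using main Bochner_Integration.integral_add[OF I(5,6)] by simp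
qed

end

end

section \<open>Energy levels with different mean winding rates\<close>

context vp_steady
begin

text \<open>A bump in the value of the steady state rather than in its energy, because values are
  what the nonlinear flow transports. The order of \<open>p\<close> and \<open>q\<close> flips since
  the profile is decreasing.\<close>

definition energy_bump :: "real \<Rightarrow> real \<Rightarrow> real \<Rightarrow> real" where
  "energy_bump p q h = bump (\<phi> q) (\<phi> p) (\<phi> h)"

lemma energy_bump_continuous: "continuous_on UNIV (energy_bump p q)"
  unfolding energy_bump_def
  by (rule continuous_on_compose2[OF bump_continuous profile_continuous]) auto

lemma energy_bump_nonneg: "0 \<le> energy_bump p q h"
  by (simp add: energy_bump_def bump_nonneg)

lemma energy_bump_eq_0_iff:
  assumes "p < q" "q < Emax"
  shows "energy_bump p q h = 0 \<longleftrightarrow> \<not> (p < h \<and> h < q)"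
proof -
  have "\<phi> q < \<phi> p" using assms by (intro profile_strict_antimono) auto
  moreover have "\<phi> q < \<phi> h \<longleftrightarrow> h < q"
    using profile_strict_antimono[of h q] profile_antimono[of q h] assms by (auto simp: not_less[symmetric])
  moreover have "\<phi> h < \<phi> p \<longleftrightarrow> p < h"
    using profile_strict_antimono[of p h] profile_antimono[of h p] assms by (auto simp: not_less[symmetric])
  ultimately show ?thesis unfolding energy_bump_def by (subst bump_eq_0_iff) auto
qed

lemma energy_bump_mass_pos:
  assumes "p < q" "q < Emax"
  shows "energy_primitive (energy_bump p q) p < 0"
proof -
  let ?G = "energy_bump p q"
  have "energy_primitive ?G q = 0"
    by (rule energy_primitive_zero[OF energy_bump_continuous, where b=q]) (use energy_bump_eq_0_iff[OF assms] assms in auto)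
  moreover have "0 < integral {p..q} ?G"
  proof (rule integral_positive)
    have "?G ((p + q) / 2) \<noteq> 0" using energy_bump_eq_0_iff[OF assms] assms by simp
    then show "0 < ?G ((p + q) / 2)" using energy_bump_nonneg[of p q "(p + q) / 2"] by simp
  qed (use assms energy_bump_nonneg continuous_on_subset[OF energy_bump_continuous] in auto)
  ultimately show ?thesis
    using primitive_diff_eq_integral(1)[OF energy_bump_continuous, of p q p q] assms by (simp add: energy_primitive_def)
qed

text \<open>At fixed \<open>x\<close> the energy has \<open>v\<close>-derivative \<open>v\<close>,
  so the integral of \<open>v\<close> times the bump over positive velocities equals
  \<open>T\<close>, whatever \<open>x\<close> is. On the support the speed lies between the two
  square roots. The factor 2 counts both signs of the velocity.\<close>

lemma energy_bump_fiber:
  assumes pq: "p < q" "q < Emax" and U: "U x < p" and a: "v0 < a"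
  defines "T \<equiv> - energy_primitive (energy_bump p q) p"
  defines "j \<equiv> integral {-a..a} (\<lambda>v. energy_bump p q (hs (x, v)))"
  shows "2 * T \<le> sqrt (2 * (q - U x)) * j" "sqrt (2 * (p - U x)) * j \<le> 2 * T"
proof -
  let ?G = "\<lambda>v. energy_bump p q (hs (x, v))"
  have a0: "0 < a" using a v0 by simp
  note nz = energy_bump_eq_0_iff[OF pq]
  have cG: "continuous_on S ?G" for S by (intro hs_comp_continuous[OF energy_bump_continuous] continuous_intros)
  have i: "(\<lambda>v. c * ?G v) integrable_on {0..a}" for c
    by (intro integrable_continuous_interval continuous_intros cG)
  have "((\<lambda>v. v * ?G v) has_integral energy_primitive (energy_bump p q) (hs (x, a)) - energy_primitive (energy_bump p q) (hs (x, 0))) {0..a}"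
  proof (rule fundamental_theorem_of_calculus)
    fix v
    have "((\<lambda>v. energy_primitive (energy_bump p q) (hs (x, v))) has_real_derivative ?G v * v) (at v)"
      by (rule DERIV_chain2[OF energy_primitive_deriv[OF energy_bump_continuous] hs_deriv_snd])
    then show "((\<lambda>v. energy_primitive (energy_bump p q) (hs (x, v))) has_vector_derivative v * ?G v) (at v within {0..a})"
      unfolding has_real_derivative_iff_has_vector_derivative[symmetric]
      by (rule has_field_derivative_at_within[OF DERIV_cong]) simp
  qed (use a0 in simp)
  moreover have "energy_primitive (energy_bump p q) (hs (x, a)) = 0"
    by (rule energy_primitive_zero[OF energy_bump_continuous, where b=Emax]) (use nz pq a a0 hs_beyond[of a x] in auto)
  moreover have "energy_primitive (energy_bump p q) (hs (x, 0)) = energy_primitive (energy_bump p q) p"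
    by (rule energy_primitive_const[OF energy_bump_continuous]) (use nz U in \<open>auto simp: hs_def\<close>)
  ultimately have T: "integral {0..a} (\<lambda>v. v * ?G v) = T" "(\<lambda>v. v * ?G v) integrable_on {0..a}"
    by (auto simp: T_def integral_unique)
  have j: "j = 2 * integral {0..a} ?G"
  proof -
    have "integral {-a..0} ?G + integral {0..a} ?G = j"
      unfolding j_def using a0 by (intro Henstock_Kurzweil_Integration.integral_combine integrable_continuous_interval cG) auto
    moreover have "integral {-a..0} ?G = integral {0..a} ?G"
      using Henstock_Kurzweil_Integration.integral_reflect_real[of a 0 ?G] by (simp add: hs_def)
    ultimately show ?thesis by simp
  qed
  have "T \<le> integral {0..a} (\<lambda>v. sqrt (2 * (q - U x)) * ?G v)"
    unfolding T(1)[symmetric]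
  proof (rule integral_le[OF T(2) i])
    fix v assume v: "v \<in> {0..a}"
    show "v * ?G v \<le> sqrt (2 * (q - U x)) * ?G v"
    proof (cases "?G v = 0")
      case False
      then have "v\<^sup>2 / 2 + U x < q" using nz[of "hs (x, v)"] by (simp add: hs_def)
      then have "v\<^sup>2 \<le> 2 * (q - U x)" by simp
      then have "v \<le> sqrt (2 * (q - U x))" by (rule real_le_rsqrt)
      then show ?thesis by (intro mult_right_mono energy_bump_nonneg)
    next
      case True
      show ?thesis unfolding True by simp
    qed
  qed
  then show "2 * T \<le> sqrt (2 * (q - U x)) * j" by (simp add: j)
  have "integral {0..a} (\<lambda>v. sqrt (2 * (p - U x)) * ?G v) \<le> T"
    unfolding T(1)[symmetric]
  proof (rule integral_le[OF i T(2)])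
    fix v assume v: "v \<in> {0..a}"
    show "sqrt (2 * (p - U x)) * ?G v \<le> v * ?G v"
    proof (cases "?G v = 0")
      case False
      then have "p < v\<^sup>2 / 2 + U x" using nz[of "hs (x, v)"] by (simp add: hs_def)
      then have "2 * (p - U x) \<le> v\<^sup>2" by simp
      then have "sqrt (2 * (p - U x)) \<le> v" using v by (intro real_le_lsqrt) auto
      then show ?thesis by (intro mult_right_mono energy_bump_nonneg)
    next
      case True
      show ?thesis unfolding True by simp
    qed
  qed
  then show "sqrt (2 * (p - U x)) * j \<le> 2 * T" by (simp add: j)
qed

lemma energy_bump_phase_integral:
  assumes pq: "p < q" "q < Emax"
  shows "integral\<^sup>L phase (\<lambda>z. energy_bump p q (hs z)) = integral {0..1} (\<lambda>x. integral {-(v0+1)..v0+1} (\<lambda>v. energy_bump p q (hs (x, v))))"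
    and "continuous_on S (\<lambda>x. integral {-(v0+1)..v0+1} (\<lambda>v. energy_bump p q (hs (x, v))))"
proof -
  have c: "continuous_on UNIV (\<lambda>z. energy_bump p q (hs (fst z, snd z)))"
    by (intro hs_comp_continuous[OF energy_bump_continuous] continuous_intros)
  have "energy_bump p q (hs (x, v)) = 0" if "v0 + 1 < \<bar>v\<bar>" for x v
    using energy_bump_eq_0_iff[OF pq] hs_beyond[of v x] that pq by auto
  from phase_integral_compact(2)[where F="\<lambda>x v. energy_bump p q (hs (x, v))", OF c this]
  show "integral\<^sup>L phase (\<lambda>z. energy_bump p q (hs z)) = integral {0..1} (\<lambda>x. integral {-(v0+1)..v0+1} (\<lambda>v. energy_bump p q (hs (x, v))))"
    by simp
  have "continuous_on (S \<times> cbox (-(v0+1)) (v0+1)) (\<lambda>(x, v). energy_bump p q (hs (x, v)))"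
    unfolding case_prod_unfold by (intro hs_comp_continuous[OF energy_bump_continuous] continuous_intros)
  from integral_continuous_on_param[OF this]
  show "continuous_on S (\<lambda>x. integral {-(v0+1)..v0+1} (\<lambda>v. energy_bump p q (hs (x, v))))" by simp
qed

lemma energy_bump_phase_pos:
  assumes pq: "p < q" "q < Emax" and U: "\<And>x. U x < p"
  shows "0 < integral\<^sup>L phase (\<lambda>z. energy_bump p q (hs z))"
proof -
  have pos: "0 < integral {-(v0+1)..v0+1} (\<lambda>v. energy_bump p q (hs (x, v)))" for x
  proof -
    have "0 < sqrt (2 * (q - U x)) * integral {-(v0+1)..v0+1} (\<lambda>v. energy_bump p q (hs (x, v)))"
      using energy_bump_fiber(1)[OF pq U, of "v0 + 1" x] energy_bump_mass_pos[OF pq] by simp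
    moreover have "0 < sqrt (2 * (q - U x))" using U[of x] pq by simp
    ultimately show ?thesis by (simp add: zero_less_mult_iff)
  qed
  show ?thesis
    unfolding energy_bump_phase_integral(1)[OF pq]
    by (rule integral_positive[of 0 1 _ 0, OF energy_bump_phase_integral(2)[OF pq]])
      (use pos less_imp_le[OF pos] in simp_all)
qed

text \<open>The two test functions live on energy levels below and above those carrying \<open>\<mu>\<close>; all levels are
  passing. The gap is positive because the transit time decreases with the energy.\<close>

lemma ex_separating_levels:
  obtains e1 e2 e3 e4 e5 e6 where "e1 < e2" "e2 < Emax" "e3 < e4" "e4 < Emax" "e5 < e6" "e6 < Emax"
    "0 < integral\<^sup>L phase (\<lambda>z. energy_bump e5 e6 (hs z)) * integral\<^sup>L phase (\<lambda>z. energy_bump e1 e2 (hs z) * winding_rate Es (\<lambda>x v. energy_bump e3 e4 (hs (x, v))) (fst z) (snd z))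
      - integral\<^sup>L phase (\<lambda>z. energy_bump e1 e2 (hs z)) * integral\<^sup>L phase (\<lambda>z. energy_bump e5 e6 (hs z) * winding_rate Es (\<lambda>x v. energy_bump e3 e4 (hs (x, v))) (fst z) (snd z))"
proof -
  have "\<exists>x0\<in>{0..1}. \<forall>y\<in>{0..1}. U y \<le> U x0"
    by (intro continuous_attains_sup continuous_on_subset[OF U(3)]) auto
  then obtain x0 where x0: "\<And>y. y \<in> {0..1} \<Longrightarrow> U y \<le> U x0" by blast
  have Ux0: "U y \<le> U x0" for y
    using x0[of "frac y"] periodic_frac[of U y] U(2) frac_lt_1[of y] by (simp add: less_imp_le)
  \<comment> \<open>Seven equal steps from the maximum of the potential to \<open>Emax\<close> leave
    room for six levels strictly in between.\<close>
  define d where "d = (Emax - U x0) / 7"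
  have d: "0 < d" using U_less_Emax[of x0] by (simp add: d_def)
  have Ed: "Emax = U x0 + 7 * d" unfolding d_def by (simp only: times_divide_eq_right nonzero_mult_div_cancel_left)
  define e where "e i = U x0 + real i * d" for i :: nat
  have e: "e 1 < e 2" "e 2 < e 3" "e 3 < e 4" "e 4 < e 5" "e 5 < e 6" "e 6 < Emax" "U y < e 1" for y
    using d Ux0[of y] by (auto simp: e_def Ed)
  have U1: "U y < e 3" "U y < e 5" for y using e by (meson less_trans)+
  have p1: "e 1 < e 2" "e 2 < Emax" and p2: "e 3 < e 4" "e 4 < Emax" and p3: "e 5 < e 6" "e 6 < Emax"
    using e by linarith+
  let ?G1 = "energy_bump (e 1) (e 2)" and ?Gm = "energy_bump (e 3) (e 4)" and ?G2 = "energy_bump (e 5) (e 6)"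
  note z1 = energy_bump_eq_0_iff[OF p1] and zm = energy_bump_eq_0_iff[OF p2] and z2 = energy_bump_eq_0_iff[OF p3]
  have b1: "?G1 h = 0" "?Gm h = 0" "?G2 h = 0" if "Emax \<le> h" for h using z1 zm z2 that e by auto
  define \<beta>1 \<beta>m \<beta>2 where "\<beta>1 = integral\<^sup>L phase (\<lambda>z. ?G1 (hs z))" and "\<beta>m = integral\<^sup>L phase (\<lambda>z. ?Gm (hs z))"
    and "\<beta>2 = integral\<^sup>L phase (\<lambda>z. ?G2 (hs z))"
  define Tm T2 where "Tm = - energy_primitive ?Gm (e 3)" and "T2 = - energy_primitive ?G2 (e 5)"
  have T: "0 < Tm" "0 < T2" using energy_bump_mass_pos[OF p2] energy_bump_mass_pos[OF p3] by (auto simp: Tm_def T2_def)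
  \<comment> \<open>The supports are disjoint and ordered by energy. On a lower support the
    primitive of a higher bump is constant, minus its mass; on a higher support the primitive of a
    lower bump is zero. This evaluates all four products in \<open>steady_average\<close>.\<close>
  have F1: "?G1 h * energy_primitive ?Gm h = - Tm * ?G1 h" for h
  proof (cases "?G1 h = 0")
    case False
    then have "h \<le> e 3" using z1 e by auto
    then have "energy_primitive ?Gm h = energy_primitive ?Gm (e 3)"
      by (intro energy_primitive_const energy_bump_continuous) (use zm in auto)
    then show ?thesis by (simp add: Tm_def)
  qed simp
  have \<Gamma>1: "energy_primitive ?G1 h * ?Gm h = 0" for h
  proof (cases "?Gm h = 0")
    case False
    then have "e 2 \<le> h" using zm[of h] e by auto
    then have "energy_primitive ?G1 h = 0"
      by (intro energy_primitive_zero[OF energy_bump_continuous, where b="e 2"]) (use z1 p1 in auto)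
    then show ?thesis by simp
  qed simp
  have F2: "?G2 h * energy_primitive ?Gm h = 0" for h
  proof (cases "?G2 h = 0")
    case False
    then have "e 4 \<le> h" using z2[of h] e by auto
    then have "energy_primitive ?Gm h = 0"
      by (intro energy_primitive_zero[OF energy_bump_continuous, where b="e 4"]) (use zm p2 in auto)
    then show ?thesis by simp
  qed simp
  have \<Gamma>2: "energy_primitive ?G2 h * ?Gm h = - T2 * ?Gm h" for h
  proof (cases "?Gm h = 0")
    case False
    then have "h \<le> e 5" using zm[of h] e by auto
    then have "energy_primitive ?G2 h = energy_primitive ?G2 (e 5)"
      by (intro energy_primitive_const energy_bump_continuous) (use z2 in auto)
    then show ?thesis by (simp add: T2_def)
  qed simp
  define c where "c = integral {0..1} (\<lambda>y. energy_primitive ?Gm (hs (y, 0)))"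
  have A1: "integral\<^sup>L phase (\<lambda>z. ?G1 (hs z) * winding_rate Es (\<lambda>x v. ?Gm (hs (x, v))) (fst z) (snd z)) = - Tm * \<beta>1 - c * \<beta>1"
    using steady_average[OF energy_bump_continuous b1(2) energy_bump_continuous b1(1)]
    unfolding F1 \<Gamma>1 c_def \<beta>1_def by simp
  have A2: "integral\<^sup>L phase (\<lambda>z. ?G2 (hs z) * winding_rate Es (\<lambda>x v. ?Gm (hs (x, v))) (fst z) (snd z)) = - T2 * \<beta>m - c * \<beta>2"
    using steady_average[OF energy_bump_continuous b1(2) energy_bump_continuous b1(3)]
    unfolding F2 \<Gamma>2 c_def \<beta>2_def \<beta>m_def by simp
  have \<beta>1: "0 < \<beta>1" unfolding \<beta>1_def by (rule energy_bump_phase_pos[OF p1 e(7)])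
  define jm j2 where "jm x = integral {-(v0+1)..v0+1} (\<lambda>v. ?Gm (hs (x, v)))"
    and "j2 x = integral {-(v0+1)..v0+1} (\<lambda>v. ?G2 (hs (x, v)))" for x
  have cj: "continuous_on S jm" "continuous_on S j2" for S
    unfolding jm_def[abs_def] j2_def[abs_def] by (intro energy_bump_phase_integral(2) p2 p3)+
  \<comment> \<open>By \<open>energy_bump_fiber\<close> the fibre mass of the middle bump is at
    least \<open>2 * Tm / r\<close>, that of the top bump at most \<open>2 * T2 / s\<close>, and
    \<open>r < s\<close>: relative to their mass, particles of higher energy spend less time over
    each \<open>x\<close>.\<close>
  have pos: "0 < T2 * jm x - Tm * j2 x" for x
  proof -
    define r s where "r = sqrt (2 * (e 4 - U x))" and "s = sqrt (2 * (e 5 - U x))"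
    have rs: "0 < r" "r < s"
      using U1(1)[of x] e(3,4) by (auto simp: r_def s_def)
    have "2 * Tm \<le> r * jm x" unfolding Tm_def r_def jm_def by (rule energy_bump_fiber[OF p2 U1(1)]) simp
    then have 1: "T2 * (2 * Tm / r) \<le> T2 * jm x" using rs T by (intro mult_left_mono) (auto simp: field_simps)
    have "s * j2 x \<le> 2 * T2" unfolding T2_def s_def j2_def by (rule energy_bump_fiber[OF p3 U1(2)]) simp
    then have 2: "Tm * j2 x \<le> Tm * (2 * T2 / s)" using rs T by (intro mult_left_mono) (auto simp: field_simps)
    have "2 * T2 * Tm / s < 2 * T2 * Tm / r" using rs T by (intro divide_strict_left_mono) auto
    then show ?thesis using 1 2 by (simp add: mult_ac)
  qed
  have "0 < integral {0..1} (\<lambda>x. T2 * jm x - Tm * j2 x)"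
    by (rule integral_positive[of _ _ _ 0]) (use pos in \<open>auto intro!: continuous_intros cj simp: less_imp_le\<close>)
  also have "integral {0..1} (\<lambda>x. T2 * jm x - Tm * j2 x) = T2 * \<beta>m - Tm * \<beta>2"
    unfolding \<beta>m_def \<beta>2_def energy_bump_phase_integral(1)[OF p2] energy_bump_phase_integral(1)[OF p3] jm_def[symmetric] j2_def[symmetric]
    by (subst integral_diff) (auto intro!: integrable_continuous_interval continuous_intros cj)
  \<comment> \<open>The constant \<open>c\<close> enters both averages in the same proportion to
    \<open>\<beta>1\<close> and \<open>\<beta>2\<close>, so it drops out of the determinant.\<close>
  finally have "0 < \<beta>1 * (T2 * \<beta>m - Tm * \<beta>2)" using \<beta>1 by simp
  also have "\<dots> = \<beta>2 * (- Tm * \<beta>1 - c * \<beta>1) - \<beta>1 * (- T2 * \<beta>m - c * \<beta>2)" by (simp add: algebra_simps)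
  finally show ?thesis
    by (intro that[OF p1 p2 p3]) (simp only: A1 A2 \<beta>1_def[symmetric] \<beta>2_def[symmetric])
qed

end

section \<open>The winding function\<close>

text \<open>\<open>\<psi>\<close> picks out a range of values of \<open>f\<close>. The bound
  \<open>C\<close> makes the coefficient of dv in the one-form bounded; the linear bound
  \<open>L\<close> makes \<mu> integrable, with mass at most \<open>L\<close>, and so bounds the
  coefficient of dx.\<close>

locale vp_winding = vp_flow \<rho> f fx fv ft \<Phi> D for \<rho> f fx fv ft \<Phi> D +
  fixes \<psi> \<psi>' :: "real \<Rightarrow> real" and C L :: real
  assumes psi_deriv: "(\<psi> has_real_derivative \<psi>' s) (at s)" and psi_deriv_continuous: "continuous_on UNIV \<psi>'"
    and psi_nonneg: "0 \<le> \<psi> s" and psi_bounded: "\<psi> s \<le> C" and psi_linear: "0 \<le> s \<Longrightarrow> \<psi> s \<le> L * s"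
begin

lemma psi_continuous: "continuous_on UNIV \<psi>"
  using psi_deriv by (intro continuous_at_imp_continuous_on) (auto intro: DERIV_isCont)

lemma psi_measurable: "\<psi> \<in> borel_measurable borel"
  using psi_continuous by (rule borel_measurable_continuous_onI)

definition \<mu> :: "real \<Rightarrow> real \<Rightarrow> real \<Rightarrow> real" where "\<mu> x v t = \<psi> (f x v t)"
definition \<mu>x :: "real \<Rightarrow> real \<Rightarrow> real \<Rightarrow> real" where "\<mu>x x v t = \<psi>' (f x v t) * fx x v t"
definition \<mu>v :: "real \<Rightarrow> real \<Rightarrow> real \<Rightarrow> real" where "\<mu>v x v t = \<psi>' (f x v t) * fv x v t"
definition \<mu>t :: "real \<Rightarrow> real \<Rightarrow> real \<Rightarrow> real" where "\<mu>t x v t = \<psi>' (f x v t) * ft x v t"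

lemma C_L_nonneg: "0 \<le> C" "0 \<le> L"
  using psi_nonneg[of 0] psi_bounded[of 0] psi_nonneg[of 1] psi_linear[of 1] by linarith+

lemma mu_phase_integrable: "0 \<le> t \<Longrightarrow> integrable phase (\<lambda>z. \<mu> (fst z) (snd z) t)"
  and mu_phase_integral_le: "0 \<le> t \<Longrightarrow> integral\<^sup>L phase (\<lambda>z. \<mu> (fst z) (snd z) t) \<le> L"
proof -
  assume t: "0 \<le> t"
  have le: "\<mu> x v t \<le> L * f x v t" for x v unfolding \<mu>_def by (rule psi_linear[OF f_nonneg[OF t]])
  have i: "integrable phase (\<lambda>z. L * f (fst z) (snd z) t)" by (rule integrable_mult_right[OF f_phase_integrable[OF t]])
  show *: "integrable phase (\<lambda>z. \<mu> (fst z) (snd z) t)"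
  proof (rule Bochner_Integration.integrable_bound[OF i])
    show "(\<lambda>z. \<mu> (fst z) (snd z) t) \<in> borel_measurable phase"
      unfolding measurable_phase \<mu>_def using measurable_comp[OF f_measurable[OF t] psi_measurable] by (simp add: o_def)
    show "AE z in phase. norm (\<mu> (fst z) (snd z) t) \<le> norm (L * f (fst z) (snd z) t)"
    proof (rule AE_I2)
      fix z :: "real \<times> real"
      show "norm (\<mu> (fst z) (snd z) t) \<le> norm (L * f (fst z) (snd z) t)"
        using le[of "fst z" "snd z"] psi_nonneg[of "f (fst z) (snd z) t"] by (simp add: \<mu>_def)
    qed
  qed
  have "integral\<^sup>L phase (\<lambda>z. \<mu> (fst z) (snd z) t) \<le> integral\<^sup>L phase (\<lambda>z. L * f (fst z) (snd z) t)"
    by (rule integral_mono[OF * i le])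
  then show "integral\<^sup>L phase (\<lambda>z. \<mu> (fst z) (snd z) t) \<le> L"
    using mass_f[OF t] by simp
qed

lemma mu_cont:
  assumes "continuous_on S x" "continuous_on S v" "continuous_on S t" "\<And>z. z \<in> S \<Longrightarrow> 0 \<le> t z"
  shows "continuous_on S (\<lambda>z. \<mu> (x z) (v z) (t z))" "continuous_on S (\<lambda>z. \<mu>x (x z) (v z) (t z))"
    "continuous_on S (\<lambda>z. \<mu>v (x z) (v z) (t z))" "continuous_on S (\<lambda>z. \<mu>t (x z) (v z) (t z))"
proof -
  have c: "continuous_on S (\<lambda>z. \<psi> (f (x z) (v z) (t z)))" "continuous_on S (\<lambda>z. \<psi>' (f (x z) (v z) (t z)))"
    by (rule continuous_on_compose2[OF psi_continuous] continuous_on_compose2[OF psi_deriv_continuous]; use assms in \<open>auto intro!: f_cont\<close>)+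
  show "continuous_on S (\<lambda>z. \<mu> (x z) (v z) (t z))" unfolding \<mu>_def by (rule c)
  show "continuous_on S (\<lambda>z. \<mu>x (x z) (v z) (t z))" "continuous_on S (\<lambda>z. \<mu>v (x z) (v z) (t z))"
    "continuous_on S (\<lambda>z. \<mu>t (x z) (v z) (t z))"
    unfolding \<mu>x_def \<mu>v_def \<mu>t_def by (intro continuous_intros c f_cont assms; assumption)+
qed

lemma mu_transport: "0 \<le> t \<Longrightarrow> \<mu>t x v t + v * \<mu>x x v t - E x t * \<mu>v x v t = 0"
proof -
  assume t: "0 \<le> t"
  have "\<mu>t x v t + v * \<mu>x x v t - E x t * \<mu>v x v t = \<psi>' (f x v t) * (ft x v t + v * fx x v t - E x t * fv x v t)"
    by (simp add: \<mu>t_def \<mu>x_def \<mu>v_def algebra_simps)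
  then show ?thesis using vlasov[OF t] by simp
qed

lemma mu_average:
  assumes t: "0 \<le> t"
  shows "integrable lborel (\<lambda>v. integral {0..1} (\<lambda>x. \<mu> x v t))" "(LBINT v. integral {0..1} (\<lambda>x. \<mu> x v t)) \<le> L"
proof -
  have "continuous_on {0..1} (\<lambda>x. \<mu> (fst (x, v)) (snd (x, v)) t)" for v
    unfolding fst_conv snd_conv using t by (intro mu_cont continuous_intros)
  from integral_phase_swap[OF mu_phase_integrable[OF t] this] mu_phase_integral_le[OF t]
  show "integrable lborel (\<lambda>v. integral {0..1} (\<lambda>x. \<mu> x v t))" "(LBINT v. integral {0..1} (\<lambda>x. \<mu> x v t)) \<le> L"
    by auto
qed

sublocale wind: transported_density \<mu> \<mu>x \<mu>v \<mu>t "\<lambda>x t. electric_field \<rho> (\<lambda>y v. f y v t) x"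
proof
  show "((\<lambda>x. \<mu> x v t) has_real_derivative \<mu>x x v t) (at x)" "((\<lambda>v. \<mu> x v t) has_real_derivative \<mu>v x v t) (at v)"
    "((\<lambda>t. \<mu> x v t) has_real_derivative \<mu>t x v t) (at t within {0..})" if "0 \<le> t" for x v t
    unfolding \<mu>_def \<mu>x_def \<mu>v_def \<mu>t_def
    by (rule DERIV_chain2[OF psi_deriv] dfx dfv dft that)+
  show "continuous_on (UNIV \<times> UNIV \<times> {0..}) (\<lambda>(x, v, t). \<mu>x x v t)" "continuous_on (UNIV \<times> UNIV \<times> {0..}) (\<lambda>(x, v, t). \<mu>v x v t)"
    "continuous_on (UNIV \<times> UNIV \<times> {0..}) (\<lambda>(x, v, t). \<mu>t x v t)" "continuous_on (UNIV \<times> UNIV \<times> {0..}) (\<lambda>(x, v, t). \<mu> x v t)"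
    unfolding case_prod_unfold by (intro mu_cont continuous_intros; auto)+
  show "continuous_on ({0..1} \<times> {0..}) (\<lambda>(x, t). E x t)"
    by (rule continuous_on_subset[OF E_continuous]) auto
  show "\<exists>C. \<forall>s\<in>{0..T}. integrable lborel (\<lambda>v. integral {0..1} (\<lambda>x. \<mu> x v s)) \<and> (LBINT v. integral {0..1} (\<lambda>x. \<mu> x v s)) \<le> C" for T
    using mu_average by (intro exI[of _ L]) auto
qed (use mu_transport psi_nonneg f_periodic in \<open>auto simp: \<mu>_def\<close>)

lemma E_cont:
  assumes "continuous_on S x" "continuous_on S t" "\<And>z. z \<in> S \<Longrightarrow> 0 \<le> t z"
  shows "continuous_on S (\<lambda>z. E (x z) (t z))"
  using assms by (auto intro!: continuous_on_compose_2[OF E_continuous])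

lemma mu_continuous_at: "0 \<le> t \<Longrightarrow> continuous_on S (\<lambda>y. \<mu> y v t)" "0 \<le> t \<Longrightarrow> continuous_on S (\<lambda>y. \<mu>v y v t)"
  "0 \<le> t \<Longrightarrow> continuous_on S (\<lambda>y. \<mu>x y v t)" "0 \<le> t \<Longrightarrow> continuous_on S (\<lambda>y. E y t)"
  by (intro mu_cont E_cont continuous_intros; assumption)+

definition B :: "real \<Rightarrow> real \<Rightarrow> real \<Rightarrow> real" where "B x v t = mean_zero_primitive (\<lambda>y. \<mu> y v t) x"
definition Bv :: "real \<Rightarrow> real \<Rightarrow> real \<Rightarrow> real" where "Bv x v t = mean_zero_primitive (\<lambda>y. \<mu>v y v t) x"
definition EBv :: "real \<Rightarrow> real \<Rightarrow> real \<Rightarrow> real" where "EBv x v t = mean_zero_primitive (\<lambda>y. E y t * \<mu>v y v t) x"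
definition EB :: "real \<Rightarrow> real \<Rightarrow> real \<Rightarrow> real" where "EB x v t = mean_zero_primitive (\<lambda>y. E y t * \<mu> y v t) x"
definition m :: "real \<Rightarrow> real \<Rightarrow> real" where "m v t = (LBINT w:{..v}. wind.average w t)"

lemma mzp_cont:
  assumes w: "continuous_on (UNIV \<times> (UNIV \<times> {0..})) (\<lambda>(y, p). w y (fst p) (snd p))"
    and "continuous_on S x" "continuous_on S v" "continuous_on S t" "\<And>z. z \<in> S \<Longrightarrow> 0 \<le> t z"
  shows "continuous_on S (\<lambda>z. mean_zero_primitive (\<lambda>y. w y (v z) (t z)) (x z))"
  by (rule continuous_on_compose2[OF mean_zero_primitive_continuous[OF w, unfolded case_prod_unfold],
        of S "\<lambda>z. (x z, v z, t z)", unfolded fst_conv snd_conv]) (use assms in \<open>auto intro!: continuous_on_Pair\<close>)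

lemma B_cont:
  assumes "continuous_on S x" "continuous_on S v" "continuous_on S t" "\<And>z. z \<in> S \<Longrightarrow> 0 \<le> t z"
  shows "continuous_on S (\<lambda>z. B (x z) (v z) (t z))" "continuous_on S (\<lambda>z. Bv (x z) (v z) (t z))"
    "continuous_on S (\<lambda>z. EBv (x z) (v z) (t z))" "continuous_on S (\<lambda>z. EB (x z) (v z) (t z))"
  unfolding B_def Bv_def EBv_def EB_def case_prod_unfold
  by (rule mzp_cont[OF _ assms]; auto intro!: mu_cont E_cont continuous_intros simp: case_prod_unfold)+

lemma B_dx: "0 \<le> t \<Longrightarrow> ((\<lambda>x. B x v t) has_real_derivative \<mu> x v t - wind.average v t) (at x)"
  unfolding B_def wind.average_def by (rule has_real_derivative_mean_zero_primitive[OF mu_continuous_at(1)])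

lemma EB_dx: "0 \<le> t \<Longrightarrow> ((\<lambda>x. EB x v t) has_real_derivative E x t * \<mu> x v t - wind.flux v t) (at x)"
  unfolding EB_def wind.flux_def
  by (rule has_real_derivative_mean_zero_primitive) (intro continuous_intros mu_continuous_at)

lemma B_dv: "0 \<le> t \<Longrightarrow> ((\<lambda>v. B x v t) has_real_derivative Bv x v t) (at v)"
  unfolding B_def Bv_def
  by (rule mean_zero_primitive_param_deriv[where U=UNIV and w="\<lambda>y v. \<mu> y v t" and wp="\<lambda>y v. \<mu>v y v t"])
    (auto intro!: wind.dv mu_cont continuous_intros simp: case_prod_unfold)

lemma EB_dv:
  assumes t: "0 \<le> t"
  shows "((\<lambda>v. EB x v t) has_real_derivative EBv x v t) (at v)"
  unfolding EB_def EBv_def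
proof (rule mean_zero_primitive_param_deriv[where U=UNIV and w="\<lambda>y v. E y t * \<mu> y v t" and wp="\<lambda>y v. E y t * \<mu>v y v t"])
  show "((\<lambda>v. E y t * \<mu> y v t) has_real_derivative E y t * \<mu>v y v t) (at v)" for y v
    by (rule DERIV_cmult[OF wind.dv[OF t]])
qed (use t in \<open>auto intro!: mu_cont E_cont continuous_intros simp: case_prod_unfold\<close>)

text \<open>The transport equation is put under the mean-zero primitive; the primitive of the
  \<open>x\<close>-derivative of \<mu> is \<mu> minus its spatial average.\<close>

lemma B_dt:
  assumes t: "0 \<le> t"
  shows "((\<lambda>t. B x v t) has_real_derivative EBv x v t - v * (\<mu> x v t - wind.average v t)) (at t within {0..})"
proof -
  have d: "((\<lambda>t. B x v t) has_real_derivative mean_zero_primitive (\<lambda>y. \<mu>t y v t) x) (at t within {0..})"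
    unfolding B_def
    by (rule mean_zero_primitive_param_deriv[where w="\<lambda>y t. \<mu> y v t" and wp="\<lambda>y t. \<mu>t y v t"])
      (use t wind.dt in \<open>auto intro!: mu_cont continuous_intros simp: case_prod_unfold\<close>)
  have "(\<lambda>y. \<mu>t y v t) = (\<lambda>y. E y t * \<mu>v y v t - v * \<mu>x y v t)"
    using mu_transport[OF t, of _ v] by (auto simp: algebra_simps)
  then have "mean_zero_primitive (\<lambda>y. \<mu>t y v t) x = EBv x v t - mean_zero_primitive (\<lambda>y. v * \<mu>x y v t) x"
    unfolding EBv_def by (simp only:) (intro mean_zero_primitive_diff continuous_intros mu_continuous_at t)
  also have "mean_zero_primitive (\<lambda>y. v * \<mu>x y v t) x = v * \<mu> x v t - integral {0..1} (\<lambda>y. v * \<mu> y v t)"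
  proof (rule mean_zero_primitive_deriv)
    show "((\<lambda>y. v * \<mu> y v t) has_real_derivative v * \<mu>x y v t) (at y)" for y
      by (rule DERIV_cmult[OF wind.dx[OF t]])
    show "v * \<mu> 1 v t = v * \<mu> 0 v t" using wind.periodic[OF t, of 0 v] by simp
  qed (intro continuous_intros mu_continuous_at t)
  finally have "mean_zero_primitive (\<lambda>y. \<mu>t y v t) x = EBv x v t - v * (\<mu> x v t - wind.average v t)"
    by (simp add: wind.average_def algebra_simps)
  with d show ?thesis by simp
qed

lemma average_continuous_at: "0 \<le> t \<Longrightarrow> continuous_on S (\<lambda>v. wind.average v t)"
  by (intro wind.cont_average continuous_intros) auto

lemma m_dv: "0 \<le> t \<Longrightarrow> ((\<lambda>v. m v t) has_real_derivative wind.average v t) (at v)"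
  unfolding m_def by (rule LBINT_atMost_deriv[OF average_continuous_at wind.average_integrable])

lemma m_dt:
  assumes t: "0 \<le> t"
  shows "((\<lambda>t. m v t) has_real_derivative wind.flux v t) (at t within {0..})"
proof -
  \<comment> \<open>The flux is frozen at its initial value for negative times, so that the
    antiderivative on the whole line applies.\<close>
  have c: "continuous_on UNIV (\<lambda>s. wind.flux v (max 0 s))"
    by (intro wind.cont_flux continuous_intros) auto
  have eq: "m v s = m v 0 + primitive (\<lambda>s. wind.flux v (max 0 s)) s" if s: "0 \<le> s" for s
  proof -
    have "primitive (\<lambda>s. wind.flux v (max 0 s)) s = integral {0..s} (\<lambda>s. wind.flux v (max 0 s))"
      by (rule primitive_eq_integral[OF c s])
    also have "\<dots> = wind.flow_through v s"
      unfolding wind.flow_through_def by (intro Henstock_Kurzweil_Integration.integral_cong) simp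
    finally show ?thesis using wind.flow_through_eq[OF s, of v] by (simp add: m_def)
  qed
  have d: "((\<lambda>s. m v 0 + primitive (\<lambda>s. wind.flux v (max 0 s)) s) has_derivative (*) (wind.flux v t)) (at t within {0..})"
    using has_field_derivative_at_within[OF DERIV_add[OF DERIV_const has_real_derivative_primitive[OF c, of t]], of "m v 0" "{0..}"] t
    by (simp add: has_field_derivative_def)
  show ?thesis unfolding has_field_derivative_def
  proof (rule has_derivative_transform[OF _ _ d])
    show "t \<in> {0..}" using t by simp
    show "m v s = m v 0 + primitive (\<lambda>s. wind.flux v (max 0 s)) s" if "s \<in> {0..}" for s
      by (rule eq) (use that in simp)
  qed
qed

lemma m_continuous: "continuous_on (UNIV \<times> UNIV \<times> {0..}) (\<lambda>(x :: real, v, t). m v t)"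
proof (rule continuous_on_partials_real3[where F="\<lambda>x. m" and Fx="\<lambda>x v t. 0" and Fv="\<lambda>x. wind.average" and Ft="\<lambda>x. wind.flux"])
  show "continuous_on (UNIV \<times> UNIV \<times> {0..}) (\<lambda>(x :: real, y, z). wind.average y z)"
    "continuous_on (UNIV \<times> UNIV \<times> {0..}) (\<lambda>(x :: real, y, z). wind.flux y z)"
    unfolding case_prod_unfold by (intro wind.cont_average wind.cont_flux continuous_intros; auto)+
qed (auto intro: m_dv m_dt)

lemma m_cont:
  assumes "continuous_on S v" "continuous_on S t" "\<And>z. z \<in> S \<Longrightarrow> 0 \<le> t z"
  shows "continuous_on S (\<lambda>z. m (v z) (t z))"
  by (rule continuous_on_compose_3[OF m_continuous, where x="\<lambda>_. 0"]) (use assms in auto)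

lemma m_bounds:
  assumes t: "0 \<le> t"
  shows "0 \<le> m v t" "m v t \<le> L"
proof -
  show "0 \<le> m v t" unfolding m_def set_lebesgue_integral_def
    by (intro integral_nonneg_AE AE_I2) (simp add: wind.average_nonneg[OF t])
  have "m v t \<le> (LBINT w. wind.average w t)"
    unfolding m_def set_lebesgue_integral_def
    using wind.average_integrable[OF t] wind.average_nonneg[OF t]
    by (intro integral_mono integrable_mult_indicator[of _ lborel, simplified]) (auto simp: indicator_def)
  also have "\<dots> \<le> L" using mu_average(2)[OF t] by (simp add: wind.average_def)
  finally show "m v t \<le> L" .
qed

lemma abs_B_le:
  assumes t: "0 \<le> t"
  shows "\<bar>B x v t\<bar> \<le> 3 * C"
proof -
  have "\<bar>B x v t\<bar> \<le> 3 * integral {0..1} (\<lambda>y. \<bar>\<mu> y v t\<bar>)"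
    unfolding B_def by (rule abs_mean_zero_primitive_le[OF mu_continuous_at(1)[OF t] wind.periodic[OF t]])
  also have "integral {0..1} (\<lambda>y. \<bar>\<mu> y v t\<bar>) \<le> integral {0..1} (\<lambda>y::real. C)"
    by (intro integral_le integrable_continuous_interval continuous_intros mu_continuous_at t)
      (use psi_nonneg psi_bounded in \<open>auto simp: \<mu>_def\<close>)
  finally show ?thesis by simp
qed

lemma abs_EB_le:
  assumes t: "0 \<le> t"
  shows "\<bar>EB x v t\<bar> \<le> 6 * C"
proof -
  have "\<bar>EB x v t\<bar> \<le> 3 * integral {0..1} (\<lambda>y. \<bar>E y t * \<mu> y v t\<bar>)"
    unfolding EB_def
    by (rule abs_mean_zero_primitive_le) (intro continuous_intros mu_continuous_at t, simp add: wind.periodic[OF t] E_periodic)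
  also have "integral {0..1} (\<lambda>y. \<bar>E y t * \<mu> y v t\<bar>) \<le> integral {0..1} (\<lambda>y::real. 2 * C)"
  proof (intro integral_le integrable_continuous_interval continuous_intros mu_continuous_at t)
    fix y
    show "\<bar>E y t * \<mu> y v t\<bar> \<le> 2 * C"
      unfolding abs_mult using abs_E_le[OF t, of y] psi_nonneg psi_bounded by (intro mult_mono) (auto simp: \<mu>_def)
  qed
  finally show ?thesis by simp
qed

definition rate :: "real \<Rightarrow> real \<Rightarrow> real \<Rightarrow> real" where
  "rate x v t = winding_rate (\<lambda>y. E y t) (\<lambda>y w. \<mu> y w t) x v"

text \<open>By Cartan's formula, the time derivative of the pulled-back one-form is the pullback of
  three terms: the differential of its contraction with the flow field, the contraction of
  \<open>\<mu>\<close> dx dv, and the form's own time derivative. The contraction is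
  \<open>- E * B - v * m\<close>; the last two terms add up to the differential of
  \<open>q\<close>.\<close>

definition q :: "real \<Rightarrow> real \<Rightarrow> real \<Rightarrow> real" where
  "q x v t = EB x v t + primitive (\<lambda>w. w * wind.average w t) v"

lemma rate_eq: assumes t: "0 \<le> t" shows "rate x v t = q x v t - E x t * B x v t - v * m v t"
proof -
  have "primitive (\<lambda>w. m w t) v = (v * m v t - primitive (\<lambda>w. w * wind.average w t) v) - (0 * m 0 t - primitive (\<lambda>w. w * wind.average w t) 0)"
    by (rule primitive_eqI)
      (auto intro!: derivative_eq_intros m_dv[OF t] has_real_derivative_primitive continuous_intros average_continuous_at[OF t])
  then show ?thesis
    by (simp add: rate_def winding_rate_def q_def EB_def B_def m_def wind.average_def)
qed

lemma rate_cont: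
  assumes "continuous_on S x" "continuous_on S v" "continuous_on S t" "\<And>z. z \<in> S \<Longrightarrow> 0 \<le> t z"
  shows "continuous_on S (\<lambda>z. rate (x z) (v z) (t z))"
proof -
  have "continuous_on (UNIV \<times> {0..}) (\<lambda>(w, t). w * wind.average w t)"
    unfolding case_prod_unfold by (intro continuous_intros wind.cont_average) auto
  from primitive_param_continuous[OF this]
  have 1: "continuous_on (UNIV \<times> {0..}) (\<lambda>(v, t). primitive (\<lambda>w. w * wind.average w t) v)" .
  have "continuous_on S (\<lambda>z. primitive (\<lambda>w. w * wind.average w (t z)) (v z))"
    by (rule continuous_on_compose_2[OF 1]) (use assms in auto)
  then have "continuous_on S (\<lambda>z. q (x z) (v z) (t z) - E (x z) (t z) * B (x z) (v z) (t z) - v z * m (v z) (t z))"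
    unfolding q_def by (intro continuous_intros B_cont E_cont m_cont assms)
  then show ?thesis
    by (rule continuous_on_eq) (use assms rate_eq in auto)
qed

text \<open>The \<open>12 * C\<close> consists of \<open>6 * C\<close> from \<open>EB\<close> and
  the field bound 2 times the bound \<open>3 * C\<close> on \<open>B\<close>; the mass below a
  velocity lies in \<open>[0, L]\<close>, so its antiderivative grows at most like
  \<open>L * \<bar>v\<bar>\<close>.\<close>

lemma abs_rate_le:
  assumes t: "0 \<le> t"
  shows "\<bar>rate x v t\<bar> \<le> 12 * C + L * \<bar>v\<bar>"
proof -
  have cm: "continuous_on UNIV (\<lambda>w. m w t)" using t by (intro m_cont continuous_intros) auto
  have "norm (primitive (\<lambda>w. m w t) v - primitive (\<lambda>w. m w t) 0) \<le> L * norm (v - 0)"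
    by (rule field_differentiable_bound[of UNIV _ "\<lambda>w. m w t"])
      (use has_real_derivative_primitive[OF cm] m_bounds[OF t] in auto)
  then have "\<bar>primitive (\<lambda>w. m w t) v\<bar> \<le> L * \<bar>v\<bar>" by simp
  moreover have "\<bar>E x t * B x v t\<bar> \<le> 2 * (3 * C)"
    unfolding abs_mult using abs_E_le[OF t] abs_B_le[OF t] by (intro mult_mono) auto
  moreover have "rate x v t = EB x v t - E x t * B x v t - primitive (\<lambda>w. m w t) v"
    by (simp add: rate_def winding_rate_def EB_def B_def m_def wind.average_def)
  ultimately show ?thesis using abs_EB_le[OF t, of x v] by linarith
qed

definition winding :: "real \<Rightarrow> real \<times> real \<Rightarrow> real" where
  "winding t z = integral {0..t} (\<lambda>s. rate (fst (\<Phi> s z)) (snd (\<Phi> s z)) s)"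

definition form :: "real \<Rightarrow> real \<times> real \<Rightarrow> real \<times> real \<Rightarrow> real" where
  "form t z d = B (fst z) (snd z) t * snd d - m (snd z) t * fst d"

lemma abs_form_le: "0 \<le> t \<Longrightarrow> \<bar>form t z d\<bar> \<le> (3 * C + L) * norm d"
proof -
  assume t: "0 \<le> t"
  have "\<bar>B (fst z) (snd z) t * snd d\<bar> \<le> (3 * C) * norm d"
    unfolding abs_mult using abs_B_le[OF t] C_L_nonneg norm_snd_le[of "snd d" "fst d"] by (intro mult_mono) auto
  moreover have "\<bar>m (snd z) t * fst d\<bar> \<le> L * norm d"
    unfolding abs_mult using m_bounds[OF t] C_L_nonneg norm_fst_le[of "fst d" "snd d"] by (intro mult_mono) auto
  ultimately show ?thesis unfolding form_def distrib_right by linarith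
qed

text \<open>The relation between the pulled-back and the initial one-form, on segments. The parts
  with \<open>B\<close> and \<open>m\<close> are differentiated in time separately as curve
  integrals; the difference of the two integrands is the derivative of \<open>q\<close> along the
  segment, and the boundary terms are the contraction with the flow field. Together they are the
  boundary difference of \<open>rate\<close>.\<close>

lemma winding_diff:
  assumes t: "0 \<le> t"
  shows "winding t (p + d) - winding t p = integral {0..1} (\<lambda>\<tau>. form t (\<Phi> t (p + \<tau> *\<^sub>R d)) (D t (p + \<tau> *\<^sub>R d) d))
     - integral {0..1} (\<lambda>\<tau>. form 0 (p + \<tau> *\<^sub>R d) d)"
proof -
  let ?V = "\<lambda>\<tau> s. snd (\<Phi> s (p + \<tau> *\<^sub>R d))" and ?X = "\<lambda>\<tau> s. fst (\<Phi> s (p + \<tau> *\<^sub>R d))"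
  let ?V1 = "\<lambda>\<tau> s. snd (D s (p + \<tau> *\<^sub>R d) d)" and ?X1 = "\<lambda>\<tau> s. fst (D s (p + \<tau> *\<^sub>R d) d)"
  let ?av = "\<lambda>\<tau> s. wind.average (?V \<tau> s) s" and ?\<mu> = "\<lambda>\<tau> s. \<mu> (?X \<tau> s) (?V \<tau> s) s" and ?E = "\<lambda>\<tau> s. E (?X \<tau> s) s"
  let ?Bz = "\<lambda>\<tau> s. B (?X \<tau> s) (?V \<tau> s) s" and ?Bvz = "\<lambda>\<tau> s. Bv (?X \<tau> s) (?V \<tau> s) s" and ?mz = "\<lambda>\<tau> s. m (?V \<tau> s) s"
  let ?Bt = "\<lambda>\<tau> s. EBv (?X \<tau> s) (?V \<tau> s) s - ?V \<tau> s * (?\<mu> \<tau> s - ?av \<tau> s)"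
  let ?fl = "\<lambda>\<tau> s. wind.flux (?V \<tau> s) s"
  let ?P1 = "\<lambda>\<tau> s. (?\<mu> \<tau> s - ?av \<tau> s) * ?X1 \<tau> s + ?Bvz \<tau> s * ?V1 \<tau> s + ?Bt \<tau> s * 0"
  let ?P2 = "\<lambda>\<tau> s. (?\<mu> \<tau> s - ?av \<tau> s) * ?V \<tau> s + ?Bvz \<tau> s * (- ?E \<tau> s) + ?Bt \<tau> s * 1"
  let ?M1 = "\<lambda>\<tau> s. 0 * ?X1 \<tau> s + ?av \<tau> s * ?V1 \<tau> s + ?fl \<tau> s * 0"
  let ?M2 = "\<lambda>\<tau> s. 0 * ?V \<tau> s + ?av \<tau> s * (- ?E \<tau> s) + ?fl \<tau> s * 1"
  have cBx: "continuous_on (UNIV \<times> UNIV \<times> {0..}) (\<lambda>(x, v, t). Bv x v t)"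
    unfolding case_prod_unfold by (intro B_cont continuous_intros) auto
  have cBt: "continuous_on (UNIV \<times> UNIV \<times> {0..}) (\<lambda>(x, v, t). EBv x v t - v * (\<mu> x v t - wind.average v t))"
    unfolding case_prod_unfold by (intro continuous_intros B_cont mu_cont wind.cont_average) auto
  have cmv: "continuous_on (UNIV \<times> UNIV \<times> {0..}) (\<lambda>(x :: real, v, t). wind.average v t)"
    and cmt: "continuous_on (UNIV \<times> UNIV \<times> {0..}) (\<lambda>(x :: real, v, t). wind.flux v t)"
    unfolding case_prod_unfold by (intro wind.cont_average wind.cont_flux continuous_intros; auto)+
  have XV\<tau>: "((\<lambda>\<tau>. ?X \<tau> s) has_real_derivative ?X1 \<tau> s) (at \<tau> within {0..1})" "((\<lambda>\<tau>. ?V \<tau> s) has_real_derivative ?V1 \<tau> s) (at \<tau> within {0..1})"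
    if "0 \<le> s" for s \<tau> using flow_line_deriv[OF that] by auto
  have XVs: "((\<lambda>s. ?X \<tau> s) has_real_derivative ?V \<tau> s) (at s within {0..})" "((\<lambda>s. ?V \<tau> s) has_real_derivative - ?E \<tau> s) (at s within {0..})"
    if "0 \<le> s" for s \<tau> using flow_fst[OF that] flow_snd[OF that] by auto
  note comp = has_real_derivative_compose_partials[where T="{0..}" and F=B and Fx="\<lambda>x v t. \<mu> x v t - wind.average v t" and Fv=Bv
      and Ft="\<lambda>x v t. EBv x v t - v * (\<mu> x v t - wind.average v t)"]
  note compm = has_real_derivative_compose_partials[where T="{0..}" and F="\<lambda>x. m" and Fx="\<lambda>x v t. 0" and Fv="\<lambda>x. wind.average"
      and Ft="\<lambda>x. wind.flux"]
  have dP1: "((\<lambda>\<tau>. ?Bz \<tau> s) has_real_derivative ?P1 \<tau> s) (at \<tau> within {0..1})" if "\<tau> \<in> {0..1}" "s \<in> {0..}" for \<tau> s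
    by (rule comp[where W="\<lambda>_. s" and X="\<lambda>\<tau>. ?X \<tau> s" and V="\<lambda>\<tau>. ?V \<tau> s", OF _ _ _ cBx cBt])
      (use that in \<open>auto intro!: B_dx B_dv B_dt XV\<tau>\<close>)
  have dP2: "((\<lambda>s. ?Bz \<tau> s) has_real_derivative ?P2 \<tau> s) (at s within {0..})" if "\<tau> \<in> {0..1}" "s \<in> {0..}" for \<tau> s
    by (rule comp[where W="\<lambda>s. s" and X="\<lambda>s. ?X \<tau> s" and V="\<lambda>s. ?V \<tau> s", OF _ _ _ cBx cBt])
      (use that in \<open>auto intro!: B_dx B_dv B_dt XVs\<close>)
  have dM1: "((\<lambda>\<tau>. ?mz \<tau> s) has_real_derivative ?M1 \<tau> s) (at \<tau> within {0..1})" if "\<tau> \<in> {0..1}" "s \<in> {0..}" for \<tau> s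
    by (rule compm[where W="\<lambda>_. s" and X="\<lambda>\<tau>. ?X \<tau> s" and V="\<lambda>\<tau>. ?V \<tau> s", OF _ _ _ cmv cmt])
      (use that in \<open>auto intro!: m_dv m_dt XV\<tau>\<close>)
  have dM2: "((\<lambda>s. ?mz \<tau> s) has_real_derivative ?M2 \<tau> s) (at s within {0..})" if "\<tau> \<in> {0..1}" "s \<in> {0..}" for \<tau> s
    by (rule compm[where W="\<lambda>s. s" and X="\<lambda>s. ?X \<tau> s" and V="\<lambda>s. ?V \<tau> s", OF _ _ _ cmv cmt])
      (use that in \<open>auto intro!: m_dv m_dt XVs\<close>)
  note ci = mu_cont B_cont m_cont E_cont wind.cont_average wind.cont_flux continuous_on_flow continuous_on_flow_deriv continuous_on_fst continuous_on_snd
    continuous_on_add continuous_on_diff continuous_on_mult continuous_on_minus continuous_on_scaleR continuous_on_const continuous_on_id blinfun.continuous_on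
  have c2: "continuous_on ({0..1} \<times> {0..}) (\<lambda>(\<tau>, s). ?P1 \<tau> s)" "continuous_on ({0..1} \<times> {0..}) (\<lambda>(\<tau>, s). ?P2 \<tau> s)"
    "continuous_on ({0..1} \<times> {0..}) (\<lambda>(\<tau>, s). ?M1 \<tau> s)" "continuous_on ({0..1} \<times> {0..}) (\<lambda>(\<tau>, s). ?M2 \<tau> s)"
    "continuous_on ({0..1} \<times> {0..}) (\<lambda>(\<tau>, s). ?V1 \<tau> s)" "continuous_on ({0..1} \<times> {0..}) (\<lambda>(\<tau>, s). ?X1 \<tau> s)"
    "continuous_on ({0..1} \<times> {0..}) (\<lambda>(\<tau>, s). ?V \<tau> s)" "continuous_on ({0..1} \<times> {0..}) (\<lambda>(\<tau>, s). - ?E \<tau> s)"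
    unfolding case_prod_unfold by (intro ci; auto)+
  have c1: "continuous_on {0..1} (\<lambda>\<tau>. ?X \<tau> s)" "continuous_on {0..1} (\<lambda>\<tau>. ?V \<tau> s)" "continuous_on {0..1} (\<lambda>\<tau>. ?X1 \<tau> s)"
    "continuous_on {0..1} (\<lambda>\<tau>. ?V1 \<tau> s)" if "0 \<le> s" for s
    using that by (intro ci; auto)+
  let ?I = "\<lambda>s. integral {0..1} (\<lambda>\<tau>. ?Bz \<tau> s * ?V1 \<tau> s) - integral {0..1} (\<lambda>\<tau>. ?mz \<tau> s * ?X1 \<tau> s)"
  let ?r = "\<lambda>z s. rate (fst (\<Phi> s z)) (snd (\<Phi> s z)) s"
  have der: "(?I has_real_derivative ?r (p + d) s - ?r p s) (at s within {0..})" if s: "0 \<le> s" for s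
  proof -
    let ?J1 = "\<lambda>\<tau>. ?P2 \<tau> s * ?V1 \<tau> s - ?P1 \<tau> s * (- ?E \<tau> s)" and ?J2 = "\<lambda>\<tau>. ?M2 \<tau> s * ?X1 \<tau> s - ?M1 \<tau> s * ?V \<tau> s"
    have s': "s \<in> {0..}" using s by simp
    have d1: "((\<lambda>s. integral {0..1} (\<lambda>\<tau>. ?Bz \<tau> s * ?V1 \<tau> s)) has_real_derivative
      integral {0..1} ?J1 + (?Bz 1 s * (- ?E 1 s) - ?Bz 0 s * (- ?E 0 s))) (at s within {0..})"
      by (rule has_real_derivative_curve_integral[OF _ _ s' dP1 dP2 _ _ c2(1,2,5,8)]) (auto intro: XV\<tau> XVs)
    have d2: "((\<lambda>s. integral {0..1} (\<lambda>\<tau>. ?mz \<tau> s * ?X1 \<tau> s)) has_real_derivative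
      integral {0..1} ?J2 + (?mz 1 s * ?V 1 s - ?mz 0 s * ?V 0 s)) (at s within {0..})"
      by (rule has_real_derivative_curve_integral[OF _ _ s' dM1 dM2 _ _ c2(3,4,6,7)]) (auto intro: XV\<tau> XVs)
    have i1: "?J1 integrable_on {0..1}" and i2: "?J2 integrable_on {0..1}"
      by (intro integrable_continuous_interval ci c1 s; auto simp: s)+
    let ?q = "\<lambda>\<tau>. q (?X \<tau> s) (?V \<tau> s) s"
    have q: "(?q has_real_derivative ?J1 \<tau> - ?J2 \<tau>) (at \<tau> within {0..1})" if \<tau>: "\<tau> \<in> {0..1}" for \<tau>
    proof -
      have dq: "((\<lambda>x. EB x v s) has_real_derivative E x s * \<mu> x v s - wind.flux v s) (at x)"
        "((\<lambda>v. EB x v s) has_real_derivative EBv x v s) (at v)" for x v by (rule EB_dx[OF s] EB_dv[OF s])+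
      \<comment> \<open>Time is frozen at \<open>s\<close>. The one-point domain \<open>{0}\<close>
        stands for it, so the time derivative to be supplied is zero and none of \<open>EB\<close>
        is required.\<close>
      have "((\<lambda>\<tau>. EB (?X \<tau> s) (?V \<tau> s) s) has_real_derivative
         (?E \<tau> s * ?\<mu> \<tau> s - ?fl \<tau> s) * ?X1 \<tau> s + EBv (?X \<tau> s) (?V \<tau> s) s * ?V1 \<tau> s + 0 * 0) (at \<tau> within {0..1})"
        by (rule has_real_derivative_compose_partials[where T="{0}" and F="\<lambda>x v _. EB x v s" and Fx="\<lambda>x v _. E x s * \<mu> x v s - wind.flux v s"
              and Fv="\<lambda>x v _. EBv x v s" and Ft="\<lambda>_ _ _. 0" and W="\<lambda>_. 0" and X="\<lambda>\<tau>. ?X \<tau> s" and V="\<lambda>\<tau>. ?V \<tau> s"])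
          (use \<tau> in \<open>auto intro!: dq XV\<tau>[OF s] B_cont continuous_intros s simp: case_prod_unfold\<close>)
      moreover have "((\<lambda>\<tau>. primitive (\<lambda>w. w * wind.average w s) (?V \<tau> s)) has_real_derivative (?V \<tau> s * ?av \<tau> s) * ?V1 \<tau> s) (at \<tau> within {0..1})"
        by (rule DERIV_chain2[OF has_real_derivative_primitive XV\<tau>(2)[OF s]]) (intro continuous_intros average_continuous_at s)
      ultimately have "(?q has_real_derivative ((?E \<tau> s * ?\<mu> \<tau> s - ?fl \<tau> s) * ?X1 \<tau> s + EBv (?X \<tau> s) (?V \<tau> s) s * ?V1 \<tau> s + 0 * 0)
         + (?V \<tau> s * ?av \<tau> s) * ?V1 \<tau> s) (at \<tau> within {0..1})"
        unfolding q_def by (rule DERIV_add)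
      then show ?thesis by (rule DERIV_cong) (simp add: algebra_simps)
    qed
    have "((\<lambda>\<tau>. ?J1 \<tau> - ?J2 \<tau>) has_integral ?q 1 - ?q 0) {0..1}"
      by (rule fundamental_theorem_of_calculus)
        (use q in \<open>auto simp only: has_real_derivative_iff_has_vector_derivative[symmetric]\<close>)
    then have "integral {0..1} ?J1 - integral {0..1} ?J2 = ?q 1 - ?q 0"
      using integral_diff[OF i1 i2] by (simp only: integral_unique)
    moreover have "(?I has_real_derivative (integral {0..1} ?J1 + (?Bz 1 s * (- ?E 1 s) - ?Bz 0 s * (- ?E 0 s)))
       - (integral {0..1} ?J2 + (?mz 1 s * ?V 1 s - ?mz 0 s * ?V 0 s))) (at s within {0..})"
      by (rule DERIV_diff[OF d1 d2])
    ultimately show ?thesis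
      by (elim DERIV_cong) (simp add: rate_eq[OF s] algebra_simps)
  qed
  have "((\<lambda>s. ?r (p + d) s - ?r p s) has_integral ?I t - ?I 0) {0..t}"
    by (rule fundamental_theorem_of_calculus[OF t])
      (auto simp only: has_real_derivative_iff_has_vector_derivative[symmetric] atLeastAtMost_iff intro!: DERIV_subset[OF der] subsetI atLeast_iff[THEN iffD2])
  moreover have "?r z integrable_on {0..t}" for z
    by (intro integrable_continuous_interval rate_cont continuous_intros; auto)
  ultimately have W: "winding t (p + d) - winding t p = ?I t - ?I 0"
    unfolding winding_def by (simp only: integral_diff[symmetric] integral_unique)
  have I: "?I s = integral {0..1} (\<lambda>\<tau>. form s (\<Phi> s (p + \<tau> *\<^sub>R d)) (D s (p + \<tau> *\<^sub>R d) d))" if s: "0 \<le> s" for s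
    unfolding form_def by (rule integral_diff[symmetric]; intro integrable_continuous_interval ci c1 s; auto simp: s)
  show ?thesis unfolding W I[OF t] I[OF order_refl] by (simp only: flow_0 deriv_flow_0)
qed

end

section \<open>Stretching of the flow\<close>

lemma line_integral_le:
  fixes h :: "real \<Rightarrow> real"
  assumes c: "continuous_on UNIV h" and h: "\<And>y. 0 \<le> h y" and x: "a \<le> x" "x \<le> b" "a \<le> x0" "x0 \<le> b"
  shows "integral {0..1} (\<lambda>\<tau>. h (x0 + \<tau> * (x - x0))) * \<bar>x - x0\<bar> \<le> integral {a..b} h"
proof -
  have H: "((\<lambda>\<tau>. primitive h (x0 + \<tau> * (x - x0))) has_real_derivative h (x0 + \<tau> * (x - x0)) * (x - x0)) (at \<tau> within {0..1})" for \<tau>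
    by (rule DERIV_chain2[OF has_real_derivative_primitive[OF c]]) (auto intro!: derivative_eq_intros)
  have "((\<lambda>\<tau>. h (x0 + \<tau> * (x - x0)) * (x - x0)) has_integral primitive h (x0 + 1 * (x - x0)) - primitive h (x0 + 0 * (x - x0))) {0..1}"
    by (rule fundamental_theorem_of_calculus) (use H in \<open>auto simp only: has_real_derivative_iff_has_vector_derivative[symmetric]\<close>)
  then have "integral {0..1} (\<lambda>\<tau>. h (x0 + \<tau> * (x - x0))) * (x - x0) = primitive h x - primitive h x0"
    by (drule_tac integral_unique) simp
  moreover have mono: "primitive h y \<le> primitive h y'" if "y \<le> y'" for y y'
    using primitive_diff_eq_integral(1)[OF c that] integral_nonneg[OF integrable_continuous_interval[OF continuous_on_subset[OF c]], of y y'] h by simp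
  moreover have "0 \<le> integral {0..1} (\<lambda>\<tau>. h (x0 + \<tau> * (x - x0)))"
    by (intro integral_nonneg integrable_continuous_interval continuous_on_compose2[OF c] continuous_intros h) auto
  ultimately have "integral {0..1} (\<lambda>\<tau>. h (x0 + \<tau> * (x - x0))) * \<bar>x - x0\<bar> = \<bar>primitive h x - primitive h x0\<bar>"
    by (metis abs_mult abs_of_nonneg)
  also have "\<dots> \<le> primitive h b - primitive h a"
    using mono[of a x] mono[of x b] mono[of a x0] mono[of x0 b] x by simp
  finally show ?thesis using primitive_diff_eq_integral(1)[OF c, of a b] x by simp
qed

lemma ex_le_average:
  fixes h :: "real \<Rightarrow> real"
  assumes "continuous_on {0..1} h"
  obtains x where "x \<in> {0..1}" "h x \<le> integral {0..1} h"
proof -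
  have "\<exists>x\<in>{0..1}. h x \<le> integral {0..1} h"
  proof (rule ccontr)
    assume "\<not> ?thesis"
    then have n: "\<And>x. x \<in> {0..1} \<Longrightarrow> integral {0..1} h < h x" by force
    obtain x where x: "x \<in> {0..1}" "\<And>y. y \<in> {0..1} \<Longrightarrow> h x \<le> h y"
      using continuous_attains_inf[OF compact_Icc _ assms] by auto
    have "integral {0..1} (\<lambda>y::real. h x) \<le> integral {0..1} h"
      using x assms by (intro integral_le integrable_continuous_interval) auto
    then show False using n[OF x(1)] by simp
  qed
  then show ?thesis using that by blast
qed

context vp_flow
begin

definition stretch :: "real \<Rightarrow> real \<Rightarrow> real" where
  "stretch a t = integral (cbox (0, -a) (1, a)) (\<lambda>z. norm (D t z))"

lemma norm_D_continuous:
  assumes "0 \<le> t"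
  shows "continuous_on S (\<lambda>z. norm (D t z))" "continuous_on T (\<lambda>y. norm (D t (y, v)))" "continuous_on T (\<lambda>w. norm (D t (x, w)))"
  using assms by (intro continuous_intros; simp)+

lemma stretch_eq:
  assumes t: "0 \<le> t"
  shows "stretch a t = integral {0..1} (\<lambda>x. integral {-a..a} (\<lambda>v. norm (D t (x, v))))"
    "stretch a t = integral {-a..a} (\<lambda>v. integral {0..1} (\<lambda>x. norm (D t (x, v))))"
    "continuous_on S (\<lambda>x. integral {-a..a} (\<lambda>v. norm (D t (x, v))))"
    "continuous_on S (\<lambda>v. integral {0..1} (\<lambda>x. norm (D t (x, v))))"
proof -
  show *: "stretch a t = integral {0..1} (\<lambda>x. integral {-a..a} (\<lambda>v. norm (D t (x, v))))"
    using integral_prod_continuous[of 0 "-a" 1 a "\<lambda>z. norm (D t z)"] norm_D_continuous[OF t] by (simp add: stretch_def)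
  have "continuous_on (cbox (0, -a) (1, a)) (\<lambda>(x, v). norm (D t (x, v)))"
    using norm_D_continuous(1)[OF t] by (simp add: case_prod_unfold)
  from integral_swap_continuous[OF this] * show "stretch a t = integral {-a..a} (\<lambda>v. integral {0..1} (\<lambda>x. norm (D t (x, v))))"
    by simp
  show "continuous_on S (\<lambda>x. integral {-a..a} (\<lambda>v. norm (D t (x, v))))"
    using integral_continuous_on_param[of S "-a" a "\<lambda>x v. norm (D t (x, v))"] norm_D_continuous[OF t] by simp
  have "continuous_on (S \<times> {0..1}) (\<lambda>(v, x). norm (D t (x, v)))"
    unfolding case_prod_unfold using t by (intro continuous_intros) auto
  then show "continuous_on S (\<lambda>v. integral {0..1} (\<lambda>x. norm (D t (x, v))))"
    using integral_continuous_on_param[of S 0 1 "\<lambda>v x. norm (D t (x, v))"] by simp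
qed

text \<open>The flow commutes with the deck translation, so the image of each horizontal circle
  advances by one and has length at least one. This linear lower bound in \<open>a\<close> later
  absorbs the additive constants of the growth estimate.\<close>

lemma stretch_ge:
  assumes t: "0 \<le> t" and a: "0 \<le> a"
  shows "2 * a \<le> stretch a t"
proof -
  have "1 \<le> integral {0..1} (\<lambda>x. norm (D t (x, v)))" for v
  proof -
    have c: "continuous_on {0..1} (\<lambda>\<tau>. fst (D t (\<tau>, v) (1, 0)))"
      using t by (intro continuous_intros) auto
    have "((\<lambda>\<tau>. fst (D t (\<tau>, v) (1, 0))) has_integral fst (\<Phi> t ((0, v) + 1 *\<^sub>R (1, 0))) - fst (\<Phi> t ((0, v) + 0 *\<^sub>R (1, 0)))) {0..1}"
      by (rule fundamental_theorem_of_calculus)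
        (use flow_line_deriv(1)[OF t, of "(0, v)" "(1, 0)"] in \<open>auto simp: has_real_derivative_iff_has_vector_derivative\<close>)
    then have "integral {0..1} (\<lambda>\<tau>. fst (D t (\<tau>, v) (1, 0))) = 1"
      using flow_shift[OF t, of 0 v] by (auto dest!: integral_unique)
    moreover have "integral {0..1} (\<lambda>\<tau>. fst (D t (\<tau>, v) (1, 0))) \<le> integral {0..1} (\<lambda>\<tau>. norm (D t (\<tau>, v)))"
    proof (intro integral_le integrable_continuous_interval c norm_D_continuous[OF t])
      fix \<tau>
      have "fst (D t (\<tau>, v) (1, 0)) \<le> norm (D t (\<tau>, v) (1, 0))"
        by (metis norm_fst_le prod.collapse real_norm_def abs_le_iff)
      also have "\<dots> \<le> norm (D t (\<tau>, v)) * norm (1 :: real, 0 :: real)" by (rule norm_blinfun)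
      finally show "fst (D t (\<tau>, v) (1, 0)) \<le> norm (D t (\<tau>, v))" by (simp add: norm_Pair)
    qed
    ultimately show ?thesis by simp
  qed
  then have "integral {-a..a} (\<lambda>v::real. 1::real) \<le> integral {-a..a} (\<lambda>v. integral {0..1} (\<lambda>x. norm (D t (x, v))))"
    by (intro integral_le integrable_continuous_interval stretch_eq[OF t]) auto
  then show ?thesis using a stretch_eq(2)[OF t, of a] by simp
qed

lemma grad_L1_norm_eq:
  assumes t: "0 \<le> t"
  shows "grad_L1_norm a (\<Phi> t) = ennreal (stretch a t)"
proof -
  have o: "onorm (frechet_derivative (\<Phi> t) (at z)) = norm (D t z)" for z
    unfolding norm_blinfun.rep_eq frechet_derivative_at[OF flow_deriv[OF t], symmetric] ..
  have i: "set_integrable lborel (cbox (0, -a) (1, a)) (\<lambda>z. norm (D t z))"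
    unfolding set_integrable_def using borel_integrable_compact[OF compact_cbox norm_D_continuous(1)[OF t]]
    by (simp add: indicator_def scaleR_conv_of_real if_distrib cong: if_cong)
  have "grad_L1_norm a (\<Phi> t) = (\<integral>\<^sup>+z. ennreal (indicator (cbox (0, -a) (1, a)) z *\<^sub>R norm (D t z)) \<partial>lborel)"
    unfolding grad_L1_norm_def o by (intro nn_integral_cong) (auto simp: indicator_def cbox_Pair_eq)
  also have "\<dots> = ennreal (LBINT z:cbox (0, -a) (1, a). norm (D t z))"
    unfolding set_lebesgue_integral_def by (rule nn_integral_eq_integral[OF i[unfolded set_integrable_def]]) simp
  also have "(LBINT z:cbox (0, -a) (1, a). norm (D t z)) = stretch a t"
    unfolding stretch_def by (rule set_borel_integral_eq_integral(2)[OF i])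
  finally show ?thesis .
qed

end

context vp_winding
begin

lemma rate_flow_cont:
  assumes "continuous_on S z" "continuous_on S s" "\<And>y. y \<in> S \<Longrightarrow> 0 \<le> s y"
  shows "continuous_on S (\<lambda>y. rate (fst (\<Phi> (s y) (z y))) (snd (\<Phi> (s y) (z y))) (s y))"
  by (intro rate_cont continuous_on_fst continuous_on_snd continuous_on_flow assms)

lemma winding_continuous: "continuous_on S (winding t)"
proof -
  have "continuous_on (S \<times> cbox 0 t) (\<lambda>(z, s). rate (fst (\<Phi> s z)) (snd (\<Phi> s z)) s)"
    unfolding case_prod_unfold by (intro rate_flow_cont continuous_intros) auto
  from integral_continuous_on_param[OF this] show ?thesis
    unfolding winding_def[abs_def] by simp
qed

lemma abs_winding_diff_le:
  assumes t: "0 \<le> t"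
  shows "\<bar>winding t (p + d) - winding t p\<bar> \<le> (3 * C + L) * (integral {0..1} (\<lambda>\<tau>. norm (D t (p + \<tau> *\<^sub>R d))) * norm d + norm d)"
proof -
  have b: "\<bar>integral {0..1} (\<lambda>\<tau>. form s (\<Phi> s (p + \<tau> *\<^sub>R d)) (D s (p + \<tau> *\<^sub>R d) d))\<bar>
      \<le> (3 * C + L) * (integral {0..1} (\<lambda>\<tau>. norm (D s (p + \<tau> *\<^sub>R d))) * norm d)" (is "\<bar>integral _ ?g\<bar> \<le> _") if s: "0 \<le> s" for s
  proof -
    have cg: "continuous_on {0..1} ?g" unfolding form_def
      by (intro B_cont m_cont continuous_on_flow continuous_on_flow_deriv continuous_on_fst continuous_on_snd continuous_on_add
          continuous_on_diff continuous_on_mult continuous_on_scaleR continuous_on_const continuous_on_id blinfun.continuous_on; simp add: s)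
    have cn: "continuous_on {0..1} (\<lambda>\<tau>. norm (D s (p + \<tau> *\<^sub>R d)))"
      by (intro continuous_on_norm continuous_on_flow_deriv continuous_on_add continuous_on_scaleR continuous_on_const continuous_on_id; simp add: s)
    have "\<bar>integral {0..1} ?g\<bar> \<le> integral {0..1} (\<lambda>\<tau>. (3 * C + L) * (norm (D s (p + \<tau> *\<^sub>R d)) * norm d))"
      unfolding real_norm_def[symmetric]
    proof (rule integral_norm_bound_integral)
      fix \<tau>
      have "norm (?g \<tau>) \<le> (3 * C + L) * norm (D s (p + \<tau> *\<^sub>R d) d)" unfolding real_norm_def by (rule abs_form_le[OF s])
      also have "\<dots> \<le> (3 * C + L) * (norm (D s (p + \<tau> *\<^sub>R d)) * norm d)"
        using C_L_nonneg by (intro mult_left_mono norm_blinfun) auto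
      finally show "norm (?g \<tau>) \<le> (3 * C + L) * (norm (D s (p + \<tau> *\<^sub>R d)) * norm d)" .
    qed (intro integrable_continuous_interval continuous_on_mult continuous_on_const cg cn)+
    then show ?thesis by simp
  qed
  \<comment> \<open>The initial term is the time-zero case of the same estimate, with
    \<open>D 0\<close> the identity, and contributes just \<open>norm d\<close>.\<close>
  have "form 0 (p + \<tau> *\<^sub>R d) d = form 0 (\<Phi> 0 (p + \<tau> *\<^sub>R d)) (D 0 (p + \<tau> *\<^sub>R d) d)" for \<tau>
    by (simp only: flow_0 deriv_flow_0)
  moreover have "integral {0..1} (\<lambda>\<tau>. norm (D 0 (p + \<tau> *\<^sub>R d))) * norm d \<le> 1 * norm d"
  proof (rule mult_right_mono)
    have "norm (D 0 z) \<le> 1" for z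
      by (rule norm_blinfun_bound) (simp_all add: deriv_flow_0)
    then have "integral {0..1} (\<lambda>\<tau>. norm (D 0 (p + \<tau> *\<^sub>R d))) \<le> integral {0..1} (\<lambda>\<tau>::real. 1::real)"
      by (intro integral_le integrable_continuous_interval continuous_on_norm continuous_on_flow_deriv continuous_on_add
          continuous_on_scaleR continuous_on_const continuous_on_id) auto
    then show "integral {0..1} (\<lambda>\<tau>. norm (D 0 (p + \<tau> *\<^sub>R d))) \<le> 1" by simp
  qed simp
  then have "(3 * C + L) * (integral {0..1} (\<lambda>\<tau>. norm (D 0 (p + \<tau> *\<^sub>R d))) * norm d) \<le> (3 * C + L) * norm d"
    using C_L_nonneg by (intro mult_left_mono) auto
  ultimately show ?thesis
    using b[OF t] b[OF order_refl] unfolding winding_diff[OF t] distrib_left by simp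
qed

text \<open>The point \<open>(x, v)\<close> is reached from \<open>(x0, 0)\<close> by a vertical and
  then a horizontal segment. The vertical line over \<open>x0\<close> is chosen so that its
  stretching is at most the average over all vertical lines. The stretching of the horizontal
  segment still depends on \<open>v\<close> and is averaged only when the estimate is
  integrated.\<close>

lemma winding_oscillation:
  assumes t: "0 \<le> t" and a: "0 \<le> a"
  obtains c where "\<And>x v. x \<in> {0..1} \<Longrightarrow> v \<in> {-a..a} \<Longrightarrow>
    \<bar>winding t (x, v) - c\<bar> \<le> (3 * C + L) * (integral {0..1} (\<lambda>y. norm (D t (y, v))) + 1 + stretch a t + a)"
proof -
  let ?K = "3 * C + L"
  have K: "0 \<le> ?K" using C_L_nonneg by simp
  obtain x0 where x0: "x0 \<in> {0..1}" "integral {-a..a} (\<lambda>v. norm (D t (x0, v))) \<le> stretch a t"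
    using ex_le_average[OF stretch_eq(3)[OF t]] stretch_eq(1)[OF t] by metis
  have "\<bar>winding t (x, v) - winding t (x0, 0)\<bar> \<le> ?K * (integral {0..1} (\<lambda>y. norm (D t (y, v))) + 1 + stretch a t + a)"
    if x: "x \<in> {0..1}" and v: "v \<in> {-a..a}" for x v
  proof -
    have "\<bar>winding t ((x0, v) + (x - x0, 0)) - winding t (x0, v)\<bar> \<le>
        ?K * (integral {0..1} (\<lambda>\<tau>. norm (D t ((x0, v) + \<tau> *\<^sub>R (x - x0, 0)))) * norm (x - x0, 0 :: real) + norm (x - x0, 0 :: real))"
      by (rule abs_winding_diff_le[OF t])
    then have "\<bar>winding t (x, v) - winding t (x0, v)\<bar> \<le>
        ?K * (integral {0..1} (\<lambda>\<tau>. norm (D t (x0 + \<tau> * (x - x0), v))) * \<bar>x - x0\<bar> + \<bar>x - x0\<bar>)"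
      by (simp add: norm_Pair)
    also have "\<dots> \<le> ?K * (integral {0..1} (\<lambda>y. norm (D t (y, v))) + 1)"
      using x x0(1) by (intro mult_left_mono[OF _ K] add_mono line_integral_le norm_D_continuous[OF t]) (auto simp: abs_le_iff)
    finally have 1: "\<bar>winding t (x, v) - winding t (x0, v)\<bar> \<le> ?K * (integral {0..1} (\<lambda>y. norm (D t (y, v))) + 1)" .
    have "\<bar>winding t ((x0, 0) + (0, v)) - winding t (x0, 0)\<bar> \<le>
        ?K * (integral {0..1} (\<lambda>\<tau>. norm (D t ((x0, 0) + \<tau> *\<^sub>R (0, v)))) * norm (0 :: real, v) + norm (0 :: real, v))"
      by (rule abs_winding_diff_le[OF t])
    then have "\<bar>winding t (x0, v) - winding t (x0, 0)\<bar> \<le>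
        ?K * (integral {0..1} (\<lambda>\<tau>. norm (D t (x0, 0 + \<tau> * (v - 0)))) * \<bar>v - 0\<bar> + \<bar>v\<bar>)"
      by (simp add: norm_Pair)
    also have "\<dots> \<le> ?K * (integral {-a..a} (\<lambda>w. norm (D t (x0, w))) + a)"
      using v a by (intro mult_left_mono[OF _ K] add_mono line_integral_le norm_D_continuous[OF t]) auto
    also have "\<dots> \<le> ?K * (stretch a t + a)"
      using x0(2) by (intro mult_left_mono[OF _ K]) simp
    finally have "\<bar>winding t (x0, v) - winding t (x0, 0)\<bar> \<le> ?K * (stretch a t + a)" .
    with 1 have "\<bar>winding t (x, v) - winding t (x0, 0)\<bar> \<le> ?K * (integral {0..1} (\<lambda>y. norm (D t (y, v))) + 1) + ?K * (stretch a t + a)"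
      by linarith
    then show ?thesis by (simp only: distrib_left add.assoc)
  qed
  then show ?thesis by (rule that)
qed

lemma integral_rate:
  assumes t: "0 \<le> t" and G: "continuous_on UNIV G"
  shows "integral (cbox (0, -a) (1, a)) (\<lambda>z. G z * winding t z)
    = integral {0..t} (\<lambda>s. integral (cbox (0, -a) (1, a)) (\<lambda>z. G z * rate (fst (\<Phi> s z)) (snd (\<Phi> s z)) s))"
proof -
  have c: "continuous_on (cbox ((0, -a), 0) ((1, a), t)) (\<lambda>(z, s). G z * rate (fst (\<Phi> s z)) (snd (\<Phi> s z)) s)"
    unfolding case_prod_unfold
    by (intro continuous_on_mult rate_flow_cont continuous_on_compose2[OF G] continuous_on_fst continuous_on_snd continuous_on_id)
      (auto simp: cbox_Pair_eq)
  have "integral (cbox (0, -a) (1, a)) (\<lambda>z. G z * winding t z)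
      = integral (cbox (0, -a) (1, a)) (\<lambda>z. integral (cbox 0 t) (\<lambda>s. G z * rate (fst (\<Phi> s z)) (snd (\<Phi> s z)) s))"
    by (simp add: winding_def)
  also have "\<dots> = integral (cbox 0 t) (\<lambda>s. integral (cbox (0, -a) (1, a)) (\<lambda>z. G z * rate (fst (\<Phi> s z)) (snd (\<Phi> s z)) s))"
    by (rule integral_swap_continuous[OF c])
  finally show ?thesis by simp
qed

text \<open>A weight of mean zero does not see the constant \<open>c\<close> of
  \<open>winding_oscillation\<close>. Integrated over the strip of area \<open>2 * a\<close>, the
  horizontal part gives \<open>stretch a t\<close> once and the vertical part \<open>2 * a\<close>
  times.\<close>

lemma integral_winding_le:
  assumes t: "0 \<le> t" and a: "0 \<le> a" and G: "continuous_on UNIV G" "\<And>z. \<bar>G z\<bar> \<le> M" "integral (cbox (0, -a) (1, a)) G = 0"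
  shows "integral (cbox (0, -a) (1, a)) (\<lambda>z. G z * winding t z) \<le> M * (3 * C + L) * ((1 + 2 * a) * stretch a t + 2 * a * (1 + a))"
proof -
  let ?Q = "cbox (0 :: real, -a) (1, a)" and ?K = "3 * C + L"
  let ?b = "\<lambda>v. integral {0..1} (\<lambda>y. norm (D t (y, v)))"
  have M: "0 \<le> M" using G(2)[of undefined] by linarith
  obtain c where c: "\<And>x v. x \<in> {0..1} \<Longrightarrow> v \<in> {-a..a} \<Longrightarrow> \<bar>winding t (x, v) - c\<bar> \<le> ?K * (?b v + 1 + stretch a t + a)"
    using winding_oscillation[OF t a] by blast
  have cG: "continuous_on ?Q G" using G(1) continuous_on_subset by blast
  have cb: "continuous_on ?Q (\<lambda>z. ?b (snd z))"
    by (rule continuous_on_compose2[OF stretch_eq(4)[OF t, of UNIV]]) (intro continuous_intros, auto)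
  have i: "(\<lambda>z. G z * winding t z) integrable_on ?Q" "(\<lambda>z. c * G z) integrable_on ?Q"
    by (intro integrable_continuous continuous_on_mult continuous_on_const cG winding_continuous)+
  have "integral ?Q (\<lambda>z. G z * winding t z) = integral ?Q (\<lambda>z. G z * winding t z) - integral ?Q (\<lambda>z. c * G z)"
    using G(3) by simp
  also have "\<dots> = integral ?Q (\<lambda>z. G z * winding t z - c * G z)"
    by (rule integral_diff[OF i, symmetric])
  also have "\<dots> \<le> integral ?Q (\<lambda>z. M * (?K * (?b (snd z) + 1 + stretch a t + a)))"
  proof (rule integral_le)
    show "(\<lambda>z. G z * winding t z - c * G z) integrable_on ?Q" by (rule integrable_diff[OF i])
    show "(\<lambda>z. M * (?K * (?b (snd z) + 1 + stretch a t + a))) integrable_on ?Q"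
      by (intro integrable_continuous continuous_on_mult continuous_on_const continuous_on_add cb)
    fix z assume "z \<in> ?Q"
    then have z: "fst z \<in> {0..1}" "snd z \<in> {-a..a}" by (cases z, simp add: cbox_Pair_eq)+
    have "G z * winding t z - c * G z = G z * (winding t z - c)" by (simp add: algebra_simps)
    also have "\<dots> \<le> \<bar>G z\<bar> * \<bar>winding t z - c\<bar>" using abs_ge_self[of "G z * (winding t z - c)"] by (simp add: abs_mult)
    also have "\<dots> \<le> M * (?K * (?b (snd z) + 1 + stretch a t + a))"
      using c[OF z] M by (intro mult_mono G(2)) auto
    finally show "G z * winding t z - c * G z \<le> M * (?K * (?b (snd z) + 1 + stretch a t + a))" .
  qed
  also have "\<dots> = M * ?K * integral ?Q (\<lambda>z. ?b (snd z) + (1 + stretch a t + a))"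
    by (simp only: integral_mult_right mult.assoc add.assoc)
  also have "integral ?Q (\<lambda>z. ?b (snd z) + (1 + stretch a t + a)) = integral ?Q (\<lambda>z. ?b (snd z)) + integral ?Q (\<lambda>z. 1 + stretch a t + a)"
    by (intro Henstock_Kurzweil_Integration.integral_add integrable_continuous cb continuous_on_const)
  also have "integral ?Q (\<lambda>z. ?b (snd z)) = stretch a t"
    using integral_prod_continuous[OF cb] stretch_eq(2)[OF t] by simp
  also have "integral ?Q (\<lambda>z. 1 + stretch a t + a) = 2 * a * (1 + stretch a t + a)"
    using a by (simp add: content_Pair)
  finally show ?thesis by (simp add: algebra_simps)
qed

lemma stretch_linear_growth:
  assumes a: "0 < a" and G: "continuous_on UNIV G" "\<And>z. \<bar>G z\<bar> \<le> M" "integral (cbox (0, -a) (1, a)) G = 0"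
    and \<kappa>: "0 < \<kappa>" "\<And>s. 0 \<le> s \<Longrightarrow> \<kappa> \<le> integral (cbox (0, -a) (1, a)) (\<lambda>z. G z * rate (fst (\<Phi> s z)) (snd (\<Phi> s z)) s)"
  shows "\<exists>A>0. \<forall>t\<ge>0. A * t \<le> stretch a t"
proof -
  let ?K = "M * (3 * C + L)"
  have K: "0 \<le> ?K" using G(2)[of undefined] C_L_nonneg by (intro mult_nonneg_nonneg) auto
  \<comment> \<open>The additive term \<open>2 * a * (1 + a)\<close> is absorbed by
    \<open>2 * a \<le> stretch a t\<close>, which changes the factor \<open>1 + 2 * a\<close> into
    \<open>2 + 3 * a\<close>. The final 1 only ensures positivity.\<close>
  define c where "c = ?K * (2 + 3 * a) + 1"
  have c: "0 < c" using K a unfolding c_def by (simp add: add_nonneg_pos)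
  have "\<kappa> / c * t \<le> stretch a t" if t: "0 \<le> t" for t
  proof -
    have cj: "continuous_on {0..t} (\<lambda>s. integral (cbox (0, -a) (1, a)) (\<lambda>z. G z * rate (fst (\<Phi> s z)) (snd (\<Phi> s z)) s))"
      by (rule integral_continuous_on_param, unfold case_prod_unfold)
        (intro continuous_on_mult rate_flow_cont continuous_on_compose2[OF G(1)] continuous_on_fst continuous_on_snd continuous_on_id; auto)
    have "integral {0..t} (\<lambda>s. \<kappa>) \<le> integral {0..t} (\<lambda>s. integral (cbox (0, -a) (1, a)) (\<lambda>z. G z * rate (fst (\<Phi> s z)) (snd (\<Phi> s z)) s))"
      by (intro integral_le integrable_continuous_interval continuous_on_const cj \<kappa>) auto
    then have "\<kappa> * t \<le> integral (cbox (0, -a) (1, a)) (\<lambda>z. G z * winding t z)"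
      using t by (simp add: integral_rate[OF t G(1)] mult.commute)
    also have "\<dots> \<le> ?K * ((1 + 2 * a) * stretch a t + 2 * a * (1 + a))"
      using a by (intro integral_winding_le[OF t _ G]) simp
    also have "\<dots> \<le> ?K * ((1 + 2 * a) * stretch a t + stretch a t * (1 + a))"
      using stretch_ge[OF t, of a] a by (intro mult_left_mono[OF _ K] add_left_mono mult_right_mono) auto
    also have "\<dots> = ?K * (2 + 3 * a) * stretch a t" by (simp add: algebra_simps)
    also have "\<dots> \<le> c * stretch a t"
      using stretch_ge[OF t, of a] a unfolding c_def by (intro mult_right_mono) auto
    finally show ?thesis using c by (simp add: field_simps)
  qed
  then show ?thesis using \<kappa>(1) c by (intro exI[of _ "\<kappa> / c"]) auto
qed

end

section \<open>Winding rates near the steady state\<close>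

lemma abs_le_one_plus_square: "\<bar>v\<bar> \<le> 1 + v\<^sup>2" for v :: real
  using zero_le_power2[of "\<bar>v\<bar> - 1"] by (simp add: power2_eq_square algebra_simps)

text \<open>A solution that stays within \<open>\<epsilon>\<close> of the steady state in the
  weighted distance for all times. One constant \<open>K\<close> serves as bound, slope at zero and
  Lipschitz constant of \<open>\<psi>\<close>.\<close>

locale close_winding = vp_winding \<rho> f fx fv ft \<Phi> D \<psi> \<psi>' K K + steady: vp_steady \<rho> fs sx sv st \<phi> Emax v0
  for \<rho> f fx fv ft \<Phi> D \<psi> \<psi>' K fs sx sv st \<phi> Emax v0 +
  fixes \<epsilon> :: real
  assumes psi_lipschitz: "\<bar>\<psi> s - \<psi> s'\<bar> \<le> K * \<bar>s - s'\<bar>"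
    and eps: "0 \<le> \<epsilon>" "\<epsilon> \<le> 1"
    and close_integrable: "0 \<le> t \<Longrightarrow> integrable phase (\<lambda>z. (1 + (snd z)\<^sup>2) * \<bar>f (fst z) (snd z) t - fs (fst z) (snd z)\<bar>)"
    and close: "0 \<le> t \<Longrightarrow> integral\<^sup>L phase (\<lambda>z. (1 + (snd z)\<^sup>2) * \<bar>f (fst z) (snd z) t - fs (fst z) (snd z)\<bar>) \<le> \<epsilon>"
begin

abbreviation "Es \<equiv> steady.Es"

definition gap :: "real \<Rightarrow> real \<times> real \<Rightarrow> real" where
  "gap t z = \<bar>f (fst z) (snd z) t - fs (fst z) (snd z)\<bar>"

lemma fs_cont: "continuous_on S x \<Longrightarrow> continuous_on S v \<Longrightarrow> continuous_on S (\<lambda>z. fs (x z) (v z))"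
  by (rule steady.f_cont(1)[where t="\<lambda>_. 0"]) auto

lemma fs_measurable [measurable]: "(\<lambda>z. fs (fst z) (snd z)) \<in> borel_measurable borel"
  by (rule steady.f_measurable[of 0]) simp

lemma gap_measurable: "0 \<le> t \<Longrightarrow> gap t \<in> borel_measurable borel"
  unfolding gap_def using f_measurable by (intro borel_measurable_abs borel_measurable_diff fs_measurable) auto

lemma gap_nonneg: "0 \<le> gap t z" by (simp add: gap_def)

lemma weighted_gap: "0 \<le> t \<Longrightarrow> integrable phase (\<lambda>z. (1 + (snd z)\<^sup>2) * gap t z)" "0 \<le> t \<Longrightarrow> integral\<^sup>L phase (\<lambda>z. (1 + (snd z)\<^sup>2) * gap t z) \<le> \<epsilon>"
  using close_integrable close unfolding gap_def by auto

lemma gap_le_weighted: "gap t z \<le> (1 + (snd z)\<^sup>2) * gap t z"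
  using gap_nonneg[of t z] by (simp add: distrib_right)

lemma gap_integrable:
  assumes t: "0 \<le> t"
  shows "integrable phase (gap t)" "integral\<^sup>L phase (gap t) \<le> \<epsilon>"
proof -
  show i: "integrable phase (gap t)"
    by (rule Bochner_Integration.integrable_bound[OF weighted_gap(1)[OF t]])
      (use gap_measurable[OF t] gap_le_weighted gap_nonneg in \<open>auto simp: measurable_phase abs_mult intro!: AE_I2 order_trans[OF gap_le_weighted]\<close>)
  have "integral\<^sup>L phase (gap t) \<le> integral\<^sup>L phase (\<lambda>z. (1 + (snd z)\<^sup>2) * gap t z)"
    by (rule integral_mono[OF i weighted_gap(1)[OF t] gap_le_weighted])
  then show "integral\<^sup>L phase (gap t) \<le> \<epsilon>" using weighted_gap(2)[OF t] by simp
qed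

lemma field_close:
  assumes t: "0 \<le> t"
  shows "\<bar>E x t - Es x\<bar> \<le> \<epsilon>"
  using vp_field_diff_le[OF vp_solution_axioms steady.vp_solution_axioms t order_refl, of x] gap_integrable(2)[OF t]
  by (simp add: gap_def[abs_def])

definition \<mu>s :: "real \<Rightarrow> real \<Rightarrow> real" where "\<mu>s x v = \<psi> (fs x v)"

lemma mus_cont: "continuous_on S x \<Longrightarrow> continuous_on S v \<Longrightarrow> continuous_on S (\<lambda>z. \<mu>s (x z) (v z))"
  unfolding \<mu>s_def by (rule continuous_on_compose2[OF psi_continuous fs_cont]) auto

lemma mus_bounds: "0 \<le> \<mu>s x v" "\<mu>s x v \<le> K" "\<mu>s x v \<le> K * fs x v"
  unfolding \<mu>s_def using psi_nonneg psi_bounded psi_linear steady.f_nonneg[of 0] by auto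

lemma mus_periodic: "\<mu>s (x + 1) v = \<mu>s x v"
  using steady.f_periodic[of 0 x v] by (simp add: \<mu>s_def)

lemma mu_gap: "\<bar>\<mu> x v t - \<mu>s x v\<bar> \<le> K * gap t (x, v)"
  using psi_lipschitz by (simp add: \<mu>_def \<mu>s_def gap_def)

text \<open>For an individual \<open>v\<close> nothing makes this small; it is at most
  \<open>K\<close>, while its integral over all velocities is at most
  \<open>K * \<epsilon>\<close>.\<close>

definition \<delta> :: "real \<Rightarrow> real \<Rightarrow> real" where
  "\<delta> t v = integral {0..1} (\<lambda>y. \<bar>\<mu> y v t - \<mu>s y v\<bar>)"

lemma mu_diff_cont: "0 \<le> t \<Longrightarrow> continuous_on S (\<lambda>y. \<bar>\<mu> y v t - \<mu>s y v\<bar>)"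
  by (intro continuous_intros mu_continuous_at mus_cont)

lemma delta:
  assumes t: "0 \<le> t"
  shows "integrable lborel (\<delta> t)" "(LBINT v. \<delta> t v) \<le> K * \<epsilon>" "0 \<le> \<delta> t v" "\<delta> t v \<le> K"
    "integrable phase (\<lambda>z. \<delta> t (snd z))" "integral\<^sup>L phase (\<lambda>z. \<delta> t (snd z)) \<le> K * \<epsilon>"
proof -
  let ?F = "\<lambda>z. \<bar>\<mu> (fst z) (snd z) t - \<mu>s (fst z) (snd z)\<bar>"
  have iK: "integrable phase (\<lambda>z. K * gap t z)" using gap_integrable(1)[OF t] by simp
  have le: "?F z \<le> K * gap t z" for z using mu_gap[of "fst z" "snd z" t] by simp
  have i: "integrable phase ?F"
  proof (rule Bochner_Integration.integrable_bound[OF iK])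
    have "continuous_on UNIV ?F" using t by (intro continuous_intros mu_cont mus_cont)
    then show "?F \<in> borel_measurable phase" unfolding measurable_phase by (rule borel_measurable_continuous_onI)
    show "AE z in phase. norm (?F z) \<le> norm (K * gap t z)" by (rule AE_I2, simp only: real_norm_def abs_abs) (rule order_trans[OF le abs_ge_self])
  qed
  have c: "continuous_on {0..1} (\<lambda>x. ?F (x, v))" for v using mu_diff_cont[OF t] by simp
  show 1: "integrable lborel (\<delta> t)" using integral_phase_swap(2)[OF i c] by (simp add: \<delta>_def[abs_def])
  have "(LBINT v. \<delta> t v) = integral\<^sup>L phase ?F" using integral_phase_swap(1)[OF i c] by (simp add: \<delta>_def)
  also have "\<dots> \<le> integral\<^sup>L phase (\<lambda>z. K * gap t z)" by (rule integral_mono[OF i iK le])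
  also have "\<dots> \<le> K * \<epsilon>" using gap_integrable(2)[OF t] C_L_nonneg by (simp add: mult_left_mono)
  finally show 2: "(LBINT v. \<delta> t v) \<le> K * \<epsilon>" .
  show nn: "0 \<le> \<delta> t v" for v unfolding \<delta>_def by (intro integral_nonneg integrable_continuous_interval mu_diff_cont t) simp
  have "\<delta> t v \<le> integral {0..1} (\<lambda>y::real. K)"
    unfolding \<delta>_def
  proof (intro integral_le integrable_continuous_interval mu_diff_cont t continuous_on_const)
    fix y show "\<bar>\<mu> y v t - \<mu>s y v\<bar> \<le> K"
      using mus_bounds[of y v] psi_nonneg[of "f y v t"] psi_bounded[of "f y v t"] unfolding \<mu>_def abs_le_iff by simp
  qed
  then show "\<delta> t v \<le> K" by simp
  show 5: "integrable phase (\<lambda>z. \<delta> t (snd z))"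
  proof (rule integrable_phaseI)
    have "\<delta> t \<in> borel_measurable borel" using borel_measurable_integrable[OF 1] by simp
    then show "(\<lambda>z. \<delta> t (snd z)) \<in> borel_measurable borel"
      by (rule measurable_compose[rotated]) (intro borel_measurable_continuous_onI continuous_intros)
  qed (use 1 nn in \<open>auto simp: set_integrable_def\<close>)
  show "integral\<^sup>L phase (\<lambda>z. \<delta> t (snd z)) \<le> K * \<epsilon>"
    unfolding integral_phase[OF 5] snd_conv LBINT_Icc_eq_integral[OF continuous_on_const] using 2 by simp
qed

lemma mus_average:
  "integrable lborel (\<lambda>v. integral {0..1} (\<lambda>x. \<mu>s x v))" "continuous_on UNIV (\<lambda>v. integral {0..1} (\<lambda>x. \<mu>s x v))"
proof -
  have c: "continuous_on UNIV (\<lambda>z. \<mu>s (fst z) (snd z))" by (intro mus_cont continuous_intros)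
  have "integrable phase (\<lambda>z. \<mu>s (fst z) (snd z))"
  proof (rule Bochner_Integration.integrable_bound)
    show "integrable phase (\<lambda>z. K * fs (fst z) (snd z))" using steady.f_phase_integrable[of 0] by simp
    show "(\<lambda>z. \<mu>s (fst z) (snd z)) \<in> borel_measurable phase"
      unfolding measurable_phase using c by (rule borel_measurable_continuous_onI)
    show "AE z in phase. norm (\<mu>s (fst z) (snd z)) \<le> norm (K * fs (fst z) (snd z))"
      using mus_bounds order_trans[OF mus_bounds(1) mus_bounds(3)] by (intro AE_I2) simp
  qed
  from integral_phase_swap(2)[OF this] show "integrable lborel (\<lambda>v. integral {0..1} (\<lambda>x. \<mu>s x v))"
    unfolding fst_conv snd_conv using mus_cont[OF continuous_on_id continuous_on_const] by blast
  have c2: "continuous_on (UNIV \<times> cbox 0 1) (\<lambda>(v :: real, x :: real). \<mu>s x v)"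
    unfolding case_prod_unfold by (intro mus_cont continuous_intros)
  show "continuous_on UNIV (\<lambda>v. integral {0..1} (\<lambda>x. \<mu>s x v))"
    using integral_continuous_on_param[OF c2] by simp
qed

definition rs :: "real \<Rightarrow> real \<Rightarrow> real" where
  "rs = winding_rate Es \<mu>s"

lemma rs_continuous: "continuous_on UNIV (\<lambda>z. rs (fst z) (snd z))"
  unfolding rs_def by (rule winding_rate_continuous[OF steady.Es(1) _ mus_average(1)]) (intro mus_cont continuous_intros)

lemma field_wave_diff:
  assumes t: "0 \<le> t"
  shows "\<bar>EB x v t - mean_zero_primitive (\<lambda>y. Es y * \<mu>s y v) x\<bar> \<le> 3 * (2 * \<delta> t v + \<epsilon> * K)"
proof -
  have ci: "continuous_on S (\<lambda>y. E y t * \<mu> y v t)" "continuous_on S (\<lambda>y. Es y * \<mu>s y v)" for S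
    using t by (intro continuous_intros mu_continuous_at mus_cont continuous_on_subset[OF steady.Es(1)]; simp)+
  have "\<bar>EB x v t - mean_zero_primitive (\<lambda>y. Es y * \<mu>s y v) x\<bar> = \<bar>mean_zero_primitive (\<lambda>y. E y t * \<mu> y v t - Es y * \<mu>s y v) x\<bar>"
    unfolding EB_def by (simp only: mean_zero_primitive_diff[OF ci])
  also have "\<dots> \<le> 3 * integral {0..1} (\<lambda>y. \<bar>E y t * \<mu> y v t - Es y * \<mu>s y v\<bar>)"
    by (rule abs_mean_zero_primitive_le) (rule continuous_on_diff[OF ci], simp only: wind.periodic[OF t] E_periodic mus_periodic steady.Es(2))
  also have "\<dots> \<le> 3 * integral {0..1} (\<lambda>y. 2 * \<bar>\<mu> y v t - \<mu>s y v\<bar> + \<epsilon> * K)"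
  proof (rule mult_left_mono[OF integral_le])
    show "(\<lambda>y. \<bar>E y t * \<mu> y v t - Es y * \<mu>s y v\<bar>) integrable_on {0..1}"
      by (intro integrable_continuous_interval continuous_on_rabs continuous_on_diff ci)
    show "(\<lambda>y. 2 * \<bar>\<mu> y v t - \<mu>s y v\<bar> + \<epsilon> * K) integrable_on {0..1}"
      by (intro integrable_continuous_interval continuous_on_add continuous_on_mult_left continuous_on_const mu_diff_cont t)
    fix y
    have eq: "E y t * \<mu> y v t - Es y * \<mu>s y v = E y t * (\<mu> y v t - \<mu>s y v) + (E y t - Es y) * \<mu>s y v"
      by (simp add: algebra_simps)
    have "\<bar>E y t * \<mu> y v t - Es y * \<mu>s y v\<bar> \<le> \<bar>E y t\<bar> * \<bar>\<mu> y v t - \<mu>s y v\<bar> + \<bar>E y t - Es y\<bar> * \<bar>\<mu>s y v\<bar>"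
      unfolding eq abs_mult[symmetric] by (rule abs_triangle_ineq)
    also have "\<dots> \<le> 2 * \<bar>\<mu> y v t - \<mu>s y v\<bar> + \<epsilon> * K"
    proof (rule add_mono)
      show "\<bar>E y t\<bar> * \<bar>\<mu> y v t - \<mu>s y v\<bar> \<le> 2 * \<bar>\<mu> y v t - \<mu>s y v\<bar>"
        by (rule mult_right_mono[OF abs_E_le[OF t] abs_ge_zero])
      show "\<bar>E y t - Es y\<bar> * \<bar>\<mu>s y v\<bar> \<le> \<epsilon> * K"
        by (rule mult_mono[OF field_close[OF t] _ eps(1) abs_ge_zero]) (use mus_bounds(1,2)[of y v] in simp)
    qed
    finally show "\<bar>E y t * \<mu> y v t - Es y * \<mu>s y v\<bar> \<le> 2 * \<bar>\<mu> y v t - \<mu>s y v\<bar> + \<epsilon> * K" .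
  qed simp
  also have "integral {0..1} (\<lambda>y. 2 * \<bar>\<mu> y v t - \<mu>s y v\<bar> + \<epsilon> * K) = 2 * \<delta> t v + \<epsilon> * K"
    unfolding \<delta>_def
    using Henstock_Kurzweil_Integration.integral_add[of "\<lambda>y. 2 * \<bar>\<mu> y v t - \<mu>s y v\<bar>" "{0..1}" "\<lambda>_. \<epsilon> * K"]
      integrable_continuous_interval[OF continuous_on_mult_left[OF mu_diff_cont[OF t]]]
      integrable_continuous_interval[OF continuous_on_const[of "{0..1}" "\<epsilon> * K"]] by simp
  finally show ?thesis .
qed

lemma wave_diff:
  assumes t: "0 \<le> t"
  shows "\<bar>E x t * B x v t - Es x * mean_zero_primitive (\<lambda>y. \<mu>s y v) x\<bar> \<le> 6 * \<delta> t v + 3 * \<epsilon> * K"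
proof -
  let ?B = "mean_zero_primitive (\<lambda>y. \<mu>s y v) x"
  have cs: "continuous_on S (\<lambda>y. \<mu>s y v)" for S by (intro mus_cont continuous_intros)
  have "\<bar>B x v t - ?B\<bar> = \<bar>mean_zero_primitive (\<lambda>y. \<mu> y v t - \<mu>s y v) x\<bar>"
    unfolding B_def by (simp only: mean_zero_primitive_diff[OF mu_continuous_at(1)[OF t] cs])
  also have "\<dots> \<le> 3 * \<delta> t v" unfolding \<delta>_def
    by (rule abs_mean_zero_primitive_le) (intro continuous_intros mu_continuous_at cs t, simp only: wind.periodic[OF t] mus_periodic)
  finally have 1: "\<bar>B x v t - ?B\<bar> \<le> 3 * \<delta> t v" .
  have "\<bar>?B\<bar> \<le> 3 * integral {0..1} (\<lambda>y. \<bar>\<mu>s y v\<bar>)"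
    by (rule abs_mean_zero_primitive_le) (intro cs, simp only: mus_periodic)
  also have "\<dots> \<le> 3 * integral {0..1} (\<lambda>y::real. K)"
    using mus_bounds by (intro mult_left_mono integral_le integrable_continuous_interval continuous_intros cs) auto
  finally have 2: "\<bar>?B\<bar> \<le> 3 * K" by simp
  have eq: "E x t * B x v t - Es x * ?B = E x t * (B x v t - ?B) + (E x t - Es x) * ?B"
    by (simp add: algebra_simps)
  have "\<bar>E x t * B x v t - Es x * ?B\<bar> \<le> \<bar>E x t\<bar> * \<bar>B x v t - ?B\<bar> + \<bar>E x t - Es x\<bar> * \<bar>?B\<bar>"
    unfolding eq abs_mult[symmetric] by (rule abs_triangle_ineq)
  also have "\<dots> \<le> 2 * (3 * \<delta> t v) + \<epsilon> * (3 * K)"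
    by (rule add_mono[OF mult_mono[OF abs_E_le[OF t] 1 _ abs_ge_zero] mult_mono[OF field_close[OF t] 2 eps(1) abs_ge_zero]]) simp
  finally show ?thesis by simp
qed

text \<open>The masses below a velocity differ by at most the total L1 distance, uniformly in that
  velocity; taking the antiderivative costs the factor \<open>\<bar>v\<bar>\<close>.\<close>

lemma mass_primitive_diff:
  assumes t: "0 \<le> t"
  shows "\<bar>primitive (\<lambda>w. m w t) v - primitive (\<lambda>w. LBINT u:{..w}. integral {0..1} (\<lambda>y. \<mu>s y u)) v\<bar> \<le> K * \<epsilon> * \<bar>v\<bar>"
proof -
  let ?a = "\<lambda>u. integral {0..1} (\<lambda>y. \<mu>s y u)" and ?ms = "\<lambda>w. LBINT u:{..w}. integral {0..1} (\<lambda>y. \<mu>s y u)"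
  have cm: "continuous_on UNIV (\<lambda>w. m w t)" using t by (intro m_cont continuous_intros) auto
  have cs: "continuous_on UNIV ?ms"
    using LBINT_atMost_deriv[OF mus_average(2,1)] by (intro continuous_at_imp_continuous_on) (auto intro: DERIV_isCont)
  have b: "\<bar>m w t - ?ms w\<bar> \<le> K * \<epsilon>" for w
  proof -
    have i: "set_integrable lborel {..w} (\<lambda>u. wind.average u t)" "set_integrable lborel {..w} ?a"
      unfolding set_integrable_def using wind.average_integrable[OF t] mus_average(1)
      by (intro integrable_mult_indicator[of _ lborel]; simp)+
    have eq: "m w t - ?ms w = (LBINT u:{..w}. wind.average u t - ?a u)"
      unfolding m_def by (rule set_integral_diff(2)[OF i, symmetric])
    have "\<bar>m w t - ?ms w\<bar> \<le> (LBINT u:{..w}. \<bar>wind.average u t - ?a u\<bar>)"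
      unfolding eq using set_integral_norm_bound[OF set_integral_diff(1)[OF i]] by simp
    also have "\<dots> \<le> (LBINT u. \<delta> t u)"
      unfolding set_lebesgue_integral_def
    proof (rule integral_mono)
      show "integrable lborel (\<lambda>u. indicat_real {..w} u *\<^sub>R \<bar>wind.average u t - ?a u\<bar>)"
        using set_integrable_abs[OF set_integral_diff(1)[OF i]] unfolding set_integrable_def .
      show "integrable lborel (\<delta> t)" by (rule delta[OF t])
      fix u
      have ci: "(\<lambda>y. \<mu> y u t) integrable_on {0..1}" "(\<lambda>y. \<mu>s y u) integrable_on {0..1}"
        by (intro integrable_continuous_interval mu_continuous_at mus_cont continuous_intros t)+
      have "\<bar>wind.average u t - ?a u\<bar> = \<bar>integral {0..1} (\<lambda>y. \<mu> y u t - \<mu>s y u)\<bar>"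
        unfolding wind.average_def by (simp only: Henstock_Kurzweil_Integration.integral_diff[OF ci])
      also have "\<dots> \<le> \<delta> t u" unfolding \<delta>_def real_norm_def[symmetric]
        by (rule integral_norm_bound_integral[OF integrable_diff[OF ci]])
          (use integrable_continuous_interval[OF mu_diff_cont[OF t]] in simp_all)
      finally show "indicat_real {..w} u *\<^sub>R \<bar>wind.average u t - ?a u\<bar> \<le> \<delta> t u"
        using delta(3)[OF t, of u] by (simp add: indicator_def)
    qed
    finally show ?thesis using delta(2)[OF t] by simp
  qed
  let ?P = "\<lambda>v. primitive (\<lambda>w. m w t) v - primitive ?ms v"
  have "norm (?P v - ?P 0) \<le> K * \<epsilon> * norm (v - 0)"
    by (rule field_differentiable_bound[of UNIV _ "\<lambda>w. m w t - ?ms w"])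
      (use DERIV_diff[OF has_real_derivative_primitive[OF cm] has_real_derivative_primitive[OF cs]] b in auto)
  then show ?thesis by simp
qed

text \<open>The error is not uniformly small: \<open>\<delta> t v\<close> is small only after
  integration in \<open>v\<close>, and the rest grows with the velocity. Both are harmless in
  averages against weights that are bounded and dominated by \<open>f\<close>. The constants are 12
  = 6 + 6 and 7 = 3 + 3 + 1, collecting the three parts of the rate.\<close>

lemma rate_diff:
  assumes t: "0 \<le> t"
  shows "\<bar>rate x v t - rs x v\<bar> \<le> 12 * \<delta> t v + 7 * K * \<epsilon> * (1 + v\<^sup>2)"
proof -
  have "K * \<epsilon> * \<bar>v\<bar> \<le> K * \<epsilon> * (1 + v\<^sup>2)" "K * \<epsilon> * 1 \<le> K * \<epsilon> * (1 + v\<^sup>2)"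
    using C_L_nonneg eps by (intro mult_left_mono abs_le_one_plus_square; simp)+
  moreover have "7 * K * \<epsilon> * (1 + v\<^sup>2) = 7 * (K * \<epsilon> * (1 + v\<^sup>2))" by simp
  ultimately have e: "6 * (K * \<epsilon>) + K * \<epsilon> * \<bar>v\<bar> \<le> 7 * K * \<epsilon> * (1 + v\<^sup>2)" by linarith
  have r: "rate x v t = EB x v t - E x t * B x v t - primitive (\<lambda>w. m w t) v"
    by (simp add: rate_def winding_rate_def EB_def B_def m_def wind.average_def)
  have s: "rs x v = mean_zero_primitive (\<lambda>y. Es y * \<mu>s y v) x - Es x * mean_zero_primitive (\<lambda>y. \<mu>s y v) x
      - primitive (\<lambda>w. LBINT u:{..w}. integral {0..1} (\<lambda>y. \<mu>s y u)) v"
    by (simp add: rs_def winding_rate_def)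
  have tri: "\<bar>(a - b - c) - (a' - b' - c')\<bar> \<le> A + B + C" if "\<bar>a - a'\<bar> \<le> A" "\<bar>b - b'\<bar> \<le> B" "\<bar>c - c'\<bar> \<le> C" for a b c a' b' c' A B C :: real
    using that by linarith
  have "\<bar>rate x v t - rs x v\<bar> \<le> 3 * (2 * \<delta> t v + \<epsilon> * K) + (6 * \<delta> t v + 3 * \<epsilon> * K) + K * \<epsilon> * \<bar>v\<bar>"
    unfolding r s by (intro tri field_wave_diff wave_diff mass_primitive_diff t)
  then show ?thesis using e by simp
qed

lemma abs_rate_quadratic:
  assumes t: "0 \<le> t"
  shows "\<bar>rate x v t\<bar> \<le> 13 * K * (1 + v\<^sup>2)"
proof -
  have "12 * K * 1 + K * \<bar>v\<bar> \<le> 12 * K * (1 + v\<^sup>2) + K * (1 + v\<^sup>2)"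
    using C_L_nonneg by (intro add_mono mult_left_mono abs_le_one_plus_square) auto
  then show ?thesis using abs_rate_le[OF t, of x v] by simp
qed

text \<open>Comparison with the rate at time 0: 32 = 13 + 12 + 7, using
  \<open>\<delta> 0 v \<le> K\<close> and \<open>\<epsilon> \<le> 1\<close>.\<close>

lemma abs_rs_quadratic: "\<bar>rs x v\<bar> \<le> 32 * K * (1 + v\<^sup>2)"
proof -
  have "K * \<epsilon> * (1 + v\<^sup>2) \<le> K * 1 * (1 + v\<^sup>2)" "K * 1 \<le> K * (1 + v\<^sup>2)"
    using C_L_nonneg eps by (intro mult_right_mono mult_left_mono; simp)+
  then show ?thesis
    using rate_diff[of 0 x v] delta(4)[of 0 v] abs_rate_quadratic[of 0 x v] by simp
qed

end

lemma abs_phase_integral_diff_le: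
  fixes X Y W :: "real \<times> real \<Rightarrow> real"
  assumes "integrable phase X" "integrable phase Y" "integrable phase W" "\<And>z. \<bar>X z - Y z\<bar> \<le> W z"
  shows "\<bar>integral\<^sup>L phase X - integral\<^sup>L phase Y\<bar> \<le> integral\<^sup>L phase W"
proof -
  have "norm (integral\<^sup>L phase (\<lambda>z. X z - Y z)) \<le> integral\<^sup>L phase W"
    by (rule Bochner_Integration.integral_norm_bound_integral) (use assms in auto)
  then show ?thesis using assms by simp
qed

context close_winding
begin

lemma kinetic_f:
  assumes t: "0 \<le> t"
  shows "integrable phase (\<lambda>z. f (fst z) (snd z) t * (1 + (snd z)\<^sup>2))"
    "integral\<^sup>L phase (\<lambda>z. f (fst z) (snd z) t * (1 + (snd z)\<^sup>2)) \<le> 1 + integral\<^sup>L phase (\<lambda>z. (1 + (snd z)\<^sup>2) * fs (fst z) (snd z))"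
proof -
  let ?W = "\<lambda>z. (1 + (snd z)\<^sup>2) * gap t z + (1 + (snd z)\<^sup>2) * fs (fst z) (snd z)"
  have iW: "integrable phase ?W"
    by (intro Bochner_Integration.integrable_add weighted_gap(1)[OF t] steady.fs_kinetic)
  have le: "f (fst z) (snd z) t * (1 + (snd z)\<^sup>2) \<le> ?W z" for z
  proof -
    have "f (fst z) (snd z) t * (1 + (snd z)\<^sup>2) \<le> (gap t z + fs (fst z) (snd z)) * (1 + (snd z)\<^sup>2)"
      by (rule mult_right_mono) (auto simp: gap_def)
    then show ?thesis by (simp add: algebra_simps)
  qed
  show i: "integrable phase (\<lambda>z. f (fst z) (snd z) t * (1 + (snd z)\<^sup>2))"
  proof (rule Bochner_Integration.integrable_bound[OF iW])
    show "(\<lambda>z. f (fst z) (snd z) t * (1 + (snd z)\<^sup>2)) \<in> borel_measurable phase"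
      unfolding measurable_phase
      by (intro borel_measurable_times f_measurable t borel_measurable_continuous_onI continuous_intros)
    show "AE z in phase. norm (f (fst z) (snd z) t * (1 + (snd z)\<^sup>2)) \<le> norm (?W z)"
    proof (rule AE_I2)
      fix z
      have "0 \<le> f (fst z) (snd z) t * (1 + (snd z)\<^sup>2)" using f_nonneg[OF t] by simp
      then show "norm (f (fst z) (snd z) t * (1 + (snd z)\<^sup>2)) \<le> norm (?W z)" using le[of z] by simp
    qed
  qed
  have "integral\<^sup>L phase (\<lambda>z. f (fst z) (snd z) t * (1 + (snd z)\<^sup>2)) \<le> integral\<^sup>L phase ?W"
    by (rule integral_mono[OF i iW le])
  then show "integral\<^sup>L phase (\<lambda>z. f (fst z) (snd z) t * (1 + (snd z)\<^sup>2)) \<le> 1 + integral\<^sup>L phase (\<lambda>z. (1 + (snd z)\<^sup>2) * fs (fst z) (snd z))"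
    using weighted_gap[OF t] steady.fs_kinetic eps by simp
qed

lemma rate_periodic: "0 \<le> t \<Longrightarrow> rate (x + 1) v t = rate x v t"
  unfolding rate_def winding_rate_def
  by (subst (1 2) mean_zero_primitive_periodic) (auto intro!: continuous_intros mu_continuous_at simp: wind.periodic E_periodic)

lemma f0_cont: "continuous_on S f0"
  unfolding f0_def by (intro f_cont continuous_intros) auto

context
  fixes g :: "real \<Rightarrow> real"
  assumes g_continuous: "continuous_on UNIV g" and g_lipschitz: "\<And>s s'. \<bar>g s - g s'\<bar> \<le> K * \<bar>s - s'\<bar>"
    and g_bounds: "\<And>s. 0 \<le> g s" "\<And>s. g s \<le> K" and g_0: "g 0 = 0"
begin

lemma g_linear: "0 \<le> s \<Longrightarrow> g s \<le> K * s"
  using g_lipschitz[of s 0] g_0 by simp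

lemma g_measurable: "g \<in> borel_measurable borel"
  using g_continuous by (rule borel_measurable_continuous_onI)

lemma g_fs: "g (fs (fst z) (snd z)) = indicator {-v0..v0} (snd z) * g (fs (fst z) (snd z))"
  using steady.fs_zero[of "snd z" "fst z"] g_0
  by (cases "v0 < \<bar>snd z\<bar>") (auto simp: indicator_def abs_le_iff not_less)

lemma profile_average_close:
  "\<bar>integral\<^sup>L phase (\<lambda>z. indicator {-v0..v0} (snd z) * g (f0 z)) - integral\<^sup>L phase (\<lambda>z. g (fs (fst z) (snd z)))\<bar> \<le> K * \<epsilon>"
proof -
  have "\<bar>integral\<^sup>L phase (\<lambda>z. indicator {-v0..v0} (snd z) * g (f0 z)) - integral\<^sup>L phase (\<lambda>z. g (fs (fst z) (snd z)))\<bar>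
      \<le> integral\<^sup>L phase (\<lambda>z. K * gap 0 z)"
  proof (rule abs_phase_integral_diff_le)
    show "integrable phase (\<lambda>z. indicator {-v0..v0} (snd z) * g (f0 z))"
      by (intro phase_integral_strip(1) continuous_on_compose2[OF g_continuous f0_cont]) auto
    have "continuous_on UNIV (\<lambda>z. g (fs (fst z) (snd z)))"
      by (intro continuous_on_compose2[OF g_continuous fs_cont] continuous_intros) auto
    from phase_integral_strip(1)[OF this, of v0] show "integrable phase (\<lambda>z. g (fs (fst z) (snd z)))"
      by (simp only: g_fs[symmetric])
    show "integrable phase (\<lambda>z. K * gap 0 z)" using gap_integrable(1)[of 0] by simp
    fix z
    have "\<bar>g (f0 z) - g (fs (fst z) (snd z))\<bar> \<le> K * gap 0 z"
      using g_lipschitz by (simp add: gap_def f0_def)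
    moreover have "0 \<le> K * gap 0 z" using C_L_nonneg gap_nonneg by simp
    ultimately show "\<bar>indicator {-v0..v0} (snd z) * g (f0 z) - g (fs (fst z) (snd z))\<bar> \<le> K * gap 0 z"
      by (subst g_fs) (simp add: indicator_def)
  qed
  also have "\<dots> \<le> K * \<epsilon>" using gap_integrable(2)[of 0] C_L_nonneg by (simp add: mult_left_mono)
  finally show ?thesis .
qed

text \<open>The selection \<open>g (f0 z)\<close> equals \<open>g\<close> of the current value along
  the flow, and the flow preserves area. So the average over moving particles is a phase-space
  integral at time \<open>s\<close>, in which both the selection and the rate can be replaced by
  their steady counterparts.\<close>

lemma moving_average_close:
  assumes s: "0 \<le> s"
  shows "integrable phase (\<lambda>z. g (f0 z) * rate (fst (\<Phi> s z)) (snd (\<Phi> s z)) s)"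
    and "\<bar>integral\<^sup>L phase (\<lambda>z. g (f0 z) * rate (fst (\<Phi> s z)) (snd (\<Phi> s z)) s)
      - integral\<^sup>L phase (\<lambda>z. g (fs (fst z) (snd z)) * rs (fst z) (snd z))\<bar>
      \<le> K\<^sup>2 * \<epsilon> * (51 + 7 * integral\<^sup>L phase (\<lambda>z. (1 + (snd z)\<^sup>2) * fs (fst z) (snd z)))"
proof -
  let ?r = "\<lambda>z. rate (fst z) (snd z) s" and ?f = "\<lambda>z. f (fst z) (snd z) s" and ?fs = "\<lambda>z. fs (fst z) (snd z)"
  let ?rs = "\<lambda>z. rs (fst z) (snd z)" and ?w = "\<lambda>z :: real \<times> real. 1 + (snd z)\<^sup>2"
  let ?X = "\<lambda>z. g (?f z) * ?r z" and ?Y = "\<lambda>z. g (?fs z) * ?rs z"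
  have K: "0 \<le> K" using C_L_nonneg by simp
  have w: "1 \<le> ?w z" for z by simp
  have "continuous_on UNIV ?r" using s by (intro rate_cont continuous_intros)
  then have r_meas: "?r \<in> borel_measurable borel" by (rule borel_measurable_continuous_onI)
  have r_per: "?r (x + 1, v) = ?r (x, v)" for x v using rate_periodic[OF s] by simp
  have X_meas: "?X \<in> borel_measurable borel"
    using measurable_compose[OF f_measurable[OF s] g_measurable] r_meas by (rule borel_measurable_times)
  have X_le: "\<bar>?X z\<bar> \<le> 13 * K\<^sup>2 * (?f z * ?w z)" for z
  proof -
    have "\<bar>?X z\<bar> \<le> (K * ?f z) * (13 * K * ?w z)"
      unfolding abs_mult using K g_bounds(1) g_linear[OF f_nonneg[OF s]] f_nonneg[OF s]
      by (intro mult_mono abs_rate_quadratic[OF s]) auto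
    then show ?thesis by (simp add: power2_eq_square algebra_simps)
  qed
  have iX: "integrable phase ?X"
  proof (rule Bochner_Integration.integrable_bound)
    show "integrable phase (\<lambda>z. 13 * K\<^sup>2 * (?f z * ?w z))" by (intro integrable_mult_right kinetic_f(1)[OF s])
    show "?X \<in> borel_measurable phase" unfolding measurable_phase by (rule X_meas)
    show "AE z in phase. norm (?X z) \<le> norm (13 * K\<^sup>2 * (?f z * ?w z))"
      unfolding real_norm_def by (rule AE_I2) (rule order_trans[OF X_le abs_ge_self])
  qed
  show "integrable phase (\<lambda>z. g (f0 z) * rate (fst (\<Phi> s z)) (snd (\<Phi> s z)) s)"
    using phase_integral_transport(2)[OF s r_meas r_per g_measurable] iX by simp
  have iY: "integrable phase ?Y"
  proof (rule Bochner_Integration.integrable_bound)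
    show "integrable phase (\<lambda>z. 32 * K\<^sup>2 * (?w z * ?fs z))" by (intro integrable_mult_right steady.fs_kinetic)
    show "?Y \<in> borel_measurable phase" unfolding measurable_phase
      by (intro borel_measurable_times measurable_compose[OF fs_measurable g_measurable] borel_measurable_continuous_onI rs_continuous)
    show "AE z in phase. norm (?Y z) \<le> norm (32 * K\<^sup>2 * (?w z * ?fs z))"
    proof (rule AE_I2)
      fix z
      have fs: "0 \<le> ?fs z" using steady.f_nonneg[of 0] by simp
      have "\<bar>?Y z\<bar> \<le> (K * ?fs z) * (32 * K * ?w z)"
        unfolding abs_mult using K g_bounds(1) g_linear[OF fs] fs by (intro mult_mono abs_rs_quadratic) auto
      then have "\<bar>?Y z\<bar> \<le> 32 * K\<^sup>2 * (?w z * ?fs z)" by (simp add: power2_eq_square algebra_simps)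
      then show "norm (?Y z) \<le> norm (32 * K\<^sup>2 * (?w z * ?fs z))"
        unfolding real_norm_def by (rule order_trans[OF _ abs_ge_self])
    qed
  qed
  \<comment> \<open>The first term pays for replacing the selection, weighted by the quadratic bound
    on the steady rate; the other two pay for replacing the rate by \<open>rate_diff\<close>. After
    integration the constants add up to 51 = 32 + 12 + 7, plus 7 times the steady kinetic
    integral.\<close>
  let ?W = "\<lambda>z. 32 * K\<^sup>2 * (?w z * gap s z) + (12 * K * \<delta> s (snd z) + 7 * K\<^sup>2 * \<epsilon> * (?f z * ?w z))"
  have iW: "integrable phase ?W"
    by (intro Bochner_Integration.integrable_add integrable_mult_right weighted_gap(1) delta(5) kinetic_f(1) s)
  have "integral\<^sup>L phase ?X = integral\<^sup>L phase (\<lambda>z. g (f0 z) * rate (fst (\<Phi> s z)) (snd (\<Phi> s z)) s)"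
    using phase_integral_transport(1)[OF s r_meas r_per g_measurable] by simp
  moreover have "\<bar>integral\<^sup>L phase ?X - integral\<^sup>L phase ?Y\<bar> \<le> integral\<^sup>L phase ?W"
  proof (rule abs_phase_integral_diff_le[OF iX iY iW])
    fix z
    have eq: "?X z - ?Y z = (g (?f z) - g (?fs z)) * ?rs z + g (?f z) * (?r z - ?rs z)" by (simp add: algebra_simps)
    have "\<bar>?X z - ?Y z\<bar> \<le> \<bar>g (?f z) - g (?fs z)\<bar> * \<bar>?rs z\<bar> + g (?f z) * \<bar>?r z - ?rs z\<bar>"
      unfolding eq using abs_triangle_ineq[of "(g (?f z) - g (?fs z)) * ?rs z" "g (?f z) * (?r z - ?rs z)"] g_bounds(1)[of "?f z"] by (simp only: abs_mult abs_of_nonneg)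
    moreover have "\<bar>g (?f z) - g (?fs z)\<bar> * \<bar>?rs z\<bar> \<le> (K * gap s z) * (32 * K * ?w z)"
      using K gap_nonneg[of s z] g_lipschitz by (intro mult_mono abs_rs_quadratic) (auto simp: gap_def)
    moreover have "g (?f z) * \<bar>?r z - ?rs z\<bar> \<le> g (?f z) * (12 * \<delta> s (snd z) + 7 * K * \<epsilon> * ?w z)"
      by (intro mult_left_mono rate_diff s g_bounds)
    moreover have "g (?f z) * (12 * \<delta> s (snd z)) \<le> K * (12 * \<delta> s (snd z))"
      using delta(3)[OF s] by (intro mult_right_mono g_bounds) simp
    moreover have "g (?f z) * (7 * K * \<epsilon> * ?w z) \<le> (K * ?f z) * (7 * K * \<epsilon> * ?w z)"
      using K eps by (intro mult_right_mono g_linear f_nonneg s) simp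
    ultimately have "\<bar>?X z - ?Y z\<bar> \<le> (K * gap s z) * (32 * K * ?w z) + (K * (12 * \<delta> s (snd z)) + (K * ?f z) * (7 * K * \<epsilon> * ?w z))"
      unfolding distrib_left[of "g (?f z)"] by linarith
    also have "\<dots> = ?W z" by (simp add: power2_eq_square algebra_simps)
    finally show "\<bar>?X z - ?Y z\<bar> \<le> ?W z" .
  qed
  moreover have "integral\<^sup>L phase ?W = 32 * K\<^sup>2 * integral\<^sup>L phase (\<lambda>z. ?w z * gap s z) + (12 * K * integral\<^sup>L phase (\<lambda>z. \<delta> s (snd z))
      + 7 * K\<^sup>2 * \<epsilon> * integral\<^sup>L phase (\<lambda>z. ?f z * ?w z))"
    using weighted_gap(1)[OF s] delta(5)[OF s] kinetic_f(1)[OF s]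
    by (subst Bochner_Integration.integral_add; (intro Bochner_Integration.integrable_add integrable_mult_right)?; simp)+
  moreover have "\<dots> \<le> 32 * K\<^sup>2 * \<epsilon> + (12 * K * (K * \<epsilon>) + 7 * K\<^sup>2 * \<epsilon> * (1 + integral\<^sup>L phase (\<lambda>z. ?w z * ?fs z)))"
    using K eps by (intro add_mono mult_left_mono weighted_gap(2) delta(6) kinetic_f(2) s) auto
  ultimately show "\<bar>integral\<^sup>L phase (\<lambda>z. g (f0 z) * rate (fst (\<Phi> s z)) (snd (\<Phi> s z)) s) - integral\<^sup>L phase ?Y\<bar>
      \<le> K\<^sup>2 * \<epsilon> * (51 + 7 * integral\<^sup>L phase (\<lambda>z. ?w z * ?fs z))"
    by (simp add: power2_eq_square algebra_simps)
qed

text \<open>Initially the steady state vanishes outside the strip, so the particles starting there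
  have mass at most \<open>\<epsilon>\<close>, but their rate is bounded only quadratically in the
  current velocity. If that velocity is at most \<open>v0\<close>, the factor
  \<open>1 + v0\<^sup>2\<close> suffices. Otherwise the particle is outside the strip at time
  \<open>s\<close>, where the steady state vanishes too, and the weighted distance at that time
  bounds its contribution.\<close>

lemma outer_average_small:
  assumes s: "0 \<le> s"
  shows "\<bar>integral\<^sup>L phase (\<lambda>z. indicator {-v0..v0} (snd z) * (g (f0 z) * rate (fst (\<Phi> s z)) (snd (\<Phi> s z)) s))
      - integral\<^sup>L phase (\<lambda>z. g (f0 z) * rate (fst (\<Phi> s z)) (snd (\<Phi> s z)) s)\<bar> \<le> K\<^sup>2 * \<epsilon> * (26 + 13 * v0\<^sup>2)"
proof -
  let ?X = "\<lambda>z. g (f0 z) * rate (fst (\<Phi> s z)) (snd (\<Phi> s z)) s"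
  define w where "w z = (if \<bar>snd z\<bar> \<le> v0 then 0 else 1 + (snd z)\<^sup>2)" for z :: "real \<times> real"
  have K: "0 \<le> K" using C_L_nonneg by simp
  have w_meas: "w \<in> borel_measurable borel"
  proof -
    have "{z :: real \<times> real. \<bar>snd z\<bar> \<le> v0} \<in> sets borel"
      by (intro borel_closed closed_Collect_le continuous_intros)
    then show ?thesis unfolding w_def
      by (intro measurable_If borel_measurable_continuous_onI continuous_intros) auto
  qed
  have w_per: "w (x + 1, v) = w (x, v)" for x v by (simp add: w_def)
  have w_le: "f (fst z) (snd z) s * w z \<le> (1 + (snd z)\<^sup>2) * gap s z" for z
  proof (cases "\<bar>snd z\<bar> \<le> v0")
    case False
    then have "f (fst z) (snd z) s = gap s z"
      using steady.fs_zero[of "snd z" "fst z"] f_nonneg[OF s] by (simp add: gap_def)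
    then show ?thesis using False by (simp add: w_def mult.commute)
  qed (use gap_nonneg[of s z] in \<open>simp add: w_def\<close>)
  have w_nonneg: "0 \<le> f (fst z) (snd z) s * w z" for z using f_nonneg[OF s] by (simp add: w_def)
  have iw: "integrable phase (\<lambda>z. f (fst z) (snd z) s * w z)"
  proof (rule Bochner_Integration.integrable_bound[OF weighted_gap(1)[OF s]])
    show "(\<lambda>z. f (fst z) (snd z) s * w z) \<in> borel_measurable phase"
      unfolding measurable_phase by (intro borel_measurable_times f_measurable[OF s] w_meas)
    show "AE z in phase. norm (f (fst z) (snd z) s * w z) \<le> norm ((1 + (snd z)\<^sup>2) * gap s z)"
      using w_nonneg by (intro AE_I2) (simp only: real_norm_def abs_of_nonneg, rule order_trans[OF w_le abs_ge_self])
  qed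
  have t1: "integral\<^sup>L phase (\<lambda>z. f0 z * w (\<Phi> s z)) = integral\<^sup>L phase (\<lambda>z. f (fst z) (snd z) s * w z)"
    and t2: "integrable phase (\<lambda>z. f0 z * w (\<Phi> s z))"
    using phase_integral_transport[OF s w_meas w_per, of "\<lambda>x. x"] iw by auto
  have t3: "integral\<^sup>L phase (\<lambda>z. f0 z * w (\<Phi> s z)) \<le> \<epsilon>"
    unfolding t1 using integral_mono[OF iw weighted_gap(1)[OF s] w_le] weighted_gap(2)[OF s] by linarith
  have iX: "integrable phase ?X" by (rule moving_average_close(1)[OF s])
  let ?W = "\<lambda>z. 13 * K\<^sup>2 * ((1 + v0\<^sup>2) * gap 0 z + f0 z * w (\<Phi> s z))"
  have "\<bar>integral\<^sup>L phase (\<lambda>z. indicator {-v0..v0} (snd z) * ?X z) - integral\<^sup>L phase ?X\<bar> \<le> integral\<^sup>L phase ?W"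
  proof (rule abs_phase_integral_diff_le[OF _ iX])
    show "integrable phase (\<lambda>z. indicator {-v0..v0} (snd z) * ?X z)"
      by (rule phase_integral_strip(1)) (intro continuous_on_mult rate_flow_cont continuous_on_compose2[OF g_continuous f0_cont] continuous_on_id continuous_on_const, use s in auto)
    show "integrable phase ?W" by (intro integrable_mult_right Bochner_Integration.integrable_add gap_integrable(1) t2) simp
    fix z
    let ?V = "snd (\<Phi> s z)"
    have f0w: "0 \<le> f0 z * w (\<Phi> s z)" using f0_nonneg by (simp add: w_def)
    show "\<bar>indicator {-v0..v0} (snd z) * ?X z - ?X z\<bar> \<le> ?W z"
    proof (cases "\<bar>snd z\<bar> \<le> v0")
      case True
      then have "indicator {-v0..v0} (snd z) = (1 :: real)" by (simp add: abs_le_iff)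
      moreover have "0 \<le> ?W z" using gap_nonneg[of 0 z] f0w by simp
      ultimately show ?thesis by simp
    next
      case False
      then have ind: "indicator {-v0..v0} (snd z) = (0 :: real)" by (auto simp: indicator_def)
      have gap: "gap 0 z = f0 z" using False steady.fs_zero[of "snd z" "fst z"] f0_nonneg[of z] by (simp add: gap_def f0_def)
      have "1 + ?V\<^sup>2 \<le> (1 + v0\<^sup>2) + w (\<Phi> s z)"
        using power_mono[of "\<bar>?V\<bar>" v0 2] by (simp add: w_def)
      then have "f0 z * (1 + ?V\<^sup>2) \<le> f0 z * ((1 + v0\<^sup>2) + w (\<Phi> s z))" by (rule mult_left_mono[OF _ f0_nonneg])
      then have 1: "13 * K\<^sup>2 * (f0 z * (1 + ?V\<^sup>2)) \<le> ?W z" unfolding gap by (intro mult_left_mono) (auto simp: algebra_simps)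
      have "\<bar>?X z\<bar> \<le> (K * f0 z) * (13 * K * (1 + ?V\<^sup>2))"
        unfolding abs_mult using K g_bounds(1) g_linear[OF f0_nonneg] f0_nonneg[of z]
        by (intro mult_mono abs_rate_quadratic[OF s]) auto
      also have "\<dots> = 13 * K\<^sup>2 * (f0 z * (1 + ?V\<^sup>2))" by (simp add: power2_eq_square)
      finally show ?thesis using 1 unfolding ind by simp
    qed
  qed
  also have "integral\<^sup>L phase ?W = 13 * K\<^sup>2 * ((1 + v0\<^sup>2) * integral\<^sup>L phase (gap 0) + integral\<^sup>L phase (\<lambda>z. f0 z * w (\<Phi> s z)))"
    using gap_integrable(1)[of 0] t2 by simp
  also have "\<dots> \<le> 13 * K\<^sup>2 * ((1 + v0\<^sup>2) * \<epsilon> + \<epsilon>)"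
    by (intro mult_left_mono add_mono gap_integrable(2) t3) auto
  finally show ?thesis by (simp add: algebra_simps)
qed

lemma strip_average_close:
  assumes s: "0 \<le> s"
  shows "\<bar>integral\<^sup>L phase (\<lambda>z. indicator {-v0..v0} (snd z) * (g (f0 z) * rate (fst (\<Phi> s z)) (snd (\<Phi> s z)) s))
      - integral\<^sup>L phase (\<lambda>z. g (fs (fst z) (snd z)) * rs (fst z) (snd z))\<bar>
      \<le> K\<^sup>2 * \<epsilon> * (77 + 13 * v0\<^sup>2 + 7 * integral\<^sup>L phase (\<lambda>z. (1 + (snd z)\<^sup>2) * fs (fst z) (snd z)))"
proof -
  have eq: "K\<^sup>2 * \<epsilon> * (77 + 13 * v0\<^sup>2 + 7 * k) = K\<^sup>2 * \<epsilon> * (26 + 13 * v0\<^sup>2) + K\<^sup>2 * \<epsilon> * (51 + 7 * k)" for k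
    by (simp add: algebra_simps)
  show ?thesis unfolding eq using outer_average_small[OF s] moving_average_close(2)[OF s] by linarith
qed

end

end

section \<open>Linear growth\<close>

lemma determinant_perturbation:
  fixes a1 a2 b1 b2 A1 A2 B1 B2 K N \<epsilon> :: real
  assumes b: "\<bar>b1 - B1\<bar> \<le> K * \<epsilon>" "\<bar>b2 - B2\<bar> \<le> K * \<epsilon>" and a: "\<bar>a1 - A1\<bar> \<le> N * \<epsilon>" "\<bar>a2 - A2\<bar> \<le> N * \<epsilon>"
    and pos: "0 \<le> K" "0 \<le> N" "0 \<le> \<epsilon>" "\<epsilon> \<le> 1"
  shows "B2 * A1 - B1 * A2 - \<epsilon> * (K * (\<bar>A1\<bar> + \<bar>A2\<bar> + 2 * N) + N * (\<bar>B1\<bar> + \<bar>B2\<bar>)) \<le> b2 * a1 - b1 * a2"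
proof -
  have *: "\<bar>b * a - B * A\<bar> \<le> K * \<epsilon> * (\<bar>A\<bar> + N) + \<bar>B\<bar> * (N * \<epsilon>)"
    if "\<bar>b - B\<bar> \<le> K * \<epsilon>" "\<bar>a - A\<bar> \<le> N * \<epsilon>" for a b A B
  proof -
    have "N * \<epsilon> \<le> N" using pos by (simp add: mult_left_le)
    then have "\<bar>a\<bar> \<le> \<bar>A\<bar> + N" using that(2) by linarith
    then have "\<bar>b - B\<bar> * \<bar>a\<bar> + \<bar>B\<bar> * \<bar>a - A\<bar> \<le> K * \<epsilon> * (\<bar>A\<bar> + N) + \<bar>B\<bar> * (N * \<epsilon>)"
      using that pos by (intro add_mono mult_mono) auto
    moreover have "b * a - B * A = (b - B) * a + B * (a - A)" by (simp add: algebra_simps)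
    ultimately show ?thesis using abs_triangle_ineq[of "(b - B) * a" "B * (a - A)"] by (simp only: abs_mult)
  qed
  have "\<epsilon> * (K * (\<bar>A1\<bar> + \<bar>A2\<bar> + 2 * N) + N * (\<bar>B1\<bar> + \<bar>B2\<bar>)) =
      (K * \<epsilon> * (\<bar>A1\<bar> + N) + \<bar>B2\<bar> * (N * \<epsilon>)) + (K * \<epsilon> * (\<bar>A2\<bar> + N) + \<bar>B1\<bar> * (N * \<epsilon>))"
    by (simp add: algebra_simps)
  then show ?thesis using *[OF b(2) a(1)] *[OF b(1) a(2)] by linarith
qed

context close_winding
begin

text \<open>The combination \<open>G\<close> of the two selections has integral zero over the strip,
  and its average against the rate is the determinant of the two masses and the two mean rates. For
  small \<open>\<epsilon>\<close> this stays above a positive constant at all times, because the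
  steady determinant is positive.\<close>

lemma stretch_growth:
  assumes g1: "continuous_on UNIV g1" "\<And>s s'. \<bar>g1 s - g1 s'\<bar> \<le> K * \<bar>s - s'\<bar>" "\<And>s. 0 \<le> g1 s" "\<And>s. g1 s \<le> K" "g1 0 = 0"
    and g2: "continuous_on UNIV g2" "\<And>s s'. \<bar>g2 s - g2 s'\<bar> \<le> K * \<bar>s - s'\<bar>" "\<And>s. 0 \<le> g2 s" "\<And>s. g2 s \<le> K" "g2 0 = 0"
  defines "B1 \<equiv> integral\<^sup>L phase (\<lambda>z. g1 (fs (fst z) (snd z)))" and "B2 \<equiv> integral\<^sup>L phase (\<lambda>z. g2 (fs (fst z) (snd z)))"
    and "A1 \<equiv> integral\<^sup>L phase (\<lambda>z. g1 (fs (fst z) (snd z)) * rs (fst z) (snd z))"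
    and "A2 \<equiv> integral\<^sup>L phase (\<lambda>z. g2 (fs (fst z) (snd z)) * rs (fst z) (snd z))"
    and "N \<equiv> K\<^sup>2 * (77 + 13 * v0\<^sup>2 + 7 * integral\<^sup>L phase (\<lambda>z. (1 + (snd z)\<^sup>2) * fs (fst z) (snd z)))"
  assumes small: "\<epsilon> * (K * (\<bar>A1\<bar> + \<bar>A2\<bar> + 2 * N) + N * (\<bar>B1\<bar> + \<bar>B2\<bar>)) < B2 * A1 - B1 * A2"
  shows "\<exists>A>0. \<forall>t\<ge>0. A * t \<le> stretch v0 t"
proof -
  let ?Q = "cbox (0, -v0) (1, v0)"
  let ?r = "\<lambda>s z. rate (fst (\<Phi> s z)) (snd (\<Phi> s z)) s"
  have cg: "continuous_on UNIV (\<lambda>z. g1 (f0 z))" "continuous_on UNIV (\<lambda>z. g2 (f0 z))"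
    using continuous_on_compose2[OF g1(1) f0_cont] continuous_on_compose2[OF g2(1) f0_cont] by auto
  define b1 b2 where "b1 = integral ?Q (\<lambda>z. g1 (f0 z))" and "b2 = integral ?Q (\<lambda>z. g2 (f0 z))"
  define a1 a2 where "a1 s = integral ?Q (\<lambda>z. g1 (f0 z) * ?r s z)" and "a2 s = integral ?Q (\<lambda>z. g2 (f0 z) * ?r s z)" for s
  have cr: "continuous_on UNIV (?r s)" if "0 \<le> s" for s
    using that by (intro rate_flow_cont continuous_on_id continuous_on_const)
  \<comment> \<open>The coefficients are the actual masses of the two selections in the strip, not
    the steady ones, so that the mean is exactly zero.\<close>
  define G where "G z = b2 * g1 (f0 z) - b1 * g2 (f0 z)" for z
  have K: "0 \<le> K" using C_L_nonneg by simp
  have N: "0 \<le> N" unfolding N_def using steady.f_nonneg[of 0] by (intro mult_nonneg_nonneg add_nonneg_nonneg integral_nonneg_AE AE_I2) auto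
  have b: "\<bar>b1 - B1\<bar> \<le> K * \<epsilon>" "\<bar>b2 - B2\<bar> \<le> K * \<epsilon>"
    using profile_average_close[OF g1] profile_average_close[OF g2]
    unfolding phase_integral_strip(2)[OF cg(1)] phase_integral_strip(2)[OF cg(2)] b1_def b2_def B1_def B2_def by auto
  have N\<epsilon>: "N * \<epsilon> = K\<^sup>2 * \<epsilon> * (77 + 13 * v0\<^sup>2 + 7 * integral\<^sup>L phase (\<lambda>z. (1 + (snd z)\<^sup>2) * fs (fst z) (snd z)))"
    by (simp add: N_def)
  have a: "\<bar>a1 s - A1\<bar> \<le> N * \<epsilon>" "\<bar>a2 s - A2\<bar> \<le> N * \<epsilon>" if s: "0 \<le> s" for s
    using strip_average_close[OF g1 s] strip_average_close[OF g2 s]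
    unfolding phase_integral_strip(2)[OF continuous_on_mult[OF cg(1) cr[OF s]]] phase_integral_strip(2)[OF continuous_on_mult[OF cg(2) cr[OF s]]]
      a1_def a2_def A1_def A2_def N\<epsilon> by auto
  have i: "(\<lambda>z. g1 (f0 z) * h z) integrable_on ?Q" "(\<lambda>z. g2 (f0 z) * h z) integrable_on ?Q" if "continuous_on UNIV h" for h
    by (rule integrable_continuous, rule continuous_on_subset[OF continuous_on_mult[OF _ that]], rule cg, simp)+
  have lin: "integral ?Q (\<lambda>z. G z * h z) = b2 * integral ?Q (\<lambda>z. g1 (f0 z) * h z) - b1 * integral ?Q (\<lambda>z. g2 (f0 z) * h z)"
    if "continuous_on UNIV h" for h
  proof -
    have "integral ?Q (\<lambda>z. G z * h z) = integral ?Q (\<lambda>z. b2 * (g1 (f0 z) * h z) - b1 * (g2 (f0 z) * h z))"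
      by (simp add: G_def algebra_simps)
    also have "\<dots> = integral ?Q (\<lambda>z. b2 * (g1 (f0 z) * h z)) - integral ?Q (\<lambda>z. b1 * (g2 (f0 z) * h z))"
      by (intro Henstock_Kurzweil_Integration.integral_diff integrable_on_mult_right i that)
    finally show ?thesis by simp
  qed
  define \<kappa> where "\<kappa> = B2 * A1 - B1 * A2 - \<epsilon> * (K * (\<bar>A1\<bar> + \<bar>A2\<bar> + 2 * N) + N * (\<bar>B1\<bar> + \<bar>B2\<bar>))"
  show ?thesis
  proof (rule stretch_linear_growth[OF steady.v0, of G "\<bar>b2\<bar> * K + \<bar>b1\<bar> * K" \<kappa>])
    show "continuous_on UNIV G" unfolding G_def by (intro continuous_on_diff continuous_on_mult_left cg)
    show "\<bar>G z\<bar> \<le> \<bar>b2\<bar> * K + \<bar>b1\<bar> * K" for z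
    proof -
      have "\<bar>b2 * g1 (f0 z)\<bar> \<le> \<bar>b2\<bar> * K" "\<bar>b1 * g2 (f0 z)\<bar> \<le> \<bar>b1\<bar> * K"
        unfolding abs_mult using g1(3,4) g2(3,4) by (intro mult_left_mono; simp)+
      then show ?thesis unfolding G_def by linarith
    qed
    show "integral ?Q G = 0" using lin[OF continuous_on_const[of _ 1]] by (simp add: b1_def b2_def)
    show "0 < \<kappa>" using small by (simp add: \<kappa>_def)
    show "\<kappa> \<le> integral ?Q (\<lambda>z. G z * ?r s z)" if s: "0 \<le> s" for s
      unfolding lin[OF cr[OF s]] \<kappa>_def a1_def[symmetric] a2_def[symmetric]
      by (rule determinant_perturbation[OF b a[OF s] K N eps])
  qed
qed

end

context vp_steady
begin

lemma gradient_growth: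
  assumes C1: "0 < C1"
  obtains \<delta> where "0 < \<delta>"
    "\<And>f fx fv ft \<Phi> D. vp_flow \<rho> f fx fv ft \<Phi> D \<Longrightarrow> (\<And>x v. f x v 0 \<le> C1) \<Longrightarrow>
      (\<integral>\<^sup>+x\<in>{0..1}. (\<integral>\<^sup>+v. ennreal ((1 + v\<^sup>2) * \<bar>f x v 0 - fs x v\<bar>) \<partial>lborel) \<partial>lborel) < ennreal \<delta> \<Longrightarrow>
      \<exists>A>0. \<forall>t\<ge>0. ennreal (A * t) \<le> grad_L1_norm v0 (\<Phi> t)"
proof -
  obtain e1 e2 e3 e4 e5 e6 where e: "e1 < e2" "e2 < Emax" "e3 < e4" "e4 < Emax" "e5 < e6" "e6 < Emax"
    and det: "0 < integral\<^sup>L phase (\<lambda>z. energy_bump e5 e6 (hs z)) * integral\<^sup>L phase (\<lambda>z. energy_bump e1 e2 (hs z) * winding_rate Es (\<lambda>x v. energy_bump e3 e4 (hs (x, v))) (fst z) (snd z))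
      - integral\<^sup>L phase (\<lambda>z. energy_bump e1 e2 (hs z)) * integral\<^sup>L phase (\<lambda>z. energy_bump e5 e6 (hs z) * winding_rate Es (\<lambda>x v. energy_bump e3 e4 (hs (x, v))) (fst z) (snd z))"
    using ex_separating_levels .
  have thr: "0 < \<phi> q" "\<phi> q < \<phi> p" if "p < q" "q < Emax" for p q
    using that profile_pos[of q] profile_strict_antimono[of p q] by auto
  \<comment> \<open>Bumps in the values of \<open>f\<close>, with end points the profile values at
    the chosen energies; composed with the profile they are the functions
    \<open>energy_bump\<close>.\<close>
  define g1 g2 \<psi> where "g1 = bump (\<phi> e2) (\<phi> e1)" and "g2 = bump (\<phi> e6) (\<phi> e5)" and "\<psi> = bump (\<phi> e4) (\<phi> e3)"
  obtain K1 where K1: "0 < K1" "\<And>s s'. \<bar>g1 s - g1 s'\<bar> \<le> K1 * \<bar>s - s'\<bar>" "\<And>s. g1 s \<le> K1"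
    unfolding g1_def using bump_lipschitz[OF thr(2)[OF e(1,2)]] by metis
  obtain K2 where K2: "0 < K2" "\<And>s s'. \<bar>g2 s - g2 s'\<bar> \<le> K2 * \<bar>s - s'\<bar>" "\<And>s. g2 s \<le> K2"
    unfolding g2_def using bump_lipschitz[OF thr(2)[OF e(5,6)]] by metis
  obtain K3 where K3: "0 < K3" "\<And>s s'. \<bar>\<psi> s - \<psi> s'\<bar> \<le> K3 * \<bar>s - s'\<bar>" "\<And>s. \<psi> s \<le> K3"
    unfolding \<psi>_def using bump_lipschitz[OF thr(2)[OF e(3,4)]] by metis
  \<comment> \<open>The sum dominates all three constants at once, so that a single constant can be
    handed to \<open>close_winding\<close>.\<close>
  define K where "K = K1 + K2 + K3"
  have K: "K1 \<le> K" "K2 \<le> K" "K3 \<le> K" using K1(1) K2(1) K3(1) by (auto simp: K_def)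
  have lip: "\<bar>g1 s - g1 s'\<bar> \<le> K * \<bar>s - s'\<bar>" "\<bar>g2 s - g2 s'\<bar> \<le> K * \<bar>s - s'\<bar>" "\<bar>\<psi> s - \<psi> s'\<bar> \<le> K * \<bar>s - s'\<bar>" for s s'
    using K1(2) K2(2) K3(2) K by (meson order_trans mult_right_mono abs_ge_zero)+
  have bd: "g1 s \<le> K" "g2 s \<le> K" "\<psi> s \<le> K" "0 \<le> g1 s" "0 \<le> g2 s" "0 \<le> \<psi> s" for s
    using K1(3)[of s] K2(3)[of s] K3(3)[of s] K by (auto simp: g1_def g2_def \<psi>_def bump_nonneg)
  have zero: "g1 0 = 0" "g2 0 = 0" "\<psi> 0 = 0"
    using thr[OF e(1,2)] thr[OF e(3,4)] thr[OF e(5,6)] by (simp_all add: g1_def g2_def \<psi>_def bump_eq_0_iff)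
  have cont: "continuous_on UNIV g1" "continuous_on UNIV g2" unfolding g1_def g2_def by (rule bump_continuous)+
  let ?rs = "winding_rate Es (\<lambda>x v. \<psi> (fs x v))"
  define B1 where "B1 = integral\<^sup>L phase (\<lambda>z. g1 (fs (fst z) (snd z)))"
  define B2 where "B2 = integral\<^sup>L phase (\<lambda>z. g2 (fs (fst z) (snd z)))"
  define A1 where "A1 = integral\<^sup>L phase (\<lambda>z. g1 (fs (fst z) (snd z)) * ?rs (fst z) (snd z))"
  define A2 where "A2 = integral\<^sup>L phase (\<lambda>z. g2 (fs (fst z) (snd z)) * ?rs (fst z) (snd z))"
  define N where "N = K\<^sup>2 * (77 + 13 * v0\<^sup>2 + 7 * integral\<^sup>L phase (\<lambda>z. (1 + (snd z)\<^sup>2) * fs (fst z) (snd z)))"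
  define T where "T = K * (\<bar>A1\<bar> + \<bar>A2\<bar> + 2 * N) + N * (\<bar>B1\<bar> + \<bar>B2\<bar>)"
  have det': "0 < B2 * A1 - B1 * A2"
    using det by (simp add: energy_bump_def B1_def B2_def A1_def A2_def g1_def g2_def \<psi>_def fs_eq)
  \<comment> \<open>The perturbation of the determinant is at most \<open>\<epsilon> * T\<close>.
    The denominator \<open>\<bar>T\<bar> + 1\<close> makes this strictly smaller than the steady
    determinant without a case distinction on \<open>T\<close>.\<close>
  define \<epsilon> where "\<epsilon> = min 1 ((B2 * A1 - B1 * A2) / (\<bar>T\<bar> + 1))"
  have eps: "0 < \<epsilon>" "\<epsilon> \<le> 1" using det' by (auto simp: \<epsilon>_def)
  have "\<epsilon> * T < \<epsilon> * (\<bar>T\<bar> + 1)" using eps by (intro mult_strict_left_mono) auto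
  also have "\<dots> \<le> (B2 * A1 - B1 * A2) / (\<bar>T\<bar> + 1) * (\<bar>T\<bar> + 1)"
    by (intro mult_right_mono) (auto simp: \<epsilon>_def)
  also have "\<dots> = B2 * A1 - B1 * A2" by simp
  finally have small: "\<epsilon> * T < B2 * A1 - B1 * A2" .
  obtain \<delta> where \<delta>: "0 < \<delta>" and stable:
    "\<And>f fx fv ft \<Phi> D t. vp_flow \<rho> f fx fv ft \<Phi> D \<Longrightarrow> (\<And>x v. f x v 0 \<le> C1) \<Longrightarrow>
      (\<integral>\<^sup>+x\<in>{0..1}. (\<integral>\<^sup>+v. ennreal ((1 + v\<^sup>2) * \<bar>f x v 0 - fs x v\<bar>) \<partial>lborel) \<partial>lborel) < ennreal \<delta> \<Longrightarrow> 0 \<le> t \<Longrightarrow>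
      integrable phase (\<lambda>z. (1 + (snd z)\<^sup>2) * \<bar>f (fst z) (snd z) t - fs (fst z) (snd z)\<bar>) \<and>
      integral\<^sup>L phase (\<lambda>z. (1 + (snd z)\<^sup>2) * \<bar>f (fst z) (snd z) t - fs (fst z) (snd z)\<bar>) \<le> \<epsilon>"
    using stability[OF C1 eps(1)] by blast
  show ?thesis
  proof (rule that[OF \<delta>])
    fix f fx fv ft \<Phi> D
    assume flow: "vp_flow \<rho> f fx fv ft \<Phi> D" and bound: "\<And>x v. f x v 0 \<le> C1"
      and near: "(\<integral>\<^sup>+x\<in>{0..1}. (\<integral>\<^sup>+v. ennreal ((1 + v\<^sup>2) * \<bar>f x v 0 - fs x v\<bar>) \<partial>lborel) \<partial>lborel) < ennreal \<delta>"
    interpret flow: vp_flow \<rho> f fx fv ft \<Phi> D by (rule flow)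
    interpret w: close_winding \<rho> f fx fv ft \<Phi> D \<psi> "bump_deriv (\<phi> e4) (\<phi> e3)" K fs sx sv st \<phi> Emax v0 \<epsilon>
    proof (unfold_locales)
      show "(\<psi> has_real_derivative bump_deriv (\<phi> e4) (\<phi> e3) s) (at s)" for s unfolding \<psi>_def by (rule bump_has_deriv)
      show "\<psi> s \<le> K * s" if "0 \<le> s" for s using lip(3)[of s 0] zero that by simp
    qed (use bump_deriv_continuous bd lip eps stable[OF flow bound near] in auto)
    have rs: "w.rs = ?rs" by (simp add: w.rs_def w.\<mu>s_def[abs_def])
    have "\<exists>A>0. \<forall>t\<ge>0. A * t \<le> flow.stretch v0 t"
      by (rule w.stretch_growth[OF cont(1) lip(1) bd(4) bd(1) zero(1) cont(2) lip(2) bd(5) bd(2) zero(2)])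
        (use small in \<open>simp add: rs A1_def A2_def B1_def B2_def N_def T_def\<close>)
    then show "\<exists>A>0. \<forall>t\<ge>0. ennreal (A * t) \<le> grad_L1_norm v0 (\<Phi> t)"
      by (metis flow.grad_L1_norm_eq ennreal_leI)
  qed
qed

end

theorem theorem1p1:
  fixes \<rho> \<phi> :: "real \<Rightarrow> real" and fs :: "real \<Rightarrow> real \<Rightarrow> real" and Emax v0 :: real
  assumes "background_density \<rho>"
    and "vlasov_poisson_solution \<rho> (\<lambda>x v t. fs x v)"
    and "\<And>x v. fs x v = \<phi> (v\<^sup>2 / 2 + potential \<rho> fs x)"
    and "\<phi> C1_differentiable_on UNIV"
    and "closure {e. \<phi> e \<noteq> 0} \<subseteq> {..Emax}"
    and "\<And>e. e < Emax \<Longrightarrow> deriv \<phi> e < 0"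
    and "v0 > 0"
    and "closure {(x, v). fs x v \<noteq> 0} \<subseteq> UNIV \<times> {-v0..v0}"
  shows "\<forall>C1>0. \<exists>\<delta>>0. \<forall>f \<Phi>.
           vlasov_poisson_solution \<rho> f \<longrightarrow>
           (\<forall>x v. f x v 0 \<le> C1) \<longrightarrow>
           (\<integral>\<^sup>+x\<in>{0..1}. (\<integral>\<^sup>+v. ennreal ((1 + v\<^sup>2) * \<bar>f x v 0 - fs x v\<bar>) \<partial>lborel) \<partial>lborel)
             < ennreal \<delta> \<longrightarrow>
           characteristic_flow (\<lambda>x t. electric_field \<rho> (\<lambda>y v. f y v t) x) \<Phi> \<longrightarrow>
           (\<exists>A>0. \<forall>t\<ge>0. grad_L1_norm v0 (\<Phi> t) \<ge> ennreal (A * t))"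
proof (intro allI impI)
  fix C1 :: real assume C1: "0 < C1"
  obtain sx sv st where "vp_solution \<rho> (\<lambda>x v t. fs x v) sx sv st"
    using vp_solutionI[OF assms(1,2)] .
  then interpret vp_steady \<rho> fs sx sv st \<phi> Emax v0
    by (intro vp_steady.intro vp_steady_axioms.intro assms)
  obtain \<delta> where \<delta>: "0 < \<delta>"
    "\<And>f fx fv ft \<Phi> D. vp_flow \<rho> f fx fv ft \<Phi> D \<Longrightarrow> (\<And>x v. f x v 0 \<le> C1) \<Longrightarrow>
      (\<integral>\<^sup>+x\<in>{0..1}. (\<integral>\<^sup>+v. ennreal ((1 + v\<^sup>2) * \<bar>f x v 0 - fs x v\<bar>) \<partial>lborel) \<partial>lborel) < ennreal \<delta> \<Longrightarrow>
      \<exists>A>0. \<forall>t\<ge>0. ennreal (A * t) \<le> grad_L1_norm v0 (\<Phi> t)"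
    using gradient_growth[OF C1] by blast
  show "\<exists>\<delta>>0. \<forall>f \<Phi>.
           vlasov_poisson_solution \<rho> f \<longrightarrow>
           (\<forall>x v. f x v 0 \<le> C1) \<longrightarrow>
           (\<integral>\<^sup>+x\<in>{0..1}. (\<integral>\<^sup>+v. ennreal ((1 + v\<^sup>2) * \<bar>f x v 0 - fs x v\<bar>) \<partial>lborel) \<partial>lborel)
             < ennreal \<delta> \<longrightarrow>
           characteristic_flow (\<lambda>x t. electric_field \<rho> (\<lambda>y v. f y v t) x) \<Phi> \<longrightarrow>
           (\<exists>A>0. \<forall>t\<ge>0. grad_L1_norm v0 (\<Phi> t) \<ge> ennreal (A * t))"
  proof (rule exI[of _ \<delta>], intro conjI allI impI)
    fix f \<Phi>
    assume f: "vlasov_poisson_solution \<rho> f" "\<forall>x v. f x v 0 \<le> C1"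
      "(\<integral>\<^sup>+x\<in>{0..1}. (\<integral>\<^sup>+v. ennreal ((1 + v\<^sup>2) * \<bar>f x v 0 - fs x v\<bar>) \<partial>lborel) \<partial>lborel) < ennreal \<delta>"
      and \<Phi>: "characteristic_flow (\<lambda>x t. electric_field \<rho> (\<lambda>y v. f y v t) x) \<Phi>"
    obtain fx fv ft where "vp_solution \<rho> f fx fv ft" using vp_solutionI[OF assms(1) f(1)] .
    from vp_flowI[OF this \<Phi>] obtain D where "vp_flow \<rho> f fx fv ft \<Phi> D" .
    then show "\<exists>A>0. \<forall>t\<ge>0. grad_L1_norm v0 (\<Phi> t) \<ge> ennreal (A * t)"
      using \<delta>(2) f(2,3) by blast
  qed (rule \<delta>(1))
qed

end
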